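(* Let $X$ be a strictly unbounded Kähler toric orbifold of real dimension $4$, with moment polygon $P=\{x\in\mathbb{R}^2: x\cdot\nu_i\ge\lambda_i,\ i=1,\dots,d\}$, and endow $X$ with the scalar-flat Kähler toric metric $g_\nu$ described in the context, for an admissible parameter $\nu\in\mathbb{R}^2$. Then $$\int_X|\mathcal{R}|^2<\infty,$$ where $\mathcal{R}$ is the Riemann curvature tensor of $g_\nu$, and the pointwise norm and volume form are those of $g_\nu$.
   Context: Toric setting. A Kähler toric 4-orbifold is a connected Kähler orbifold $(X,\omega,J)$ of real dimension $4$ with an effective, Hamiltonian, holomorphic action of $\mathbb{T}^2=\mathbb{R}^2/2\pi\mathbb{Z}^2$ whose moment map $\phi:X\to\mathbb{R}^2$ is proper onto its convex image $P=\phi(X)$ (the moment polygon). It is unbounded if $P$ is unbounded with finitely many vertices, and strictly unbounded if moreover its two unbounded edges are not parallel. Write $P=\{x\in\mathbb{R}^2: x\cdot\nu_i\ge\lambda_i,\ i=1,\dots,d\}$, where $\nu_1,\dots,\nu_d\in\mathbb{Z}^2$ are the primitive inward normals of the consecutive edges; edges $1$ and $d$ are the unbounded ones, and the numbering is such that $\det(\nu_{i+1},\nu_i)>0$ (e.g. $\nu_1=(0,1),\nu_2=(1,0)$ for $\mathbb{C}^2$). Here $\det(v,w)=v_1w_2-v_2w_1$. The metrics $g_\nu$. A vector $\nu=(\alpha,\beta)\in\mathbb{R}^2$ is admissible if $\nu=0$ or $\det(\nu,\nu_1)>0$ and $\det(\nu,\nu_d)>0$. Let $0<a_1<\dots<a_{d-1}$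 be such that the Euclidean length of the $i$-th edge of $P$ is $(a_i-a_{i-1})|\nu_i|$ for $2\le i\le d-1$. On $\mathbb{H}=\{(H,r):r>0\}$ put $H_i=H+a_i$, $\rho_i=\sqrt{r^2+H_i^2}$ and $$\xi=\nu_1\log r+\tfrac12\sum_{i=1}^{d-1}(\nu_{i+1}-\nu_i)\log(H_i+\rho_i)+\nu H .$$ Let $D\xi$ be the $2\times2$ matrix with columns $\xi_H,\xi_r$, and $V=r\det D\xi>0$. There is a diffeomorphism $\mu=(x_1,x_2):\mathbb{H}\to\mathrm{int}(P)$ with $\partial_Hx_1=r\xi_{2,r}$, $\partial_rx_1=-r\xi_{2,H}$, $\partial_Hx_2=-r\xi_{1,r}$, $\partial_rx_2=r\xi_{1,H}$. On $X_0=\phi^{-1}(\mathrm{int}(P))\simeq \mathrm{int}(P)\times\mathbb{T}^2$ with coordinates $(x_1,x_2,\theta_1,\theta_2)$ and $\omega=dx_1\wedge d\theta_1+dx_2\wedge d\theta_2$, the metric $$g_\nu=V(dH^2+dr^2)+\sum_{a,b}\big(V(D\xi D\xi^t)^{-1}\big)_{ab}\,d\theta_a\,d\theta_b$$ extends to a complete scalar-flat Kähler toric metric on $X$. *)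

theory Defs
  imports "HOL-Analysis.Analysis" "HOL-Algebra.Bij"
begin

section \<open>Smooth maps between Euclidean spaces\<close>

text \<open>All iterated directional derivatives exist and are Frechet differentiable on the open set
  \<open>U\<close>, i.e. \<open>f\<close> is \<open>C\<^sup>\<infinity>\<close> on \<open>U\<close>.\<close>

definition smooth_on :: "'a::euclidean_space set \<Rightarrow> ('a \<Rightarrow> 'b::real_normed_vector) \<Rightarrow> bool" where
  "smooth_on U f \<longleftrightarrow> open U \<and>
     (\<forall>vs. \<forall>x\<in>U. foldr (\<lambda>v h y. frechet_derivative h (at y) v) vs f differentiable (at x))"

definition pd :: "'n::finite \<Rightarrow> (real^'n \<Rightarrow> real) \<Rightarrow> real^'n \<Rightarrow> real" where
  "pd i f x = frechet_derivative f (at x) (axis i 1)"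

section \<open>Effective 4-dimensional orbifolds\<close>

record 'x chart =
  cdom :: "(real^4) set"
  cgrp :: "(real^4 \<Rightarrow> real^4) set"
  cproj :: "real^4 \<Rightarrow> 'x"

text \<open>\<open>cproj c\<close> identifies \<open>cdom c / cgrp c\<close> homeomorphically with an open subset of the space.
  Elements of \<open>BijGroup U\<close> are extensional, so \<open>card (cgrp c)\<close> is the order of the group and
  the group acts effectively.\<close>

definition orbifold_chart :: "'x topology \<Rightarrow> 'x chart \<Rightarrow> bool" where
  "orbifold_chart T c \<longleftrightarrow>
     open (cdom c) \<and> connected (cdom c) \<and>
     finite (cgrp c) \<and> subgroup (cgrp c) (BijGroup (cdom c)) \<and>
     (\<forall>\<gamma>\<in>cgrp c. smooth_on (cdom c) \<gamma>) \<and>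
     continuous_map (top_of_set (cdom c)) T (cproj c) \<and>
     open_map (top_of_set (cdom c)) T (cproj c) \<and>
     (\<forall>u\<in>cdom c. \<forall>v\<in>cdom c. cproj c u = cproj c v \<longleftrightarrow> (\<exists>\<gamma>\<in>cgrp c. \<gamma> u = v))"

text \<open>\<open>h\<close> is a smooth open embedding of \<open>W\<close> into the chart \<open>d\<close> that lifts the map \<open>p\<close>, whose
  values are points of the orbifold.\<close>

definition is_lift :: "(real^4 \<Rightarrow> 'x) \<Rightarrow> 'x chart \<Rightarrow> (real^4) set \<Rightarrow> (real^4 \<Rightarrow> real^4) \<Rightarrow> bool" where
  "is_lift p d W h \<longleftrightarrow>
     open W \<and> smooth_on W h \<and> inj_on h W \<and> (\<forall>w\<in>W. det (jacobian h (at w)) \<noteq> 0) \<and>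
     h ` W \<subseteq> cdom d \<and> (\<forall>w\<in>W. cproj d (h w) = p w)"

definition orbifold :: "'x topology \<Rightarrow> 'x chart set \<Rightarrow> bool" where
  "orbifold T A \<longleftrightarrow>
     Hausdorff_space T \<and>
     (\<exists>\<B>. countable \<B> \<and> (\<forall>B\<in>\<B>. openin T B) \<and>
        (\<forall>U x. openin T U \<and> x \<in> U \<longrightarrow> (\<exists>B\<in>\<B>. x \<in> B \<and> B \<subseteq> U))) \<and>
     (\<forall>c\<in>A. orbifold_chart T c) \<and>
     (\<Union>c\<in>A. cproj c ` cdom c) = topspace T \<and>
     (\<forall>c\<in>A. \<forall>d\<in>A. \<forall>u\<in>cdom c. \<forall>v\<in>cdom d. cproj c u = cproj d v \<longrightarrow>
        (\<exists>W h. u \<in> W \<and> W \<subseteq> cdom c \<and> is_lift (cproj c) d W h \<and> h u = v))"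

section \<open>Tensor fields on an orbifold\<close>

text \<open>A field of bilinear forms or of endomorphisms is given by its coefficient matrices in every
  chart. Invariance under \<open>\<tau>\<close> is tested on all local lifts of \<open>\<tau>\<close>; for \<open>\<tau> = id\<close> these are the
  coordinate changes and the elements of the local groups, so that invariance under \<open>id\<close> says that
  the matrices define a tensor field on the orbifold.\<close>

type_synonym 'x field2 = "'x chart \<Rightarrow> real^4 \<Rightarrow> real^4^4"

definition form_invariant :: "'x chart set \<Rightarrow> ('x \<Rightarrow> 'x) \<Rightarrow> 'x field2 \<Rightarrow> bool" where
  "form_invariant A \<tau> b \<longleftrightarrow>
     (\<forall>c\<in>A. \<forall>d\<in>A. \<forall>W h. W \<subseteq> cdom c \<and> is_lift (\<tau> \<circ> cproj c) d W h \<longrightarrow>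
        (\<forall>w\<in>W. transpose (jacobian h (at w)) ** b d (h w) ** jacobian h (at w) = b c w))"

definition endo_invariant :: "'x chart set \<Rightarrow> ('x \<Rightarrow> 'x) \<Rightarrow> 'x field2 \<Rightarrow> bool" where
  "endo_invariant A \<tau> J \<longleftrightarrow>
     (\<forall>c\<in>A. \<forall>d\<in>A. \<forall>W h. W \<subseteq> cdom c \<and> is_lift (\<tau> \<circ> cproj c) d W h \<longrightarrow>
        (\<forall>w\<in>W. jacobian h (at w) ** J c w = J d (h w) ** jacobian h (at w)))"

definition riemannian_metric :: "'x chart set \<Rightarrow> 'x field2 \<Rightarrow> bool" where
  "riemannian_metric A g \<longleftrightarrow>
     form_invariant A id g \<and>
     (\<forall>c\<in>A. smooth_on (cdom c) (g c) \<and>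
        (\<forall>u\<in>cdom c. transpose (g c u) = g c u \<and> (\<forall>v. v \<noteq> 0 \<longrightarrow> v \<bullet> (g c u *v v) > 0)))"

definition symplectic_form :: "'x chart set \<Rightarrow> 'x field2 \<Rightarrow> bool" where
  "symplectic_form A \<omega> \<longleftrightarrow>
     form_invariant A id \<omega> \<and>
     (\<forall>c\<in>A. smooth_on (cdom c) (\<omega> c) \<and>
        (\<forall>u\<in>cdom c. transpose (\<omega> c u) = - \<omega> c u \<and> det (\<omega> c u) \<noteq> 0 \<and>
           (\<forall>i j k. pd i (\<lambda>y. \<omega> c y $ j $ k) u + pd j (\<lambda>y. \<omega> c y $ k $ i) u
                    + pd k (\<lambda>y. \<omega> c y $ i $ j) u = 0)))"

text \<open>The last condition is the vanishing of the Nijenhuis tensor \<open>N(\<partial>\<^sub>j, \<partial>\<^sub>k)\<^sup>i\<close>.\<close>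

definition complex_structure :: "'x chart set \<Rightarrow> 'x field2 \<Rightarrow> bool" where
  "complex_structure A J \<longleftrightarrow>
     endo_invariant A id J \<and>
     (\<forall>c\<in>A. smooth_on (cdom c) (J c) \<and>
        (\<forall>u\<in>cdom c. J c u ** J c u = - mat 1 \<and>
           (\<forall>i j k. (\<Sum>l\<in>UNIV.
                J c u $ l $ j * pd l (\<lambda>y. J c y $ i $ k) u
              - J c u $ l $ k * pd l (\<lambda>y. J c y $ i $ j) u
              - J c u $ i $ l * (pd j (\<lambda>y. J c y $ l $ k) u - pd k (\<lambda>y. J c y $ l $ j) u)) = 0)))"

definition kaehler_structure :: "'x chart set \<Rightarrow> 'x field2 \<Rightarrow> 'x field2 \<Rightarrow> bool" where
  "kaehler_structure A \<omega> J \<longleftrightarrow>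
     symplectic_form A \<omega> \<and> complex_structure A J \<and>
     riemannian_metric A (\<lambda>c u. \<omega> c u ** J c u)"

section \<open>Torus actions and toric orbifolds\<close>

text \<open>\<open>\<T>\<^sup>2 = \<real>\<^sup>2 / 2\<pi>\<int>\<^sup>2\<close>; its actions are written as actions of \<open>\<real>\<^sup>2\<close> that are trivial on \<open>2\<pi>\<int>\<^sup>2\<close>.\<close>

definition period_lattice :: "(real^2) set" where
  "period_lattice = {t. \<forall>i. \<exists>k::int. t $ i = 2 * pi * of_int k}"

definition torus_action :: "'x topology \<Rightarrow> 'x chart set \<Rightarrow> (real^2 \<Rightarrow> 'x \<Rightarrow> 'x) \<Rightarrow> bool" where
  "torus_action T A act \<longleftrightarrow>
     continuous_map (prod_topology euclidean T) T (\<lambda>(t, p). act t p) \<and>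
     (\<forall>s t. \<forall>p\<in>topspace T. act (s + t) p = act s (act t p)) \<and>
     (\<forall>t\<in>period_lattice. \<forall>p\<in>topspace T. act t p = p) \<and>
     (\<forall>c\<in>A. \<forall>d\<in>A. \<forall>t. \<forall>u\<in>cdom c. \<forall>v\<in>cdom d. act t (cproj c u) = cproj d v \<longrightarrow>
        (\<exists>N W F. open N \<and> t \<in> N \<and> u \<in> W \<and> W \<subseteq> cdom c \<and>
           smooth_on (N \<times> W) (\<lambda>(s, w). F s w) \<and> F t u = v \<and>
           (\<forall>s\<in>N. is_lift (act s \<circ> cproj c) d W (F s))))"

definition effective_action :: "'x topology \<Rightarrow> (real^2 \<Rightarrow> 'x \<Rightarrow> 'x) \<Rightarrow> bool" where
  "effective_action T act \<longleftrightarrow>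
     (\<forall>t. (\<forall>p\<in>topspace T. act t p = p) \<longrightarrow> t \<in> period_lattice)"

text \<open>\<open>F\<close> is a lift of the action for small times with \<open>F 0 = id\<close>, so the vector derivative below is
  the fundamental vector field \<open>K\<^sub>a\<close> in the chart \<open>c\<close>, and the condition reads
  \<open>d\<phi>\<^sub>a = \<omega>(\<cdot>, K\<^sub>a)\<close>. With this sign \<open>x\<close> is a moment map for \<open>\<partial>\<^sub>\<theta>\<close> and
  \<open>\<omega> = dx\<^sub>1 \<and> d\<theta>\<^sub>1 + dx\<^sub>2 \<and> d\<theta>\<^sub>2\<close>.\<close>

definition moment_map ::
  "'x topology \<Rightarrow> 'x chart set \<Rightarrow> 'x field2 \<Rightarrow> (real^2 \<Rightarrow> 'x \<Rightarrow> 'x) \<Rightarrow> ('x \<Rightarrow> real^2) \<Rightarrow> bool" where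
  "moment_map T A \<omega> act \<phi> \<longleftrightarrow>
     (\<forall>t. \<forall>p\<in>topspace T. \<phi> (act t p) = \<phi> p) \<and>
     (\<forall>c\<in>A. smooth_on (cdom c) (\<phi> \<circ> cproj c)) \<and>
     (\<forall>c\<in>A. \<forall>N W F.
        open N \<and> 0 \<in> N \<and> W \<subseteq> cdom c \<and> smooth_on (N \<times> W) (\<lambda>(s, w). F s w) \<and>
        (\<forall>s\<in>N. is_lift (act s \<circ> cproj c) c W (F s)) \<and> (\<forall>w\<in>W. F 0 w = w) \<longrightarrow>
        (\<forall>w\<in>W. \<forall>a v.
           frechet_derivative (\<lambda>y. \<phi> (cproj c y) $ a) (at w) v
           = v \<bullet> (\<omega> c w *v vector_derivative (\<lambda>s. F (s *\<^sub>R axis a 1) w) (at 0))))"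

definition kaehler_toric_orbifold ::
  "'x topology \<Rightarrow> 'x chart set \<Rightarrow> 'x field2 \<Rightarrow> 'x field2 \<Rightarrow> (real^2 \<Rightarrow> 'x \<Rightarrow> 'x) \<Rightarrow>
   ('x \<Rightarrow> real^2) \<Rightarrow> bool" where
  "kaehler_toric_orbifold T A \<omega> J act \<phi> \<longleftrightarrow>
     orbifold T A \<and> connected_space T \<and> kaehler_structure A \<omega> J \<and>
     torus_action T A act \<and> effective_action T act \<and>
     (\<forall>t. form_invariant A (act t) \<omega> \<and> endo_invariant A (act t) J) \<and>
     moment_map T A \<omega> act \<phi> \<and>
     convex (\<phi> ` topspace T) \<and> proper_map T (top_of_set (\<phi> ` topspace T)) \<phi>"

section \<open>Moment polygons\<close>

definition det2 :: "real^2 \<Rightarrow> real^2 \<Rightarrow> real" where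
  "det2 v w = v $ 1 * w $ 2 - v $ 2 * w $ 1"

definition primitive_vector :: "real^2 \<Rightarrow> bool" where
  "primitive_vector v \<longleftrightarrow> (\<exists>p q :: int. coprime p q \<and> v = vector [of_int p, of_int q])"

definition polygon_edge :: "(real^2) set \<Rightarrow> (nat \<Rightarrow> real^2) \<Rightarrow> (nat \<Rightarrow> real) \<Rightarrow> nat \<Rightarrow> (real^2) set" where
  "polygon_edge P n lam i = {x \<in> P. x \<bullet> n i = lam i}"

text \<open>The edges are genuine (not empty and not a point), consecutive ones share a vertex, the first
  and the last one are unbounded and not parallel.\<close>

definition strictly_unbounded_polygon ::
  "(real^2) set \<Rightarrow> nat \<Rightarrow> (nat \<Rightarrow> real^2) \<Rightarrow> (nat \<Rightarrow> real) \<Rightarrow> bool" where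
  "strictly_unbounded_polygon P d n lam \<longleftrightarrow>
     2 \<le> d \<and>
     P = {x. \<forall>i\<in>{1..d}. x \<bullet> n i \<ge> lam i} \<and>
     (\<forall>i\<in>{1..d}. primitive_vector (n i)) \<and>
     (\<forall>i\<in>{1..d}. \<exists>x\<in>polygon_edge P n lam i. \<exists>y\<in>polygon_edge P n lam i. x \<noteq> y) \<and>
     (\<forall>i\<in>{1..d-1}. det2 (n (i+1)) (n i) > 0 \<and>
        polygon_edge P n lam i \<inter> polygon_edge P n lam (i+1) \<noteq> {}) \<and>
     (\<forall>i\<in>{1..d}. bounded (polygon_edge P n lam i) \<longleftrightarrow> i \<noteq> 1 \<and> i \<noteq> d) \<and>
     det2 (n 1) (n d) \<noteq> 0"

definition admissible :: "nat \<Rightarrow> (nat \<Rightarrow> real^2) \<Rightarrow> real^2 \<Rightarrow> bool" where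
  "admissible d n \<nu> \<longleftrightarrow> \<nu> = 0 \<or> (det2 \<nu> (n 1) > 0 \<and> det2 \<nu> (n d) > 0)"

text \<open>The edges in question are segments, so their length is their diameter.\<close>

definition edge_parameters ::
  "(real^2) set \<Rightarrow> nat \<Rightarrow> (nat \<Rightarrow> real^2) \<Rightarrow> (nat \<Rightarrow> real) \<Rightarrow> (nat \<Rightarrow> real) \<Rightarrow> bool" where
  "edge_parameters P d n lam a \<longleftrightarrow>
     0 < a 1 \<and>
     (\<forall>i\<in>{2..d-1}. a (i-1) < a i \<and>
        diameter (polygon_edge P n lam i) = (a i - a (i-1)) * norm (n i))"

section \<open>The metrics \<open>g\<^sub>\<nu>\<close>\<close>

text \<open>Points of the half plane are vectors with components \<open>H\<close> and \<open>r\<close>.\<close>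

definition half_plane :: "(real^2) set" where
  "half_plane = {h. h $ 2 > 0}"

definition xi :: "nat \<Rightarrow> (nat \<Rightarrow> real^2) \<Rightarrow> (nat \<Rightarrow> real) \<Rightarrow> real^2 \<Rightarrow> real^2 \<Rightarrow> real^2" where
  "xi d n a \<nu> h =
     ln (h $ 2) *\<^sub>R n 1
     + (1/2) *\<^sub>R (\<Sum>i=1..d-1.
         ln ((h $ 1 + a i) + sqrt ((h $ 2)\<^sup>2 + (h $ 1 + a i)\<^sup>2)) *\<^sub>R (n (i+1) - n i))
     + (h $ 1) *\<^sub>R \<nu>"

definition Dxi :: "nat \<Rightarrow> (nat \<Rightarrow> real^2) \<Rightarrow> (nat \<Rightarrow> real) \<Rightarrow> real^2 \<Rightarrow> real^2 \<Rightarrow> real^2^2" where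
  "Dxi d n a \<nu> h = jacobian (xi d n a \<nu>) (at h)"

definition Vfun :: "nat \<Rightarrow> (nat \<Rightarrow> real^2) \<Rightarrow> (nat \<Rightarrow> real) \<Rightarrow> real^2 \<Rightarrow> real^2 \<Rightarrow> real" where
  "Vfun d n a \<nu> h = h $ 2 * det (Dxi d n a \<nu> h)"

definition moment_coordinates ::
  "(real^2) set \<Rightarrow> nat \<Rightarrow> (nat \<Rightarrow> real^2) \<Rightarrow> (nat \<Rightarrow> real) \<Rightarrow> real^2 \<Rightarrow> (real^2 \<Rightarrow> real^2) \<Rightarrow> bool" where
  "moment_coordinates P d n a \<nu> \<mu> \<longleftrightarrow>
     bij_betw \<mu> half_plane (interior P) \<and>
     smooth_on half_plane \<mu> \<and> smooth_on (interior P) (inv_into half_plane \<mu>) \<and>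
     (\<forall>h\<in>half_plane.
        pd 1 (\<lambda>y. \<mu> y $ 1) h = h $ 2 * pd 2 (\<lambda>y. xi d n a \<nu> y $ 2) h \<and>
        pd 2 (\<lambda>y. \<mu> y $ 1) h = - h $ 2 * pd 1 (\<lambda>y. xi d n a \<nu> y $ 2) h \<and>
        pd 1 (\<lambda>y. \<mu> y $ 2) h = - h $ 2 * pd 2 (\<lambda>y. xi d n a \<nu> y $ 1) h \<and>
        pd 2 (\<lambda>y. \<mu> y $ 2) h = h $ 2 * pd 1 (\<lambda>y. xi d n a \<nu> y $ 1) h)"

text \<open>Vectors in \<open>\<real>\<^sup>4\<close> are written as pairs of a base component (\<open>x\<close> or \<open>(H, r)\<close>) and an angular
  component \<open>\<theta>\<close>.\<close>

definition base :: "real^4 \<Rightarrow> real^2" where "base y = vector [y $ 1, y $ 2]"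
definition angle :: "real^4 \<Rightarrow> real^2" where "angle y = vector [y $ 3, y $ 4]"
definition join4 :: "real^2 \<Rightarrow> real^2 \<Rightarrow> real^4" where
  "join4 x \<theta> = vector [x $ 1, x $ 2, \<theta> $ 1, \<theta> $ 2]"

text \<open>Coefficient matrix of \<open>g\<^sub>\<nu>\<close> in the coordinates \<open>(H, r, \<theta>\<^sub>1, \<theta>\<^sub>2)\<close>.\<close>

definition gnu :: "nat \<Rightarrow> (nat \<Rightarrow> real^2) \<Rightarrow> (nat \<Rightarrow> real) \<Rightarrow> real^2 \<Rightarrow> real^4 \<Rightarrow> real^4^4" where
  "gnu d n a \<nu> y =
     (let h = base y; V = Vfun d n a \<nu> h;
          B = V *\<^sub>R matrix_inv (Dxi d n a \<nu> h ** transpose (Dxi d n a \<nu> h))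
      in vector [vector [V, 0, 0, 0],
                 vector [0, V, 0, 0],
                 vector [0, 0, B $ 1 $ 1, B $ 1 $ 2],
                 vector [0, 0, B $ 2 $ 1, B $ 2 $ 2]])"

text \<open>Matrix of \<open>dx\<^sub>1 \<and> d\<theta>\<^sub>1 + dx\<^sub>2 \<and> d\<theta>\<^sub>2\<close> in the coordinates \<open>(x\<^sub>1, x\<^sub>2, \<theta>\<^sub>1, \<theta>\<^sub>2)\<close>.\<close>

definition darboux :: "real^4^4" where
  "darboux = vector [vector [0, 0, 1, 0],
                     vector [0, 0, 0, 1],
                     vector [-1, 0, 0, 0],
                     vector [0, -1, 0, 0]]"

text \<open>\<open>\<Psi>\<close> is the universal cover of an equivariant symplectic identification of
  \<open>interior P \<times> \<T>\<^sup>2\<close> with \<open>X\<^sub>0 = \<phi>\<^sup>-\<^sup>1(interior P)\<close> that intertwines the projection with \<open>\<phi>\<close>.\<close>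

definition action_angle ::
  "'x topology \<Rightarrow> 'x chart set \<Rightarrow> 'x field2 \<Rightarrow> (real^2 \<Rightarrow> 'x \<Rightarrow> 'x) \<Rightarrow> ('x \<Rightarrow> real^2) \<Rightarrow>
   (real^4 \<Rightarrow> 'x) \<Rightarrow> bool" where
  "action_angle T A \<omega> act \<phi> \<Psi> \<longleftrightarrow>
     (let Q = interior (\<phi> ` topspace T); E = {y. base y \<in> Q} in
      \<Psi> ` E = {p \<in> topspace T. \<phi> p \<in> Q} \<and>
      (\<forall>y\<in>E. \<phi> (\<Psi> y) = base y) \<and>
      (\<forall>y\<in>E. \<forall>t. act t (\<Psi> y) = \<Psi> (y + join4 0 t)) \<and>
      (\<forall>y\<in>E. \<forall>z\<in>E. \<Psi> y = \<Psi> z \<longleftrightarrow> base y = base z \<and> angle y - angle z \<in> period_lattice) \<and>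
      (\<forall>c\<in>A. \<forall>u\<in>cdom c. \<forall>y\<in>E. cproj c u = \<Psi> y \<longrightarrow>
         (\<exists>W h. y \<in> W \<and> W \<subseteq> E \<and> is_lift \<Psi> c W h \<and> h y = u)) \<and>
      (\<forall>c\<in>A. \<forall>W h. W \<subseteq> E \<and> is_lift \<Psi> c W h \<longrightarrow>
         (\<forall>w\<in>W. transpose (jacobian h (at w)) ** \<omega> c (h w) ** jacobian h (at w) = darboux)))"

text \<open>\<open>g\<close> is a Riemannian metric on the whole orbifold which on \<open>X\<^sub>0\<close> is given by the formula for
  \<open>g\<^sub>\<nu>\<close> in the coordinates \<open>(H, r, \<theta>) \<mapsto> \<Psi>(\<mu>(H, r), \<theta>)\<close>.\<close>

definition extends_gnu ::
  "'x chart set \<Rightarrow> nat \<Rightarrow> (nat \<Rightarrow> real^2) \<Rightarrow> (nat \<Rightarrow> real) \<Rightarrow> real^2 \<Rightarrow> (real^2 \<Rightarrow> real^2) \<Rightarrow>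
   (real^4 \<Rightarrow> 'x) \<Rightarrow> 'x field2 \<Rightarrow> bool" where
  "extends_gnu A d n a \<nu> \<mu> \<Psi> g \<longleftrightarrow>
     riemannian_metric A g \<and>
     (\<forall>c\<in>A. \<forall>W h. W \<subseteq> {y. base y \<in> half_plane} \<and>
        is_lift (\<lambda>y. \<Psi> (join4 (\<mu> (base y)) (angle y))) c W h \<longrightarrow>
        (\<forall>w\<in>W. transpose (jacobian h (at w)) ** g c (h w) ** jacobian h (at w) = gnu d n a \<nu> w))"

section \<open>Curvature and volume\<close>

text \<open>\<open>christoffel G k i j\<close> is \<open>\<Gamma>\<^sup>k\<^sub>i\<^sub>j\<close> and \<open>riemann G l i j k\<close> is the \<open>l\<close>-th component of
  \<open>R(\<partial>\<^sub>i, \<partial>\<^sub>j) \<partial>\<^sub>k\<close>, for a metric with coefficient matrix \<open>G\<close>.\<close>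

definition christoffel :: "(real^'n \<Rightarrow> real^'n^'n) \<Rightarrow> 'n::finite \<Rightarrow> 'n \<Rightarrow> 'n \<Rightarrow> real^'n \<Rightarrow> real" where
  "christoffel G k i j u =
     (1/2) * (\<Sum>l\<in>UNIV. matrix_inv (G u) $ k $ l *
       (pd i (\<lambda>y. G y $ j $ l) u + pd j (\<lambda>y. G y $ i $ l) u - pd l (\<lambda>y. G y $ i $ j) u))"

definition riemann ::
  "(real^'n \<Rightarrow> real^'n^'n) \<Rightarrow> 'n::finite \<Rightarrow> 'n \<Rightarrow> 'n \<Rightarrow> 'n \<Rightarrow> real^'n \<Rightarrow> real" where
  "riemann G l i j k u =
     pd i (christoffel G l j k) u - pd j (christoffel G l i k) u
     + (\<Sum>m\<in>UNIV. christoffel G l i m u * christoffel G m j k u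
                 - christoffel G l j m u * christoffel G m i k u)"

definition riemann_norm_sq :: "(real^'n \<Rightarrow> real^'n^'n) \<Rightarrow> real^'n::finite \<Rightarrow> real" where
  "riemann_norm_sq G u =
     (\<Sum>i\<in>UNIV. \<Sum>j\<in>UNIV. \<Sum>k\<in>UNIV. \<Sum>l\<in>UNIV. \<Sum>i'\<in>UNIV. \<Sum>j'\<in>UNIV. \<Sum>k'\<in>UNIV. \<Sum>l'\<in>UNIV.
        matrix_inv (G u) $ i $ i' * matrix_inv (G u) $ j $ j' * matrix_inv (G u) $ k $ k'
        * G u $ l $ l' * riemann G l i j k u * riemann G l' i' j' k' u)"

text \<open>The function \<open>|R|\<^sup>2\<close> on the orbifold; the value does not depend on the chart chosen.\<close>

definition curvature_norm_sq :: "'x chart set \<Rightarrow> 'x field2 \<Rightarrow> 'x \<Rightarrow> real" where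
  "curvature_norm_sq A g p =
     (SOME y. \<exists>c\<in>A. \<exists>u\<in>cdom c. cproj c u = p \<and> y = riemann_norm_sq (g c) u)"

text \<open>The Riemannian volume: the Borel measure that over each chart \<open>U \<rightarrow> U/G\<close> is \<open>1/|G|\<close> times the
  push-forward of \<open>\<surd>(det g) du\<close>.\<close>

definition riemannian_volume :: "'x topology \<Rightarrow> 'x chart set \<Rightarrow> 'x field2 \<Rightarrow> 'x measure \<Rightarrow> bool" where
  "riemannian_volume T A g M \<longleftrightarrow>
     space M = topspace T \<and> sets M = sigma_sets (topspace T) {S. openin T S} \<and>
     (\<forall>c\<in>A. \<forall>B\<in>sets M. B \<subseteq> cproj c ` cdom c \<longrightarrow>
        emeasure M B =
          (\<integral>\<^sup>+u\<in>{u \<in> cdom c. cproj c u \<in> B}. ennreal (sqrt (det (g c u))) \<partial>lborel)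
          / of_nat (card (cgrp c)))"

end

theory Submission
  imports Defs
begin

text \<open>The function \<open>|\<R>|\<^sup>2\<close> is continuous on the orbifold, hence integrable over compact sets; the moment map is
  proper, so only the region of large \<open>R = |(H, r)|\<close> matters. Rescaling \<open>(H, r)\<close> by \<open>e = 1/R\<close> turns \<open>g\<^sub>\<nu>\<close> into a
  constant multiple of a metric that depends smoothly on \<open>e\<close> up to \<open>e = 0\<close>, also across the axis \<open>r = 0\<close>,
  on a fixed compact set of base points. Since the curvature is invariant under diffeomorphisms and scales
  with the metric, this gives \<open>|\<R>|\<^sup>2 = O(R\<^bsup>-4\<^esup>)\<close> and a volume density \<open>O(R)\<close> if \<open>\<nu> \<noteq> 0\<close>. If \<open>\<nu> = 0\<close>, the limit metric
  is a flat cone, which improves the first bound to \<open>O(R\<^bsup>-3\<^esup>)\<close> with a bounded density. In both cases the integral over the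
  shell \<open>R \<sim> 2\<^sup>j\<close> is \<open>O(2\<^bsup>-j\<^esup>)\<close>. The complement of \<open>X\<^sub>0\<close> is null: it lies in the minimum sets of the
  components \<open>\<phi> \<bullet> \<nu>\<^sub>i\<close> of the moment map, whose Hessians cannot vanish at critical points because a Killing field is
  determined by its \<open>1\<close>-jet at a point.\<close>

section \<open>Calculus of smooth functions\<close>

text \<open>The circle generated by the edge normal \<open>N\<close> collapses on the axis
  \<open>r = 0\<close>. With \<open>\<theta> = \<alpha> N + \<beta> \<tau>\<close>, polar
  coordinates \<open>(r, \<alpha>)\<close> and coefficients written in \<open>s = r^2\<close>, the
  metric becomes regular there. The obstacle is \<open>log (H + \<rho>)\<close>: it is smooth across
  the axis only where \<open>H > 0\<close>, and in the rescaled limit it is singular on the whole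
  half axis \<open>H \<le> 0\<close>. No single chart of this kind serves both unbounded edges. Each
  end is therefore treated with its own normal on \<open>H \<ge> - R/2\<close>, and the reflection
  of \<open>H\<close> exchanges the two. The regimes differ in the scaling of
  \<open>\<beta>\<close>. If \<open>\<nu> \<noteq> 0\<close>, the constant \<open>\<nu>\<close>
  dominates \<open>\<xi>_H\<close>, \<open>\<beta>\<close> is scaled by \<open>e\<close>, and the
  metric is \<open>R^2\<close> times the model. If \<open>\<nu> = 0\<close>, \<open>\<beta>\<close>
  is not scaled and the factor is \<open>R\<close>; all \<open>a_i\<close> merge at
  \<open>e = 0\<close>, which leaves a cone with one vertex. Admissibility, respectively nonparallel
  unbounded edges, makes the limit nondegenerate. The Killing argument runs with the metric of the
  given Kaehler structure: its torus invariance is known on all of \<open>X\<close>, while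
  \<open>g\<close> has a formula only over the interior of \<open>P\<close>.\<close>

definition dird :: "'a::real_normed_vector \<Rightarrow> ('a \<Rightarrow> 'b::real_normed_vector) \<Rightarrow> 'a \<Rightarrow> 'b" where
  "dird v f x = frechet_derivative f (at x) v"

lemma dird_eqI: "(f has_derivative f') (at x) \<Longrightarrow> dird v f x = f' v"
  unfolding dird_def using frechet_derivative_at by metis

lemma pd_eq_dird: "pd i f = dird (axis i 1) f"
  by (auto simp: pd_def dird_def)

lemma has_derivative_dird:
  "f differentiable (at x) \<Longrightarrow> (f has_derivative (\<lambda>v. dird v f x)) (at x)"
  unfolding dird_def using frechet_derivative_works by metis

lemma dird_linear: "f differentiable (at x) \<Longrightarrow> linear (\<lambda>v. dird v f x)"
  using has_derivative_dird has_derivative_linear by blast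

lemma dird_lincomb:
  assumes "f differentiable (at x)"
  shows "dird (\<Sum>i\<in>I. c i *\<^sub>R b i) f x = (\<Sum>i\<in>I. c i *\<^sub>R dird (b i) f x)"
proof -
  note lin = dird_linear[OF assms]
  show ?thesis
    by (simp only: linear_sum[OF lin] linear_cmul[OF lin])
qed

lemma dird_cong_open:
  assumes "open U" "\<And>x. x \<in> U \<Longrightarrow> f x = g x" "x \<in> U"
  shows "dird v f x = dird v g x"
proof -
  have *: "(f has_derivative D) (at x) \<longleftrightarrow> (g has_derivative D) (at x)" for D
    by (metis assms has_derivative_transform_within_open)
  show ?thesis unfolding dird_def frechet_derivative_def * ..
qed

text \<open>The recursion peels off the innermost derivative, while \<open>foldr\<close> in
  \<open>smooth_on_def\<close> peels off the outermost. This form suits closure proofs: product and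
  chain rule express \<open>dird v\<close> of a compound by functions of one order less, so
  induction on \<open>n\<close> with the functions generalised goes through.\<close>

primrec ck :: "nat \<Rightarrow> 'a::euclidean_space set \<Rightarrow> ('a \<Rightarrow> 'b::real_normed_vector) \<Rightarrow> bool" where
  "ck 0 U f = (\<forall>x\<in>U. f differentiable (at x))"
| "ck (Suc n) U f = ((\<forall>x\<in>U. f differentiable (at x)) \<and> (\<forall>v. ck n U (dird v f)))"

lemma ck_diff: "ck n U f \<Longrightarrow> x \<in> U \<Longrightarrow> f differentiable (at x)"
  by (cases n) auto

lemma ck_SucD: "ck (Suc n) U f \<Longrightarrow> ck n U f"
  by (induction n arbitrary: f) auto

text \<open>The innermost derivative of \<open>foldr\<close> is the last entry of the list, hence
  the case split from the right and the appended \<open>[v]\<close>.\<close>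

lemma ck_foldr:
  "ck n U f \<longleftrightarrow> (\<forall>vs. length vs \<le> n \<longrightarrow> (\<forall>x\<in>U. foldr dird vs f differentiable (at x)))"
proof (induction n arbitrary: f)
  case 0
  then show ?case by auto
next
  case (Suc n)
  show ?case
  proof
    assume L: "ck (Suc n) U f"
    show "\<forall>vs. length vs \<le> Suc n \<longrightarrow> (\<forall>x\<in>U. foldr dird vs f differentiable (at x))"
    proof (intro allI impI)
      fix vs :: "'a list" assume "length vs \<le> Suc n"
      with L Suc show "\<forall>x\<in>U. foldr dird vs f differentiable (at x)"
        by (cases vs rule: rev_cases) (auto intro: ck_diff)
    qed
  next
    assume R: "\<forall>vs. length vs \<le> Suc n \<longrightarrow> (\<forall>x\<in>U. foldr dird vs f differentiable (at x))"
    have "\<forall>x\<in>U. foldr dird vs (dird v f) differentiable (at x)" if "length vs \<le> n" for vs v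
      using R[rule_format, of "vs @ [v]"] that by auto
    then show "ck (Suc n) U f"
      using R[rule_format, of "[]"] Suc by auto
  qed
qed

lemma smooth_on_ck: "smooth_on U f \<longleftrightarrow> open U \<and> (\<forall>n. ck n U f)"
proof -
  have "(\<lambda>v h y. frechet_derivative h (at y) v) = (dird :: 'a \<Rightarrow> ('a \<Rightarrow> 'b) \<Rightarrow> 'a \<Rightarrow> 'b)"
    by (intro ext) (simp add: dird_def)
  then show ?thesis unfolding smooth_on_def ck_foldr by auto
qed

lemma smooth_on_open: "smooth_on U f \<Longrightarrow> open U" by (simp add: smooth_on_def)

lemma smooth_on_diff: "smooth_on U f \<Longrightarrow> x \<in> U \<Longrightarrow> f differentiable (at x)"
  using ck_diff smooth_on_ck by blast

lemma smooth_on_has_derivative: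
  "smooth_on U f \<Longrightarrow> x \<in> U \<Longrightarrow> (f has_derivative (\<lambda>v. dird v f x)) (at x)"
  using has_derivative_dird smooth_on_diff by blast

lemma smooth_on_continuous: "smooth_on U f \<Longrightarrow> continuous_on U f"
  by (meson continuous_at_imp_continuous_on differentiable_imp_continuous_within smooth_on_diff)

lemma smooth_on_dird: "smooth_on U f \<Longrightarrow> smooth_on U (dird v f)"
  by (metis smooth_on_ck ck.simps(2))

lemma smooth_on_pd: "smooth_on U f \<Longrightarrow> smooth_on U (pd i f)"
  by (simp add: pd_eq_dird smooth_on_dird)

lemma ck_subset: "ck n U f \<Longrightarrow> V \<subseteq> U \<Longrightarrow> ck n V f"
  by (induction n arbitrary: f) auto

lemma smooth_on_subset: "smooth_on U f \<Longrightarrow> open V \<Longrightarrow> V \<subseteq> U \<Longrightarrow> smooth_on V f"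
  using smooth_on_ck ck_subset by blast

lemma ck_cong: "open U \<Longrightarrow> (\<And>x. x \<in> U \<Longrightarrow> f x = g x) \<Longrightarrow> ck n U f \<Longrightarrow> ck n U g"
proof (induction n arbitrary: f g)
  case 0
  then show ?case
    by (simp) (metis differentiable_def has_derivative_transform_within_open)
next
  case (Suc n)
  have "\<forall>x\<in>U. g differentiable (at x)"
    using Suc.prems by simp (metis differentiable_def has_derivative_transform_within_open)
  moreover have "ck n U (dird v g)" for v
    using Suc.IH[of "dird v f" "dird v g"] Suc.prems dird_cong_open[OF Suc.prems(1,2)] by auto
  ultimately show ?case by simp
qed

lemma smooth_on_cong:
  "smooth_on U f \<Longrightarrow> (\<And>x. x \<in> U \<Longrightarrow> f x = g x) \<Longrightarrow> smooth_on U g"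
  unfolding smooth_on_ck using ck_cong by blast

lemma ck_const: "ck n U (\<lambda>x. c)"
proof (induction n arbitrary: c)
  case (Suc n)
  have "dird v (\<lambda>x::'a. c) = (\<lambda>x. 0)" for v
    by (rule ext) (rule dird_eqI[OF has_derivative_const])
  then show ?case using Suc by auto
qed auto

lemma ck_linear:
  assumes L: "bounded_linear L" and "open U" "ck n U f" shows "ck n U (\<lambda>x. L (f x))"
  using assms(3)
proof (induction n arbitrary: f)
  case 0
  then show ?case
    using L by (auto simp: differentiable_def dest: bounded_linear.has_derivative)
next
  case (Suc n)
  have d: "((\<lambda>x. L (f x)) has_derivative (\<lambda>v. L (dird v f x))) (at x)" if "x \<in> U" for x
    using Suc.prems that by (intro bounded_linear.has_derivative[OF L]) (auto intro!: has_derivative_dird)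
  have "ck n U (dird v (\<lambda>x. L (f x)))" for v
    by (rule ck_cong[OF \<open>open U\<close> _ Suc.IH[of "dird v f"]]) (use Suc.prems dird_eqI[OF d] in auto)
  then show ?case using d by (auto simp: differentiable_def)
qed

lemma ck_add:
  assumes "open U" "ck n U f" "ck n U g" shows "ck n U (\<lambda>x. f x + g x)"
  using assms(2,3)
proof (induction n arbitrary: f g)
  case (Suc n)
  have d: "((\<lambda>x. f x + g x) has_derivative (\<lambda>v. dird v f x + dird v g x)) (at x)" if "x \<in> U" for x
    using Suc.prems that by (intro has_derivative_add) (auto intro!: has_derivative_dird)
  have "ck n U (dird v (\<lambda>x. f x + g x))" for v
    by (rule ck_cong[OF \<open>open U\<close> _ Suc.IH[of "dird v f" "dird v g"]]) (use Suc.prems dird_eqI[OF d] in auto)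
  then show ?case using d by (auto simp: differentiable_def)
qed auto

lemma ck_bilinear:
  assumes B: "bounded_bilinear B" and "open U" "ck n U f" "ck n U g"
  shows "ck n U (\<lambda>x. B (f x) (g x))"
  using assms(3,4)
proof (induction n arbitrary: f g)
  case 0
  then show ?case
    using B by (fastforce simp: differentiable_def dest: bounded_bilinear.FDERIV)
next
  case (Suc n)
  have d: "((\<lambda>x. B (f x) (g x)) has_derivative (\<lambda>v. B (f x) (dird v g x) + B (dird v f x) (g x))) (at x)"
    if "x \<in> U" for x
    using Suc.prems that by (intro bounded_bilinear.FDERIV[OF B]) (auto intro!: has_derivative_dird)
  have "ck n U (dird v (\<lambda>x. B (f x) (g x)))" for v
  proof (rule ck_cong[OF \<open>open U\<close>])
    show "ck n U (\<lambda>x. B (f x) (dird v g x) + B (dird v f x) (g x))"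
      using Suc.prems ck_SucD[OF Suc.prems(1)] ck_SucD[OF Suc.prems(2)]
      by (intro ck_add \<open>open U\<close> Suc.IH) auto
  qed (use dird_eqI[OF d] in auto)
  then show ?case using d by (auto simp: differentiable_def)
qed

lemma ck_sum:
  assumes "open U" "finite I" "\<And>i. i \<in> I \<Longrightarrow> ck n U (f i)" shows "ck n U (\<lambda>x. \<Sum>i\<in>I. f i x)"
  using assms(2,3) by (induction I) (auto intro: ck_const ck_add[OF assms(1)])

text \<open>In the chain rule \<open>g\<close> is differentiated in the direction
  \<open>dird v f x\<close>, which depends on \<open>x\<close>. Expanding this direction in
  \<open>Basis\<close> gives a sum of products of derivatives in fixed directions, to which the
  product rule and the induction hypothesis apply.\<close>

lemma ck_compose:
  fixes f :: "'a::euclidean_space \<Rightarrow> 'b::euclidean_space" and g :: "'b \<Rightarrow> 'c::real_normed_vector"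
  assumes "open U" "open V" "f ` U \<subseteq> V" "ck n U f" "ck n V g"
  shows "ck n U (\<lambda>x. g (f x))"
  using assms(4,5)
proof (induction n arbitrary: g)
  case 0
  then show ?case using assms(3)
    by (auto intro!: differentiable_compose[where f = g and g = f])
next
  case (Suc n)
  have d: "((\<lambda>x. g (f x)) has_derivative (\<lambda>v. dird (dird v f x) g (f x))) (at x)" if "x \<in> U" for x
    using Suc.prems that assms(3)
    by (intro has_derivative_compose[of f _ x UNIV g, simplified]) (auto intro!: has_derivative_dird)
  have "ck n U (dird v (\<lambda>x. g (f x)))" for v
  proof (rule ck_cong[OF \<open>open U\<close>])
    show "ck n U (\<lambda>x. \<Sum>b\<in>Basis. (dird v f x \<bullet> b) *\<^sub>R dird b g (f x))"
      using Suc.prems ck_SucD[OF Suc.prems(1)]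
      by (intro ck_sum \<open>open U\<close> ck_bilinear[OF bounded_bilinear_scaleR] Suc.IH
            ck_linear[OF bounded_linear_inner_left]) auto
    fix x assume x: "x \<in> U"
    have "dird (\<Sum>b\<in>Basis. (dird v f x \<bullet> b) *\<^sub>R b) g (f x) =
      (\<Sum>b\<in>Basis. (dird v f x \<bullet> b) *\<^sub>R dird b g (f x))"
      using Suc.prems x assms(3) by (auto intro!: dird_lincomb)
    then show "(\<Sum>b\<in>Basis. (dird v f x \<bullet> b) *\<^sub>R dird b g (f x)) = dird v (\<lambda>x. g (f x)) x"
      using dird_eqI[OF d[OF x]] by (simp add: euclidean_representation)
  qed
  then show ?case using d by (auto simp: differentiable_def)
qed

lemma ck_id: "ck n U (\<lambda>x. x)"
proof (cases n)
  case (Suc m)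
  have "dird v (\<lambda>x::'a. x) = (\<lambda>x. v)" for v
    by (rule ext) (rule dird_eqI[OF has_derivative_ident])
  then show ?thesis using Suc by (auto intro: ck_const)
qed auto

section \<open>Closure properties of smooth functions\<close>

named_theorems smooth_intros

lemma smooth_on_const[smooth_intros]: "open U \<Longrightarrow> smooth_on U (\<lambda>x. c)"
  by (simp add: smooth_on_ck ck_const)

lemma smooth_on_id[smooth_intros]: "open U \<Longrightarrow> smooth_on U (\<lambda>x. x)"
  by (simp add: smooth_on_ck ck_id)

lemma smooth_on_add[smooth_intros]:
  "smooth_on U f \<Longrightarrow> smooth_on U g \<Longrightarrow> smooth_on U (\<lambda>x. f x + g x)"
  by (simp add: smooth_on_ck ck_add)

lemma smooth_on_bounded_linear:
  "bounded_linear L \<Longrightarrow> smooth_on U f \<Longrightarrow> smooth_on U (\<lambda>x. L (f x))"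
  by (simp add: smooth_on_ck ck_linear)

lemma smooth_on_minus[smooth_intros]: "smooth_on U f \<Longrightarrow> smooth_on U (\<lambda>x. - f x)"
  by (rule smooth_on_bounded_linear[OF bounded_linear_minus[OF bounded_linear_ident]])

lemma smooth_on_difference[smooth_intros]:
  "smooth_on U f \<Longrightarrow> smooth_on U g \<Longrightarrow> smooth_on U (\<lambda>x. f x - g x)"
  using smooth_on_add[of U f "\<lambda>x. - g x"] smooth_on_minus by auto

lemma smooth_on_mult[smooth_intros]:
  fixes f g :: "'a::euclidean_space \<Rightarrow> real"
  shows "smooth_on U f \<Longrightarrow> smooth_on U g \<Longrightarrow> smooth_on U (\<lambda>x. f x * g x)"
  by (simp add: smooth_on_ck ck_bilinear[OF bounded_bilinear_mult])

lemma smooth_on_scaleR[smooth_intros]: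
  "smooth_on U f \<Longrightarrow> smooth_on U g \<Longrightarrow> smooth_on U (\<lambda>x. f x *\<^sub>R g x)"
  by (simp add: smooth_on_ck ck_bilinear[OF bounded_bilinear_scaleR])

lemma smooth_on_inner[smooth_intros]:
  "smooth_on U f \<Longrightarrow> smooth_on U g \<Longrightarrow> smooth_on U (\<lambda>x. f x \<bullet> g x)"
  by (simp add: smooth_on_ck ck_bilinear[OF bounded_bilinear_inner])

lemma smooth_on_sum[smooth_intros]:
  "finite I \<Longrightarrow> open U \<Longrightarrow> (\<And>i. i \<in> I \<Longrightarrow> smooth_on U (f i)) \<Longrightarrow> smooth_on U (\<lambda>x. \<Sum>i\<in>I. f i x)"
  by (simp add: smooth_on_ck ck_sum)

lemma smooth_on_prod[smooth_intros]:
  fixes f :: "'i \<Rightarrow> 'a::euclidean_space \<Rightarrow> real"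
  shows "finite I \<Longrightarrow> open U \<Longrightarrow> (\<And>i. i \<in> I \<Longrightarrow> smooth_on U (f i)) \<Longrightarrow> smooth_on U (\<lambda>x. \<Prod>i\<in>I. f i x)"
  by (induction I rule: finite_induct) (auto intro!: smooth_intros)

lemma smooth_on_power[smooth_intros]:
  fixes f :: "'a::euclidean_space \<Rightarrow> real"
  shows "smooth_on U f \<Longrightarrow> smooth_on U (\<lambda>x. f x ^ k)"
  by (induction k) (auto intro!: smooth_intros dest: smooth_on_open)

lemma smooth_on_compose:
  fixes f :: "'a::euclidean_space \<Rightarrow> 'b::euclidean_space"
  shows "smooth_on V g \<Longrightarrow> smooth_on U f \<Longrightarrow> f ` U \<subseteq> V \<Longrightarrow> smooth_on U (\<lambda>x. g (f x))"
  unfolding smooth_on_ck using ck_compose by blast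

text \<open>The derivative is a polynomial in \<open>inverse x\<close> itself, so order
  \<open>n\<close> yields order \<open>n + 1\<close>.\<close>

lemma smooth_on_inverse_real: "smooth_on (- {0}) (inverse :: real \<Rightarrow> real)"
proof -
  have o: "open (- {0::real})" by auto
  have "ck n (- {0}) (inverse :: real \<Rightarrow> real)" for n
  proof (induction n)
    case 0
    then show ?case by (auto intro!: differentiable_inverse)
  next
    case (Suc n)
    have d: "((inverse :: real \<Rightarrow> real) has_derivative (\<lambda>v. (- v) * (inverse x * inverse x))) (at x)"
      if "x \<noteq> 0" for x
      using has_derivative_inverse'[OF that] by (simp add: mult.commute mult.left_commute)
    have "ck n (- {0}) (dird v (inverse :: real \<Rightarrow> real))" for v
    proof (rule ck_cong[OF o])
      show "ck n (- {0}) (\<lambda>x::real. (- v) * (inverse x * inverse x))"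
        by (intro ck_bilinear[OF bounded_bilinear_mult o] ck_const Suc)
    qed (use dird_eqI[OF d] in auto)
    then show ?case by (auto intro!: differentiable_inverse)
  qed
  then show ?thesis by (simp add: smooth_on_ck o)
qed

lemma smooth_on_inverse[smooth_intros]:
  fixes f :: "'a::euclidean_space \<Rightarrow> real"
  shows "smooth_on U f \<Longrightarrow> (\<And>x. x \<in> U \<Longrightarrow> f x \<noteq> 0) \<Longrightarrow> smooth_on U (\<lambda>x. inverse (f x))"
  by (rule smooth_on_compose[OF smooth_on_inverse_real]) auto

lemma smooth_on_divide[smooth_intros]:
  fixes f :: "'a::euclidean_space \<Rightarrow> real"
  shows "smooth_on U f \<Longrightarrow> smooth_on U g \<Longrightarrow> (\<And>x. x \<in> U \<Longrightarrow> g x \<noteq> 0) \<Longrightarrow> smooth_on U (\<lambda>x. f x / g x)"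
  unfolding divide_inverse by (intro smooth_intros)

text \<open>The same bootstrap: the derivative is a constant times
  \<open>inverse (sqrt x)\<close>.\<close>

lemma smooth_on_sqrt_real: "smooth_on {0<..} (sqrt :: real \<Rightarrow> real)"
proof -
  have o: "open {0::real<..}" by auto
  have d: "(sqrt has_derivative (\<lambda>v. (v / 2) * inverse (sqrt x))) (at x)" if "0 < x" for x
    by (rule has_derivative_eq_rhs[OF has_derivative_real_sqrt[OF that has_derivative_ident]])
       (auto simp: field_simps)
  have "ck n {0<..} (sqrt :: real \<Rightarrow> real)" for n
  proof (induction n)
    case 0
    then show ?case using d by (auto simp: differentiable_def)
  next
    case (Suc n)
    have "ck n {0<..} (dird v (sqrt :: real \<Rightarrow> real))" for v
    proof (rule ck_cong[OF o])
      show "ck n {0<..} (\<lambda>x::real. (v / 2) * inverse (sqrt x))"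
        by (rule ck_bilinear[OF bounded_bilinear_mult o ck_const
              ck_compose[where g = inverse and V = "- {0}", OF o _ _ Suc]])
           (use smooth_on_inverse_real in \<open>auto simp: smooth_on_ck\<close>)
    qed (use dird_eqI[OF d] in auto)
    then show ?case using d by (auto simp: differentiable_def)
  qed
  then show ?thesis by (simp add: smooth_on_ck o)
qed

lemma smooth_on_sqrt[smooth_intros]:
  fixes f :: "'a::euclidean_space \<Rightarrow> real"
  shows "smooth_on U f \<Longrightarrow> (\<And>x. x \<in> U \<Longrightarrow> 0 < f x) \<Longrightarrow> smooth_on U (\<lambda>x. sqrt (f x))"
  by (rule smooth_on_compose[OF smooth_on_sqrt_real]) auto

lemma smooth_on_sin_cos_real:
  "smooth_on UNIV (sin :: real \<Rightarrow> real)" "smooth_on UNIV (cos :: real \<Rightarrow> real)"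
proof -
  have ds: "((sin :: real \<Rightarrow> real) has_derivative (\<lambda>v. v * cos x)) (at x)"
   and dc: "((cos :: real \<Rightarrow> real) has_derivative (\<lambda>v. (- v) * sin x)) (at x)" for x
    by (auto intro!: derivative_eq_intros)
  have es: "dird v (sin :: real \<Rightarrow> real) = (\<lambda>x. v * cos x)"
   and ec: "dird v (cos :: real \<Rightarrow> real) = (\<lambda>x. (- v) * sin x)" for v
    using dird_eqI[OF ds] dird_eqI[OF dc] by auto
  have "ck n UNIV (sin :: real \<Rightarrow> real) \<and> ck n UNIV (cos :: real \<Rightarrow> real)" for n
  proof (induction n)
    case 0
    then show ?case using ds dc by (auto simp: differentiable_def)
  next
    case (Suc n)
    then have "ck n UNIV (dird v (sin :: real \<Rightarrow> real))" "ck n UNIV (dird v (cos :: real \<Rightarrow> real))" for v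
      unfolding es ec by (intro ck_bilinear[OF bounded_bilinear_mult open_UNIV] ck_const; simp)+
    moreover have "(sin :: real \<Rightarrow> real) differentiable (at x)" "(cos :: real \<Rightarrow> real) differentiable (at x)" for x
      using ds dc differentiable_def by blast+
    ultimately show ?case by simp
  qed
  then show "smooth_on UNIV (sin :: real \<Rightarrow> real)" "smooth_on UNIV (cos :: real \<Rightarrow> real)"
    by (auto simp: smooth_on_ck)
qed

lemma smooth_on_sin[smooth_intros]:
  fixes f :: "'a::euclidean_space \<Rightarrow> real"
  shows "smooth_on U f \<Longrightarrow> smooth_on U (\<lambda>x. sin (f x))"
  by (rule smooth_on_compose[OF smooth_on_sin_cos_real(1)]) auto

lemma smooth_on_cos[smooth_intros]:
  fixes f :: "'a::euclidean_space \<Rightarrow> real"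
  shows "smooth_on U f \<Longrightarrow> smooth_on U (\<lambda>x. cos (f x))"
  by (rule smooth_on_compose[OF smooth_on_sin_cos_real(2)]) auto

lemma smooth_on_fst[smooth_intros]: "smooth_on U f \<Longrightarrow> smooth_on U (\<lambda>x. fst (f x))"
  by (rule smooth_on_bounded_linear[OF bounded_linear_fst])

lemma smooth_on_snd[smooth_intros]: "smooth_on U f \<Longrightarrow> smooth_on U (\<lambda>x. snd (f x))"
  by (rule smooth_on_bounded_linear[OF bounded_linear_snd])

lemma smooth_on_Pair[smooth_intros]:
  assumes "smooth_on U f" "smooth_on U g" shows "smooth_on U (\<lambda>x. (f x, g x))"
proof -
  have "smooth_on U (\<lambda>x. (\<lambda>a. (a, 0)) (f x) + (\<lambda>b. (0, b)) (g x))"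
    by (intro smooth_on_add; intro smooth_on_bounded_linear[of "\<lambda>a. (a, 0)"]
        smooth_on_bounded_linear[of "\<lambda>b. (0, b)"] assms bounded_linear_Pair
        bounded_linear_ident bounded_linear_zero)
  then show ?thesis by simp
qed

lemma smooth_on_nth[smooth_intros]: "smooth_on U f \<Longrightarrow> smooth_on U (\<lambda>x. f x $ i)"
  by (rule smooth_on_bounded_linear[OF bounded_linear_vec_nth])

lemma smooth_on_vec:
  fixes f :: "'a::euclidean_space \<Rightarrow> real^'n"
  assumes "open U" "\<And>i. smooth_on U (\<lambda>x. f x $ i)" shows "smooth_on U f"
proof -
  have "smooth_on U (\<lambda>x. \<Sum>i\<in>UNIV. (f x $ i) *\<^sub>R (axis i 1 :: real^'n))"
    by (intro smooth_intros assms) auto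
  then show ?thesis
    by (rule smooth_on_cong) (auto simp: vec_eq_iff axis_def if_distrib cong: if_cong)
qed

lemma smooth_on_matrix:
  fixes f :: "'a::euclidean_space \<Rightarrow> real^'n^'m"
  assumes "open U" "\<And>i j. smooth_on U (\<lambda>x. f x $ i $ j)" shows "smooth_on U f"
proof -
  have "smooth_on U (\<lambda>x. \<Sum>i\<in>UNIV. \<Sum>j\<in>UNIV. (f x $ i $ j) *\<^sub>R (axis i (axis j 1) :: real^'n^'m))"
    by (intro smooth_intros assms) auto
  then show ?thesis
  proof (rule smooth_on_cong)
    fix x
    have "(\<Sum>i\<in>UNIV. \<Sum>j\<in>UNIV. (f x $ i $ j) *\<^sub>R (axis i (axis j 1) :: real^'n^'m)) $ k $ l =
      (\<Sum>i\<in>UNIV. \<Sum>j\<in>UNIV. if k = i then if l = j then f x $ i $ j else 0 else 0)" for k l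
      by (simp, intro sum.cong refl, auto simp: axis_def)
    also have "\<dots> k l = (\<Sum>i\<in>UNIV. if k = i then (\<Sum>j\<in>UNIV. if l = j then f x $ i $ j else 0) else 0)" for k l
      by (intro sum.cong) auto
    also have "\<dots> k l = f x $ k $ l" for k l by simp
    finally show "(\<Sum>i\<in>UNIV. \<Sum>j\<in>UNIV. (f x $ i $ j) *\<^sub>R (axis i (axis j 1) :: real^'n^'m)) = f x"
      by (simp add: vec_eq_iff)
  qed
qed

section \<open>Determinants and inverse matrices\<close>

lemma smooth_on_det:
  fixes f :: "'a::euclidean_space \<Rightarrow> real^'n^'n"
  assumes "smooth_on U f" shows "smooth_on U (\<lambda>x. det (f x))"
  unfolding det_def using smooth_on_open[OF assms] finite_permutations[of "UNIV :: 'n set"]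
  by (intro smooth_intros assms) auto

lemma matrix_inv_mult:
  fixes A :: "real^'n^'n"
  assumes "det A \<noteq> 0"
  shows "A ** matrix_inv A = mat 1" "matrix_inv A ** A = mat 1"
proof -
  have "\<exists>B. A ** B = mat 1 \<and> B ** A = mat 1"
    using assms by (simp add: invertible_det_nz[symmetric] invertible_def)
  then have "A ** matrix_inv A = mat 1 \<and> matrix_inv A ** A = mat 1"
    unfolding matrix_inv_def by (rule someI_ex)
  then show "A ** matrix_inv A = mat 1" "matrix_inv A ** A = mat 1" by auto
qed

text \<open>Cramer's rule for the columns of the identity. It exhibits the entries of the inverse as
  quotients of polynomials in the entries, from which smoothness of \<open>matrix_inv\<close>
  follows.\<close>

lemma matrix_inv_nth:
  fixes A :: "real^'n^'n"
  assumes "det A \<noteq> 0"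
  shows "matrix_inv A $ k $ l = det (\<chi> i j. if j = k then axis l 1 $ i else A $ i $ j) / det A"
proof -
  have "A *v (matrix_inv A *v axis l 1) = axis l 1"
    using assms by (simp add: matrix_vector_mul_assoc matrix_inv_mult)
  then have "matrix_inv A *v axis l 1 = (\<chi> k. det (\<chi> i j. if j = k then axis l 1 $ i else A $ i $ j) / det A)"
    using cramer[OF assms] by blast
  moreover have "(matrix_inv A *v axis l 1) $ k = matrix_inv A $ k $ l"
    by (simp add: matrix_vector_mult_def axis_def if_distrib cong: if_cong)
  ultimately show ?thesis by simp
qed

lemma smooth_on_matrix_inv:
  fixes f :: "'a::euclidean_space \<Rightarrow> real^'n^'n"
  assumes f: "smooth_on U f" and d: "\<And>x. x \<in> U \<Longrightarrow> det (f x) \<noteq> 0"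
  shows "smooth_on U (\<lambda>x. matrix_inv (f x))"
proof (rule smooth_on_matrix)
  show o: "open U" using f smooth_on_open by blast
  fix k l
  have "smooth_on U (\<lambda>x. (\<chi> i j. if j = k then axis l 1 $ i else f x $ i $ j) :: real^'n^'n)"
  proof (rule smooth_on_matrix[OF o])
    fix i j
    show "smooth_on U (\<lambda>x. (\<chi> i j. if j = k then axis l 1 $ i else f x $ i $ j) $ i $ j)"
      by (cases "j = k") (auto intro!: smooth_intros f o)
  qed
  then have "smooth_on U (\<lambda>x. det (\<chi> i j. if j = k then axis l 1 $ i else f x $ i $ j) / det (f x))"
    by (intro smooth_intros smooth_on_det f d)
  then show "smooth_on U (\<lambda>x. matrix_inv (f x) $ k $ l)"
    by (rule smooth_on_cong) (simp add: matrix_inv_nth d)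
qed

subsection \<open>Partial derivatives\<close>

lemma has_derivative_pd:
  fixes f :: "real^'n \<Rightarrow> real"
  assumes "f differentiable (at x)"
  shows "(f has_derivative (\<lambda>v. \<Sum>i\<in>UNIV. v $ i * pd i f x)) (at x)"
proof (rule has_derivative_eq_rhs[OF has_derivative_dird[OF assms]], rule ext)
  fix v :: "real^'n"
  have "v = (\<Sum>i\<in>UNIV. v $ i *\<^sub>R axis i 1)"
    by (auto simp: vec_eq_iff axis_def if_distrib cong: if_cong)
  then have "dird v f x = dird (\<Sum>i\<in>UNIV. v $ i *\<^sub>R axis i 1) f x" by simp
  also have "\<dots> = (\<Sum>i\<in>UNIV. v $ i * pd i f x)"
    unfolding dird_lincomb[OF assms] by (simp add: pd_eq_dird)
  finally show "dird v f x = (\<Sum>i\<in>UNIV. v $ i * pd i f x)" .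
qed

lemma jacobian_nth: "jacobian f (at x) $ i $ j = frechet_derivative f (at x) (axis j 1) $ i"
  by (simp add: jacobian_def matrix_def)

lemma pd_component:
  fixes h :: "real^'n \<Rightarrow> real^'m"
  assumes "h differentiable (at x)"
  shows "pd j (\<lambda>y. h y $ i) x = jacobian h (at x) $ i $ j"
proof -
  have "((\<lambda>y. h y $ i) has_derivative (\<lambda>v. dird v h x $ i)) (at x)"
    by (rule bounded_linear.has_derivative[OF bounded_linear_vec_nth has_derivative_dird[OF assms]])
  from dird_eqI[OF this] show ?thesis by (simp add: pd_eq_dird jacobian_nth dird_def)
qed

lemma jacobian_eqI:
  fixes h :: "real^'n \<Rightarrow> real^'m"
  assumes "(h has_derivative (\<lambda>v. M *v v)) (at x)" shows "jacobian h (at x) = M"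
  unfolding jacobian_def using frechet_derivative_at[OF assms] by (metis matrix_of_matrix_vector_mul)

lemma jacobian_compose:
  fixes h :: "real^'n \<Rightarrow> real^'m" and k :: "real^'m \<Rightarrow> real^'l"
  assumes "h differentiable (at x)" "k differentiable (at (h x))"
  shows "jacobian (\<lambda>y. k (h y)) (at x) = jacobian k (at (h x)) ** jacobian h (at x)"
proof (rule jacobian_eqI)
  have "((\<lambda>y. k (h y)) has_derivative (\<lambda>v. jacobian k (at (h x)) *v (jacobian h (at x) *v v))) (at x)"
    using assms[unfolded jacobian_works] by (rule has_derivative_compose[of h _ x UNIV k, simplified])
  then show "((\<lambda>y. k (h y)) has_derivative (\<lambda>v. (jacobian k (at (h x)) ** jacobian h (at x)) *v v)) (at x)"
    by (simp add: matrix_vector_mul_assoc)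
qed

lemma pd_compose:
  fixes f :: "real^'m \<Rightarrow> real" and h :: "real^'n \<Rightarrow> real^'m"
  assumes "h differentiable (at x)" "f differentiable (at (h x))"
  shows "pd i (\<lambda>y. f (h y)) x = (\<Sum>a\<in>UNIV. jacobian h (at x) $ a $ i * pd a f (h x))"
proof -
  have "((\<lambda>y. f (h y)) has_derivative (\<lambda>v. \<Sum>a\<in>UNIV. (dird v h x) $ a * pd a f (h x))) (at x)"
    by (rule has_derivative_compose[of h _ x UNIV f, simplified,
          OF has_derivative_dird[OF assms(1)] has_derivative_pd[OF assms(2)]])
  from dird_eqI[OF this] show ?thesis by (simp add: pd_eq_dird jacobian_nth dird_def)
qed

lemma pd_add:
  "f differentiable (at x) \<Longrightarrow> g differentiable (at x) \<Longrightarrow> pd i (\<lambda>y. f y + g y) x = pd i f x + pd i g x"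
  unfolding pd_eq_dird by (intro dird_eqI has_derivative_add has_derivative_dird)

lemma pd_mult:
  "f differentiable (at x) \<Longrightarrow> g differentiable (at x) \<Longrightarrow>
   pd i (\<lambda>y. f y * g y) x = f x * pd i g x + pd i f x * g x"
  unfolding pd_eq_dird by (intro dird_eqI has_derivative_mult has_derivative_dird)

lemma pd_sum:
  "(\<And>k. k \<in> I \<Longrightarrow> f k differentiable (at x)) \<Longrightarrow> pd i (\<lambda>y. \<Sum>k\<in>I. f k y) x = (\<Sum>k\<in>I. pd i (f k) x)"
  unfolding pd_eq_dird by (intro dird_eqI has_derivative_sum has_derivative_dird)

lemma pd_const [simp]: "pd i (\<lambda>y. c) x = 0"
  unfolding pd_eq_dird by (rule dird_eqI[OF has_derivative_const])

lemma pd_cmult: "f differentiable (at x) \<Longrightarrow> pd i (\<lambda>y. c * f y) x = c * pd i f x"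
  using pd_mult[of "\<lambda>y. c" x f i] by simp

lemma pd_cong_open:
  "open U \<Longrightarrow> (\<And>x. x \<in> U \<Longrightarrow> f x = g x) \<Longrightarrow> x \<in> U \<Longrightarrow> pd i f x = pd i g x"
  unfolding pd_eq_dird by (rule dird_cong_open)

lemma smooth_on_jacobian:
  fixes h :: "real^'n \<Rightarrow> real^'m"
  assumes "smooth_on U h" shows "smooth_on U (\<lambda>x. jacobian h (at x))"
proof (rule smooth_on_matrix)
  show "smooth_on U (\<lambda>x. jacobian h (at x) $ i $ j)" for i j
    using smooth_on_nth[OF smooth_on_dird[OF assms, of "axis j 1"], of i]
    by (simp add: jacobian_nth dird_def)
qed (use assms smooth_on_open in blast)

text \<open>By the chain rule the two Jacobians multiply to the identity. This supplies the
  nondegeneracy demanded by \<open>is_lift\<close>, for chart group elements and for the passage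
  from \<open>(H, r)\<close> to moment coordinates.\<close>

lemma det_jacobian_left_inverse:
  fixes f :: "real^'n \<Rightarrow> real^'n"
  assumes f: "f differentiable (at x)" and g: "g differentiable (at (f x))"
    and U: "open U" "x \<in> U" "\<And>y. y \<in> U \<Longrightarrow> g (f y) = y"
  shows "det (jacobian f (at x)) \<noteq> 0"
proof -
  have "((\<lambda>y. g (f y)) has_derivative (\<lambda>v. mat 1 *v v)) (at x)"
    using has_derivative_transform_within_open[OF has_derivative_ident U(1,2), of "\<lambda>y. g (f y)"] U(3) by simp
  from jacobian_eqI[OF this] have "det (jacobian g (at (f x)) ** jacobian f (at x)) = 1"
    using jacobian_compose[OF f g] by simp
  then show ?thesis by (auto simp: det_mul)
qed

subsection \<open>Symmetry of second derivatives\<close>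

lemma has_real_derivative_line:
  fixes f :: "'a::euclidean_space \<Rightarrow> real"
  assumes "f differentiable (at (p + s *\<^sub>R u))"
  shows "((\<lambda>s. f (p + s *\<^sub>R u)) has_real_derivative dird u f (p + s *\<^sub>R u)) (at s)"
proof -
  have "((\<lambda>s. p + s *\<^sub>R u) has_derivative (\<lambda>h. h *\<^sub>R u)) (at s)"
    by (auto intro!: derivative_eq_intros)
  from has_derivative_compose[of _ _ s UNIV f, simplified, OF this has_derivative_dird[OF assms]]
  have "((\<lambda>s. f (p + s *\<^sub>R u)) has_derivative (\<lambda>h. dird (h *\<^sub>R u) f (p + s *\<^sub>R u))) (at s)" .
  then show ?thesis
    unfolding has_field_derivative_def linear_cmul[OF dird_linear[OF assms]]
    by (simp add: mult.commute[of _ "dird u f (p + s *\<^sub>R u)"])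
qed

text \<open>Mean value theorem twice: in direction \<open>u\<close> for the difference of
  \<open>f\<close> between the two sides of the parallelogram, then in direction \<open>v\<close>
  for \<open>dird u f\<close>.\<close>

lemma second_difference:
  fixes f :: "'a::euclidean_space \<Rightarrow> real"
  assumes f: "smooth_on U f" and "0 < d"
    and U: "\<And>s t. 0 \<le> s \<Longrightarrow> s \<le> d \<Longrightarrow> 0 \<le> t \<Longrightarrow> t \<le> d \<Longrightarrow> x + s *\<^sub>R u + t *\<^sub>R v \<in> U"
  shows "\<exists>s t. 0 \<le> s \<and> s \<le> d \<and> 0 \<le> t \<and> t \<le> d \<and>
    f (x + d *\<^sub>R u + d *\<^sub>R v) - f (x + d *\<^sub>R u) - f (x + d *\<^sub>R v) + f x
      = d * d * dird v (dird u f) (x + s *\<^sub>R u + t *\<^sub>R v)"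
proof -
  let ?g = "\<lambda>s. f (x + d *\<^sub>R v + s *\<^sub>R u) - f (x + s *\<^sub>R u)"
  have U': "x + d *\<^sub>R v + s *\<^sub>R u \<in> U" "x + s *\<^sub>R u \<in> U" if "0 \<le> s" "s \<le> d" for s
    using U[of s d] U[of s 0] that \<open>0 < d\<close> by (auto simp: algebra_simps)
  have "\<exists>s>0. s < d \<and> ?g d - ?g 0 =
     (d - 0) * (dird u f (x + d *\<^sub>R v + s *\<^sub>R u) - dird u f (x + s *\<^sub>R u))"
    by (rule MVT2[OF \<open>0 < d\<close>])
       (intro DERIV_diff has_real_derivative_line smooth_on_diff[OF f] U')
  then obtain s where s: "0 < s" "s < d" and 1: "?g d - ?g 0 =
     d * (dird u f (x + d *\<^sub>R v + s *\<^sub>R u) - dird u f (x + s *\<^sub>R u))" by auto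
  have "\<exists>t>0. t < d \<and> dird u f ((x + s *\<^sub>R u) + d *\<^sub>R v) - dird u f ((x + s *\<^sub>R u) + 0 *\<^sub>R v) =
     (d - 0) * dird v (dird u f) ((x + s *\<^sub>R u) + t *\<^sub>R v)"
    by (rule MVT2[OF \<open>0 < d\<close>])
       (use s U in \<open>intro has_real_derivative_line smooth_on_diff[OF smooth_on_dird[OF f]]; simp\<close>)
  then obtain t where t: "0 < t" "t < d" and 2: "dird u f (x + s *\<^sub>R u + d *\<^sub>R v) - dird u f (x + s *\<^sub>R u) =
     d * dird v (dird u f) (x + s *\<^sub>R u + t *\<^sub>R v)" by auto
  have eq: "x + d *\<^sub>R v + s *\<^sub>R u = x + s *\<^sub>R u + d *\<^sub>R v" for s by simp
  show ?thesis
    using 1 2 s t unfolding eq by (intro exI[of _ s] exI[of _ t]) (simp add: algebra_simps)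
qed

text \<open>The second difference over the parallelogram spanned by \<open>d u\<close> and
  \<open>d v\<close> is symmetric in \<open>u\<close> and \<open>v\<close>. Hence the two mixed
  derivatives, each taken at some point of the parallelogram, agree; continuity at \<open>x\<close>
  turns this into equality at \<open>x\<close>.\<close>

lemma dird_commute:
  fixes f :: "'a::euclidean_space \<Rightarrow> real"
  assumes f: "smooth_on U f" and x: "x \<in> U"
  shows "dird v (dird u f) x = dird u (dird v f) x"
proof (rule ccontr)
  let ?a = "dird v (dird u f)" and ?b = "dird u (dird v f)"
  define e where "e = \<bar>?a x - ?b x\<bar> / 2"
  assume "?a x \<noteq> ?b x"
  then have "e > 0" by (simp add: e_def)
  have "isCont ?a x" "isCont ?b x"
    using f x by (meson continuous_on_eq_continuous_at smooth_on_continuous smooth_on_dird smooth_on_open)+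
  then obtain r1 r2 where r1: "r1 > 0" "\<And>y. dist y x < r1 \<Longrightarrow> dist (?a y) (?a x) < e"
    and r2: "r2 > 0" "\<And>y. dist y x < r2 \<Longrightarrow> dist (?b y) (?b x) < e"
    unfolding continuous_at_eps_delta using \<open>e > 0\<close> by metis
  obtain r3 where r3: "r3 > 0" "ball x r3 \<subseteq> U"
    using f x smooth_on_open openE by metis
  define r where "r = min r1 (min r2 r3)"
  define d where "d = r / (2 * (norm u + norm v + 1))"
  have "r > 0" using r1 r2 r3 by (simp add: r_def)
  then have "d > 0" by (simp add: d_def add_nonneg_pos)
  have near: "dist (x + s *\<^sub>R u + t *\<^sub>R v) x < r" if "0 \<le> s" "s \<le> d" "0 \<le> t" "t \<le> d" for s t
  proof -
    have "dist (x + s *\<^sub>R u + t *\<^sub>R v) x = norm (s *\<^sub>R u + t *\<^sub>R v)" by (simp add: dist_norm)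
    also have "\<dots> \<le> s * norm u + t * norm v"
      using norm_triangle_ineq[of "s *\<^sub>R u" "t *\<^sub>R v"] that by simp
    also have "\<dots> \<le> d * norm u + d * norm v"
      using that by (intro add_mono mult_right_mono) auto
    also have "\<dots> < d * (2 * (norm u + norm v + 1))"
      using \<open>d > 0\<close> by (simp add: algebra_simps add_nonneg_pos add_pos_nonneg)
    also have "\<dots> = r" using norm_ge_zero[of u] norm_ge_zero[of v] by (simp add: d_def field_simps add_nonneg_eq_0_iff)
    finally show ?thesis .
  qed
  have near': "dist (x + s *\<^sub>R v + t *\<^sub>R u) x < r" if "0 \<le> s" "s \<le> d" "0 \<le> t" "t \<le> d" for s t
    using near[of t s] that by (simp add: algebra_simps)
  have inU: "y \<in> U" if "dist y x < r" for y
    using that r3(2) by (auto simp: r_def dist_commute subset_iff)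
  obtain s t where st: "0 \<le> s" "s \<le> d" "0 \<le> t" "t \<le> d" and
    1: "f (x + d *\<^sub>R u + d *\<^sub>R v) - f (x + d *\<^sub>R u) - f (x + d *\<^sub>R v) + f x
      = d * d * ?a (x + s *\<^sub>R u + t *\<^sub>R v)"
    using second_difference[OF f \<open>d > 0\<close>, of x u v] near inU by metis
  obtain s' t' where st': "0 \<le> s'" "s' \<le> d" "0 \<le> t'" "t' \<le> d" and
    2: "f (x + d *\<^sub>R v + d *\<^sub>R u) - f (x + d *\<^sub>R v) - f (x + d *\<^sub>R u) + f x
      = d * d * ?b (x + s' *\<^sub>R v + t' *\<^sub>R u)"
    using second_difference[OF f \<open>d > 0\<close>, of x v u] near' inU by metis
  have "x + d *\<^sub>R v + d *\<^sub>R u = x + d *\<^sub>R u + d *\<^sub>R v" by simp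
  then have "d * d * ?a (x + s *\<^sub>R u + t *\<^sub>R v) = d * d * ?b (x + s' *\<^sub>R v + t' *\<^sub>R u)"
    using 1 2[unfolded \<open>x + d *\<^sub>R v + d *\<^sub>R u = x + d *\<^sub>R u + d *\<^sub>R v\<close>] by linarith
  then have "?a (x + s *\<^sub>R u + t *\<^sub>R v) = ?b (x + s' *\<^sub>R v + t' *\<^sub>R u)"
    using \<open>d > 0\<close> by simp
  moreover have "\<bar>?a (x + s *\<^sub>R u + t *\<^sub>R v) - ?a x\<bar> < e"
    using r1(2)[of "x + s *\<^sub>R u + t *\<^sub>R v"] near[OF st] by (simp add: r_def dist_real_def)
  moreover have "\<bar>?b (x + s' *\<^sub>R v + t' *\<^sub>R u) - ?b x\<bar> < e"
    using r2(2)[of "x + s' *\<^sub>R v + t' *\<^sub>R u"] near'[OF st'] by (simp add: r_def dist_real_def)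
  ultimately show False unfolding e_def by argo
qed

lemma pd_commute: "smooth_on U f \<Longrightarrow> x \<in> U \<Longrightarrow> pd i (pd j f) x = pd j (pd i f) x"
  unfolding pd_eq_dird by (rule dird_commute)

subsection \<open>Local inverses and null sets\<close>

lemma blinfun_jacobian_continuous:
  fixes f :: "'a::euclidean_space \<Rightarrow> 'a"
  assumes "smooth_on U f"
  shows "continuous_on U (\<lambda>x. Blinfun (\<lambda>v. dird v f x))"
proof (rule continuous_on_blinfun_componentwise)
  fix i :: 'a
  have "blinfun_apply (Blinfun (\<lambda>v. dird v f x)) i = dird i f x" if "x \<in> U" for x
    using bounded_linear_Blinfun_apply has_derivative_bounded_linear
      has_derivative_dird[OF smooth_on_diff[OF assms that]] by (metis (mono_tags))
  moreover have "continuous_on U (dird i f)"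
    using assms smooth_on_continuous smooth_on_dird by blast
  ultimately show "continuous_on U (\<lambda>x. blinfun_apply (Blinfun (\<lambda>v. dird v f x)) i)"
    by (simp cong: continuous_on_cong)
qed

text \<open>The inverse function theorem gives a differentiable inverse \<open>k\<close> whose
  derivative at \<open>y\<close> is the inverse matrix of \<open>D f\<close> at \<open>k y\<close>.
  The right-hand side is a smooth function of \<open>k y\<close>, so \<open>ck n\<close> for
  \<open>k\<close> gives \<open>ck n\<close> for its derivatives, and smoothness follows by
  induction.\<close>

lemma smooth_local_inverse:
  fixes f :: "real^'n \<Rightarrow> real^'n"
  assumes f: "smooth_on U f" and x: "x \<in> U" and d: "det (jacobian f (at x)) \<noteq> 0"
  obtains U' V k where "open U'" "U' \<subseteq> U" "x \<in> U'" "open V" "homeomorphism U' V f k" "smooth_on V k"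
    "\<And>y. y \<in> V \<Longrightarrow> det (jacobian k (at y)) \<noteq> 0"
proof -
  \<comment> \<open>Restricting to the points with invertible Jacobian makes the matrix formula for
    the derivative of \<open>k\<close> valid on all of \<open>V\<close>.\<close>
  define W where "W = {y \<in> U. det (jacobian f (at y)) \<noteq> 0}"
  have sJ: "smooth_on U (\<lambda>x. jacobian f (at x))" by (rule smooth_on_jacobian[OF f])
  have "open W"
  proof -
    have "continuous_on U (\<lambda>y. det (jacobian f (at y)))"
      by (rule smooth_on_continuous[OF smooth_on_det[OF sJ]])
    then have "open ((\<lambda>y. det (jacobian f (at y))) -` (- {0}) \<inter> U)"
      by (metis continuous_on_open_vimage smooth_on_open[OF f] open_Compl closed_singleton)
    moreover have "W = (\<lambda>y. det (jacobian f (at y))) -` (- {0}) \<inter> U" by (auto simp: W_def)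
    ultimately show ?thesis by simp
  qed
  have fW: "smooth_on W f" by (rule smooth_on_subset[OF f \<open>open W\<close>]) (auto simp: W_def)
  let ?D = "\<lambda>x. Blinfun (\<lambda>v. dird v f x)"
  have D: "blinfun_apply (?D y) = (\<lambda>v. jacobian f (at y) *v v)" "(f has_derivative blinfun_apply (?D y)) (at y)"
    if "y \<in> W" for y
  proof -
    have h: "(f has_derivative (\<lambda>v. dird v f y)) (at y)" by (rule smooth_on_has_derivative[OF fW that])
    then have e: "blinfun_apply (?D y) = (\<lambda>v. dird v f y)"
      using bounded_linear_Blinfun_apply has_derivative_bounded_linear by blast
    show "(f has_derivative blinfun_apply (?D y)) (at y)" using h e by simp
    show "blinfun_apply (?D y) = (\<lambda>v. jacobian f (at y) *v v)"
      unfolding e by (rule has_derivative_unique[OF h smooth_on_diff[OF fW that, unfolded jacobian_works]])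
  qed
  have xW: "x \<in> W" using x d by (simp add: W_def)
  define Ji where "Ji = Blinfun (\<lambda>v. matrix_inv (jacobian f (at x)) *v v)"
  have Ji: "blinfun_apply Ji = (\<lambda>v. matrix_inv (jacobian f (at x)) *v v)"
    unfolding Ji_def by (rule bounded_linear_Blinfun_apply) (simp add: matrix_vector_mul_bounded_linear)
  have inv: "Ji o\<^sub>L ?D x = id_blinfun"
    by (rule blinfun_eqI) (simp add: Ji D[OF xW] matrix_vector_mul_assoc matrix_inv_mult[OF d])
  obtain U' V k k' where H: "open U'" "U' \<subseteq> W" "x \<in> U'" "open V" "homeomorphism U' V f k"
    and k': "\<And>y. y \<in> V \<Longrightarrow> (k has_derivative (k' y)) (at y)"
    and k'': "\<And>y. y \<in> V \<Longrightarrow> k' y = inv_into UNIV (blinfun_apply (?D (k y)))"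
    using inverse_function_theorem[OF \<open>open W\<close> D(2) blinfun_jacobian_continuous[OF fW] xW inv] by metis
  have kV: "k ` V \<subseteq> U'" using H(5) by (simp add: homeomorphism_def)
  have k'_eq: "k' y = (\<lambda>v. matrix_inv (jacobian f (at (k y))) *v v)" if "y \<in> V" for y
  proof -
    have W: "k y \<in> W" using kV H that by blast
    then have nz: "det (jacobian f (at (k y))) \<noteq> 0" by (simp add: W_def)
    show ?thesis unfolding k''[OF that] D(1)[OF W]
      by (rule inv_unique_comp) (auto simp: fun_eq_iff matrix_vector_mul_assoc matrix_inv_mult[OF nz])
  qed
  define M where "M = (\<lambda>z. matrix_inv (jacobian f (at z)))"
  have sM: "smooth_on W M" unfolding M_def
    by (rule smooth_on_matrix_inv[OF smooth_on_jacobian[OF fW]]) (simp add: W_def)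
  have kd: "dird v k y = M (k y) *v v" if "y \<in> V" for v y
    using dird_eqI[OF k'[OF that]] k'_eq[OF that] by (simp add: M_def)
  have "ck n V k" for n
  proof (induction n)
    case 0
    then show ?case using k' by (auto simp: differentiable_def)
  next
    case (Suc n)
    have "ck n V (dird v k)" for v
    proof (rule ck_cong[OF \<open>open V\<close> kd[symmetric]])
      have "smooth_on W (\<lambda>z. M z *v v)"
        unfolding matrix_vector_mult_def
        by (rule smooth_on_vec[OF \<open>open W\<close>]) (simp, intro smooth_intros sM \<open>open W\<close>, auto)
      then show "ck n V (\<lambda>y. M (k y) *v v)"
        using kV H by (intro ck_compose[OF \<open>open V\<close> \<open>open W\<close> _ Suc]) (auto simp: smooth_on_ck)
    qed
    then show ?case using k' by (auto simp: differentiable_def)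
  qed
  then have "smooth_on V k" using \<open>open V\<close> by (simp add: smooth_on_ck)
  moreover have "det (jacobian k (at y)) \<noteq> 0" if "y \<in> V" for y
  proof -
    have "jacobian k (at y) = M (k y)"
      using k'[OF that] k'_eq[OF that] by (intro jacobian_eqI) (simp add: M_def)
    moreover have "k y \<in> W" using kV H that by blast
    then have nz: "det (jacobian f (at (k y))) \<noteq> 0" by (simp add: W_def)
    have "det (M (k y)) * det (jacobian f (at (k y))) = 1"
      unfolding M_def det_mul[symmetric] matrix_inv_mult[OF nz] by simp
    ultimately show ?thesis by auto
  qed
  ultimately show ?thesis using that H by (metis (no_types, lifting) W_def mem_Collect_eq subsetI subset_iff)
qed

text \<open>Replacing the coordinate \<open>y $ i\<close> by the value \<open>f y\<close> gives a
  local diffeomorphism wherever \<open>pd i f\<close> does not vanish. It sends the zero set into a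
  coordinate hyperplane, and the smooth inverse carries null sets to null sets.\<close>

lemma negligible_regular_zeros:
  fixes f :: "real^'n \<Rightarrow> real"
  assumes f: "smooth_on U f"
  shows "negligible {x \<in> U. f x = 0 \<and> pd i f x \<noteq> 0}" (is "negligible ?Z")
proof -
  have o: "open U" using f smooth_on_open by blast
  have "\<exists>W. openin (top_of_set ?Z) W \<and> x \<in> W \<and> negligible W" if x: "x \<in> ?Z" for x
  proof -
    define g :: "real^'n \<Rightarrow> real^'n" where "g = (\<lambda>y. y + (f y - y $ i) *\<^sub>R axis i 1)"
    have sg: "smooth_on U g" unfolding g_def by (intro smooth_intros f o)
    have xU: "x \<in> U" using x by simp
    have "(g has_derivative (\<lambda>v. v + (dird v f x - v $ i) *\<^sub>R axis i 1)) (at x)"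
      unfolding g_def
      by (intro has_derivative_add has_derivative_ident has_derivative_scaleR_left has_derivative_diff
          smooth_on_has_derivative[OF f xU] bounded_linear.has_derivative[OF bounded_linear_vec_nth])
    from fun_cong[OF has_derivative_unique[OF smooth_on_diff[OF sg xU, unfolded jacobian_works] this]]
    have J: "jacobian g (at x) *v v = v + (dird v f x - v $ i) *\<^sub>R axis i 1" for v .
    have "det (jacobian g (at x)) \<noteq> 0"
    proof -
      have "v = 0" if "jacobian g (at x) *v v = 0" for v
      proof -
        have v: "v + (dird v f x - v $ i) *\<^sub>R axis i 1 = 0" using that J by simp
        then have "v $ j = 0" if "j \<noteq> i" for j
          using that by (auto simp: vec_eq_iff axis_def dest: spec[of _ j])
        then have v2: "v = (v $ i) *\<^sub>R axis i 1" by (auto simp: vec_eq_iff axis_def)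
        have "dird v f x = 0" using v by (auto simp: vec_eq_iff axis_def dest: spec[of _ i])
        moreover have "dird v f x = (v $ i) * pd i f x"
          by (subst v2) (simp add: linear_cmul[OF dird_linear[OF smooth_on_diff[OF f xU]]] pd_eq_dird)
        ultimately have "v $ i = 0" using x by simp
        then show "v = 0" using v2 by simp
      qed
      then have "\<exists>B. B ** jacobian g (at x) = mat 1"
        using matrix_left_invertible_ker by blast
      then show ?thesis by (metis invertible_det_nz invertible_left_inverse)
    qed
    from smooth_local_inverse[OF sg xU this]
    obtain U' V k where U': "open U'" "U' \<subseteq> U" "x \<in> U'" "open V" "homeomorphism U' V g k" "smooth_on V k"
      by metis
    let ?H = "{y. y $ i = 0} \<inter> V"
    have "negligible (k ` ?H)"
    proof (rule negligible_differentiable_image_negligible)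
      have "negligible {y::real^'n. y $ i = 0}" by (rule negligible_standard_hyperplane_cart)
      then show "negligible ?H" by (rule negligible_subset) auto
      show "k differentiable_on ?H"
        using smooth_on_diff[OF U'(6)] by (auto simp: differentiable_on_def intro: differentiable_at_withinI)
    qed auto
    moreover have "?Z \<inter> U' \<subseteq> k ` ?H"
    proof
      fix z assume z: "z \<in> ?Z \<inter> U'"
      then have "k (g z) = z" "g z \<in> V" using U'(5) by (auto simp: homeomorphism_def)
      moreover have "g z $ i = 0" using z by (simp add: g_def)
      ultimately show "z \<in> k ` ?H" by force
    qed
    ultimately have "negligible (?Z \<inter> U')" using negligible_subset by blast
    then show ?thesis using U' x by (intro exI[of _ "?Z \<inter> U'"]) (auto simp: openin_open)
  qed
  then show ?thesis using locally_negligible_alt[of ?Z] by blast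
qed

section \<open>Invariance of the curvature\<close>

subsection \<open>Smoothness\<close>

lemma smooth_on_christoffel:
  fixes G :: "real^'n \<Rightarrow> real^'n^'n"
  assumes "smooth_on U G" "\<And>u. u \<in> U \<Longrightarrow> det (G u) \<noteq> 0"
  shows "smooth_on U (christoffel G k i j)"
  unfolding christoffel_def using assms smooth_on_open[OF assms(1)]
  by (intro smooth_intros smooth_on_matrix_inv smooth_on_pd) auto

lemma smooth_on_riemann:
  fixes G :: "real^'n \<Rightarrow> real^'n^'n"
  assumes "smooth_on U G" "\<And>u. u \<in> U \<Longrightarrow> det (G u) \<noteq> 0"
  shows "smooth_on U (riemann G l i j k)"
  unfolding riemann_def using assms smooth_on_open[OF assms(1)]
  by (intro smooth_intros smooth_on_pd smooth_on_christoffel) auto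

lemma smooth_on_riemann_norm_sq:
  fixes G :: "real^'n \<Rightarrow> real^'n^'n"
  assumes "smooth_on U G" "\<And>u. u \<in> U \<Longrightarrow> det (G u) \<noteq> 0"
  shows "smooth_on U (riemann_norm_sq G)"
  unfolding riemann_norm_sq_def using assms smooth_on_open[OF assms(1)]
  by (intro smooth_intros smooth_on_matrix_inv smooth_on_riemann) auto

lemma christoffel_cong:
  assumes "open U" "\<And>x. x \<in> U \<Longrightarrow> F x = G x" "u \<in> U"
  shows "christoffel F k i j u = christoffel G k i j u"
proof -
  have "pd i (\<lambda>y. F y $ j $ l) u = pd i (\<lambda>y. G y $ j $ l) u" for i j l
    by (rule pd_cong_open[OF assms(1) _ assms(3)]) (simp add: assms(2))
  then show ?thesis using assms(2,3) by (simp add: christoffel_def)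
qed

lemma riemann_cong:
  assumes "open U" "\<And>x. x \<in> U \<Longrightarrow> F x = G x" "u \<in> U"
  shows "riemann F l i j k u = riemann G l i j k u"
proof -
  have "pd i (christoffel F l j k) u = pd i (christoffel G l j k) u" for i j l k
    by (rule pd_cong_open[OF assms(1) _ assms(3)]) (rule christoffel_cong[OF assms(1,2)])
  then show ?thesis using christoffel_cong[OF assms] by (simp add: riemann_def)
qed

lemma riemann_norm_sq_cong:
  assumes "open U" "\<And>x. x \<in> U \<Longrightarrow> F x = G x" "u \<in> U"
  shows "riemann_norm_sq F u = riemann_norm_sq G u"
  using riemann_cong[OF assms] assms(2,3) by (simp add: riemann_norm_sq_def)

subsection \<open>Quadratic contractions\<close>

text \<open>Handles one pair of indices of a tensor norm: \<open>M\<close> is the inverse metric and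
  \<open>B\<close> the form on the remaining indices. Three nested copies around \<open>form\<close>
  give the norm of a tensor with three lower indices and one upper index, so a coordinate change can
  be carried out one index at a time.\<close>

definition contraction :: "real^'n^'n \<Rightarrow> ('a \<Rightarrow> 'a \<Rightarrow> real) \<Rightarrow> 'a^'n \<Rightarrow> 'a^'n \<Rightarrow> real" where
  "contraction M B X Y = (\<Sum>i\<in>UNIV. \<Sum>i'\<in>UNIV. M $ i $ i' * B (X $ i) (Y $ i'))"

lemma bilinear_contraction:
  fixes B :: "'a::real_vector \<Rightarrow> 'a \<Rightarrow> real"
  assumes "bilinear B" shows "bilinear (contraction M B)"
  unfolding bilinear_def contraction_def
  by (auto intro!: linearI simp: bilinear_ladd[OF assms] bilinear_radd[OF assms] bilinear_lmul[OF assms]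
      bilinear_rmul[OF assms] sum.distrib[symmetric] sum_distrib_left algebra_simps)

lemma contraction_transform:
  fixes B :: "'a::real_vector \<Rightarrow> 'a \<Rightarrow> real" and M J :: "real^'n^'n"
  assumes B: "bilinear B"
  shows "contraction M B (\<chi> i. \<Sum>a\<in>UNIV. J $ a $ i *\<^sub>R X $ a) (\<chi> i. \<Sum>a\<in>UNIV. J $ a $ i *\<^sub>R Y $ a) =
    contraction (J ** M ** transpose J) B X Y"
proof -
  have "contraction M B (\<chi> i. \<Sum>a\<in>UNIV. J $ a $ i *\<^sub>R X $ a) (\<chi> i. \<Sum>a\<in>UNIV. J $ a $ i *\<^sub>R Y $ a) =
    (\<Sum>i\<in>UNIV. \<Sum>i'\<in>UNIV. \<Sum>a\<in>UNIV. \<Sum>a'\<in>UNIV. J $ a $ i * M $ i $ i' * J $ a' $ i' * B (X $ a) (Y $ a'))"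
    unfolding contraction_def
  proof (intro sum.cong refl)
    fix i i' :: 'n
    have "B (\<Sum>a\<in>UNIV. J $ a $ i *\<^sub>R X $ a) (\<Sum>a\<in>UNIV. J $ a $ i' *\<^sub>R Y $ a) =
      (\<Sum>a\<in>UNIV. \<Sum>a'\<in>UNIV. J $ a $ i * J $ a' $ i' * B (X $ a) (Y $ a'))"
      by (simp add: bilinear_sum[OF B] bilinear_lmul[OF B] bilinear_rmul[OF B] sum.cartesian_product
          case_prod_beta algebra_simps)
    then show "M $ i $ i' * B ((\<chi> i. \<Sum>a\<in>UNIV. J $ a $ i *\<^sub>R X $ a) $ i) ((\<chi> i. \<Sum>a\<in>UNIV. J $ a $ i *\<^sub>R Y $ a) $ i') =
      (\<Sum>a\<in>UNIV. \<Sum>a'\<in>UNIV. J $ a $ i * M $ i $ i' * J $ a' $ i' * B (X $ a) (Y $ a'))"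
      by (simp add: sum_distrib_left algebra_simps)
  qed
  also have "\<dots> = (\<Sum>i\<in>UNIV. \<Sum>a\<in>UNIV. \<Sum>i'\<in>UNIV. \<Sum>a'\<in>UNIV. J $ a $ i * M $ i $ i' * J $ a' $ i' * B (X $ a) (Y $ a'))"
    by (intro sum.cong refl sum.swap)
  also have "\<dots> = (\<Sum>a\<in>UNIV. \<Sum>i\<in>UNIV. \<Sum>a'\<in>UNIV. \<Sum>i'\<in>UNIV. J $ a $ i * M $ i $ i' * J $ a' $ i' * B (X $ a) (Y $ a'))"
    by (subst sum.swap) (intro sum.cong refl sum.swap)
  also have "\<dots> = (\<Sum>a\<in>UNIV. \<Sum>a'\<in>UNIV. \<Sum>i\<in>UNIV. \<Sum>i'\<in>UNIV. J $ a $ i * M $ i $ i' * J $ a' $ i' * B (X $ a) (Y $ a'))"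
    by (intro sum.cong refl sum.swap)
  also have "\<dots> = (\<Sum>a\<in>UNIV. \<Sum>a'\<in>UNIV. \<Sum>i'\<in>UNIV. \<Sum>i\<in>UNIV. J $ a $ i * M $ i $ i' * J $ a' $ i' * B (X $ a) (Y $ a'))"
    by (intro sum.cong refl sum.swap)
  also have "\<dots> = contraction (J ** M ** transpose J) B X Y"
    unfolding contraction_def matrix_matrix_mult_def transpose_def
    by (simp add: sum_distrib_right)
  finally show ?thesis .
qed

text \<open>The upper index \<open>l\<close> comes last, so that
  \<open>rtensor G u $ i $ j $ k\<close> is a vector to which a Jacobian or
  \<open>form (G u)\<close> applies.\<close>

definition rtensor :: "(real^'n \<Rightarrow> real^'n^'n) \<Rightarrow> real^'n::finite \<Rightarrow> real^'n^'n^'n^'n" where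
  "rtensor G u = (\<chi> i j k l. riemann G l i j k u)"

definition form :: "real^'n^'n \<Rightarrow> real^'n \<Rightarrow> real^'n \<Rightarrow> real" where
  "form M x y = x \<bullet> (M *v y)"

lemma bilinear_form: "bilinear (form M)"
  unfolding bilinear_def form_def
  by (auto intro!: linearI simp: inner_add_left inner_add_right matrix_vector_right_distrib
      matrix_vector_mult_scaleR)

lemma form_transform: "form (transpose J ** M ** J) x y = form M (J *v x) (J *v y)"
proof -
  have "x \<bullet> (transpose J *v z) = (J *v x) \<bullet> z" for z
    by (metis dot_lmul_matrix vector_transpose_matrix)
  then show ?thesis unfolding form_def by (metis matrix_vector_mul_assoc)
qed

text \<open>Only the order of summation differs; the primed indices are moved past the unprimed ones
  by adjacent swaps.\<close>

lemma riemann_norm_sq_contraction: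
  "riemann_norm_sq G u = (let I = matrix_inv (G u) in
     contraction I (contraction I (contraction I (form (G u)))) (rtensor G u) (rtensor G u))"
proof -
  let ?I = "matrix_inv (G u)" and ?R = "riemann G"
  let ?t = "\<lambda>i i' j j' k k' l l'. ?I $ i $ i' * ?I $ j $ j' * ?I $ k $ k' * G u $ l $ l' * ?R l i j k u * ?R l' i' j' k' u"
  have "contraction ?I (contraction ?I (contraction ?I (form (G u)))) (rtensor G u) (rtensor G u) =
    (\<Sum>i\<in>UNIV. \<Sum>i'\<in>UNIV. \<Sum>j\<in>UNIV. \<Sum>j'\<in>UNIV. \<Sum>k\<in>UNIV. \<Sum>k'\<in>UNIV. \<Sum>l\<in>UNIV. \<Sum>l'\<in>UNIV. ?t i i' j j' k k' l l')"
    by (simp add: contraction_def form_def rtensor_def inner_vec_def matrix_vector_mult_def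
        sum_distrib_left algebra_simps)
  also have "\<dots> = (\<Sum>i\<in>UNIV. \<Sum>j\<in>UNIV. \<Sum>i'\<in>UNIV. \<Sum>j'\<in>UNIV. \<Sum>k\<in>UNIV. \<Sum>k'\<in>UNIV. \<Sum>l\<in>UNIV. \<Sum>l'\<in>UNIV. ?t i i' j j' k k' l l')"
    by (rule sum.cong[OF refl], rule sum.swap)
  also have "\<dots> = (\<Sum>i\<in>UNIV. \<Sum>j\<in>UNIV. \<Sum>i'\<in>UNIV. \<Sum>k\<in>UNIV. \<Sum>j'\<in>UNIV. \<Sum>k'\<in>UNIV. \<Sum>l\<in>UNIV. \<Sum>l'\<in>UNIV. ?t i i' j j' k k' l l')"
    by (rule sum.cong[OF refl], rule sum.cong[OF refl], rule sum.cong[OF refl], rule sum.swap)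
  also have "\<dots> = (\<Sum>i\<in>UNIV. \<Sum>j\<in>UNIV. \<Sum>k\<in>UNIV. \<Sum>i'\<in>UNIV. \<Sum>j'\<in>UNIV. \<Sum>k'\<in>UNIV. \<Sum>l\<in>UNIV. \<Sum>l'\<in>UNIV. ?t i i' j j' k k' l l')"
    by (rule sum.cong[OF refl], rule sum.cong[OF refl], rule sum.swap)
  also have "\<dots> = (\<Sum>i\<in>UNIV. \<Sum>j\<in>UNIV. \<Sum>k\<in>UNIV. \<Sum>i'\<in>UNIV. \<Sum>j'\<in>UNIV. \<Sum>l\<in>UNIV. \<Sum>k'\<in>UNIV. \<Sum>l'\<in>UNIV. ?t i i' j j' k k' l l')"
    by (rule sum.cong[OF refl], rule sum.cong[OF refl], rule sum.cong[OF refl], rule sum.cong[OF refl], rule sum.cong[OF refl], rule sum.swap)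
  also have "\<dots> = (\<Sum>i\<in>UNIV. \<Sum>j\<in>UNIV. \<Sum>k\<in>UNIV. \<Sum>i'\<in>UNIV. \<Sum>l\<in>UNIV. \<Sum>j'\<in>UNIV. \<Sum>k'\<in>UNIV. \<Sum>l'\<in>UNIV. ?t i i' j j' k k' l l')"
    by (rule sum.cong[OF refl], rule sum.cong[OF refl], rule sum.cong[OF refl], rule sum.cong[OF refl], rule sum.swap)
  also have "\<dots> = (\<Sum>i\<in>UNIV. \<Sum>j\<in>UNIV. \<Sum>k\<in>UNIV. \<Sum>l\<in>UNIV. \<Sum>i'\<in>UNIV. \<Sum>j'\<in>UNIV. \<Sum>k'\<in>UNIV. \<Sum>l'\<in>UNIV. ?t i i' j j' k k' l l')"
    by (rule sum.cong[OF refl], rule sum.cong[OF refl], rule sum.cong[OF refl], rule sum.swap)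
  finally show ?thesis by (simp add: riemann_norm_sq_def Let_def)
qed

subsection \<open>Matrix-valued partial derivatives\<close>

definition mpd :: "'n::finite \<Rightarrow> (real^'n \<Rightarrow> real^'m^'k) \<Rightarrow> real^'n \<Rightarrow> real^'m^'k" where
  "mpd i M x = (\<chi> a b. pd i (\<lambda>y. M y $ a $ b) x)"

lemma matrix_diff_ldistrib: "(A::real^'a^'b) ** (B - C) = A ** B - A ** C"
  by (simp add: matrix_matrix_mult_def vec_eq_iff sum_subtractf[symmetric] algebra_simps)

lemma matrix_diff_rdistrib: "((B::real^'a^'b) - C) ** A = B ** A - C ** A"
  by (simp add: matrix_matrix_mult_def vec_eq_iff sum_subtractf[symmetric] algebra_simps)

lemma matrix_add_rdistrib': "((B::real^'a^'b) + C) ** A = B ** A + C ** A"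
  by (simp add: matrix_matrix_mult_def vec_eq_iff sum.distrib[symmetric] algebra_simps)

lemma mpd_mult:
  fixes M :: "real^'n \<Rightarrow> real^'b^'a" and N :: "real^'n \<Rightarrow> real^'c^'b"
  assumes "smooth_on U M" "smooth_on U N" "x \<in> U"
  shows "mpd i (\<lambda>y. M y ** N y) x = mpd i M x ** N x + M x ** mpd i N x"
proof -
  have d: "(\<lambda>y. M y $ a $ b) differentiable (at x)" "(\<lambda>y. N y $ b $ c) differentiable (at x)" for a b c
    by (intro smooth_on_diff[OF _ assms(3)] smooth_intros assms(1,2))+
  have dm: "(\<lambda>y. M y $ a $ b * N y $ b $ c) differentiable (at x)" for a b c
    using d by (rule differentiable_mult)
  show ?thesis
    unfolding mpd_def matrix_matrix_mult_def vec_eq_iff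
    by (simp add: pd_sum dm pd_mult d sum.distrib)
qed

lemma mpd_add:
  assumes "smooth_on U M" "smooth_on U N" "x \<in> U"
  shows "mpd i (\<lambda>y. M y + N y) x = mpd i M x + mpd i N x"
proof -
  have d: "(\<lambda>y. M y $ a $ b) differentiable (at x)" "(\<lambda>y. N y $ a $ b) differentiable (at x)" for a b
    by (intro smooth_on_diff[OF _ assms(3)] smooth_intros assms(1,2))+
  show ?thesis
    unfolding mpd_def vec_eq_iff by (simp add: pd_add d)
qed

lemma mpd_cong_open:
  assumes "open U" "\<And>x. x \<in> U \<Longrightarrow> M x = N x" "x \<in> U" shows "mpd i M x = mpd i N x"
  unfolding mpd_def vec_eq_iff
  by (auto intro!: pd_cong_open[OF assms(1) _ assms(3)] simp: assms(2))

text \<open>The connection matrix \<open>\<Gamma>_i\<close> with row \<open>k\<close> and column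
  \<open>j\<close>. In this notation curvature is \<open>\<partial>_i \<Gamma>_j - \<partial>_j
  \<Gamma>_i + [\<Gamma>_i, \<Gamma>_j]\<close>, and a coordinate change is a gauge
  transformation.\<close>

definition conn :: "(real^'n \<Rightarrow> real^'n^'n) \<Rightarrow> 'n::finite \<Rightarrow> real^'n \<Rightarrow> real^'n^'n" where
  "conn G i u = (\<chi> k j. christoffel G k i j u)"

definition curv :: "(real^'n \<Rightarrow> real^'n^'n) \<Rightarrow> 'n::finite \<Rightarrow> 'n \<Rightarrow> real^'n \<Rightarrow> real^'n^'n" where
  "curv G i j u = (\<chi> l k. riemann G l i j k u)"

lemma curv_conn:
  "curv G i j u = mpd i (conn G j) u - mpd j (conn G i) u
     + (conn G i u ** conn G j u - conn G j u ** conn G i u)"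
  by (simp add: curv_def conn_def mpd_def riemann_def vec_eq_iff matrix_matrix_mult_def sum_subtractf)

text \<open>Christoffel symbols of the first kind. They contain no inverse metric, so their
  transformation follows by differentiating the pull-back formula alone.\<close>

definition christoffel_low :: "(real^'n \<Rightarrow> real^'n^'n) \<Rightarrow> 'n::finite \<Rightarrow> 'n \<Rightarrow> 'n \<Rightarrow> real^'n \<Rightarrow> real" where
  "christoffel_low G l i j u =
     (1/2) * (pd i (\<lambda>y. G y $ j $ l) u + pd j (\<lambda>y. G y $ i $ l) u - pd l (\<lambda>y. G y $ i $ j) u)"

lemma sum_christoffel:
  assumes "det (G u) \<noteq> 0"
  shows "(\<Sum>k\<in>UNIV. G u $ l $ k * christoffel G k i j u) = christoffel_low G l i j u"
proof -
  have "christoffel G k i j u = (\<Sum>m\<in>UNIV. matrix_inv (G u) $ k $ m * christoffel_low G m i j u)" for k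
    by (simp add: christoffel_def christoffel_low_def sum_distrib_left algebra_simps)
  then have "(\<chi> k. christoffel G k i j u) = matrix_inv (G u) *v (\<chi> m. christoffel_low G m i j u)"
    by (simp add: matrix_vector_mult_def)
  then have "G u *v (\<chi> k. christoffel G k i j u) = (\<chi> m. christoffel_low G m i j u)"
    by (simp add: matrix_vector_mul_assoc matrix_inv_mult[OF assms])
  then show ?thesis by (simp add: matrix_vector_mult_def vec_eq_iff)
qed

subsection \<open>Pull-back of a metric\<close>

text \<open>\<open>G'\<close> is the pull-back of \<open>G\<close>. The forms are symmetric and
  nondegenerate of either sign: the reflection of \<open>H\<close> reverses the sign of the metric
  formula, and the flat model is \<open>- \<delta>\<close> times a Euclidean metric with the sign of
  \<open>\<delta>\<close> left open.\<close>

locale metric_pullback =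
  fixes G G' :: "real^'n::finite \<Rightarrow> real^'n^'n" and h :: "real^'n \<Rightarrow> real^'n" and U W :: "(real^'n) set"
  assumes G: "smooth_on U G" and sym: "\<And>u. u \<in> U \<Longrightarrow> transpose (G u) = G u"
    and detG: "\<And>u. u \<in> U \<Longrightarrow> det (G u) \<noteq> 0"
    and h: "smooth_on W h" and hW: "h ` W \<subseteq> U"
    and detJ: "\<And>w. w \<in> W \<Longrightarrow> det (jacobian h (at w)) \<noteq> 0"
    and G': "\<And>w. w \<in> W \<Longrightarrow> transpose (jacobian h (at w)) ** G (h w) ** jacobian h (at w) = G' w"
begin

definition J where "J w = jacobian h (at w)"

definition Hs where "Hs i w = mpd i J w"

lemma oW: "open W" using h smooth_on_open by blast

lemma oU: "open U" using G smooth_on_open by blast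

lemma hU: "w \<in> W \<Longrightarrow> h w \<in> U" using hW by blast

lemma J: "smooth_on W J" unfolding J_def by (rule smooth_on_jacobian[OF h])

lemma Jcomp: "smooth_on W (\<lambda>y. J y $ a $ b)" by (intro smooth_intros J)

lemma Gh: "smooth_on W (\<lambda>w. G (h w))" by (rule smooth_on_compose[OF G h hW])

lemma G'J: "w \<in> W \<Longrightarrow> transpose (J w) ** G (h w) ** J w = G' w"
  using G' by (simp add: J_def)

lemma G'_nth: "w \<in> W \<Longrightarrow> G' w $ j $ l = (\<Sum>a\<in>UNIV. \<Sum>b\<in>UNIV. J w $ a $ j * G (h w) $ a $ b * J w $ b $ l)"
  by (subst G'J[symmetric])
     (simp_all add: matrix_matrix_mult_def transpose_def sum_distrib_right, subst sum.swap, simp)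

lemma G'smooth: "smooth_on W G'"
proof (rule smooth_on_matrix[OF oW])
  fix i j
  have "smooth_on W (\<lambda>w. \<Sum>a\<in>UNIV. \<Sum>b\<in>UNIV. J w $ a $ i * G (h w) $ a $ b * J w $ b $ j)"
    by (intro smooth_intros J Gh oW finite)
  then show "smooth_on W (\<lambda>w. G' w $ i $ j)"
    by (rule smooth_on_cong) (simp add: G'_nth)
qed

lemma symG: "u \<in> U \<Longrightarrow> G u $ a $ b = G u $ b $ a"
  using sym[of u] by (simp add: vec_eq_iff transpose_def)

lemma detG': "w \<in> W \<Longrightarrow> det (G' w) \<noteq> 0"
  using detJ[of w] detG[OF hU, of w] by (simp add: G'J[symmetric] det_mul det_transpose J_def)

lemma Hs_sym: assumes "w \<in> W" shows "Hs i w $ c $ j = Hs j w $ c $ i"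
proof -
  have e: "J y $ c $ j = pd j (\<lambda>y. h y $ c) y" if "y \<in> W" for y j
    using pd_component[OF smooth_on_diff[OF h that]] by (simp add: J_def)
  have "Hs i w $ c $ j = pd i (pd j (\<lambda>y. h y $ c)) w" for i j
    unfolding Hs_def mpd_def using pd_cong_open[OF oW e assms] by simp
  then show ?thesis using pd_commute[OF smooth_on_nth[OF h] assms] by simp
qed

lemma pd_Gh:
  assumes w: "w \<in> W"
  shows "pd i (\<lambda>y. G (h y) $ b $ c) w = (\<Sum>a\<in>UNIV. J w $ a $ i * pd a (\<lambda>u. G u $ b $ c) (h w))"
  unfolding J_def
  by (rule pd_compose[OF smooth_on_diff[OF h w] smooth_on_diff[OF smooth_on_nth[OF smooth_on_nth[OF G]] hU[OF w]]])

text \<open>Each derivative of \<open>J^T G J\<close> consists of two Hessian terms \<open>P\<close>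
  and one term \<open>Q\<close> that differentiates \<open>G\<close>. Since the Hessian of
  \<open>h\<close> is symmetric, four of the six \<open>P\<close> terms cancel in the alternating
  sum and the other two coincide; the \<open>Q\<close> terms assemble to the symbols of
  \<open>G\<close>.\<close>

lemma christoffel_low_pullback:
  assumes w: "w \<in> W"
  shows "christoffel_low G' l i j w =
    (\<Sum>a\<in>UNIV. \<Sum>b\<in>UNIV. Hs i w $ a $ j * G (h w) $ a $ b * J w $ b $ l) +
    (\<Sum>a\<in>UNIV. \<Sum>b\<in>UNIV. \<Sum>c\<in>UNIV. J w $ a $ i * J w $ b $ j * J w $ c $ l * christoffel_low G c a b (h w))"
proof -
  define D where "D a b c = pd a (\<lambda>u. G u $ b $ c) (h w)" for a b c
  define P where "P i j l = (\<Sum>a\<in>UNIV. \<Sum>b\<in>UNIV. Hs i w $ a $ j * G (h w) $ a $ b * J w $ b $ l)" for i j l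
  define Q where "Q i j l = (\<Sum>a\<in>UNIV. \<Sum>b\<in>UNIV. \<Sum>c\<in>UNIV. J w $ a $ i * J w $ b $ j * J w $ c $ l * D a b c)" for i j l
  have d: "(\<lambda>y. J y $ a $ b) differentiable (at w)" "(\<lambda>y. G (h y) $ a $ b) differentiable (at w)" for a b
    by (intro smooth_on_diff[OF _ w] smooth_intros J Gh)+
  have "pd i (\<lambda>y. G' y $ j $ l) w = P i j l + P i l j + Q i j l" for i j l
  proof -
    have "pd i (\<lambda>y. G' y $ j $ l) w = pd i (\<lambda>y. \<Sum>a\<in>UNIV. \<Sum>b\<in>UNIV. J y $ a $ j * G (h y) $ a $ b * J y $ b $ l) w"
      by (rule pd_cong_open[OF oW G'_nth w])
    also have "\<dots> = (\<Sum>a\<in>UNIV. \<Sum>b\<in>UNIV. pd i (\<lambda>y. J y $ a $ j * G (h y) $ a $ b * J y $ b $ l) w)"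
      using d by (simp add: pd_sum differentiable_sum)
    also have "\<dots> = (\<Sum>a\<in>UNIV. \<Sum>b\<in>UNIV. Hs i w $ a $ j * G (h w) $ a $ b * J w $ b $ l
       + J w $ a $ j * G (h w) $ a $ b * Hs i w $ b $ l
       + (\<Sum>c\<in>UNIV. J w $ c $ i * J w $ a $ j * J w $ b $ l * D c a b))"
      using d by (intro sum.cong refl)
        (simp add: pd_mult pd_Gh[OF w] Hs_def mpd_def D_def sum_distrib_left sum_distrib_right algebra_simps)
    also have "\<dots> = P i j l + (\<Sum>a\<in>UNIV. \<Sum>b\<in>UNIV. J w $ a $ j * G (h w) $ a $ b * Hs i w $ b $ l)
       + (\<Sum>a\<in>UNIV. \<Sum>b\<in>UNIV. \<Sum>c\<in>UNIV. J w $ c $ i * J w $ a $ j * J w $ b $ l * D c a b)"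
      by (simp add: sum.distrib P_def)
    also have "(\<Sum>a\<in>UNIV. \<Sum>b\<in>UNIV. J w $ a $ j * G (h w) $ a $ b * Hs i w $ b $ l) = P i l j"
    proof -
      have "J w $ b $ j * G (h w) $ b $ a * Hs i w $ a $ l = Hs i w $ a $ l * G (h w) $ a $ b * J w $ b $ j" for a b
        using symG[OF hU[OF w], of b a] by simp
      then have "(\<Sum>b\<in>UNIV. \<Sum>a\<in>UNIV. J w $ b $ j * G (h w) $ b $ a * Hs i w $ a $ l) =
        (\<Sum>b\<in>UNIV. \<Sum>a\<in>UNIV. Hs i w $ a $ l * G (h w) $ a $ b * J w $ b $ j)"
        by (intro sum.cong refl)
      also have "\<dots> = P i l j" unfolding P_def by (rule sum.swap)
      finally show ?thesis .
    qed
    also have "(\<Sum>a\<in>UNIV. \<Sum>b\<in>UNIV. \<Sum>c\<in>UNIV. J w $ c $ i * J w $ a $ j * J w $ b $ l * D c a b) = Q i j l"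
    proof -
      have "(\<Sum>a\<in>UNIV. \<Sum>b\<in>UNIV. \<Sum>c\<in>UNIV. J w $ c $ i * J w $ a $ j * J w $ b $ l * D c a b) =
        (\<Sum>a\<in>UNIV. \<Sum>c\<in>UNIV. \<Sum>b\<in>UNIV. J w $ c $ i * J w $ a $ j * J w $ b $ l * D c a b)"
        by (intro sum.cong refl sum.swap)
      also have "\<dots> = Q i j l" unfolding Q_def by (rule sum.swap)
      finally show ?thesis .
    qed
    finally show ?thesis .
  qed
  moreover have "P i j l = P j i l" for i j l
    unfolding P_def using Hs_sym[OF w] by simp
  ultimately have 1: "christoffel_low G' l i j w = P i j l + (1/2) * (Q i j l + Q j i l - Q l i j)"
    by (simp add: christoffel_low_def)
  have Qjil: "Q j i l = (\<Sum>a\<in>UNIV. \<Sum>b\<in>UNIV. \<Sum>c\<in>UNIV. J w $ a $ i * J w $ b $ j * J w $ c $ l * D b a c)"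
    unfolding Q_def by (subst sum.swap) (simp add: algebra_simps)
  have Qlij: "Q l i j = (\<Sum>a\<in>UNIV. \<Sum>b\<in>UNIV. \<Sum>c\<in>UNIV. J w $ a $ i * J w $ b $ j * J w $ c $ l * D c a b)"
  proof -
    have "Q l i j = (\<Sum>a\<in>UNIV. \<Sum>c\<in>UNIV. \<Sum>b\<in>UNIV. J w $ c $ l * J w $ a $ i * J w $ b $ j * D c a b)"
      unfolding Q_def by (rule sum.swap)
    also have "\<dots> = (\<Sum>a\<in>UNIV. \<Sum>b\<in>UNIV. \<Sum>c\<in>UNIV. J w $ c $ l * J w $ a $ i * J w $ b $ j * D c a b)"
      by (intro sum.cong refl sum.swap)
    finally show ?thesis by (simp add: algebra_simps)
  qed
  have "(1/2) * (Q i j l + Q j i l - Q l i j) =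
    (\<Sum>a\<in>UNIV. \<Sum>b\<in>UNIV. \<Sum>c\<in>UNIV. J w $ a $ i * J w $ b $ j * J w $ c $ l * christoffel_low G c a b (h w))"
    unfolding Qjil Qlij unfolding Q_def sum.distrib[symmetric] sum_subtractf[symmetric] sum_distrib_left
    by (intro sum.cong refl) (simp add: christoffel_low_def D_def algebra_simps)
  then show ?thesis using 1 by (simp add: P_def)
qed

text \<open>Pull-back of the connection as a matrix valued one-form: the form index is transformed
  by \<open>J\<close>, the matrix indices stay in the target.\<close>

definition Ah where "Ah i w = (\<Sum>a\<in>UNIV. J w $ a $ i *\<^sub>R conn G a (h w))"

text \<open>The gauge transformation law with gauge \<open>J\<close>. Multiplication by the
  invertible matrix \<open>M = J^T G\<close> lowers the free index and turns both sides into
  \<open>christoffel_low G'\<close>.\<close>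

lemma conn_pullback:
  assumes w: "w \<in> W"
  shows "J w ** conn G' i w = Ah i w ** J w + Hs i w"
proof -
  have "(J w ** conn G' i w) $ c $ j = (Ah i w ** J w + Hs i w) $ c $ j" for c j
  proof -
    define M where "M = transpose (J w) ** G (h w)"
    have M_nth: "M $ l $ c = (\<Sum>d\<in>UNIV. J w $ d $ l * G (h w) $ d $ c)" for l c
      by (simp add: M_def matrix_matrix_mult_def transpose_def)
    have detM: "det M \<noteq> 0"
      using detJ[OF w] detG[OF hU[OF w]] by (simp add: M_def det_mul det_transpose J_def)
    have L: "M *v (\<chi> c. (J w ** conn G' i w) $ c $ j) = (\<chi> l. christoffel_low G' l i j w)"
    proof -
      have "(\<chi> c. (J w ** conn G' i w) $ c $ j) = J w *v (\<chi> k. christoffel G' k i j w)"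
        by (simp add: vec_eq_iff matrix_vector_mult_def matrix_matrix_mult_def conn_def)
      then have "M *v (\<chi> c. (J w ** conn G' i w) $ c $ j) = G' w *v (\<chi> k. christoffel G' k i j w)"
        using G'J[OF w] by (simp add: matrix_vector_mul_assoc M_def)
      then show ?thesis
        using sum_christoffel[where G = G', OF detG'[OF w]] by (simp add: matrix_vector_mult_def)
    qed
    have R: "M *v (\<chi> c. (Ah i w ** J w + Hs i w) $ c $ j) = (\<chi> l. christoffel_low G' l i j w)"
    proof -
      have "(M *v (\<chi> c. (Ah i w ** J w + Hs i w) $ c $ j)) $ l = christoffel_low G' l i j w" for l
      proof -
        have "(Ah i w ** J w) $ c $ j = (\<Sum>b\<in>UNIV. \<Sum>a\<in>UNIV. J w $ a $ i * christoffel G c a b (h w) * J w $ b $ j)" for c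
          by (simp add: matrix_matrix_mult_def Ah_def conn_def sum_distrib_right)
        then have 1: "(Ah i w ** J w) $ c $ j = (\<Sum>a\<in>UNIV. \<Sum>b\<in>UNIV. J w $ a $ i * christoffel G c a b (h w) * J w $ b $ j)" for c
          by (subst sum.swap) simp
        have "(M *v (\<chi> c. (Ah i w ** J w + Hs i w) $ c $ j)) $ l =
          (\<Sum>c\<in>UNIV. M $ l $ c * (Ah i w ** J w) $ c $ j) + (\<Sum>c\<in>UNIV. M $ l $ c * Hs i w $ c $ j)"
          by (simp add: matrix_vector_mult_def algebra_simps sum.distrib)
        also have "(\<Sum>c\<in>UNIV. M $ l $ c * Hs i w $ c $ j) =
           (\<Sum>a\<in>UNIV. \<Sum>b\<in>UNIV. Hs i w $ a $ j * G (h w) $ a $ b * J w $ b $ l)"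
        proof (rule sum.cong[OF refl])
          fix c
          have "J w $ d $ l * G (h w) $ d $ c * Hs i w $ c $ j = Hs i w $ c $ j * G (h w) $ c $ d * J w $ d $ l" for d
            using symG[OF hU[OF w], of c d] by simp
          then show "M $ l $ c * Hs i w $ c $ j = (\<Sum>b\<in>UNIV. Hs i w $ c $ j * G (h w) $ c $ b * J w $ b $ l)"
            unfolding M_nth sum_distrib_right by (intro sum.cong refl)
        qed
        also have "(\<Sum>c\<in>UNIV. M $ l $ c * (Ah i w ** J w) $ c $ j) =
          (\<Sum>a\<in>UNIV. \<Sum>b\<in>UNIV. \<Sum>d\<in>UNIV. J w $ a $ i * J w $ b $ j * J w $ d $ l * christoffel_low G d a b (h w))"
        proof -
          have "(\<Sum>c\<in>UNIV. M $ l $ c * (Ah i w ** J w) $ c $ j) =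
            (\<Sum>c\<in>UNIV. \<Sum>a\<in>UNIV. \<Sum>b\<in>UNIV. \<Sum>d\<in>UNIV. J w $ a $ i * J w $ b $ j * J w $ d $ l * (G (h w) $ d $ c * christoffel G c a b (h w)))"
          proof (rule sum.cong[OF refl])
            fix c :: 'n
            have "M $ l $ c * (Ah i w ** J w) $ c $ j =
              (\<Sum>a\<in>UNIV. \<Sum>b\<in>UNIV. M $ l $ c * (J w $ a $ i * christoffel G c a b (h w) * J w $ b $ j))"
              unfolding 1 sum_distrib_left ..
            also have "\<dots> = (\<Sum>a\<in>UNIV. \<Sum>b\<in>UNIV. \<Sum>d\<in>UNIV. J w $ a $ i * J w $ b $ j * J w $ d $ l * (G (h w) $ d $ c * christoffel G c a b (h w)))"
              by (intro sum.cong[OF refl]) (simp add: M_nth sum_distrib_left sum_distrib_right algebra_simps)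
            finally show "M $ l $ c * (Ah i w ** J w) $ c $ j =
              (\<Sum>a\<in>UNIV. \<Sum>b\<in>UNIV. \<Sum>d\<in>UNIV. J w $ a $ i * J w $ b $ j * J w $ d $ l * (G (h w) $ d $ c * christoffel G c a b (h w)))" .
          qed
          also have "\<dots> = (\<Sum>a\<in>UNIV. \<Sum>c\<in>UNIV. \<Sum>b\<in>UNIV. \<Sum>d\<in>UNIV. J w $ a $ i * J w $ b $ j * J w $ d $ l * (G (h w) $ d $ c * christoffel G c a b (h w)))"
            by (rule sum.swap)
          also have "\<dots> = (\<Sum>a\<in>UNIV. \<Sum>b\<in>UNIV. \<Sum>c\<in>UNIV. \<Sum>d\<in>UNIV. J w $ a $ i * J w $ b $ j * J w $ d $ l * (G (h w) $ d $ c * christoffel G c a b (h w)))"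
            by (intro sum.cong refl sum.swap)
          also have "\<dots> = (\<Sum>a\<in>UNIV. \<Sum>b\<in>UNIV. \<Sum>d\<in>UNIV. \<Sum>c\<in>UNIV. J w $ a $ i * J w $ b $ j * J w $ d $ l * (G (h w) $ d $ c * christoffel G c a b (h w)))"
            by (intro sum.cong refl sum.swap)
          finally show ?thesis
            unfolding sum_distrib_left[symmetric] sum_christoffel[where G = G, OF detG[OF hU[OF w]]] .
        qed
        finally show ?thesis unfolding christoffel_low_pullback[OF w] by simp
      qed
      then show ?thesis by (simp add: vec_eq_iff)
    qed
    have "matrix_inv M *v (M *v x) = x" for x
      by (simp add: matrix_vector_mul_assoc matrix_inv_mult[OF detM])
    then have "(\<chi> c. (J w ** conn G' i w) $ c $ j) = (\<chi> c. (Ah i w ** J w + Hs i w) $ c $ j)"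
      using L R by metis
    then show ?thesis by (simp add: vec_eq_iff)
  qed
  then show ?thesis by (simp add: vec_eq_iff)
qed

lemma conn_smooth: "smooth_on U (conn G i)"
  by (rule smooth_on_matrix[OF oU]) (simp add: conn_def smooth_on_christoffel[OF G detG])

lemma conn'_smooth: "smooth_on W (conn G' i)"
  by (rule smooth_on_matrix[OF oW]) (simp add: conn_def smooth_on_christoffel[OF G'smooth detG'])

lemma Ah_smooth: "smooth_on W (Ah i)"
  unfolding Ah_def by (intro smooth_intros J finite oW smooth_on_compose[OF conn_smooth h hW])

lemma Hs_smooth: "smooth_on W (Hs i)"
  by (rule smooth_on_matrix[OF oW]) (simp add: Hs_def mpd_def smooth_on_pd Jcomp)

lemma mpd_Ah:
  assumes w: "w \<in> W"
  shows "mpd i (Ah j) w = (\<Sum>a\<in>UNIV. Hs i w $ a $ j *\<^sub>R conn G a (h w))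
    + (\<Sum>a\<in>UNIV. \<Sum>b\<in>UNIV. (J w $ a $ i * J w $ b $ j) *\<^sub>R mpd a (conn G b) (h w))"
proof -
  have dc: "(\<lambda>u. conn G a u $ k $ l) differentiable (at (h w))" for a k l
    by (intro smooth_on_diff[OF _ hU[OF w]] smooth_intros conn_smooth)
  have d: "(\<lambda>y. J y $ a $ b) differentiable (at w)" "(\<lambda>y. conn G a (h y) $ k $ l) differentiable (at w)" for a b k l
    by (intro smooth_on_diff[OF _ w] smooth_intros J smooth_on_compose[OF conn_smooth h hW])+
  have "pd i (\<lambda>y. Ah j y $ k $ l) w = (\<Sum>a\<in>UNIV. Hs i w $ a $ j * conn G a (h w) $ k $ l)
     + (\<Sum>a\<in>UNIV. \<Sum>b\<in>UNIV. (J w $ a $ i * J w $ b $ j) * mpd a (conn G b) (h w) $ k $ l)" for k l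
  proof -
    have "pd i (\<lambda>y. Ah j y $ k $ l) w = pd i (\<lambda>y. \<Sum>b\<in>UNIV. J y $ b $ j * conn G b (h y) $ k $ l) w"
      by (simp add: Ah_def)
    also have "\<dots> = (\<Sum>b\<in>UNIV. J w $ b $ j * (\<Sum>a\<in>UNIV. J w $ a $ i * mpd a (conn G b) (h w) $ k $ l)
         + Hs i w $ b $ j * conn G b (h w) $ k $ l)"
      using d pd_compose[OF smooth_on_diff[OF h w] dc]
      by (simp add: pd_sum pd_mult Hs_def mpd_def J_def)
    also have "\<dots> = (\<Sum>b\<in>UNIV. \<Sum>a\<in>UNIV. J w $ a $ i * J w $ b $ j * mpd a (conn G b) (h w) $ k $ l)
         + (\<Sum>b\<in>UNIV. Hs i w $ b $ j * conn G b (h w) $ k $ l)"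
      by (simp add: sum.distrib sum_distrib_left algebra_simps)
    also have "(\<Sum>b\<in>UNIV. \<Sum>a\<in>UNIV. J w $ a $ i * J w $ b $ j * mpd a (conn G b) (h w) $ k $ l) =
      (\<Sum>a\<in>UNIV. \<Sum>b\<in>UNIV. J w $ a $ i * J w $ b $ j * mpd a (conn G b) (h w) $ k $ l)" by (rule sum.swap)
    finally show ?thesis by simp
  qed
  then show ?thesis by (simp add: vec_eq_iff mpd_def)
qed

text \<open>Differentiating \<open>conn_pullback\<close> and antisymmetrising in \<open>i, j\<close>
  gives the tensor law. The inhomogeneous terms \<open>Hs\<close> cancel, partly by symmetry of the
  derivatives of \<open>h\<close> and partly against the commutator.\<close>

lemma curv_pullback:
  assumes w: "w \<in> W"
  shows "J w ** curv G' i j w = (\<Sum>a\<in>UNIV. \<Sum>b\<in>UNIV. (J w $ a $ i * J w $ b $ j) *\<^sub>R curv G a b (h w)) ** J w"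
proof -
  have 1: "Hs i w ** conn G' j w + J w ** mpd i (conn G' j) w =
    mpd i (Ah j) w ** J w + Ah j w ** Hs i w + mpd i (Hs j) w" for i j
  proof -
    have "mpd i (\<lambda>y. J y ** conn G' j y) w = mpd i (\<lambda>y. Ah j y ** J y + Hs j y) w"
      by (rule mpd_cong_open[OF oW conn_pullback w])
    moreover
    have "smooth_on W (\<lambda>y. Ah j y ** J y)"
      by (rule smooth_on_matrix[OF oW])
         (unfold matrix_matrix_mult_def, simp, intro smooth_intros Ah_smooth J oW finite)
    from mpd_add[OF this Hs_smooth w, of i j]
    have "mpd i (\<lambda>y. Ah j y ** J y + Hs j y) w = mpd i (Ah j) w ** J w + Ah j w ** Hs i w + mpd i (Hs j) w"
      unfolding mpd_mult[OF Ah_smooth J w] by (simp add: Hs_def[of i])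
    ultimately show ?thesis
      unfolding mpd_mult[OF J conn'_smooth w] by (simp add: Hs_def[of i])
  qed
  \<comment> \<open>Third derivatives of \<open>h\<close> commute.\<close>
  have Hc: "mpd i (Hs j) w = mpd j (Hs i) w"
    by (simp add: Hs_def mpd_def vec_eq_iff pd_commute[OF Jcomp w])
  \<comment> \<open>The Hessian part of \<open>mpd_Ah\<close> is symmetric in \<open>i, j\<close>
    and drops out.\<close>
  have 2: "mpd i (Ah j) w - mpd j (Ah i) w =
    (\<Sum>a\<in>UNIV. \<Sum>b\<in>UNIV. (J w $ a $ i * J w $ b $ j) *\<^sub>R (mpd a (conn G b) (h w) - mpd b (conn G a) (h w)))"
  proof -
    have "(\<Sum>a\<in>UNIV. \<Sum>b\<in>UNIV. (J w $ a $ j * J w $ b $ i) *\<^sub>R mpd a (conn G b) (h w)) =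
      (\<Sum>a\<in>UNIV. \<Sum>b\<in>UNIV. (J w $ a $ i * J w $ b $ j) *\<^sub>R mpd b (conn G a) (h w))"
      by (subst sum.swap) (simp add: mult.commute)
    then show ?thesis
      unfolding mpd_Ah[OF w] using Hs_sym[OF w, of i _ j]
      by (simp add: scaleR_diff_right sum_subtractf)
  qed
  have 3: "Ah i w ** Ah j w - Ah j w ** Ah i w =
    (\<Sum>a\<in>UNIV. \<Sum>b\<in>UNIV. (J w $ a $ i * J w $ b $ j) *\<^sub>R
       (conn G a (h w) ** conn G b (h w) - conn G b (h w) ** conn G a (h w)))"
  proof -
    have p: "Ah i w ** Ah j w = (\<Sum>a\<in>UNIV. \<Sum>b\<in>UNIV. (J w $ a $ i * J w $ b $ j) *\<^sub>R (conn G a (h w) ** conn G b (h w)))" for i j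
    proof -
      have bl: "bilinear ((**) :: real^'n^'n \<Rightarrow> real^'n^'n \<Rightarrow> real^'n^'n)"
        unfolding bilinear_def
        by (auto intro!: linearI simp: matrix_add_ldistrib matrix_add_rdistrib' scalar_matrix_assoc)
           (simp_all add: matrix_matrix_mult_def vec_eq_iff sum_distrib_left algebra_simps)
      show ?thesis unfolding Ah_def
        by (simp add: bilinear_sum[OF bl] bilinear_lmul[OF bl] bilinear_rmul[OF bl] sum.cartesian_product
            case_prod_beta mult.commute)
    qed
    have "Ah j w ** Ah i w = (\<Sum>a\<in>UNIV. \<Sum>b\<in>UNIV. (J w $ a $ i * J w $ b $ j) *\<^sub>R (conn G b (h w) ** conn G a (h w)))"
      unfolding p by (subst sum.swap) (simp add: mult.commute)
    then show ?thesis unfolding p[of i j] by (simp add: scaleR_diff_right sum_subtractf)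
  qed
  have 4: "J w ** (conn G' i w ** conn G' j w) = Ah i w ** (Ah j w ** J w) + Ah i w ** Hs j w + Hs i w ** conn G' j w" for i j
  proof -
    have "J w ** (conn G' i w ** conn G' j w) = (Ah i w ** J w + Hs i w) ** conn G' j w"
      using conn_pullback[OF w, of i] by (simp add: matrix_mul_assoc)
    also have "\<dots> = Ah i w ** (J w ** conn G' j w) + Hs i w ** conn G' j w"
      by (simp add: matrix_add_rdistrib' matrix_mul_assoc)
    finally show ?thesis unfolding conn_pullback[OF w] by (simp add: matrix_add_ldistrib)
  qed
  have "J w ** curv G' i j w =
     (J w ** mpd i (conn G' j) w - J w ** mpd j (conn G' i) w) +
     (J w ** (conn G' i w ** conn G' j w) - J w ** (conn G' j w ** conn G' i w))"
    by (simp add: curv_conn matrix_add_ldistrib matrix_diff_ldistrib)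
  also have "\<dots> = (mpd i (Ah j) w ** J w + Ah j w ** Hs i w + mpd i (Hs j) w - Hs i w ** conn G' j w)
     - (mpd j (Ah i) w ** J w + Ah i w ** Hs j w + mpd j (Hs i) w - Hs j w ** conn G' i w)
     + (J w ** (conn G' i w ** conn G' j w) - J w ** (conn G' j w ** conn G' i w))"
    unfolding 1[symmetric] by simp
  also have "\<dots> = (mpd i (Ah j) w ** J w - mpd j (Ah i) w ** J w)
     + (Ah i w ** (Ah j w ** J w) - Ah j w ** (Ah i w ** J w))"
    unfolding 4 Hc by simp
  also have "\<dots> = ((mpd i (Ah j) w - mpd j (Ah i) w) + (Ah i w ** Ah j w - Ah j w ** Ah i w)) ** J w"
    by (simp add: matrix_add_rdistrib' matrix_diff_rdistrib matrix_mul_assoc)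
  also have "\<dots> = (\<Sum>a\<in>UNIV. \<Sum>b\<in>UNIV. (J w $ a $ i * J w $ b $ j) *\<^sub>R curv G a b (h w)) ** J w"
    unfolding 2 3 sum.distrib[symmetric] scaleR_add_right[symmetric] curv_conn ..
  finally show ?thesis .
qed

lemma riemann_norm_sq_pullback:
  assumes w: "w \<in> W" shows "riemann_norm_sq G' w = riemann_norm_sq G (h w)"
proof -
  let ?J = "J w" and ?R = "rtensor G (h w)"
  \<comment> \<open>\<open>T\<close> is the curvature of \<open>G\<close> at \<open>h w\<close> with
    its three lower indices pulled back. By \<open>curv_pullback\<close> it is the curvature of
    \<open>G'\<close> with \<open>J\<close> applied to the upper index; so the metric contraction of
    the upper index agrees at once, and the three lower ones follow from \<open>JI\<close>.\<close>
  define T where "T = (\<chi> i. \<Sum>a\<in>UNIV. ?J $ a $ i *\<^sub>R (\<chi> j. \<Sum>b\<in>UNIV. ?J $ b $ j *\<^sub>R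
     (\<chi> k. \<Sum>c\<in>UNIV. ?J $ c $ k *\<^sub>R ?R $ a $ b $ c)))"
  define I where "I = matrix_inv (G (h w))"
  define I' where "I' = matrix_inv (G' w)"
  have dJ: "det ?J \<noteq> 0" using detJ[OF w] by (simp add: J_def)
  have T: "?J *v (rtensor G' w $ i $ j $ k) = T $ i $ j $ k" for i j k
  proof -
    have "(?J *v (rtensor G' w $ i $ j $ k)) $ d = T $ i $ j $ k $ d" for d
    proof -
      have "(?J *v (rtensor G' w $ i $ j $ k)) $ d = (?J ** curv G' i j w) $ d $ k"
        by (simp add: rtensor_def curv_def matrix_vector_mult_def matrix_matrix_mult_def)
      also have "\<dots> = (\<Sum>c\<in>UNIV. \<Sum>a\<in>UNIV. \<Sum>b\<in>UNIV. ?J $ a $ i * (?J $ b $ j * (?J $ c $ k * ?R $ a $ b $ c $ d)))"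
        unfolding curv_pullback[OF w]
        by (simp add: matrix_matrix_mult_def curv_def rtensor_def sum_distrib_right sum_distrib_left algebra_simps)
      also have "\<dots> = (\<Sum>a\<in>UNIV. \<Sum>c\<in>UNIV. \<Sum>b\<in>UNIV. ?J $ a $ i * (?J $ b $ j * (?J $ c $ k * ?R $ a $ b $ c $ d)))"
        by (rule sum.swap)
      also have "\<dots> = (\<Sum>a\<in>UNIV. \<Sum>b\<in>UNIV. \<Sum>c\<in>UNIV. ?J $ a $ i * (?J $ b $ j * (?J $ c $ k * ?R $ a $ b $ c $ d)))"
        by (intro sum.cong refl sum.swap)
      also have "\<dots> = T $ i $ j $ k $ d"
        by (simp add: T_def sum_distrib_left)
      finally show ?thesis .
    qed
    then show ?thesis by (simp add: vec_eq_iff)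
  qed
  have JI: "?J ** I' ** transpose ?J = I"
  proof -
    let ?K = "?J ** I' ** transpose ?J"
    have "transpose ?J ** G (h w) ** ?J ** I' = mat 1"
      unfolding I'_def G'J[OF w] by (rule matrix_inv_mult(1)[OF detG'[OF w]])
    then have "transpose ?J ** (G (h w) ** (?J ** I')) = mat 1" by (simp add: matrix_mul_assoc)
    then have "G (h w) ** (?J ** I') ** transpose ?J = mat 1"
      using matrix_left_right_inverse by blast
    then have "G (h w) ** ?K = mat 1" by (simp add: matrix_mul_assoc)
    then have "I ** G (h w) ** ?K = I" by (metis matrix_mul_assoc matrix_mul_rid)
    then show ?thesis by (simp add: I_def matrix_inv_mult[OF detG[OF hU[OF w]]])
  qed
  have b0: "bilinear (form (G (h w)))" by (rule bilinear_form)
  note b1 = bilinear_contraction[OF b0] note b2 = bilinear_contraction[OF b1]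
  have "riemann_norm_sq G' w = contraction I' (contraction I' (contraction I' (form (G' w)))) (rtensor G' w) (rtensor G' w)"
    by (simp add: riemann_norm_sq_contraction I'_def Let_def)
  also have "\<dots> = contraction I' (contraction I' (contraction I' (form (G (h w))))) T T"
    unfolding contraction_def G'J[OF w, symmetric] form_transform T ..
  also have "\<dots> = contraction I (contraction I' (contraction I' (form (G (h w)))))
      (\<chi> a j. \<Sum>b\<in>UNIV. ?J $ b $ j *\<^sub>R (\<chi> k. \<Sum>c\<in>UNIV. ?J $ c $ k *\<^sub>R ?R $ a $ b $ c))
      (\<chi> a j. \<Sum>b\<in>UNIV. ?J $ b $ j *\<^sub>R (\<chi> k. \<Sum>c\<in>UNIV. ?J $ c $ k *\<^sub>R ?R $ a $ b $ c))"
    unfolding JI[symmetric] contraction_transform[OF b2, symmetric] T_def by simp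
  also have "\<dots> = contraction I (contraction I (contraction I' (form (G (h w)))))
      (\<chi> a b k. \<Sum>c\<in>UNIV. ?J $ c $ k *\<^sub>R ?R $ a $ b $ c) (\<chi> a b k. \<Sum>c\<in>UNIV. ?J $ c $ k *\<^sub>R ?R $ a $ b $ c)"
  proof -
    have "contraction I' (contraction I' (form (G (h w))))
        (\<chi> j. \<Sum>b\<in>UNIV. ?J $ b $ j *\<^sub>R (\<chi> k. \<Sum>c\<in>UNIV. ?J $ c $ k *\<^sub>R ?R $ a $ b $ c))
        (\<chi> j. \<Sum>b\<in>UNIV. ?J $ b $ j *\<^sub>R (\<chi> k. \<Sum>c\<in>UNIV. ?J $ c $ k *\<^sub>R ?R $ a' $ b $ c)) =
      contraction I (contraction I' (form (G (h w))))
        (\<chi> b k. \<Sum>c\<in>UNIV. ?J $ c $ k *\<^sub>R ?R $ a $ b $ c) (\<chi> b k. \<Sum>c\<in>UNIV. ?J $ c $ k *\<^sub>R ?R $ a' $ b $ c)" for a a'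
      unfolding JI[symmetric] contraction_transform[OF b1, symmetric] by simp
    then show ?thesis unfolding contraction_def[of I "contraction _ (contraction _ _)"] by simp
  qed
  also have "\<dots> = contraction I (contraction I (contraction I (form (G (h w))))) ?R ?R"
  proof -
    have "contraction I' (form (G (h w)))
        (\<chi> k. \<Sum>c\<in>UNIV. ?J $ c $ k *\<^sub>R ?R $ a $ b $ c) (\<chi> k. \<Sum>c\<in>UNIV. ?J $ c $ k *\<^sub>R ?R $ a' $ b' $ c) =
      contraction I (form (G (h w))) (?R $ a $ b) (?R $ a' $ b')" for a b a' b'
      unfolding JI[symmetric] contraction_transform[OF b0, symmetric] by simp
    then show ?thesis
      unfolding contraction_def[of I "contraction I (contraction _ _)"] contraction_def[of I "contraction _ (form _)"] by simp
  qed
  also have "\<dots> = riemann_norm_sq G (h w)" by (simp add: riemann_norm_sq_contraction I_def Let_def)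
  finally show ?thesis .
qed

end

subsection \<open>Scaling, constant metrics, metrics depending on a parameter\<close>

lemma matrix_inv_eqI:
  fixes A :: "real^'n^'n" assumes "A ** B = mat 1" shows "matrix_inv A = B"
proof -
  have "det A * det B = 1" using assms by (metis det_mul det_I)
  then have "det A \<noteq> 0" by auto
  then have "matrix_inv A ** (A ** B) = B" by (simp add: matrix_mul_assoc matrix_inv_mult)
  then show ?thesis using assms by simp
qed

lemma matrix_inv_scaleR:
  fixes M :: "real^'n^'n" assumes "det M \<noteq> 0" "c \<noteq> 0"
  shows "matrix_inv (c *\<^sub>R M) = (1/c) *\<^sub>R matrix_inv M"
proof -
  have "(c *\<^sub>R M) ** ((1/c) *\<^sub>R matrix_inv M) = mat 1"
    using matrix_inv_mult(1)[OF assms(1)] assms(2)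
    by (simp add: matrix_matrix_mult_def vec_eq_iff)
  then show ?thesis by (rule matrix_inv_eqI)
qed

text \<open>The Christoffel symbols and \<open>riemann\<close>, which carries an upper index, are
  unchanged by a constant factor. The norm contains three inverse metrics and one metric, hence
  \<open>c^-3\<close> times \<open>c\<close>.\<close>

lemma riemann_norm_sq_scale:
  fixes G :: "real^'n \<Rightarrow> real^'n^'n"
  assumes G: "smooth_on U G" and d: "\<And>u. u \<in> U \<Longrightarrow> det (G u) \<noteq> 0" and c: "c \<noteq> 0" and u: "u \<in> U"
  shows "riemann_norm_sq (\<lambda>y. c *\<^sub>R G y) u = riemann_norm_sq G u / c\<^sup>2"
proof -
  have o: "open U" using G smooth_on_open by blast
  have C: "christoffel (\<lambda>y. c *\<^sub>R G y) k i j x = christoffel G k i j x" if "x \<in> U" for k i j x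
  proof -
    have "pd i (\<lambda>y. c * G y $ j $ l) x = c * pd i (\<lambda>y. G y $ j $ l) x" for i j l
      by (rule pd_cmult) (intro smooth_on_diff[OF _ that] smooth_intros G)
    moreover have "m / c * (c * x + c * y - c * z) = m * (x + y - z)" for m x y z
      using c by (simp add: field_simps)
    ultimately show ?thesis
      by (simp add: christoffel_def matrix_inv_scaleR[OF d[OF that] c])
  qed
  have R: "riemann (\<lambda>y. c *\<^sub>R G y) l i j k u = riemann G l i j k u" for l i j k
  proof -
    have "pd i (christoffel (\<lambda>y. c *\<^sub>R G y) l j k) u = pd i (christoffel G l j k) u" for i j l k
      by (rule pd_cong_open[OF o C u])
    then show ?thesis using C[OF u] by (simp add: riemann_def)
  qed
  show ?thesis
    unfolding riemann_norm_sq_def matrix_inv_scaleR[OF d[OF u] c] R sum_divide_distrib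
    using c by (intro sum.cong refl) (simp add: power2_eq_square field_simps)
qed

lemma riemann_norm_sq_const: "riemann_norm_sq (\<lambda>y. M) u = 0"
proof -
  have "christoffel (\<lambda>y. M) k i j = (\<lambda>u. 0)" for k i j
    by (rule ext) (simp add: christoffel_def)
  then have "riemann (\<lambda>y. M) l i j k u = 0" for l i j k
    by (simp add: riemann_def)
  then show ?thesis by (simp add: riemann_norm_sq_def)
qed

lemma pd_slice:
  fixes f :: "real \<times> (real^'n) \<Rightarrow> real"
  assumes "smooth_on U f" "(e, y) \<in> U"
  shows "pd i (\<lambda>y. f (e, y)) y = dird (0, axis i 1) f (e, y)"
proof -
  have "((\<lambda>y. (e, y)) has_derivative (\<lambda>v. (0, v))) (at y)"
    by (intro derivative_eq_intros) auto
  from has_derivative_compose[of _ _ y UNIV f, simplified, OF this smooth_on_has_derivative[OF assms]]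
  show ?thesis unfolding pd_eq_dird by (rule dird_eqI)
qed

lemma open_slice: "open (U :: (real \<times> (real^'n)) set) \<Longrightarrow> open {y. (e, y) \<in> U}"
  using open_vimage[of U "\<lambda>y. (e, y)"]
  by (simp add: vimage_def continuous_on_Pair continuous_on_const continuous_on_id)

text \<open>The curvature of \<open>G e\<close> takes derivatives in \<open>y\<close> only. On the
  product space these are directional derivatives along \<open>(0, axis i 1)\<close>, which preserve
  joint smoothness in \<open>(e, y)\<close>.\<close>

lemma smooth_on_riemann_norm_sq_param:
  fixes G :: "real \<Rightarrow> real^'n \<Rightarrow> real^'n^'n"
  assumes G: "smooth_on U (\<lambda>(e, y). G e y)" and d: "\<And>e y. (e, y) \<in> U \<Longrightarrow> det (G e y) \<noteq> 0"
  shows "smooth_on U (\<lambda>(e, y). riemann_norm_sq (G e) y)"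
proof -
  let ?G = "\<lambda>p. G (fst p) (snd p)"
  have o: "open U" using G smooth_on_open by blast
  have G': "smooth_on U ?G" using G by (simp add: case_prod_beta')
  have d': "p \<in> U \<Longrightarrow> det (?G p) \<noteq> 0" for p using d by (cases p) auto
  define D where "D i f = (dird (0, axis i 1) f :: real \<times> (real^'n) \<Rightarrow> real)" for i f
  define C where "C k i j p = (1/2) * (\<Sum>l\<in>UNIV. matrix_inv (?G p) $ k $ l *
       (D i (\<lambda>p. ?G p $ j $ l) p + D j (\<lambda>p. ?G p $ i $ l) p - D l (\<lambda>p. ?G p $ i $ j) p))" for k i j p
  have sD: "smooth_on U f \<Longrightarrow> smooth_on U (D i f)" for i f
    unfolding D_def by (rule smooth_on_dird)
  have sC: "smooth_on U (C k i j)" for k i j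
    unfolding C_def by (intro smooth_intros sD smooth_on_matrix_inv G' d' o finite)
  have pdD: "pd i (\<lambda>y. f (e, y)) y = D i f (e, y)" if "smooth_on U f" "(e, y) \<in> U" for i f e y
    using pd_slice[OF that] by (simp add: D_def)
  have CC: "christoffel (G e) k i j y = C k i j (e, y)" if "(e, y) \<in> U" for k i j e y
  proof -
    have "pd i (\<lambda>y. G e y $ j $ l) y = D i (\<lambda>p. ?G p $ j $ l) (e, y)" for i j l
      using pdD[of "\<lambda>p. ?G p $ j $ l", OF _ that] by (simp add: smooth_on_nth[OF smooth_on_nth[OF G']])
    then show ?thesis by (simp add: christoffel_def C_def)
  qed
  have R: "riemann (G e) l i j k y = D i (C l j k) (e, y) - D j (C l i k) (e, y)
     + (\<Sum>m\<in>UNIV. C l i m (e, y) * C m j k (e, y) - C l j m (e, y) * C m i k (e, y))" if "(e, y) \<in> U" for l i j k e y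
  proof -
    have "pd i (christoffel (G e) l j k) y = D i (C l j k) (e, y)" for i j l k
    proof -
      have "pd i (christoffel (G e) l j k) y = pd i (\<lambda>y. C l j k (e, y)) y"
        by (rule pd_cong_open[OF open_slice[OF o, of e]]) (use that CC in auto)
      then show ?thesis using pdD[OF sC that] by simp
    qed
    then show ?thesis by (simp add: riemann_def CC[OF that])
  qed
  have "smooth_on U (\<lambda>p. \<Sum>i\<in>UNIV. \<Sum>j\<in>UNIV. \<Sum>k\<in>UNIV. \<Sum>l\<in>UNIV. \<Sum>i'\<in>UNIV. \<Sum>j'\<in>UNIV. \<Sum>k'\<in>UNIV. \<Sum>l'\<in>UNIV.
        matrix_inv (?G p) $ i $ i' * matrix_inv (?G p) $ j $ j' * matrix_inv (?G p) $ k $ k'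
        * ?G p $ l $ l' * (D i (C l j k) p - D j (C l i k) p
     + (\<Sum>m\<in>UNIV. C l i m p * C m j k p - C l j m p * C m i k p)) * (D i' (C l' j' k') p - D j' (C l' i' k') p
     + (\<Sum>m\<in>UNIV. C l' i' m p * C m j' k' p - C l' j' m p * C m i' k' p)))"
    by (intro smooth_intros sD sC smooth_on_matrix_inv G' d' o finite)
  then show ?thesis
    by (rule smooth_on_cong) (auto simp: riemann_norm_sq_def R)
qed

section \<open>Model metrics\<close>

lemma vector_4 [simp]:
  "(vector [x, y, z, w] :: ('a::zero)^4) $ 1 = x"
  "(vector [x, y, z, w] :: 'a^4) $ 2 = y"
  "(vector [x, y, z, w] :: 'a^4) $ 3 = z"
  "(vector [x, y, z, w] :: 'a^4) $ 4 = w"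
  by (simp_all add: vector_def)

lemma det_4:
  "det (A :: real^4^4) =
     A$1$1 * (A$2$2 * A$3$3 * A$4$4 + A$2$3 * A$3$4 * A$4$2 + A$2$4 * A$3$2 * A$4$3
            - A$2$2 * A$3$4 * A$4$3 - A$2$3 * A$3$2 * A$4$4 - A$2$4 * A$3$3 * A$4$2)
   - A$1$2 * (A$2$1 * A$3$3 * A$4$4 + A$2$3 * A$3$4 * A$4$1 + A$2$4 * A$3$1 * A$4$3
            - A$2$1 * A$3$4 * A$4$3 - A$2$3 * A$3$1 * A$4$4 - A$2$4 * A$3$3 * A$4$1)
   + A$1$3 * (A$2$1 * A$3$2 * A$4$4 + A$2$2 * A$3$4 * A$4$1 + A$2$4 * A$3$1 * A$4$2
            - A$2$1 * A$3$4 * A$4$2 - A$2$2 * A$3$1 * A$4$4 - A$2$4 * A$3$2 * A$4$1)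
   - A$1$4 * (A$2$1 * A$3$2 * A$4$3 + A$2$2 * A$3$3 * A$4$1 + A$2$3 * A$3$1 * A$4$2
            - A$2$1 * A$3$3 * A$4$2 - A$2$2 * A$3$1 * A$4$3 - A$2$3 * A$3$2 * A$4$1)"
proof -
  have f: "finite {2::4, 3, 4}" "1 \<notin> {2::4, 3, 4}" "finite {3::4, 4}" "2 \<notin> {3::4, 4}" "finite {4::4}" "3 \<notin> {4::4}"
    by auto
  show ?thesis
    unfolding det_def UNIV_4
    unfolding sum_over_permutations_insert[OF f(1,2)]
    unfolding sum_over_permutations_insert[OF f(3,4)]
    unfolding sum_over_permutations_insert[OF f(5,6)]
    unfolding permutes_sing
    by (simp add: sign_swap_id permutation_swap_id sign_compose sign_id swap_id_eq permutation_compose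
        transpose_def algebra_simps)
qed

text \<open>The metric belonging to \<open>\<xi> = (log r + S) N + T \<tau>\<close> in the coordinates \<open>(H, r cos \<alpha>, r sin \<alpha>, \<beta>)\<close>, where
  \<open>\<theta> = \<alpha> N + \<beta> \<tau>\<close>. With \<open>s = r\<^sup>2\<close>, the arguments stand for \<open>\<delta> = det (N, \<tau>)\<close>, \<open>x = \<partial>\<^sub>H S\<close>,
  \<open>w = \<partial>\<^sub>s S\<close>, \<open>z = \<partial>\<^sub>H T\<close> and \<open>t = \<partial>\<^sub>s T\<close>. Unlike the original coordinates, these are regular at \<open>r = 0\<close>.\<close>

definition model :: "real \<Rightarrow> real \<Rightarrow> real \<Rightarrow> real \<Rightarrow> real \<Rightarrow> real^4 \<Rightarrow> real^4^4" where
  "model \<delta> x w z t y =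
    (let s = (y $ 2)\<^sup>2 + (y $ 3)\<^sup>2; X = w * z - x * t; D = - (z + 2 * s * X); V = \<delta> * D;
         E = \<delta> / D * (4 * t\<^sup>2 - 4 * z * X - 4 * s * X\<^sup>2);
         b = - (\<delta> / D) * (x * z + (1 + 2 * s * w) * (2 * t));
         c = \<delta> / D * (s * x\<^sup>2 + (1 + 2 * s * w)\<^sup>2)
     in vector [vector [V, 0, 0, 0],
                vector [0, V + E * (y $ 3)\<^sup>2, - E * y $ 2 * y $ 3, - b * y $ 3],
                vector [0, - E * y $ 2 * y $ 3, V + E * (y $ 2)\<^sup>2, b * y $ 2],
                vector [0, - b * y $ 3, b * y $ 2, c]])"

text \<open>The determinant of \<open>\<xi>_H\<close> and \<open>\<xi>_r\<close>, times
  \<open>r\<close>, in the basis \<open>N\<close>, \<open>\<tau>\<close>; thus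
  \<open>V = \<delta> D\<close>.\<close>

definition modelD :: "real \<Rightarrow> real \<Rightarrow> real \<Rightarrow> real \<Rightarrow> real^4 \<Rightarrow> real" where
  "modelD x w z t y = - (z + 2 * ((y $ 2)\<^sup>2 + (y $ 3)\<^sup>2) * (w * z - x * t))"

lemma det_model:
  assumes "modelD x w z t y \<noteq> 0"
  shows "det (model \<delta> x w z t y) = (\<delta> * modelD x w z t y)\<^sup>2 * \<delta>\<^sup>2"
proof -
  define D where "D = modelD x w z t y"
  define s where "s = (y $ 2)\<^sup>2 + (y $ 3)\<^sup>2"
  define X where "X = w * z - x * t"
  define V where "V = \<delta> * D"
  define E where "E = \<delta> / D * (4 * t\<^sup>2 - 4 * z * X - 4 * s * X\<^sup>2)"
  define b where "b = - (\<delta> / D) * (x * z + (1 + 2 * s * w) * (2 * t))"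
  define c where "c = \<delta> / D * (s * x\<^sup>2 + (1 + 2 * s * w)\<^sup>2)"
  have D: "D = - (z + 2 * s * X)" by (simp add: D_def modelD_def s_def X_def)
  have D0: "D \<noteq> 0" using assms by (simp add: D_def)
  have "det (model \<delta> x w z t y) = V * (V * ((V + E * s) * c - s * b\<^sup>2))"
    unfolding det_4 model_def Let_def
    unfolding X_def[symmetric] s_def[symmetric] D[symmetric] V_def[symmetric] E_def[symmetric]
      b_def[symmetric] c_def[symmetric]
    by (simp add: s_def power2_eq_square algebra_simps)
  \<comment> \<open>This is the origin of \<open>E\<close>: the coefficient of
    \<open>d\<alpha>^2\<close> is \<open>s (V + E s)\<close>. Since \<open>D^2\<close> and
    \<open>z^2\<close> agree modulo \<open>s\<close>, solving for \<open>E\<close> leaves no pole at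
    \<open>s = 0\<close>.\<close>
  also have "V + E * s = \<delta> / D * (z\<^sup>2 + 4 * s * t\<^sup>2)"
  proof -
    have "V + E * s = \<delta> / D * (D\<^sup>2 + s * (4 * t\<^sup>2 - 4 * z * X - 4 * s * X\<^sup>2))"
      using D0 by (simp add: V_def E_def field_simps power2_eq_square)
    also have "D\<^sup>2 + s * (4 * t\<^sup>2 - 4 * z * X - 4 * s * X\<^sup>2) = z\<^sup>2 + 4 * s * t\<^sup>2"
      unfolding D by algebra
    finally show ?thesis .
  qed
  also have "\<delta> / D * (z\<^sup>2 + 4 * s * t\<^sup>2) * c - s * b\<^sup>2 = (\<delta> / D)\<^sup>2 * D\<^sup>2"
  proof -
    \<comment> \<open>Lagrange's identity for the vectors \<open>(sqrt s x, 1 + 2 s w)\<close> and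
      \<open>(z, 2 sqrt s t)\<close>, whose determinant is \<open>D\<close>.\<close>
    have "(z\<^sup>2 + 4 * s * t\<^sup>2) * (s * x\<^sup>2 + (1 + 2 * s * w)\<^sup>2) - s * (x * z + (1 + 2 * s * w) * (2 * t))\<^sup>2 = D\<^sup>2"
      unfolding D X_def by algebra
    moreover have "\<delta> / D * (z\<^sup>2 + 4 * s * t\<^sup>2) * c - s * b\<^sup>2 = (\<delta> / D)\<^sup>2 *
      ((z\<^sup>2 + 4 * s * t\<^sup>2) * (s * x\<^sup>2 + (1 + 2 * s * w)\<^sup>2) - s * (x * z + (1 + 2 * s * w) * (2 * t))\<^sup>2)"
      unfolding c_def b_def power_mult_distrib power2_minus by (simp only: power2_eq_square[of "\<delta> / D"]) (simp only: right_diff_distrib mult.assoc mult.left_commute mult.commute)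
    ultimately show ?thesis by simp
  qed
  finally show ?thesis using D0 by (simp add: V_def D_def power2_eq_square)
qed

section \<open>Pulling the model back to the toric metric\<close>

definition toric_metric :: "(real^2 \<Rightarrow> real^2) \<Rightarrow> (real^2 \<Rightarrow> real^2) \<Rightarrow> real^4 \<Rightarrow> real^4^4" where
  "toric_metric XH XR y =
    (let h = base y; A = XH h; B = XR h; dt = det2 A B; V = h $ 2 * dt; f = h $ 2 / dt
     in vector [vector [V, 0, 0, 0],
                vector [0, V, 0, 0],
                vector [0, 0, f * ((A $ 2)\<^sup>2 + (B $ 2)\<^sup>2), - f * (A $ 1 * A $ 2 + B $ 1 * B $ 2)],
                vector [0, 0, - f * (A $ 1 * A $ 2 + B $ 1 * B $ 2), f * ((A $ 1)\<^sup>2 + (B $ 1)\<^sup>2)]])"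

text \<open>The angular part of \<open>y\<close> minus \<open>\<theta>\<close> is
  \<open>\<alpha> N + \<beta> \<tau>\<close>, solved by Cramer's rule. The factor \<open>m\<close>
  scales \<open>\<beta>\<close> independently of \<open>(H, r)\<close>. The base angle
  \<open>\<theta>\<close> is free, so that a given point can be moved to
  \<open>\<alpha> = \<beta> = 0\<close>.\<close>

definition polar :: "real \<Rightarrow> real \<Rightarrow> real^2 \<Rightarrow> real^2 \<Rightarrow> real^2 \<Rightarrow> real^4 \<Rightarrow> real^4" where
  "polar e m N \<tau> \<theta> y =
    (let \<delta> = det2 N \<tau>; \<alpha> = (\<tau> $ 2 * (y $ 3 - \<theta> $ 1) - \<tau> $ 1 * (y $ 4 - \<theta> $ 2)) / \<delta>
     in vector [e * y $ 1, e * y $ 2 * cos \<alpha>, e * y $ 2 * sin \<alpha>,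
                m * (N $ 1 * (y $ 4 - \<theta> $ 2) - N $ 2 * (y $ 3 - \<theta> $ 1)) / \<delta>])"

lemma smooth_on_vector4:
  assumes "smooth_on U f1" "smooth_on U f2" "smooth_on U f3" "smooth_on U f4"
  shows "smooth_on U (\<lambda>y. vector [f1 y, f2 y, f3 y, f4 y] :: real^4)"
proof (rule smooth_on_vec)
  show "open U" using assms smooth_on_open by blast
  fix i :: 4
  show "smooth_on U (\<lambda>y. (vector [f1 y, f2 y, f3 y, f4 y] :: real^4) $ i)"
    using exhaust_4[of i] assms by auto
qed

lemma smooth_on_divide_const:
  fixes f :: "'a::euclidean_space \<Rightarrow> real"
  shows "smooth_on U f \<Longrightarrow> smooth_on U (\<lambda>x. f x / c)"
  using smooth_on_mult[of U f "\<lambda>x. inverse c"] smooth_on_const[of U "inverse c"] smooth_on_open[of U f]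
  by (simp add: divide_inverse)

lemma smooth_polar: "smooth_on UNIV (polar e m N \<tau> \<theta>)"
  unfolding polar_def Let_def
  by (intro smooth_on_vector4 smooth_on_divide_const smooth_on_mult smooth_on_difference smooth_on_cos smooth_on_sin
      smooth_on_nth smooth_on_const smooth_on_id open_UNIV)

lemma jacobian_polar:
  fixes e m :: real and N \<tau> \<theta> :: "real^2" and y :: "real^4"
  defines "\<delta> \<equiv> det2 N \<tau>"
  defines "\<alpha> \<equiv> (\<tau> $ 2 * (y $ 3 - \<theta> $ 1) - \<tau> $ 1 * (y $ 4 - \<theta> $ 2)) / \<delta>"
  shows "jacobian (polar e m N \<tau> \<theta>) (at y) =
    vector [vector [e, 0, 0, 0],
            vector [0, e * cos \<alpha>, - e * y $ 2 * sin \<alpha> * (\<tau> $ 2 / \<delta>), e * y $ 2 * sin \<alpha> * (\<tau> $ 1 / \<delta>)],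
            vector [0, e * sin \<alpha>, e * y $ 2 * cos \<alpha> * (\<tau> $ 2 / \<delta>), - e * y $ 2 * cos \<alpha> * (\<tau> $ 1 / \<delta>)],
            vector [0, 0, - m * (N $ 2 / \<delta>), m * (N $ 1 / \<delta>)]]" (is "_ = ?M")
proof (rule jacobian_eqI)
  let ?a = "\<lambda>y::real^4. (\<tau> $ 2 * (y $ 3 - \<theta> $ 1) - \<tau> $ 1 * (y $ 4 - \<theta> $ 2)) / \<delta>"
  have n: "((\<lambda>y::real^4. y $ i) has_derivative (\<lambda>v. v $ i)) (at y)" for i
    by (rule bounded_linear_imp_has_derivative[OF bounded_linear_vec_nth])
  have a: "(?a has_derivative (\<lambda>v. (\<tau> $ 2 * v $ 3 - \<tau> $ 1 * v $ 4) / \<delta>)) (at y)"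
  proof -
    have "((\<lambda>y::real^4. inverse \<delta> * (\<tau> $ 2 * (y $ 3 - \<theta> $ 1) - \<tau> $ 1 * (y $ 4 - \<theta> $ 2))) has_derivative
      (\<lambda>v. inverse \<delta> * (\<tau> $ 2 * (v $ 3 - 0) - \<tau> $ 1 * (v $ 4 - 0)))) (at y)"
      by (intro has_derivative_mult_right has_derivative_diff has_derivative_const n)
    then show ?thesis by (simp add: divide_inverse mult.commute)
  qed
  have s: "((\<lambda>y. sin (?a y)) has_derivative (\<lambda>v. (\<tau> $ 2 * v $ 3 - \<tau> $ 1 * v $ 4) / \<delta> * cos \<alpha>)) (at y)"
    using has_derivative_sin[OF a] by (simp add: \<alpha>_def)
  have c: "((\<lambda>y. cos (?a y)) has_derivative (\<lambda>v. - ((\<tau> $ 2 * v $ 3 - \<tau> $ 1 * v $ 4) / \<delta> * sin \<alpha>))) (at y)"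
    using has_derivative_cos[OF a] by (simp add: \<alpha>_def)
  have "((\<lambda>y. polar e m N \<tau> \<theta> y $ i) has_derivative (\<lambda>v. (?M *v v) $ i)) (at y)" for i
  proof -
    consider "i = 1" | "i = 2" | "i = 3" | "i = 4" using exhaust_4[of i] by auto
    then show ?thesis
    proof cases
      case 1
      show ?thesis unfolding 1 polar_def Let_def
        by (rule has_derivative_eq_rhs, simp, rule has_derivative_mult[OF has_derivative_const n])
           (simp add: fun_eq_iff matrix_vector_mult_def sum_4)
    next
      case 2
      show ?thesis unfolding 2 polar_def Let_def \<delta>_def[symmetric]
        by (rule has_derivative_eq_rhs, simp,
            rule has_derivative_mult[OF has_derivative_mult[OF has_derivative_const n] c])
           (simp add: fun_eq_iff matrix_vector_mult_def sum_4 \<alpha>_def divide_inverse algebra_simps)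
    next
      case 3
      show ?thesis unfolding 3 polar_def Let_def \<delta>_def[symmetric]
        by (rule has_derivative_eq_rhs, simp,
            rule has_derivative_mult[OF has_derivative_mult[OF has_derivative_const n] s])
           (simp add: fun_eq_iff matrix_vector_mult_def sum_4 \<alpha>_def divide_inverse algebra_simps)
    next
      case 4
      have "((\<lambda>y::real^4. inverse \<delta> * (m * (N $ 1 * (y $ 4 - \<theta> $ 2) - N $ 2 * (y $ 3 - \<theta> $ 1)))) has_derivative
        (\<lambda>v. inverse \<delta> * (m * (N $ 1 * (v $ 4 - 0) - N $ 2 * (v $ 3 - 0))))) (at y)"
        by (intro has_derivative_mult_right has_derivative_diff has_derivative_const n)
      moreover have "(\<lambda>v. (?M *v v) $ 4) = (\<lambda>v. inverse \<delta> * (m * (N $ 1 * (v $ 4 - 0) - N $ 2 * (v $ 3 - 0))))"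
        by (simp add: fun_eq_iff matrix_vector_mult_def sum_4 divide_inverse algebra_simps)
      moreover have "(\<lambda>y::real^4. inverse \<delta> * (m * (N $ 1 * (y $ 4 - \<theta> $ 2) - N $ 2 * (y $ 3 - \<theta> $ 1)))) =
        (\<lambda>y. polar e m N \<tau> \<theta> y $ 4)"
        by (simp add: fun_eq_iff polar_def Let_def \<delta>_def divide_inverse mult.commute)
      ultimately show ?thesis unfolding 4 by (simp only:)
    qed
  qed
  then show "(polar e m N \<tau> \<theta> has_derivative (\<lambda>v. ?M *v v)) (at y)"
    by (subst has_derivative_componentwise_within)
       (auto simp: Basis_vec_def inner_axis)
qed

text \<open>With \<open>\<eta> = y_2 dy_3 - y_3 dy_2\<close>, which is \<open>s d\<alpha>\<close>,
  the model reads \<open>V (dy_1^2 + dy_2^2 + dy_3^2) + E \<eta>^2 + 2 b \<eta> dy_4 + c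
  dy_4^2\<close>.\<close>

lemma pullback_model_nth:
  fixes J :: "real^4^4"
  shows "(transpose J ** model \<delta> x w z t y ** J) $ i $ j =
    (let s = (y $ 2)\<^sup>2 + (y $ 3)\<^sup>2; D = modelD x w z t y; X = w * z - x * t; V = \<delta> * D;
         E = \<delta> / D * (4 * t\<^sup>2 - 4 * z * X - 4 * s * X\<^sup>2);
         b = - (\<delta> / D) * (x * z + (1 + 2 * s * w) * (2 * t));
         c = \<delta> / D * (s * x\<^sup>2 + (1 + 2 * s * w)\<^sup>2);
         \<eta> = (\<lambda>i. y $ 2 * J $ 3 $ i - y $ 3 * J $ 2 $ i)
     in V * (J $ 1 $ i * J $ 1 $ j + J $ 2 $ i * J $ 2 $ j + J $ 3 $ i * J $ 3 $ j) + E * \<eta> i * \<eta> j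
        + b * (\<eta> i * J $ 4 $ j + J $ 4 $ i * \<eta> j) + c * J $ 4 $ i * J $ 4 $ j)"
proof -
  define s where "s = (y $ 2)\<^sup>2 + (y $ 3)\<^sup>2"
  define D where "D = modelD x w z t y"
  define X where "X = w * z - x * t"
  define V where "V = \<delta> * D"
  define E where "E = \<delta> / D * (4 * t\<^sup>2 - 4 * z * X - 4 * s * X\<^sup>2)"
  define b where "b = - (\<delta> / D) * (x * z + (1 + 2 * s * w) * (2 * t))"
  define c where "c = \<delta> / D * (s * x\<^sup>2 + (1 + 2 * s * w)\<^sup>2)"
  have D: "D = - (z + 2 * s * X)" by (simp add: D_def modelD_def s_def X_def)
  show ?thesis
    unfolding matrix_matrix_mult_def transpose_def model_def Let_def
    unfolding X_def[symmetric] s_def[symmetric] D_def[symmetric] D[symmetric] V_def[symmetric] E_def[symmetric]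
      b_def[symmetric] c_def[symmetric]
    by (simp add: sum_4 power2_eq_square algebra_simps)
qed

text \<open>At \<open>p\<close> one has \<open>s = (e r)^2\<close>, so the hypotheses on
  \<open>XH\<close> and \<open>XR\<close> express the derivatives of \<open>\<xi>\<close> by
  rescaled coefficients. The splitting \<open>e = m m'\<close> treats both regimes together:
  \<open>m = 1\<close>, \<open>m' = e\<close> and \<open>m = e\<close>,
  \<open>m' = 1\<close>.\<close>

lemma toric_metric_polar:
  fixes N \<tau> \<theta> :: "real^2" and y :: "real^4" and m m' :: real
  defines "\<delta> \<equiv> det2 N \<tau>" and "e \<equiv> m * m'"
  defines "p \<equiv> polar e m N \<tau> \<theta> y" and "J \<equiv> jacobian (polar e m N \<tau> \<theta>) (at y)"
  assumes m: "m > 0" "m' > 0" and \<delta>: "\<delta> \<noteq> 0" and r: "y $ 2 > 0" and D: "modelD x w z t p \<noteq> 0"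
    and XH: "XH (base y) = (e * x) *\<^sub>R N + (m' * z) *\<^sub>R \<tau>"
    and XR: "XR (base y) = (1 / y $ 2 + 2 * e\<^sup>2 * y $ 2 * w) *\<^sub>R N + (m' * (2 * e * y $ 2 * t)) *\<^sub>R \<tau>"
  shows "toric_metric XH XR y = (1 / (e * m)) *\<^sub>R (transpose J ** model \<delta> x w z t p ** J)"
    and "y $ 2 * det2 (XH (base y)) (XR (base y)) = m' * (\<delta> * modelD x w z t p)"
proof -
  define d where "d = modelD x w z t p"
  define r where "r = e * y $ 2"
  define \<alpha> where "\<alpha> = (\<tau> $ 2 * (y $ 3 - \<theta> $ 1) - \<tau> $ 1 * (y $ 4 - \<theta> $ 2)) / \<delta>"
  have e0: "e > 0" using m by (simp add: e_def)
  have r0: "r > 0" using e0 r by (simp add: r_def)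
  have p: "p $ 2 = r * cos \<alpha>" "p $ 3 = r * sin \<alpha>"
    by (simp_all add: p_def polar_def Let_def r_def \<alpha>_def \<delta>_def)
  have s: "(p $ 2)\<^sup>2 + (p $ 3)\<^sup>2 = r\<^sup>2"
    unfolding p power_mult_distrib by (metis distrib_left mult.right_neutral sin_cos_squared_add2)
  have d: "d = - (z + 2 * r\<^sup>2 * (w * z - x * t))" by (simp add: d_def modelD_def s)
  have base: "base y $ 2 = y $ 2" by (simp add: base_def)
  have dt: "det2 (XH (base y)) (XR (base y)) = m' * \<delta> * d / y $ 2"
  proof -
    have "det2 (XH (base y)) (XR (base y)) =
      ((e * x) * (m' * (2 * e * y $ 2 * t)) - (m' * z) * (1 / y $ 2 + 2 * e\<^sup>2 * y $ 2 * w)) * \<delta>"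
      unfolding XH XR det2_def \<delta>_def by (simp add: algebra_simps)
    also have "(e * x) * (m' * (2 * e * y $ 2 * t)) - (m' * z) * (1 / y $ 2 + 2 * e\<^sup>2 * y $ 2 * w) = m' * d / y $ 2"
      using assms(8) unfolding d r_def by (simp add: field_simps power2_eq_square)
    finally show ?thesis by simp
  qed
  then show V: "y $ 2 * det2 (XH (base y)) (XR (base y)) = m' * (\<delta> * modelD x w z t p)"
    using assms(8) by (simp add: d_def)
  define u where "u = 1 + 2 * r\<^sup>2 * w"
  have d0: "d \<noteq> 0" using D by (simp add: d_def)
  \<comment> \<open>\<open>al\<close> is the differential of \<open>\<alpha>\<close> and
    \<open>J4\<close> that of \<open>m \<beta>\<close>.\<close>
  define J4 where "J4 = (\<lambda>i::4. if i = 3 then - m * (N $ 2 / \<delta>) else if i = 4 then m * (N $ 1 / \<delta>) else 0)"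
  define al where "al = (\<lambda>i::4. if i = 3 then \<tau> $ 2 / \<delta> else if i = 4 then - (\<tau> $ 1 / \<delta>) else 0)"
  have J4: "J $ 4 $ i = J4 i" for i
    unfolding J_def jacobian_polar J4_def using exhaust_4[of i] by (auto simp: \<delta>_def)
  have eta: "p $ 2 * J $ 3 $ i - p $ 3 * J $ 2 $ i = r\<^sup>2 * al i" for i
  proof -
    have "r * cos \<alpha> * (e * y $ 2 * cos \<alpha> * a) - r * sin \<alpha> * (- (e * y $ 2 * sin \<alpha> * a)) = r\<^sup>2 * a" for a
    proof -
      have "r * cos \<alpha> * (e * y $ 2 * cos \<alpha> * a) - r * sin \<alpha> * (- (e * y $ 2 * sin \<alpha> * a)) =
        r\<^sup>2 * a * ((cos \<alpha>)\<^sup>2 + (sin \<alpha>)\<^sup>2)" unfolding r_def by algebra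
      then show ?thesis by simp
    qed
    from this[of "\<tau> $ 2 / \<delta>"] this[of "- (\<tau> $ 1 / \<delta>)"] show ?thesis
      unfolding J_def jacobian_polar p al_def using exhaust_4[of i] by (auto simp: \<delta>_def[symmetric] \<alpha>_def[symmetric])
  qed
  have J0: "J $ 1 $ i * J $ 1 $ j + J $ 2 $ i * J $ 2 $ j + J $ 3 $ i * J $ 3 $ j =
     (if i = j \<and> (i = 1 \<or> i = 2) then e\<^sup>2 else r\<^sup>2 * al i * al j)" for i j
  proof -
    have cs: "e * cos \<alpha> * (e * cos \<alpha>) + e * sin \<alpha> * (e * sin \<alpha>) = e\<^sup>2"
    proof -
      have "e * cos \<alpha> * (e * cos \<alpha>) + e * sin \<alpha> * (e * sin \<alpha>) = e\<^sup>2 * ((cos \<alpha>)\<^sup>2 + (sin \<alpha>)\<^sup>2)"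
        by algebra
      then show ?thesis by simp
    qed
    have rr: "- (e * y $ 2 * sin \<alpha>) * a * (- (e * y $ 2 * sin \<alpha>) * b) + e * y $ 2 * cos \<alpha> * a * (e * y $ 2 * cos \<alpha> * b) = r\<^sup>2 * a * b" for a b
    proof -
      have "- (e * y $ 2 * sin \<alpha>) * a * (- (e * y $ 2 * sin \<alpha>) * b) + e * y $ 2 * cos \<alpha> * a * (e * y $ 2 * cos \<alpha> * b)
        = r\<^sup>2 * a * b * ((sin \<alpha>)\<^sup>2 + (cos \<alpha>)\<^sup>2)"
        unfolding r_def by algebra
      then show ?thesis by simp
    qed
    have J1: "J $ 1 $ i = (if i = 1 then e else 0)"
      and J2: "J $ 2 $ i = (if i = 2 then e * cos \<alpha> else - (e * y $ 2 * sin \<alpha>) * al i)"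
      and J3: "J $ 3 $ i = (if i = 2 then e * sin \<alpha> else e * y $ 2 * cos \<alpha> * al i)" for i
      unfolding J_def jacobian_polar al_def
      using exhaust_4[of i] by (auto simp: \<delta>_def[symmetric] \<alpha>_def[symmetric])
    have al: "al 1 = 0" "al 2 = 0" by (simp_all add: al_def)
    consider "i = 2" "j = 2" | "i = 2" "j \<noteq> 2" | "i \<noteq> 2" "j = 2" | "i \<noteq> 2" "j \<noteq> 2" by blast
    then show ?thesis
    proof cases
      case 1
      then show ?thesis unfolding J1 J2 J3 using cs by simp
    next
      case 4
      then show ?thesis unfolding J1 J2 J3 using rr[of "al i" "al j"]
        by (cases "i = 1"; cases "j = 1") (simp_all add: al power2_eq_square)
    qed (unfold J1 J2 J3, simp_all add: al algebra_simps)
  qed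
  have VE: "\<delta> * d + \<delta> / d * (4 * t\<^sup>2 - 4 * z * (w * z - x * t) - 4 * r\<^sup>2 * (w * z - x * t)\<^sup>2) * r\<^sup>2
    = \<delta> / d * (z\<^sup>2 + 4 * r\<^sup>2 * t\<^sup>2)"
  proof -
    have "d\<^sup>2 + r\<^sup>2 * (4 * t\<^sup>2 - 4 * z * (w * z - x * t) - 4 * r\<^sup>2 * (w * z - x * t)\<^sup>2) = z\<^sup>2 + 4 * r\<^sup>2 * t\<^sup>2"
      unfolding d by algebra
    moreover have "\<delta> * d + \<delta> / d * Q * r\<^sup>2 = \<delta> / d * (d\<^sup>2 + r\<^sup>2 * Q)" for Q
      using d0 by (simp add: field_simps power2_eq_square)
    ultimately show ?thesis by simp
  qed
  have M: "(transpose J ** model \<delta> x w z t p ** J) $ i $ j =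
    (if i = j \<and> (i = 1 \<or> i = 2) then e\<^sup>2 * (\<delta> * d) else
     \<delta> / d * (r\<^sup>2 * (z\<^sup>2 + 4 * r\<^sup>2 * t\<^sup>2) * al i * al j - (x * z + u * (2 * t)) * r\<^sup>2 * (al i * J4 j + J4 i * al j)
       + (r\<^sup>2 * x\<^sup>2 + u\<^sup>2) * J4 i * J4 j))" for i j
  proof (cases "i = j \<and> (i = 1 \<or> i = 2)")
    case True
    then have "al i = 0" "J4 i = 0" by (auto simp: al_def J4_def)
    then show ?thesis using True
      unfolding pullback_model_nth Let_def eta J4 J0 s by (simp add: d_def)
  next
    case False
    have "(transpose J ** model \<delta> x w z t p ** J) $ i $ j =
      (\<delta> * d + \<delta> / d * (4 * t\<^sup>2 - 4 * z * (w * z - x * t) - 4 * r\<^sup>2 * (w * z - x * t)\<^sup>2) * r\<^sup>2) * (r\<^sup>2 * al i * al j)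
      - \<delta> / d * (x * z + u * (2 * t)) * r\<^sup>2 * (al i * J4 j + J4 i * al j)
      + \<delta> / d * (r\<^sup>2 * x\<^sup>2 + u\<^sup>2) * J4 i * J4 j"
      unfolding pullback_model_nth Let_def eta J4 J0 s if_not_P[OF False] d_def[symmetric] u_def[symmetric]
      by (simp add: algebra_simps power2_eq_square add_divide_distrib)
    then show ?thesis unfolding VE if_not_P[OF False] by (simp add: algebra_simps add_divide_distrib)
  qed
  have f: "base y $ 2 / det2 (XH (base y)) (XR (base y)) = (y $ 2)\<^sup>2 / (m' * \<delta> * d)"
    unfolding dt base by (simp add: power2_eq_square)
  \<comment> \<open>An identity for the entries of \<open>D\<xi> D\<xi>^t\<close> itself.
    \<open>toric_metric\<close> contains its cofactors; their exchanged indices and signs are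
    exactly those carried by \<open>al\<close> and \<open>J4\<close>.\<close>
  have key: "(y $ 2)\<^sup>2 / (m' * \<delta> * d) * (XH (base y) $ i * XH (base y) $ j + XR (base y) $ i * XR (base y) $ j) =
    1 / (e * m) * (\<delta> / d * (r\<^sup>2 * (z\<^sup>2 + 4 * r\<^sup>2 * t\<^sup>2) * (\<tau> $ i / \<delta>) * (\<tau> $ j / \<delta>)
       + (x * z + u * (2 * t)) * r\<^sup>2 * (\<tau> $ i / \<delta> * (m * (N $ j / \<delta>)) + m * (N $ i / \<delta>) * (\<tau> $ j / \<delta>))
       + (r\<^sup>2 * x\<^sup>2 + u\<^sup>2) * (m * (N $ i / \<delta>)) * (m * (N $ j / \<delta>))))" (is "?L = ?R") for i j
  proof -
    have xr: "XR (base y) $ i = (u / y $ 2) * N $ i + (m' * (2 * r * t)) * \<tau> $ i" for i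
      unfolding XR u_def r_def using assms(8) by (simp add: field_simps power2_eq_square)
    have xh: "XH (base y) $ i = m' * (m * x * N $ i + z * \<tau> $ i)" for i
      unfolding XH e_def by (simp add: algebra_simps)
    have xr': "y $ 2 * XR (base y) $ i = (1 / m) * (m * u * N $ i + 2 * r\<^sup>2 * t * \<tau> $ i)" for i
      unfolding xr using assms(8) m by (simp add: r_def e_def field_simps power2_eq_square)
    have yr: "y $ 2 = r / (m * m')" using m by (simp add: r_def e_def)
    have xh': "y $ 2 * XH (base y) $ i = (r / m) * (m * x * N $ i + z * \<tau> $ i)" for i
      unfolding xh yr using m by simp
    have "?L = ((y $ 2 * XH (base y) $ i) * (y $ 2 * XH (base y) $ j) + (y $ 2 * XR (base y) $ i) * (y $ 2 * XR (base y) $ j)) / (m' * \<delta> * d)"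
      by (simp add: power2_eq_square algebra_simps add_divide_distrib)
    also have "\<dots> = 1 / (e * m) / (\<delta> * d) * (r\<^sup>2 * ((m * x * N $ i + z * \<tau> $ i) * (m * x * N $ j + z * \<tau> $ j))
       + (m * u * N $ i + 2 * r\<^sup>2 * t * \<tau> $ i) * (m * u * N $ j + 2 * r\<^sup>2 * t * \<tau> $ j))"
    proof -
      have "(r / m * A * (r / m * B) + 1 / m * C * (1 / m * E)) / (m' * \<delta> * d) =
        1 / (e * m) / (\<delta> * d) * (r\<^sup>2 * (A * B) + C * E)" for A B C E
        using m \<delta> d0 by (simp add: e_def field_simps power2_eq_square)
      then show ?thesis unfolding xh' xr' .
    qed
    also have "r\<^sup>2 * ((m * x * N $ i + z * \<tau> $ i) * (m * x * N $ j + z * \<tau> $ j))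
       + (m * u * N $ i + 2 * r\<^sup>2 * t * \<tau> $ i) * (m * u * N $ j + 2 * r\<^sup>2 * t * \<tau> $ j) =
       r\<^sup>2 * (z\<^sup>2 + 4 * r\<^sup>2 * t\<^sup>2) * (\<tau> $ i * \<tau> $ j) + (x * z + u * (2 * t)) * r\<^sup>2 * (m * (\<tau> $ i * N $ j + N $ i * \<tau> $ j))
       + (r\<^sup>2 * x\<^sup>2 + u\<^sup>2) * (m\<^sup>2 * (N $ i * N $ j))"
      by (simp add: power2_eq_square algebra_simps)
    also have "1 / (e * m) / (\<delta> * d) * \<dots> = ?R"
      using \<delta> d0 by (simp add: power2_eq_square add_divide_distrib distrib_left) (simp add: field_simps)
    finally show ?thesis .
  qed
  have em: "e\<^sup>2 / (e * m) = m'" using m by (simp add: e_def power2_eq_square)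
  have V': "y $ 2 * det2 (XH (base y)) (XR (base y)) = 1 / (e * m) * (e\<^sup>2 * (\<delta> * d))"
    unfolding V d_def[symmetric] using em by (metis mult.commute mult_1 times_divide_eq_left times_divide_eq_right)
  show "toric_metric XH XR y = (1 / (e * m)) *\<^sub>R (transpose J ** model \<delta> x w z t p ** J)"
    unfolding vec_eq_iff forall_4 toric_metric_def Let_def f
    unfolding vector_scaleR_component M base V' vector_4
    using key[of 1 1] key[of 1 2] key[of 2 2]
    by (simp add: al_def J4_def power2_eq_square algebra_simps)
qed

subsection \<open>The flat cone\<close>

definition rad :: "real^4 \<Rightarrow> real" where
  "rad y = sqrt ((y $ 2)\<^sup>2 + (y $ 3)\<^sup>2 + (y $ 1)\<^sup>2)"

text \<open>The complement of the half axis \<open>y_2 = y_3 = 0\<close>,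
  \<open>y_1 \<le> 0\<close>, for any \<open>y_4\<close>.\<close>

definition flat_dom :: "(real^4) set" where
  "flat_dom = {y. 0 < (y $ 2)\<^sup>2 + (y $ 3)\<^sup>2 + (y $ 1)\<^sup>2 \<and> 0 < y $ 1 + rad y}"

text \<open>The coordinates \<open>z_1 = sqrt (\<rho> - H) e^(i \<alpha>)\<close> and
  \<open>z_2 = sqrt (\<rho> + H) e^(i \<beta>)\<close> of flat \<open>C^2\<close>. Because
  \<open>r^2 = (\<rho> - H) (\<rho> + H)\<close>, the first one is \<open>(y_2 + i y_3) / q\<close>,
  which is smooth across the axis where \<open>H > 0\<close>.\<close>

definition flat_coord :: "real^4 \<Rightarrow> real^4" where
  "flat_coord y = (let q = sqrt (y $ 1 + rad y) in vector [y $ 2 / q, y $ 3 / q, q * cos (y $ 4), q * sin (y $ 4)])"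

lemma open_positive: "continuous_on UNIV f \<Longrightarrow> open {y. 0 < (f y :: real)}"
  by (intro open_Collect_less continuous_on_const)

lemma open_flat_dom: "open flat_dom"
  unfolding flat_dom_def rad_def Collect_conj_eq
  by (intro open_Int open_positive continuous_intros)

lemma smooth_rad: "smooth_on flat_dom rad"
  unfolding rad_def by (intro smooth_intros open_flat_dom) (auto simp: flat_dom_def)

lemma smooth_flat_coord: "smooth_on flat_dom flat_coord"
  unfolding flat_coord_def Let_def
  by (intro smooth_on_vector4 smooth_intros open_flat_dom smooth_rad) (auto simp: flat_dom_def)

lemma jacobian_flat_coord:
  assumes y: "y \<in> flat_dom"
  defines "\<rho> \<equiv> rad y" and "q \<equiv> sqrt (y $ 1 + rad y)"
  defines "g \<equiv> y $ 1 + \<rho>" and "m \<equiv> 1 / (2 * \<rho> * q)"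
  shows "jacobian flat_coord (at y) =
    vector [vector [- m * y $ 2, m * (2 * \<rho> - (y $ 2)\<^sup>2 / g), - m * y $ 2 * y $ 3 / g, 0],
            vector [- m * y $ 3, - m * y $ 2 * y $ 3 / g, m * (2 * \<rho> - (y $ 3)\<^sup>2 / g), 0],
            vector [m * cos (y $ 4) * g, m * cos (y $ 4) * y $ 2, m * cos (y $ 4) * y $ 3, - q * sin (y $ 4)],
            vector [m * sin (y $ 4) * g, m * sin (y $ 4) * y $ 2, m * sin (y $ 4) * y $ 3, q * cos (y $ 4)]]"
    (is "_ = ?M")
proof (rule jacobian_eqI)
  have n: "((\<lambda>y::real^4. y $ i) has_derivative (\<lambda>v. v $ i)) (at y)" for i
    by (rule bounded_linear_imp_has_derivative[OF bounded_linear_vec_nth])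
  have \<rho>0: "\<rho> > 0" using y by (simp add: \<rho>_def rad_def flat_dom_def)
  have g0: "g > 0" using y by (simp add: g_def \<rho>_def flat_dom_def)
  have q0: "q > 0" using g0 by (simp add: q_def g_def \<rho>_def)
  have q2: "q * q = g" using g0 by (simp add: q_def g_def \<rho>_def)
  have r: "(rad has_derivative (\<lambda>v. (y $ 2 * v $ 2 + y $ 3 * v $ 3 + y $ 1 * v $ 1) / \<rho>)) (at y)"
  proof -
    have "((\<lambda>y::real^4. y $ 2 * y $ 2 + y $ 3 * y $ 3 + y $ 1 * y $ 1) has_derivative
       (\<lambda>v. (y $ 2 * v $ 2 + v $ 2 * y $ 2) + (y $ 3 * v $ 3 + v $ 3 * y $ 3) + (y $ 1 * v $ 1 + v $ 1 * y $ 1))) (at y)"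
      by (intro has_derivative_add has_derivative_mult n)
    from has_derivative_real_sqrt[OF _ this]
    have "((\<lambda>y::real^4. sqrt (y $ 2 * y $ 2 + y $ 3 * y $ 3 + y $ 1 * y $ 1)) has_derivative
       (\<lambda>v. ((y $ 2 * v $ 2 + v $ 2 * y $ 2) + (y $ 3 * v $ 3 + v $ 3 * y $ 3) + (y $ 1 * v $ 1 + v $ 1 * y $ 1)) *
          (inverse (sqrt (y $ 2 * y $ 2 + y $ 3 * y $ 3 + y $ 1 * y $ 1)) / 2))) (at y)"
      using y by (simp add: flat_dom_def power2_eq_square)
    moreover have "(\<lambda>y::real^4. sqrt (y $ 2 * y $ 2 + y $ 3 * y $ 3 + y $ 1 * y $ 1)) = rad"
      by (simp add: rad_def power2_eq_square fun_eq_iff)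
    moreover have "sqrt (y $ 2 * y $ 2 + y $ 3 * y $ 3 + y $ 1 * y $ 1) = \<rho>"
      by (simp add: \<rho>_def rad_def power2_eq_square)
    moreover have "(\<lambda>v::real^4. ((y $ 2 * v $ 2 + v $ 2 * y $ 2) + (y $ 3 * v $ 3 + v $ 3 * y $ 3) + (y $ 1 * v $ 1 + v $ 1 * y $ 1)) *
          (inverse \<rho> / 2)) = (\<lambda>v. (y $ 2 * v $ 2 + y $ 3 * v $ 3 + y $ 1 * v $ 1) / \<rho>)"
    proof
      fix v :: "real^4"
      have "(y $ 2 * v $ 2 + v $ 2 * y $ 2) + (y $ 3 * v $ 3 + v $ 3 * y $ 3) + (y $ 1 * v $ 1 + v $ 1 * y $ 1) =
        2 * (y $ 2 * v $ 2 + y $ 3 * v $ 3 + y $ 1 * v $ 1)" by (simp add: algebra_simps)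
      moreover have "2 * S * (inverse \<rho> / 2) = S / \<rho>" for S by (simp add: field_simps)
      ultimately show "((y $ 2 * v $ 2 + v $ 2 * y $ 2) + (y $ 3 * v $ 3 + v $ 3 * y $ 3) + (y $ 1 * v $ 1 + v $ 1 * y $ 1)) *
          (inverse \<rho> / 2) = (y $ 2 * v $ 2 + y $ 3 * v $ 3 + y $ 1 * v $ 1) / \<rho>" by (simp only:)
    qed
    ultimately show ?thesis by (simp only:)
  qed
  have q: "((\<lambda>y. sqrt (y $ 1 + rad y)) has_derivative (\<lambda>v. m * (g * v $ 1 + y $ 2 * v $ 2 + y $ 3 * v $ 3))) (at y)"
  proof -
    have "((\<lambda>y. sqrt (y $ 1 + rad y)) has_derivative
      (\<lambda>v. (v $ 1 + (y $ 2 * v $ 2 + y $ 3 * v $ 3 + y $ 1 * v $ 1) / \<rho>) * (inverse (sqrt (y $ 1 + rad y)) / 2))) (at y)"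
      using y by (intro has_derivative_real_sqrt has_derivative_add n r) (simp add: flat_dom_def)
    moreover have "(\<lambda>v::real^4. (v $ 1 + (y $ 2 * v $ 2 + y $ 3 * v $ 3 + y $ 1 * v $ 1) / \<rho>) * (inverse (sqrt (y $ 1 + rad y)) / 2)) =
       (\<lambda>v. m * (g * v $ 1 + y $ 2 * v $ 2 + y $ 3 * v $ 3))"
    proof
      fix v :: "real^4"
      have "v $ 1 + (y $ 2 * v $ 2 + y $ 3 * v $ 3 + y $ 1 * v $ 1) / \<rho> = (g * v $ 1 + y $ 2 * v $ 2 + y $ 3 * v $ 3) / \<rho>"
        using \<rho>0 by (simp add: g_def field_simps)
      then show "(v $ 1 + (y $ 2 * v $ 2 + y $ 3 * v $ 3 + y $ 1 * v $ 1) / \<rho>) * (inverse (sqrt (y $ 1 + rad y)) / 2) =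
        m * (g * v $ 1 + y $ 2 * v $ 2 + y $ 3 * v $ 3)"
        unfolding q_def[symmetric] m_def using \<rho>0 q0 by (simp add: field_simps)
    qed
    ultimately show ?thesis by (simp only:)
  qed
  have iq: "((\<lambda>y. inverse (sqrt (y $ 1 + rad y))) has_derivative
      (\<lambda>v. - (inverse q * (m * (g * v $ 1 + y $ 2 * v $ 2 + y $ 3 * v $ 3)) * inverse q))) (at y)"
    using Deriv.has_derivative_inverse[OF _ q] q0 by (simp add: q_def)
  have c: "((\<lambda>y::real^4. cos (y $ 4)) has_derivative (\<lambda>v. - (v $ 4 * sin (y $ 4)))) (at y)"
    using has_derivative_cos[OF n[of 4]] by simp
  have s: "((\<lambda>y::real^4. sin (y $ 4)) has_derivative (\<lambda>v. v $ 4 * cos (y $ 4))) (at y)"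
    using has_derivative_sin[OF n[of 4]] by simp
  have mq: "inverse q = 2 * \<rho> * m" "m / g = m * inverse q * inverse q"
    using \<rho>0 q0 g0 by (auto simp: m_def field_simps q2[symmetric])
  have mq': "a / q = 2 * \<rho> * m * a" for a using mq(1) by (simp add: divide_inverse)
  have "((\<lambda>y. flat_coord y $ i) has_derivative (\<lambda>v. (?M *v v) $ i)) (at y)" for i
  proof -
    have e: "(\<lambda>y. flat_coord y $ 1) = (\<lambda>y. y $ 2 * inverse (sqrt (y $ 1 + rad y)))"
      "(\<lambda>y. flat_coord y $ 2) = (\<lambda>y. y $ 3 * inverse (sqrt (y $ 1 + rad y)))"
      "(\<lambda>y. flat_coord y $ 3) = (\<lambda>y. sqrt (y $ 1 + rad y) * cos (y $ 4))"
      "(\<lambda>y. flat_coord y $ 4) = (\<lambda>y. sqrt (y $ 1 + rad y) * sin (y $ 4))"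
      by (simp_all add: flat_coord_def Let_def divide_inverse fun_eq_iff)
    have q': "sqrt (y $ 1 + rad y) = q" by (simp add: q_def)
    have qq: "inverse q * (m * Q) * inverse q = m / g * Q" for Q
      unfolding mq(2) by simp
    consider "i = 1" | "i = 2" | "i = 3" | "i = 4" using exhaust_4[of i] by auto
    then show ?thesis
    proof cases
      case 1
      show ?thesis unfolding 1 e
        by (rule has_derivative_eq_rhs[OF has_derivative_mult[OF n iq]])
           (unfold q' qq, use g0 in \<open>simp add: fun_eq_iff matrix_vector_mult_def sum_4 mq(1) mq' field_simps power2_eq_square\<close>)
    next
      case 2
      show ?thesis unfolding 2 e
        by (rule has_derivative_eq_rhs[OF has_derivative_mult[OF n iq]])
           (unfold q' qq, use g0 in \<open>simp add: fun_eq_iff matrix_vector_mult_def sum_4 mq(1) mq' field_simps power2_eq_square\<close>)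
    next
      case 3
      show ?thesis unfolding 3 e
        by (rule has_derivative_eq_rhs[OF has_derivative_mult[OF q c]])
           (unfold q', simp add: fun_eq_iff matrix_vector_mult_def sum_4 algebra_simps)
    next
      case 4
      show ?thesis unfolding 4 e
        by (rule has_derivative_eq_rhs[OF has_derivative_mult[OF q s]])
           (unfold q', simp add: fun_eq_iff matrix_vector_mult_def sum_4 algebra_simps)
    qed
  qed
  then show "(flat_coord has_derivative (\<lambda>v. ?M *v v)) (at y)"
    by (subst has_derivative_componentwise_within)
       (auto simp: Basis_vec_def inner_axis)
qed

text \<open>The model of \<open>\<xi> = N log r + (1/2) (\<tau> - N) log (H + \<rho>)\<close>, the
  data of a cone with a single vertex. The coefficients come from
  \<open>\<partial>_H log (H + \<rho>) = 1/\<rho>\<close> and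
  \<open>\<partial>_s log (H + \<rho>) = 1 / (2 \<rho> (H + \<rho>))\<close>.\<close>

definition flat_model :: "real \<Rightarrow> real^4 \<Rightarrow> real^4^4" where
  "flat_model \<delta> y = (let \<rho> = rad y; g = y $ 1 + \<rho> in
     model \<delta> (- 1 / (2 * \<rho>)) (- 1 / (4 * \<rho> * g)) (1 / (2 * \<rho>)) (1 / (4 * \<rho> * g)) y)"

lemma flat_model_pullback:
  assumes y: "y \<in> flat_dom"
  shows "transpose (jacobian flat_coord (at y)) ** ((- \<delta>) *\<^sub>R mat 1) ** jacobian flat_coord (at y) = flat_model \<delta> y"
proof -
  define \<rho> where "\<rho> = rad y"
  define q where "q = sqrt (y $ 1 + rad y)"
  define g where "g = y $ 1 + \<rho>"
  define m where "m = 1 / (2 * \<rho> * q)"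
  define J where "J = jacobian flat_coord (at y)"
  have \<rho>0: "\<rho> > 0" using y by (simp add: \<rho>_def rad_def flat_dom_def)
  have g0: "g > 0" using y by (simp add: g_def \<rho>_def flat_dom_def)
  have q0: "q > 0" using g0 by (simp add: q_def g_def \<rho>_def)
  have q2: "q * q = g" using g0 by (simp add: q_def g_def \<rho>_def)
  have m2: "m * m = 1 / (4 * \<rho> * \<rho> * g)" by (simp add: m_def q2[symmetric])
  have \<rho>2: "(y $ 2)\<^sup>2 + (y $ 3)\<^sup>2 + (y $ 1)\<^sup>2 = \<rho>\<^sup>2"
    using y by (simp add: \<rho>_def rad_def flat_dom_def)
  have y1: "y $ 1 = g - \<rho>" by (simp add: g_def)
  have s: "(y $ 2)\<^sup>2 + (y $ 3)\<^sup>2 = g * (2 * \<rho> - g)"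
    using \<rho>2 unfolding y1 by (simp add: power2_eq_square algebra_simps)
  have y3: "(y $ 3)\<^sup>2 = g * (2 * \<rho> - g) - (y $ 2)\<^sup>2" using s by simp
  define a where "a = y $ 2"
  define b where "b = y $ 3"
  \<comment> \<open>Treating the reciprocals as variables subject to \<open>g ig = 1\<close> and
    \<open>2 \<rho> ir = 1\<close> turns the entries into polynomial identities.\<close>
  define ig where "ig = 1 / g"
  define ir where "ir = 1 / (2 * \<rho>)"
  have J: "J = vector [vector [- m * a, m * (2 * \<rho> - a\<^sup>2 * ig), - m * a * b * ig, 0],
            vector [- m * b, - m * a * b * ig, m * (2 * \<rho> - b\<^sup>2 * ig), 0],
            vector [m * cos (y $ 4) * g, m * cos (y $ 4) * a, m * cos (y $ 4) * b, - q * sin (y $ 4)],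
            vector [m * sin (y $ 4) * g, m * sin (y $ 4) * a, m * sin (y $ 4) * b, q * cos (y $ 4)]]"
    using jacobian_flat_coord[OF y] by (simp add: J_def m_def q_def g_def \<rho>_def a_def b_def ig_def)
  have ig: "g * ig = 1" and ir: "2 * \<rho> * ir = 1" using g0 \<rho>0 by (simp_all add: ig_def ir_def)
  have sab: "a\<^sup>2 + b\<^sup>2 = g * (2 * \<rho> - g)" using s by (simp add: a_def b_def)
  have mm: "m * m = ir * ir * ig" using m2 by (simp add: ig_def ir_def)
  have h11: "- m * a * (- m * a) + - m * b * (- m * b) + m * m * g * g = ir"
  proof -
    have "- m * a * (- m * a) + - m * b * (- m * b) + m * m * g * g = m * m * (a\<^sup>2 + b\<^sup>2 + g * g)" by algebra
    also have "\<dots> = (ir * (2 * \<rho> * ir)) * (g * ig)" unfolding mm sab by algebra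
    finally show ?thesis using ig ir by simp
  qed
  have h12: "- m * a * (m * (2 * \<rho> - a\<^sup>2 * ig)) + - m * b * (- m * a * b * ig) + m * m * g * a = 0"
    if "a\<^sup>2 + b\<^sup>2 = g * (2 * \<rho> - g)" for a b
  proof -
    have "- m * a * (m * (2 * \<rho> - a\<^sup>2 * ig)) + - m * b * (- m * a * b * ig) + m * m * g * a =
      m * m * a * ((a\<^sup>2 + b\<^sup>2) * ig + g - 2 * \<rho>)" by algebra
    also have "(a\<^sup>2 + b\<^sup>2) * ig + g - 2 * \<rho> = (g * ig - 1) * (2 * \<rho> - g)" unfolding that by algebra
    finally show ?thesis using ig by simp
  qed
  have h22: "m * (2 * \<rho> - a\<^sup>2 * ig) * (m * (2 * \<rho> - a\<^sup>2 * ig)) + - m * a * b * ig * (- m * a * b * ig) + m * m * a * a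
      = ir * (1 + b\<^sup>2 * ig\<^sup>2)"
    if ab: "a\<^sup>2 + b\<^sup>2 = g * (2 * \<rho> - g)" for a b
  proof -
    have "m * (2 * \<rho> - a\<^sup>2 * ig) * (m * (2 * \<rho> - a\<^sup>2 * ig)) + - m * a * b * ig * (- m * a * b * ig) + m * m * a * a
      = m * m * (4 * \<rho> * \<rho> - 4 * \<rho> * ig * a\<^sup>2 + a\<^sup>2 * ig * ig * (a\<^sup>2 + b\<^sup>2) + a\<^sup>2)" by algebra
    also have "\<dots> = (2 * \<rho> * ir) * ((2 * \<rho> * ir) * ig - 2 * ir * ig\<^sup>2 * a\<^sup>2 + (g * ig) * ir * ig\<^sup>2 * a\<^sup>2)
      + ir * ir * ig * a\<^sup>2 * (1 - (g * ig) * (g * ig))"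
      unfolding mm ab by algebra
    also have "\<dots> = ig - ir * ig\<^sup>2 * a\<^sup>2" unfolding ig ir by simp
    also have "\<dots> = ig - ir * ig\<^sup>2 * (g * (2 * \<rho> - g) - b\<^sup>2)" using ab by algebra
    also have "ig - ir * ig\<^sup>2 * (g * (2 * \<rho> - g) - b\<^sup>2) =
      ig - (2 * \<rho> * ir) * (g * ig) * ig + ir * (g * ig) * (g * ig) + ir * ig\<^sup>2 * b\<^sup>2" by algebra
    also have "\<dots> = ir * (1 + b\<^sup>2 * ig\<^sup>2)" unfolding ig ir by (simp add: algebra_simps)
    finally show ?thesis .
  qed
  have h23: "m * (2 * \<rho> - a\<^sup>2 * ig) * (- m * a * b * ig) + - m * a * b * ig * (m * (2 * \<rho> - b\<^sup>2 * ig)) + m * m * a * b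
      = - (ir * (a * b * ig\<^sup>2))"
  proof -
    have "m * (2 * \<rho> - a\<^sup>2 * ig) * (- m * a * b * ig) + - m * a * b * ig * (m * (2 * \<rho> - b\<^sup>2 * ig)) + m * m * a * b
      = m * m * a * b * (ig * ig * (a\<^sup>2 + b\<^sup>2) - 4 * \<rho> * ig + 1)" by algebra
    also have "\<dots> = ir * ig * a * b * ((2 * \<rho> * ir) * (g * ig) * ig - 2 * (2 * \<rho> * ir) * ig)
       + ir * ir * ig * a * b * (1 - (g * ig) * (g * ig))"
      unfolding mm sab by algebra
    also have "\<dots> = - (ir * (a * b * ig\<^sup>2))" unfolding ig ir by (simp add: power2_eq_square)
    finally show ?thesis .
  qed
  have L: "(transpose J ** ((- \<delta>) *\<^sub>R mat 1) ** J) $ i $ j =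
    - \<delta> * (J $ 1 $ i * J $ 1 $ j + J $ 2 $ i * J $ 2 $ j + (J $ 3 $ i * J $ 3 $ j + J $ 4 $ i * J $ 4 $ j))" for i j
    by (simp add: matrix_matrix_mult_def transpose_def mat_def sum_4 algebra_simps)
  have cs: "a * cos (y $ 4) * c * (a * cos (y $ 4) * d) + a * sin (y $ 4) * c * (a * sin (y $ 4) * d) = a * a * c * d" for a c d
  proof -
    have "a * cos (y $ 4) * c * (a * cos (y $ 4) * d) + a * sin (y $ 4) * c * (a * sin (y $ 4) * d) =
      a * a * c * d * ((sin (y $ 4))\<^sup>2 + (cos (y $ 4))\<^sup>2)" by algebra
    then show ?thesis by simp
  qed
  have cs0: "a * cos (y $ 4) * c * (- q * sin (y $ 4)) + a * sin (y $ 4) * c * (q * cos (y $ 4)) = 0"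
    "- q * sin (y $ 4) * (a * cos (y $ 4) * c) + q * cos (y $ 4) * (a * sin (y $ 4) * c) = 0" for a c
    by simp_all
  have cs4: "- q * sin (y $ 4) * (- q * sin (y $ 4)) + q * cos (y $ 4) * (q * cos (y $ 4)) = g"
  proof -
    have "- q * sin (y $ 4) * (- q * sin (y $ 4)) + q * cos (y $ 4) * (q * cos (y $ 4)) =
      q * q * ((sin (y $ 4))\<^sup>2 + (cos (y $ 4))\<^sup>2)" by algebra
    then show ?thesis by (simp add: q2)
  qed
  have R: "flat_model \<delta> y = vector [vector [- \<delta> / (2 * \<rho>), 0, 0, 0],
     vector [0, - \<delta> / (2 * \<rho>) * (1 + (y $ 3)\<^sup>2 / g\<^sup>2), \<delta> / (2 * \<rho>) * (y $ 2 * y $ 3 / g\<^sup>2), 0],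
     vector [0, \<delta> / (2 * \<rho>) * (y $ 2 * y $ 3 / g\<^sup>2), - \<delta> / (2 * \<rho>) * (1 + (y $ 2)\<^sup>2 / g\<^sup>2), 0],
     vector [0, 0, 0, - \<delta> * g]]"
  proof -
    \<comment> \<open>Here \<open>x = - z\<close> and \<open>w = - t\<close>, so \<open>X\<close>
      vanishes and \<open>D\<close> reduces to \<open>- z\<close>.\<close>
    have X: "(- 1 / (4 * \<rho> * g)) * (1 / (2 * \<rho>)) - (- 1 / (2 * \<rho>)) * (1 / (4 * \<rho> * g)) = 0" by simp
    have b: "(- 1 / (2 * \<rho>)) * (1 / (2 * \<rho>)) + (1 + 2 * (g * (2 * \<rho> - g)) * (- 1 / (4 * \<rho> * g))) * (2 * (1 / (4 * \<rho> * g))) = 0"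
      using \<rho>0 g0 by (simp add: field_simps power2_eq_square)
    have c: "g * (2 * \<rho> - g) * (- 1 / (2 * \<rho>))\<^sup>2 + (1 + 2 * (g * (2 * \<rho> - g)) * (- 1 / (4 * \<rho> * g)))\<^sup>2 = g / (2 * \<rho>)"
      using \<rho>0 g0 by (simp add: field_simps power2_eq_square)
    show ?thesis
      unfolding flat_model_def Let_def \<rho>_def[symmetric] g_def[symmetric] model_def s X b c
      using \<rho>0 g0 by (simp add: field_simps power2_eq_square) (simp add: add_divide_distrib diff_divide_distrib)
  qed
  have R': "flat_model \<delta> y = vector [vector [- \<delta> * ir, 0, 0, 0],
     vector [0, - \<delta> * (ir * (1 + b\<^sup>2 * ig\<^sup>2)), - \<delta> * (- (ir * (a * b * ig\<^sup>2))), 0],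
     vector [0, - \<delta> * (- (ir * (a * b * ig\<^sup>2))), - \<delta> * (ir * (1 + a\<^sup>2 * ig\<^sup>2)), 0],
     vector [0, 0, 0, - \<delta> * g]]"
    unfolding R by (simp add: a_def b_def ig_def ir_def power_divide)
  note h = h11 h12[OF sab] h22[OF sab] h23
  have sba: "b\<^sup>2 + a\<^sup>2 = g * (2 * \<rho> - g)" using sab by simp
  have H: "(transpose J ** ((- \<delta>) *\<^sub>R mat 1) ** J) $ i $ j = (transpose J ** ((- \<delta>) *\<^sub>R mat 1) ** J) $ j $ i" for i j
    unfolding L by (simp add: mult.commute)
  have e: "(transpose J ** ((- \<delta>) *\<^sub>R mat 1) ** J) $ 1 $ 1 = - \<delta> * ir"
    "(transpose J ** ((- \<delta>) *\<^sub>R mat 1) ** J) $ 1 $ 2 = 0"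
    "(transpose J ** ((- \<delta>) *\<^sub>R mat 1) ** J) $ 1 $ 3 = 0"
    "(transpose J ** ((- \<delta>) *\<^sub>R mat 1) ** J) $ 1 $ 4 = 0"
    "(transpose J ** ((- \<delta>) *\<^sub>R mat 1) ** J) $ 2 $ 2 = - \<delta> * (ir * (1 + b\<^sup>2 * ig\<^sup>2))"
    "(transpose J ** ((- \<delta>) *\<^sub>R mat 1) ** J) $ 2 $ 3 = - \<delta> * (- (ir * (a * b * ig\<^sup>2)))"
    "(transpose J ** ((- \<delta>) *\<^sub>R mat 1) ** J) $ 2 $ 4 = 0"
    "(transpose J ** ((- \<delta>) *\<^sub>R mat 1) ** J) $ 3 $ 3 = - \<delta> * (ir * (1 + a\<^sup>2 * ig\<^sup>2))"
    "(transpose J ** ((- \<delta>) *\<^sub>R mat 1) ** J) $ 3 $ 4 = 0"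
    "(transpose J ** ((- \<delta>) *\<^sub>R mat 1) ** J) $ 4 $ 4 = - \<delta> * g"
    unfolding L
    unfolding J vector_4 cs cs0 cs4
    subgoal using h11 by simp
    subgoal using h12[OF sab] by simp
    subgoal using h12[OF sba] by (simp add: algebra_simps)
    subgoal by simp
    subgoal using h22[OF sab] by simp
    subgoal using h23 by simp
    subgoal by simp
    subgoal using h22[OF sba] by (simp add: algebra_simps)
    subgoal by simp
    subgoal by simp
    done
  show ?thesis
    unfolding J_def[symmetric] vec_eq_iff forall_4 R' vector_4
    using e H[of 1] H[of 2] H[of 3] by metis
qed

text \<open>A pull-back of a constant form is flat; the nonzero determinant of the Jacobian is read
  off from \<open>det_model\<close>.\<close>

lemma riemann_flat_model:
  assumes \<delta>: "\<delta> \<noteq> 0" and y: "y \<in> flat_dom"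
  shows "riemann_norm_sq (flat_model \<delta>) y = 0"
proof -
  interpret metric_pullback "\<lambda>_. (- \<delta>) *\<^sub>R mat 1" "flat_model \<delta>" flat_coord UNIV flat_dom
  proof
    show "smooth_on UNIV (\<lambda>_::real^4. (- \<delta>) *\<^sub>R mat 1 :: real^4^4)" by (intro smooth_intros open_UNIV)
    show "transpose ((- \<delta>) *\<^sub>R mat 1) = ((- \<delta>) *\<^sub>R mat 1 :: real^4^4)"
      by (simp add: transpose_def mat_def vec_eq_iff)
    have "det ((- \<delta>) *\<^sub>R mat 1 :: real^4^4) = (- \<delta>) ^ CARD(4)"
      by (subst det_diagonal) (auto simp: mat_def)
    then show d: "det ((- \<delta>) *\<^sub>R mat 1 :: real^4^4) \<noteq> 0" using \<delta> by simp
    show "smooth_on flat_dom flat_coord" by (rule smooth_flat_coord)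
    show "transpose (jacobian flat_coord (at w)) ** ((- \<delta>) *\<^sub>R mat 1) ** jacobian flat_coord (at w) = flat_model \<delta> w"
      if "w \<in> flat_dom" for w by (rule flat_model_pullback[OF that])
    show "det (jacobian flat_coord (at w)) \<noteq> 0" if w: "w \<in> flat_dom" for w
    proof -
      have "rad w > 0" using w by (simp add: rad_def flat_dom_def)
      then have nz: "modelD (- 1 / (2 * rad w)) (- 1 / (4 * rad w * (w $ 1 + rad w))) (1 / (2 * rad w))
        (1 / (4 * rad w * (w $ 1 + rad w))) w \<noteq> 0" by (simp add: modelD_def)
      then have "det (flat_model \<delta> w) \<noteq> 0"
        unfolding flat_model_def Let_def using \<delta> by (simp add: det_model)
      then show ?thesis unfolding flat_model_pullback[OF w, symmetric] by (auto simp: det_mul)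
    qed
  qed auto
  show ?thesis using riemann_norm_sq_pullback[OF y] by (simp add: riemann_norm_sq_const)
qed

section \<open>Asymptotics of the metrics\<close>

definition hrad :: "real^2 \<Rightarrow> real \<Rightarrow> real" where
  "hrad h a = sqrt ((h $ 2)\<^sup>2 + (h $ 1 + a)\<^sup>2)"

text \<open>With \<open>c i = n (i+1) - n i\<close> and \<open>N = n 1\<close>, \<open>xiH\<close>
  and \<open>xiR\<close> are the columns of \<open>Dxi\<close>. Arbitrary \<open>c\<close>,
  \<open>a\<close> and \<open>N\<close> let the same formulas describe the reflected data.\<close>

definition xiH :: "'i set \<Rightarrow> ('i \<Rightarrow> real^2) \<Rightarrow> ('i \<Rightarrow> real) \<Rightarrow> real^2 \<Rightarrow> real^2 \<Rightarrow> real^2" where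
  "xiH I c a \<nu> h = (1/2) *\<^sub>R (\<Sum>i\<in>I. (1 / hrad h (a i)) *\<^sub>R c i) + \<nu>"

definition xiR :: "'i set \<Rightarrow> ('i \<Rightarrow> real^2) \<Rightarrow> ('i \<Rightarrow> real) \<Rightarrow> real^2 \<Rightarrow> real^2 \<Rightarrow> real^2" where
  "xiR I c a N h = (1 / h $ 2) *\<^sub>R N +
     (1/2) *\<^sub>R (\<Sum>i\<in>I. (h $ 2 / (hrad h (a i) * (h $ 1 + a i + hrad h (a i)))) *\<^sub>R c i)"

lemma hrad_pos: "h $ 2 > 0 \<Longrightarrow> hrad h a > 0"
  by (simp add: hrad_def add_pos_nonneg)

lemma hrad_gt: assumes "h $ 2 > 0" shows "\<bar>h $ 1 + a\<bar> < hrad h a"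
proof -
  have "sqrt ((h $ 1 + a)\<^sup>2) < hrad h a"
    unfolding hrad_def using assms by (intro real_sqrt_less_mono) simp
  then show ?thesis by simp
qed

lemma hrad_add_pos: "h $ 2 > 0 \<Longrightarrow> h $ 1 + a + hrad h a > 0"
  using hrad_gt[of h a] by linarith

lemma norm_base: "norm (base y) = sqrt ((y $ 1)\<^sup>2 + (y $ 2)\<^sup>2)"
  by (simp add: norm_vec_def L2_set_def sum_2 base_def)

lemma base_nth [simp]: "base y $ 1 = y $ 1" "base y $ 2 = y $ 2"
  by (simp_all add: base_def)

text \<open>The parameter \<open>e\<close> below is the inverse \<open>1/R\<close> of the scale, and \<open>e = 0\<close> is the limit metric. The exponent \<open>k\<close> is
  \<open>0\<close> if \<open>\<nu> = 0\<close>, with \<open>\<tau>\<close> the normal at the far end, and \<open>1\<close> otherwise, with \<open>\<tau> = \<nu>\<close>.\<close>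

locale one_side =
  fixes I :: "'i set" and p q a :: "'i \<Rightarrow> real" and N \<tau> :: "real^2" and k :: nat
  assumes fin: "finite I" and k: "k = 0 \<or> k = 1" and nz: "det2 N \<tau> \<noteq> 0"
    and k0: "k = 0 \<Longrightarrow> sum p I = - 1" "k = 0 \<Longrightarrow> sum q I = 1" and k1: "k = 1 \<Longrightarrow> sum p I > - 1"
begin

section \<open>Rescaled coefficients and their limit\<close>

definition HS where "HS e i y = y $ 1 + e * a i" for e :: real and y :: "real^4"
definition RS where "RS e i y = sqrt ((y $ 2)\<^sup>2 + (y $ 3)\<^sup>2 + (HS e i y)\<^sup>2)"
definition fx where "fx e y = (1/2) * (\<Sum>i\<in>I. p i / RS e i y)"
definition fw where "fw e y = (1/2) * (\<Sum>i\<in>I. p i / (2 * RS e i y * (HS e i y + RS e i y)))"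
text \<open>The \<open>\<tau>\<close> component of \<open>\<xi>_H\<close> divided by
  \<open>e^(1-k)\<close>. For \<open>k = 1\<close> the vector \<open>\<nu> = \<tau>\<close>
  contributes the constant \<open>1\<close> and the logarithms enter at order \<open>e\<close>; for
  \<open>k = 0\<close> the logarithms form the whole component.\<close>

definition fz where "fz e y = real k + e ^ k * ((1/2) * (\<Sum>i\<in>I. q i / RS e i y))"
definition ft where "ft e y = e ^ k * ((1/2) * (\<Sum>i\<in>I. q i / (2 * RS e i y * (HS e i y + RS e i y))))"

definition \<delta> where "\<delta> = det2 N \<tau>"
definition DM where "DM e y = modelD (fx e y) (fw e y) (fz e y) (ft e y) y"
definition GM where "GM e y = model \<delta> (fx e y) (fw e y) (fz e y) (ft e y) y"

text \<open>Open in \<open>(e, y)\<close>, with \<open>e\<close> ranging over all reals, so that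
  \<open>e = 0\<close> is an interior value and derivatives in \<open>e\<close> exist there.\<close>

definition dom0 :: "(real \<times> (real^4)) set" where
  "dom0 = {P. \<forall>i\<in>I. 0 < (snd P $ 2)\<^sup>2 + (snd P $ 3)\<^sup>2 + (HS (fst P) i (snd P))\<^sup>2 \<and>
     0 < HS (fst P) i (snd P) + RS (fst P) i (snd P)}"
definition dom :: "(real \<times> (real^4)) set" where "dom = {P \<in> dom0. DM (fst P) (snd P) \<noteq> 0}"

lemma open_dom0: "open dom0"
proof -
  have "dom0 = (\<Inter>i\<in>I. {P. 0 < (snd P $ 2)\<^sup>2 + (snd P $ 3)\<^sup>2 + (HS (fst P) i (snd P))\<^sup>2} \<inter>
     {P. 0 < HS (fst P) i (snd P) + RS (fst P) i (snd P)})"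
    by (auto simp: dom0_def)
  moreover have "open \<dots>"
    unfolding HS_def RS_def
    by (intro open_INT fin ballI open_Int open_Collect_less continuous_intros)
  ultimately show ?thesis by simp
qed

lemma smooth_HS: "smooth_on dom0 (\<lambda>P. HS (fst P) i (snd P))"
  unfolding HS_def by (intro smooth_intros open_dom0)

lemma smooth_RS: "i \<in> I \<Longrightarrow> smooth_on dom0 (\<lambda>P. RS (fst P) i (snd P))"
  unfolding RS_def by (intro smooth_intros smooth_HS open_dom0) (auto simp: dom0_def)

lemma RS_pos: "P \<in> dom0 \<Longrightarrow> i \<in> I \<Longrightarrow> RS (fst P) i (snd P) > 0"
  by (auto simp: dom0_def RS_def)

lemma RS_nz: "P \<in> dom0 \<Longrightarrow> i \<in> I \<Longrightarrow> RS (fst P) i (snd P) \<noteq> 0"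
  "P \<in> dom0 \<Longrightarrow> i \<in> I \<Longrightarrow> 2 * RS (fst P) i (snd P) * (HS (fst P) i (snd P) + RS (fst P) i (snd P)) \<noteq> 0"
  using RS_pos by (fastforce simp: dom0_def)+

lemma smooth_coeffs:
  "smooth_on dom0 (\<lambda>P. fx (fst P) (snd P))" "smooth_on dom0 (\<lambda>P. fw (fst P) (snd P))"
  "smooth_on dom0 (\<lambda>P. fz (fst P) (snd P))" "smooth_on dom0 (\<lambda>P. ft (fst P) (snd P))"
  unfolding fx_def fw_def fz_def ft_def
  by (intro smooth_intros fin open_dom0 smooth_RS smooth_HS RS_nz; assumption)+

lemma smooth_DM: "smooth_on dom0 (\<lambda>P. DM (fst P) (snd P))"
  unfolding DM_def modelD_def by (intro smooth_intros smooth_coeffs open_dom0)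

lemma open_dom: "open dom"
proof -
  have "open ((\<lambda>P. DM (fst P) (snd P)) -` (- {0}) \<inter> dom0)"
    using smooth_on_continuous[OF smooth_DM] open_dom0 continuous_on_open_vimage[OF open_dom0] by blast
  moreover have "(\<lambda>P. DM (fst P) (snd P)) -` (- {0}) \<inter> dom0 = dom" by (auto simp: dom_def)
  ultimately show ?thesis by simp
qed

lemma smooth_GM: "smooth_on dom (\<lambda>P. GM (fst P) (snd P))"
proof -
  have c: "smooth_on dom (\<lambda>P. fx (fst P) (snd P))" "smooth_on dom (\<lambda>P. fw (fst P) (snd P))"
    "smooth_on dom (\<lambda>P. fz (fst P) (snd P))" "smooth_on dom (\<lambda>P. ft (fst P) (snd P))"
    "smooth_on dom (\<lambda>P. DM (fst P) (snd P))"
    using smooth_on_subset[OF _ open_dom] smooth_coeffs smooth_DM by (auto simp: dom_def)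
  have D: "- (fz e y + 2 * ((y $ 2)\<^sup>2 + (y $ 3)\<^sup>2) * (fw e y * fz e y - fx e y * ft e y)) = DM e y" for e y
    by (simp add: DM_def modelD_def)
  have nz: "P \<in> dom \<Longrightarrow> DM (fst P) (snd P) \<noteq> 0" for P by (simp add: dom_def)
  show ?thesis
  proof (rule smooth_on_matrix[OF open_dom])
    fix i j :: 4
    consider "i = 1" | "i = 2" | "i = 3" | "i = 4" using exhaust_4[of i] by auto
    then show "smooth_on dom (\<lambda>P. GM (fst P) (snd P) $ i $ j)"
      unfolding GM_def model_def Let_def D
      using exhaust_4[of j]
      by cases (elim disjE; simp only: vector_4; intro smooth_intros c open_dom nz; assumption?)+
  qed
qed

definition F where "F e y = riemann_norm_sq (GM e) y"

lemma det_GM: "(e, y) \<in> dom \<Longrightarrow> det (GM e y) \<noteq> 0"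
  using nz by (simp add: dom_def GM_def DM_def det_model \<delta>_def)

lemma smooth_F: "smooth_on dom (\<lambda>P. F (fst P) (snd P))"
  using smooth_on_riemann_norm_sq_param[of dom GM] smooth_GM det_GM
  by (simp add: F_def case_prod_beta')

text \<open>Far points land here under \<open>polar\<close> with \<open>e = 1/R\<close> and base
  angle equal to their own angle. The bound \<open>- 1/2\<close> keeps \<open>K\<close> away from
  the negative half axis, where \<open>H + \<rho>\<close> vanishes in the limit.\<close>

definition K :: "(real^4) set" where
  "K = {y. (y $ 1)\<^sup>2 + (y $ 2)\<^sup>2 + (y $ 3)\<^sup>2 = 1 \<and> - (1/2) \<le> y $ 1 \<and> y $ 4 = 0}"

lemma compact_K: "compact K"
proof -
  have "closed K" unfolding K_def Collect_conj_eq
    by (intro closed_Int closed_Collect_eq closed_Collect_le continuous_intros)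
  moreover have "K \<subseteq> cball 0 1"
  proof
    fix y assume "y \<in> K"
    then have "norm y = 1" by (simp add: norm_vec_def L2_set_def sum_4 K_def)
    then show "y \<in> cball 0 1" by simp
  qed
  ultimately show ?thesis using compact_eq_bounded_closed bounded_cball bounded_subset by blast
qed

lemma RS_0: "RS 0 i y = rad y" "HS 0 i y = y $ 1"
  by (simp_all add: RS_def HS_def rad_def)

lemma K_rad: assumes "y \<in> K" shows "rad y = 1" "0 < y $ 1 + 1"
  using assms by (auto simp: K_def rad_def algebra_simps)

lemma coeffs_0:
  "fx 0 y = sum p I / (2 * rad y)" "fw 0 y = sum p I / (4 * rad y * (y $ 1 + rad y))"
  "k = 0 \<Longrightarrow> fz 0 y = sum q I / (2 * rad y)" "k = 0 \<Longrightarrow> ft 0 y = sum q I / (4 * rad y * (y $ 1 + rad y))"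
  "k = 1 \<Longrightarrow> fz 0 y = 1" "k = 1 \<Longrightarrow> ft 0 y = 0"
  unfolding fx_def fw_def fz_def ft_def RS_0 by (simp_all add: sum_divide_distrib[symmetric])

text \<open>Nondegeneracy of the limit. For \<open>k = 0\<close>, \<open>D\<close> is
  \<open>- 1/2\<close> on \<open>K\<close>. For \<open>k = 1\<close> it is
  \<open>- (1 + sum p I (1 - H) / 2)\<close>, and \<open>sum p I > - 1\<close> bounds its absolute
  value below by \<open>(1 + H) / 2 > 0\<close>.\<close>

lemma K_dom: assumes "y \<in> K" shows "(0, y) \<in> dom"
proof -
  have rd: "rad y = 1" "0 < y $ 1 + 1" using K_rad[OF assms] by auto
  have e: "(y $ 2)\<^sup>2 + (y $ 3)\<^sup>2 + (y $ 1)\<^sup>2 = 1" using assms by (simp add: K_def)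
  have "(0, y) \<in> dom0" by (auto simp: dom0_def RS_0 rd e)
  moreover have "DM 0 y \<noteq> 0"
    using k
  proof
    assume 0: "k = 0"
    show ?thesis unfolding DM_def modelD_def coeffs_0(1,2) coeffs_0(3,4)[OF 0] k0[OF 0] rd by simp
  next
    assume 1: "k = 1"
    have s: "(y $ 2)\<^sup>2 + (y $ 3)\<^sup>2 = (1 - y $ 1) * (1 + y $ 1)" using e by (simp add: power2_eq_square algebra_simps)
    have y1: "y $ 1 \<le> 1" "- (1/2) \<le> y $ 1"
    proof -
      have "(y $ 1)\<^sup>2 \<le> 1" using e by (smt (verit) zero_le_power2)
      then show "y $ 1 \<le> 1" using abs_square_le_1 by (metis abs_le_D1)
      show "- (1/2) \<le> y $ 1" using assms by (simp add: K_def)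
    qed
    have "DM 0 y = - (1 + sum p I * (1 - y $ 1) / 2)"
      unfolding DM_def modelD_def coeffs_0(1,2) coeffs_0(5,6)[OF 1] rd s using rd(2) by (simp add: field_simps)
    moreover have "sum p I * (1 - y $ 1) \<ge> - 1 * (1 - y $ 1)"
      using k1[OF 1] y1 by (intro mult_right_mono) auto
    ultimately show ?thesis using y1 by (auto simp: field_simps)
  qed
  ultimately show ?thesis by (simp add: dom_def)
qed

text \<open>At \<open>e = 0\<close> all \<open>a i\<close> merge, and only the sums of
  \<open>p\<close> and \<open>q\<close> survive. Their values \<open>- 1\<close> and
  \<open>1\<close> say that the total increment is \<open>\<tau> - N\<close>, which is the cone
  \<open>flat_model\<close>.\<close>

lemma F_0: assumes "k = 0" "y \<in> K" shows "F 0 y = 0"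
proof -
  have yf: "y \<in> flat_dom" using assms(2) K_rad[OF assms(2)]
    by (auto simp: flat_dom_def rad_def)
  have "GM 0 = flat_model \<delta>"
  proof
    fix y show "GM 0 y = flat_model \<delta> y"
      unfolding GM_def flat_model_def Let_def coeffs_0(1,2) coeffs_0(3,4)[OF assms(1)] k0[OF assms(1)] by simp
  qed
  then show ?thesis unfolding F_def using riemann_flat_model[OF _ yf] nz by (simp add: \<delta>_def)
qed

text \<open>Compactness of \<open>{0} \<times> K\<close> inside the open set \<open>dom\<close>
  makes the bounds uniform for small \<open>e\<close>. For \<open>k = 0\<close> the extra factor
  \<open>e\<close> comes from the mean value theorem in \<open>e\<close>, starting at
  \<open>F 0 y = 0\<close>.\<close>

lemma model_bounds:
  obtains e0 C where "0 < e0" "e0 \<le> 1" "\<And>e y. 0 \<le> e \<Longrightarrow> e \<le> e0 \<Longrightarrow> y \<in> K \<Longrightarrow>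
    (e, y) \<in> dom \<and> \<bar>F e y\<bar> \<le> C * e ^ (1 - k) \<and> \<bar>DM e y\<bar> \<le> C" "C \<ge> 0"
proof -
  have "compact ({0::real} \<times> K)" by (intro compact_Times compact_K) auto
  moreover have "{0} \<times> K \<subseteq> dom" using K_dom by auto
  moreover have "vector [1, 0, 0, 0] \<in> K" by (simp add: K_def)
  then have "{0::real} \<times> K \<noteq> {}" by blast
  ultimately obtain e1 where e1: "e1 > 0" "{x. infdist x ({0} \<times> K) \<le> e1} \<subseteq> dom"
    using compact_in_open_separated[of "{0} \<times> K" dom] open_dom by metis
  define e0 where "e0 = min e1 1"
  have e0: "e0 > 0" "e0 \<le> 1" using e1 by (auto simp: e0_def)
  let ?S = "{0..e0} \<times> K"
  have sub: "?S \<subseteq> dom"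
  proof
    fix P assume P: "P \<in> ?S"
    then obtain e y where [simp]: "P = (e, y)" and ey: "0 \<le> e" "e \<le> e0" "y \<in> K" by auto
    have "infdist P ({0} \<times> K) \<le> dist P (0, y)" using ey by (intro infdist_le) auto
    also have "\<dots> = e" using ey by (simp add: dist_Pair_Pair)
    finally show "P \<in> dom" using e1 ey by (auto simp: e0_def)
  qed
  have cS: "compact ?S" by (intro compact_Times compact_K) auto
  have bd: "\<exists>C. \<forall>P\<in>?S. \<bar>f P\<bar> \<le> C" if "smooth_on dom f" for f :: "real \<times> (real^4) \<Rightarrow> real"
  proof -
    have "continuous_on ?S f" using smooth_on_continuous[OF that] sub continuous_on_subset by blast
    then have "bounded (f ` ?S)" using cS compact_continuous_image compact_imp_bounded by blast
    then show ?thesis unfolding bounded_iff by (metis image_eqI real_norm_def)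
  qed
  have sD: "smooth_on dom (\<lambda>P. DM (fst P) (snd P))"
    by (rule smooth_on_subset[OF smooth_DM open_dom]) (auto simp: dom_def)
  obtain C1 where C1: "\<And>P. P \<in> ?S \<Longrightarrow> \<bar>F (fst P) (snd P)\<bar> \<le> C1" using bd[OF smooth_F] by blast
  obtain C2 where C2: "\<And>P. P \<in> ?S \<Longrightarrow> \<bar>dird (1, 0) (\<lambda>P. F (fst P) (snd P)) P\<bar> \<le> C2"
    using bd[OF smooth_on_dird[OF smooth_F]] by blast
  obtain C3 where C3: "\<And>P. P \<in> ?S \<Longrightarrow> \<bar>DM (fst P) (snd P)\<bar> \<le> C3" using bd[OF sD] by blast
  define C where "C = max 0 (max C1 (max C2 C3))"
  have "\<bar>F e y\<bar> \<le> C * e ^ (1 - k)" if ey: "0 \<le> e" "e \<le> e0" "y \<in> K" for e y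
    using k
  proof
    assume "k = 1"
    then show ?thesis using C1[of "(e, y)"] ey by (auto simp: C_def)
  next
    assume k0: "k = 0"
    show ?thesis
    proof (cases "e = 0")
      case True
      then show ?thesis using F_0[OF k0 ey(3)] k0 by simp
    next
      case False
      let ?f = "\<lambda>P. F (fst P) (snd P)"
      have "\<exists>s>0. s < e \<and> ?f ((0, y) + e *\<^sub>R (1, 0)) - ?f ((0, y) + 0 *\<^sub>R (1, 0)) =
        (e - 0) * dird (1, 0) ?f ((0, y) + s *\<^sub>R (1, 0))"
      proof (rule MVT2)
        show "0 < e" using False ey by simp
        fix s assume "0 \<le> s" "s \<le> e"
        then have "(0, y) + s *\<^sub>R (1, 0) \<in> dom" using ey sub by auto
        then show "((\<lambda>s. ?f ((0, y) + s *\<^sub>R (1, 0))) has_real_derivative dird (1, 0) ?f ((0, y) + s *\<^sub>R (1, 0))) (at s)"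
          by (intro has_real_derivative_line smooth_on_diff[OF smooth_F])
      qed
      then obtain s where s: "0 < s" "s < e" "F e y - F 0 y = e * dird (1, 0) ?f (s, y)" by auto
      then have "\<bar>F e y\<bar> = e * \<bar>dird (1, 0) ?f (s, y)\<bar>"
        using F_0[OF k0 ey(3)] ey by (simp add: abs_mult)
      also have "\<dots> \<le> e * C2" using C2[of "(s, y)"] s ey by (intro mult_left_mono) auto
      also have "\<dots> \<le> e * C" using ey by (intro mult_left_mono) (auto simp: C_def)
      finally show ?thesis using k0 by (simp add: mult.commute)
    qed
  qed
  moreover have "\<bar>DM e y\<bar> \<le> C" if "0 \<le> e" "e \<le> e0" "y \<in> K" for e y
    using C3[of "(e, y)"] that by (auto simp: C_def)
  moreover have "(e, y) \<in> dom" if "0 \<le> e" "e \<le> e0" "y \<in> K" for e y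
    using sub that by auto
  ultimately show ?thesis using that[of e0 C] e0 by (auto simp: C_def)
qed

section \<open>Curvature and volume density at scale \<open>1/e\<close>\<close>

definition XH where "XH h = ((1/2) * (\<Sum>i\<in>I. p i / hrad h (a i))) *\<^sub>R N +
   (real k + (1/2) * (\<Sum>i\<in>I. q i / hrad h (a i))) *\<^sub>R \<tau>"
definition XR where "XR h =
   (1 / h $ 2 + (1/2) * (\<Sum>i\<in>I. p i * h $ 2 / (hrad h (a i) * (h $ 1 + a i + hrad h (a i))))) *\<^sub>R N +
   ((1/2) * (\<Sum>i\<in>I. q i * h $ 2 / (hrad h (a i) * (h $ 1 + a i + hrad h (a i))))) *\<^sub>R \<tau>"

text \<open>Homogeneity: \<open>polar\<close> multiplies \<open>H + a_i\<close> and
  \<open>\<rho>_i\<close> by \<open>e\<close>. The identity \<open>e^(1-k) e^k = e\<close>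
  distributes the powers of \<open>e\<close> over the \<open>\<tau>\<close> components.\<close>

lemma scaled_coeffs:
  fixes e :: real and y \<theta>
  defines "P \<equiv> polar e (e ^ k) N \<tau> \<theta> y"
  assumes e: "e > 0" and r: "y $ 2 > 0"
  shows "RS e i P = e * hrad (base y) (a i)" "HS e i P = e * (y $ 1 + a i)"
    "(e, P) \<in> dom0"
    "XH (base y) = (e * fx e P) *\<^sub>R N + (e ^ (1 - k) * fz e P) *\<^sub>R \<tau>"
    "XR (base y) = (1 / y $ 2 + 2 * e\<^sup>2 * y $ 2 * fw e P) *\<^sub>R N + (e ^ (1 - k) * (2 * e * y $ 2 * ft e P)) *\<^sub>R \<tau>"
proof -
  have s: "(P $ 2)\<^sup>2 + (P $ 3)\<^sup>2 = (e * y $ 2)\<^sup>2"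
  proof -
    have "(c * cos x)\<^sup>2 + (c * sin x)\<^sup>2 = c\<^sup>2" for c x :: real
      unfolding power_mult_distrib by (metis distrib_left mult.right_neutral sin_cos_squared_add2)
    then show ?thesis by (simp add: P_def polar_def Let_def)
  qed
  show H: "HS e i P = e * (y $ 1 + a i)" for i by (simp add: HS_def P_def polar_def Let_def algebra_simps)
  show R: "RS e i P = e * hrad (base y) (a i)" for i
  proof -
    have "(e * y $ 2)\<^sup>2 + (e * (y $ 1 + a i))\<^sup>2 = e\<^sup>2 * ((y $ 2)\<^sup>2 + (y $ 1 + a i)\<^sup>2)" by algebra
    then show ?thesis unfolding RS_def s H hrad_def using e by (simp add: real_sqrt_mult)
  qed
  have rb: "base y $ 2 > 0" using r by simp
  have hp: "hrad (base y) (a i) > 0" "y $ 1 + a i + hrad (base y) (a i) > 0" for i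
    using hrad_pos[OF rb] hrad_add_pos[OF rb, of "a i"] by auto
  have HR: "HS e i P + RS e i P = e * (y $ 1 + a i + hrad (base y) (a i))" for i
    unfolding H R by (simp add: algebra_simps)
  show "(e, P) \<in> dom0"
    using r e hp by (auto simp: dom0_def HR s add_pos_nonneg)
  have kk: "e ^ (1 - k) * e ^ k = e" "e ^ (1 - k) * real k = real k" using k by auto
  have x: "e * fx e P = (1/2) * (\<Sum>i\<in>I. p i / hrad (base y) (a i))"
    unfolding fx_def R using e by (simp add: sum_distrib_left)
  have sq: "e * (\<Sum>i\<in>I. q i / RS e i P) = (\<Sum>i\<in>I. q i / hrad (base y) (a i))"
    unfolding R using e by (simp add: sum_distrib_left)
  have z: "e ^ (1 - k) * fz e P = real k + (1/2) * (\<Sum>i\<in>I. q i / hrad (base y) (a i))"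
  proof -
    have "e ^ (1 - k) * fz e P = e ^ (1 - k) * real k + (e ^ (1 - k) * e ^ k) * ((1/2) * (\<Sum>i\<in>I. q i / RS e i P))"
      unfolding fz_def by (simp only: distrib_left mult.assoc)
    then show ?thesis unfolding kk sq[symmetric] by simp
  qed
  show "XH (base y) = (e * fx e P) *\<^sub>R N + (e ^ (1 - k) * fz e P) *\<^sub>R \<tau>"
    unfolding x z XH_def ..
  have w': "e\<^sup>2 * (c / (2 * RS e i P * (HS e i P + RS e i P))) =
     c / (2 * (hrad (base y) (a i) * (y $ 1 + a i + hrad (base y) (a i))))" for c i
    unfolding HR unfolding R using e by (simp add: power2_eq_square mult.assoc mult.left_commute)
  have w: "2 * e\<^sup>2 * y $ 2 * ((1/2) * (\<Sum>i\<in>I. c i / (2 * RS e i P * (HS e i P + RS e i P)))) =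
     (1/2) * (\<Sum>i\<in>I. c i * y $ 2 / (hrad (base y) (a i) * (y $ 1 + a i + hrad (base y) (a i))))" for c
  proof -
    have "2 * e\<^sup>2 * y $ 2 * ((1/2) * (\<Sum>i\<in>I. c i / (2 * RS e i P * (HS e i P + RS e i P)))) =
      y $ 2 * (\<Sum>i\<in>I. e\<^sup>2 * (c i / (2 * RS e i P * (HS e i P + RS e i P))))"
      by (subst sum_distrib_left[symmetric]) simp
    also have "\<dots> = (1/2) * (\<Sum>i\<in>I. c i * y $ 2 / (hrad (base y) (a i) * (y $ 1 + a i + hrad (base y) (a i))))"
      unfolding w' sum_distrib_left by (intro sum.cong refl) (simp add: field_simps)
    finally show ?thesis .
  qed
  have t: "e ^ (1 - k) * (2 * e * y $ 2 * ft e P) =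
     (1/2) * (\<Sum>i\<in>I. q i * y $ 2 / (hrad (base y) (a i) * (y $ 1 + a i + hrad (base y) (a i))))"
  proof -
    have "e ^ (1 - k) * (2 * e * y $ 2 * ft e P) = (e ^ (1 - k) * e ^ k) *
      (2 * e * y $ 2 * ((1/2) * (\<Sum>i\<in>I. q i / (2 * RS e i P * (HS e i P + RS e i P)))))"
      unfolding ft_def by (simp only: mult.assoc mult.left_commute)
    also have "\<dots> = 2 * e\<^sup>2 * y $ 2 * ((1/2) * (\<Sum>i\<in>I. q i / (2 * RS e i P * (HS e i P + RS e i P))))"
      unfolding kk by (simp add: power2_eq_square)
    finally show ?thesis unfolding w .
  qed
  show "XR (base y) = (1 / y $ 2 + 2 * e\<^sup>2 * y $ 2 * fw e P) *\<^sub>R N + (e ^ (1 - k) * (2 * e * y $ 2 * ft e P)) *\<^sub>R \<tau>"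
    unfolding t fw_def w XR_def base_nth ..
qed

text \<open>\<open>toric_metric_polar\<close> with \<open>m = e^k\<close> and
  \<open>m' = e^(1-k)\<close> makes the metric a pull-back of \<open>1 / (e e^k)\<close> times the
  model; invariance and scaling of the norm give the square of the inverse factor.\<close>

lemma riemann_toric_metric_scale:
  assumes e: "e > 0" and r: "y $ 2 > 0" and P: "(e, polar e (e ^ k) N \<tau> \<theta> y) \<in> dom"
  shows "riemann_norm_sq (toric_metric XH XR) y = (e * e ^ k)\<^sup>2 * F e (polar e (e ^ k) N \<tau> \<theta> y)"
    and "y $ 2 * det2 (XH (base y)) (XR (base y)) = e ^ (1 - k) * (\<delta> * DM e (polar e (e ^ k) N \<tau> \<theta> y))"
proof -
  define h where "h = polar e (e ^ k) N \<tau> \<theta>"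
  define U where "U = {y. (e, y) \<in> dom}"
  define W where "W = {y. y $ 2 > 0 \<and> (e, h y) \<in> dom}"
  define c where "c = 1 / (e * e ^ k)"
  have c0: "c > 0" using e by (simp add: c_def)
  have ee: "e ^ k * e ^ (1 - k) = e" using k by auto
  have sh: "smooth_on UNIV h" unfolding h_def by (rule smooth_polar)
  have oU: "open U" unfolding U_def by (rule open_slice[OF open_dom])
  have oW: "open W"
  proof -
    have "W = {y. 0 < y $ 2} \<inter> h -` U" by (auto simp: W_def U_def)
    moreover have "open (h -` U)"
      by (rule open_vimage[OF oU smooth_on_continuous[OF sh]])
    moreover have "open {y::real^4. 0 < y $ 2}" by (intro open_positive continuous_intros)
    ultimately show ?thesis by auto
  qed
  have sG: "smooth_on U (GM e)"
  proof -
    have "smooth_on U (\<lambda>y. (\<lambda>P. GM (fst P) (snd P)) (e, y))"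
      by (rule smooth_on_compose[OF smooth_GM]) (auto intro!: smooth_intros oU[unfolded U_def] simp: U_def)
    then show ?thesis by simp
  qed
  have tor: "toric_metric XH XR w = (1 / (e * e ^ k)) *\<^sub>R (transpose (jacobian h (at w)) ** GM e (h w) ** jacobian h (at w))"
    "w $ 2 * det2 (XH (base w)) (XR (base w)) = e ^ (1 - k) * (\<delta> * DM e (h w))"
    if w: "w \<in> W" for w
  proof -
    have w2: "w $ 2 > 0" and D: "DM e (h w) \<noteq> 0" using w by (auto simp: W_def dom_def)
    note * = toric_metric_polar[of "e ^ k" "e ^ (1 - k)" N \<tau> w "fx e (h w)" "fw e (h w)" "fz e (h w)" "ft e (h w)" \<theta> XH XR,
      unfolded ee, folded h_def]
    show "toric_metric XH XR w = (1 / (e * e ^ k)) *\<^sub>R (transpose (jacobian h (at w)) ** GM e (h w) ** jacobian h (at w))"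
      unfolding GM_def \<delta>_def
      by (rule *(1)) (use e nz w2 D scaled_coeffs(4,5)[OF e w2, of \<theta>] in \<open>simp_all add: DM_def h_def\<close>)
    show "w $ 2 * det2 (XH (base w)) (XR (base w)) = e ^ (1 - k) * (\<delta> * DM e (h w))"
      unfolding DM_def \<delta>_def
      by (rule *(2)) (use e nz w2 D scaled_coeffs(4,5)[OF e w2, of \<theta>] in \<open>simp_all add: DM_def h_def\<close>)
  qed
  have yW: "y \<in> W" using r P by (simp add: W_def h_def)
  show "y $ 2 * det2 (XH (base y)) (XR (base y)) = e ^ (1 - k) * (\<delta> * DM e (polar e (e ^ k) N \<tau> \<theta> y))"
    using tor(2)[OF yW] by (simp add: h_def)
  interpret metric_pullback "\<lambda>y. c *\<^sub>R GM e y" "toric_metric XH XR" h U W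
  proof
    show "smooth_on U (\<lambda>y. c *\<^sub>R GM e y)" by (intro smooth_intros sG oU)
    show "transpose (c *\<^sub>R GM e u) = c *\<^sub>R GM e u" for u
      unfolding GM_def model_def Let_def vec_eq_iff transpose_def by (simp add: forall_4)
    show "det (c *\<^sub>R GM e u) \<noteq> 0" if "u \<in> U" for u
    proof -
      have "c *\<^sub>R GM e u = matrix ((*\<^sub>R) c) ** GM e u"
        by (simp add: matrix_scaleR mat_def matrix_matrix_mult_def vec_eq_iff if_distrib if_distribR cong: if_cong)
      then have "det (c *\<^sub>R GM e u) = det (matrix ((*\<^sub>R) c) ** GM e u)" by (rule arg_cong)
      then show ?thesis using det_GM that c0 by (simp add: det_mul U_def)
    qed
    show "smooth_on W h" by (rule smooth_on_subset[OF sh oW]) auto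
    show "h ` W \<subseteq> U" by (auto simp: W_def U_def)
    show "transpose (jacobian h (at w)) ** (c *\<^sub>R GM e (h w)) ** jacobian h (at w) = toric_metric XH XR w" if "w \<in> W" for w
      unfolding tor(1)[OF that] c_def
      by (simp add: matrix_matrix_mult_def vec_eq_iff sum_distrib_left algebra_simps)
    show "det (jacobian h (at w)) \<noteq> 0" if "w \<in> W" for w
    proof -
      have "w $ 2 > 0" using that by (simp add: W_def)
      define \<alpha> where "\<alpha> = (\<tau> $ 2 * (w $ 3 - \<theta> $ 1) - \<tau> $ 1 * (w $ 4 - \<theta> $ 2)) / det2 N \<tau>"
      define n1 n2 t1 t2 where "n1 = N $ 1 / det2 N \<tau>" and "n2 = N $ 2 / det2 N \<tau>"
        and "t1 = \<tau> $ 1 / det2 N \<tau>" and "t2 = \<tau> $ 2 / det2 N \<tau>"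
      have "det (jacobian h (at w)) = e ^ 3 * w $ 2 * e ^ k * ((cos \<alpha>)\<^sup>2 + (sin \<alpha>)\<^sup>2) * (n1 * t2 - n2 * t1)"
        unfolding h_def jacobian_polar det_4 vector_4 \<alpha>_def[symmetric] n1_def[symmetric] n2_def[symmetric]
          t1_def[symmetric] t2_def[symmetric]
        by algebra
      also have "n1 * t2 - n2 * t1 = 1 / det2 N \<tau>"
      proof -
        have "n1 * t2 - n2 * t1 = (N $ 1 * \<tau> $ 2 - N $ 2 * \<tau> $ 1) / (det2 N \<tau> * det2 N \<tau>)"
          by (simp add: n1_def n2_def t1_def t2_def diff_divide_distrib)
        then show ?thesis using nz unfolding det2_def by simp
      qed
      finally show ?thesis using e \<open>w $ 2 > 0\<close> nz by simp
    qed
  qed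
  have "riemann_norm_sq (toric_metric XH XR) y = riemann_norm_sq (\<lambda>y. c *\<^sub>R GM e y) (h y)"
    by (rule riemann_norm_sq_pullback[OF yW])
  also have "\<dots> = riemann_norm_sq (GM e) (h y) / c\<^sup>2"
    using c0 yW by (intro riemann_norm_sq_scale[OF sG]) (auto simp: U_def W_def det_GM)
  finally show "riemann_norm_sq (toric_metric XH XR) y = (e * e ^ k)\<^sup>2 * F e (polar e (e ^ k) N \<tau> \<theta> y)"
    using e by (simp add: F_def c_def h_def power_divide)
qed

text \<open>Each point is rescaled by its own distance, \<open>e = 1 / norm (base y)\<close>. The
  second quantity is the volume density \<open>r V\<close> up to sign, with \<open>r \<le> R\<close>
  and \<open>V = O(e^(1-k))\<close>.\<close>

lemma one_side_bound:
  obtains C R0 where "R0 \<ge> 1" "\<And>y. y $ 2 > 0 \<Longrightarrow> R0 \<le> norm (base y) \<Longrightarrow> - (norm (base y) / 2) \<le> y $ 1 \<Longrightarrow>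
    \<bar>riemann_norm_sq (toric_metric XH XR) y\<bar> \<le> C / norm (base y) ^ (3 + k) \<and>
    \<bar>y $ 2 * (y $ 2 * det2 (XH (base y)) (XR (base y)))\<bar> \<le> C * norm (base y) ^ k"
proof -
  obtain e0 C where e0: "0 < e0" "e0 \<le> 1" and C: "\<And>e y. 0 \<le> e \<Longrightarrow> e \<le> e0 \<Longrightarrow> y \<in> K \<Longrightarrow>
    (e, y) \<in> dom \<and> \<bar>F e y\<bar> \<le> C * e ^ (1 - k) \<and> \<bar>DM e y\<bar> \<le> C" and C0: "C \<ge> 0"
    using model_bounds by metis
  show ?thesis
  proof (rule that[of "1 / e0" "C + \<bar>\<delta>\<bar> * C"])
    show "1 / e0 \<ge> 1" using e0 by simp
    fix y :: "real^4" assume r: "y $ 2 > 0" and R: "1 / e0 \<le> norm (base y)" and y1: "- (norm (base y) / 2) \<le> y $ 1"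
    define n where "n = norm (base y)"
    define e where "e = 1 / n"
    have n0: "n > 0" using R e0 by (smt (verit) n_def zero_less_divide_1_iff)
    have e: "e > 0" "e \<le> e0" using n0 R e0 by (auto simp: e_def n_def field_simps)
    \<comment> \<open>With the angle of \<open>y\<close> itself as base angle, \<open>P\<close> has
      \<open>\<alpha> = \<beta> = 0\<close> and lies in the compact set \<open>K\<close> whatever
      the angles are.\<close>
    define P where "P = polar e (e ^ k) N \<tau> (angle y) y"
    have "angle y $ 1 = y $ 3" "angle y $ 2 = y $ 4" by (simp_all add: angle_def)
    then have P: "P $ 1 = e * y $ 1" "P $ 2 = e * y $ 2" "P $ 3 = 0" "P $ 4 = 0"
      by (simp_all add: P_def polar_def Let_def)
    have PK: "P \<in> K"
    proof -
      have "(y $ 1)\<^sup>2 + (y $ 2)\<^sup>2 = n\<^sup>2" unfolding n_def norm_base by simp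
      then have "(e * y $ 1)\<^sup>2 + (e * y $ 2)\<^sup>2 = 1"
        using n0 by (simp add: e_def power_mult_distrib power_divide add_divide_distrib[symmetric])
      moreover have "- (1/2) \<le> e * y $ 1" using y1 n0 by (simp add: e_def n_def[symmetric] field_simps)
      ultimately show ?thesis by (simp add: K_def P)
    qed
    note CP = C[OF less_imp_le[OF e(1)] e(2) PK]
    note * = riemann_toric_metric_scale[OF e(1) r, of "angle y", folded P_def]
    have "\<bar>riemann_norm_sq (toric_metric XH XR) y\<bar> = (e * e ^ k)\<^sup>2 * \<bar>F e P\<bar>"
      using *(1) CP by (simp add: abs_mult)
    also have "\<dots> \<le> (e * e ^ k)\<^sup>2 * (C * e ^ (1 - k))" using CP by (intro mult_left_mono) auto
    \<comment> \<open>\<open>2 (1 + k) + (1 - k) = 3 + k\<close>.\<close>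
    also have "\<dots> = C * e ^ (3 + k)" using k by (auto simp: power2_eq_square power3_eq_cube power_add numeral_eq_Suc)
    also have "\<dots> = C / n ^ (3 + k)" by (simp add: e_def power_divide)
    also have "\<dots> \<le> (C + \<bar>\<delta>\<bar> * C) / n ^ (3 + k)" using n0 C0 by (intro divide_right_mono) auto
    finally have 1: "\<bar>riemann_norm_sq (toric_metric XH XR) y\<bar> \<le> (C + \<bar>\<delta>\<bar> * C) / n ^ (3 + k)" .
    have yn: "y $ 2 \<le> n" unfolding n_def using component_le_norm_cart[of "base y" 2] by simp
    have "\<bar>y $ 2 * (y $ 2 * det2 (XH (base y)) (XR (base y)))\<bar> = y $ 2 * (e ^ (1 - k) * (\<bar>\<delta>\<bar> * \<bar>DM e P\<bar>))"
      using *(2) CP r e by (simp add: abs_mult)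
    also have "\<dots> \<le> n * (e ^ (1 - k) * (\<bar>\<delta>\<bar> * C))"
      using yn r e CP C0 by (intro mult_mono) auto
    also have "\<dots> = \<bar>\<delta>\<bar> * C * n ^ k" using k n0 by (auto simp: e_def)
    also have "\<dots> \<le> (C + \<bar>\<delta>\<bar> * C) * n ^ k" using n0 C0 by (intro mult_right_mono) auto
    finally show "\<bar>riemann_norm_sq (toric_metric XH XR) y\<bar> \<le> (C + \<bar>\<delta>\<bar> * C) / norm (base y) ^ (3 + k) \<and>
      \<bar>y $ 2 * (y $ 2 * det2 (XH (base y)) (XR (base y)))\<bar> \<le> (C + \<bar>\<delta>\<bar> * C) * norm (base y) ^ k"
      using 1 by (simp add: n_def)
  qed
qed

end

subsection \<open>Both ends of the half plane\<close>

lemma det2_lincomb: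
  "det2 N \<tau> *\<^sub>R c = det2 c \<tau> *\<^sub>R N + det2 N c *\<^sub>R \<tau>"
  by (simp add: det2_def vec_eq_iff forall_2 algebra_simps)

lemma det2_sum: "det2 (\<Sum>i\<in>I. c i) \<tau> = (\<Sum>i\<in>I. det2 (c i) \<tau>)" "det2 N (\<Sum>i\<in>I. c i) = (\<Sum>i\<in>I. det2 N (c i))"
  by (simp_all add: det2_def sum_distrib_left sum_distrib_right sum_subtractf)

text \<open>Chooses the basis: \<open>\<tau>\<close> is the normal \<open>N + sum c I\<close> at the
  far end if \<open>\<nu> = 0\<close>, and \<open>\<nu>\<close> otherwise; \<open>p\<close>,
  \<open>q\<close> are the coordinates of the increments. For \<open>\<nu> \<noteq> 0\<close>,
  \<open>1 + sum p I\<close> is the quotient of \<open>det2 (N + sum c I) \<nu>\<close> and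
  \<open>det2 N \<nu>\<close>, positive by \<open>cond\<close>. The product form of
  \<open>cond\<close> is symmetric under the exchange of the two ends.\<close>

lemma far_right:
  fixes I :: "'i set" and c :: "'i \<Rightarrow> real^2"
  assumes fin: "finite I"
    and cond: "\<nu> = 0 \<and> det2 N (N + sum c I) \<noteq> 0 \<or> \<nu> \<noteq> 0 \<and> det2 \<nu> N * det2 \<nu> (N + sum c I) > 0"
  defines "k \<equiv> if \<nu> = 0 then 0 else (1::nat)"
  obtains C R0 where "R0 \<ge> 1" "\<And>y. y $ 2 > 0 \<Longrightarrow> R0 \<le> norm (base y) \<Longrightarrow> - (norm (base y) / 2) \<le> y $ 1 \<Longrightarrow>
    \<bar>riemann_norm_sq (toric_metric (xiH I c a \<nu>) (xiR I c a N)) y\<bar> \<le> C / norm (base y) ^ (3 + k) \<and>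
    \<bar>y $ 2 * (y $ 2 * det2 (xiH I c a \<nu> (base y)) (xiR I c a N (base y)))\<bar> \<le> C * norm (base y) ^ k"
proof -
  define \<tau> where "\<tau> = (if \<nu> = 0 then N + sum c I else \<nu>)"
  define p where "p i = det2 (c i) \<tau> / det2 N \<tau>" for i
  define q where "q i = det2 N (c i) / det2 N \<tau>" for i
  have nz: "det2 N \<tau> \<noteq> 0"
    using cond by (auto simp: \<tau>_def det2_def mult.commute)
  have c: "c i = p i *\<^sub>R N + q i *\<^sub>R \<tau>" for i
  proof -
    have "c i = (1 / det2 N \<tau>) *\<^sub>R (det2 N \<tau> *\<^sub>R c i)" using nz by simp
    also have "\<dots> = p i *\<^sub>R N + q i *\<^sub>R \<tau>"
      unfolding det2_lincomb[of N \<tau> "c i"] by (simp add: scaleR_right_distrib p_def q_def)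
    finally show ?thesis .
  qed
  have sp: "sum p I = det2 (sum c I) \<tau> / det2 N \<tau>" and sq: "sum q I = det2 N (sum c I) / det2 N \<tau>"
    by (simp_all add: p_def q_def det2_sum sum_divide_distrib)
  interpret one_side I p q a N \<tau> k
  proof
    show "finite I" "det2 N \<tau> \<noteq> 0" by (fact fin nz)+
    show "k = 0 \<or> k = 1" by (simp add: k_def)
    show "sum p I = - 1" if "k = 0"
    proof -
      have "det2 (sum c I) \<tau> = - det2 N \<tau>"
        using that by (simp add: \<tau>_def k_def det2_def algebra_simps split: if_splits)
      then show ?thesis using nz by (simp add: sp)
    qed
    show "sum q I = 1" if "k = 0"
    proof -
      have "det2 N (sum c I) = det2 N \<tau>"
        using that by (simp add: \<tau>_def k_def det2_def algebra_simps split: if_splits)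
      then show ?thesis using nz by (simp add: sq)
    qed
    show "sum p I > - 1" if "k = 1"
    proof -
      have \<nu>: "\<nu> \<noteq> 0" "\<tau> = \<nu>" using that by (auto simp: k_def \<tau>_def split: if_splits)
      have "sum p I + 1 = det2 (N + sum c I) \<nu> / det2 N \<nu>"
        using nz \<nu> by (simp add: sp det2_def field_simps)
      also have "\<dots> > 0"
      proof -
        have "det2 N \<nu> * det2 (N + sum c I) \<nu> = det2 \<nu> N * det2 \<nu> (N + sum c I)"
          by (simp add: det2_def algebra_simps)
        then have "det2 N \<nu> * det2 (N + sum c I) \<nu> > 0" using cond \<nu> by auto
        then show ?thesis by (auto simp: zero_less_mult_iff zero_less_divide_iff)
      qed
      finally show ?thesis by simp
    qed
  qed
  have "XH h = xiH I c a \<nu> h" for h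
  proof -
    have "real k *\<^sub>R \<tau> = \<nu>" by (simp add: k_def \<tau>_def)
    moreover have "(\<Sum>i\<in>I. (1 / hrad h (a i)) *\<^sub>R c i) = (\<Sum>i\<in>I. p i / hrad h (a i)) *\<^sub>R N + (\<Sum>i\<in>I. q i / hrad h (a i)) *\<^sub>R \<tau>"
      by (subst c) (simp add: scaleR_right_distrib sum.distrib scaleR_left.sum)
    ultimately show ?thesis by (simp add: XH_def xiH_def scaleR_right_distrib scaleR_left_distrib)
  qed
  moreover have "XR h = xiR I c a N h" for h
  proof -
    have "(\<Sum>i\<in>I. (h $ 2 / (hrad h (a i) * (h $ 1 + a i + hrad h (a i)))) *\<^sub>R c i) =
      (\<Sum>i\<in>I. p i * h $ 2 / (hrad h (a i) * (h $ 1 + a i + hrad h (a i)))) *\<^sub>R N +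
      (\<Sum>i\<in>I. q i * h $ 2 / (hrad h (a i) * (h $ 1 + a i + hrad h (a i)))) *\<^sub>R \<tau>"
      by (subst c) (simp add: scaleR_right_distrib sum.distrib scaleR_left.sum mult.commute)
    then show ?thesis by (simp add: XR_def xiR_def scaleR_right_distrib scaleR_left_distrib)
  qed
  ultimately have "XH = xiH I c a \<nu>" "XR = xiR I c a N" by auto
  then show ?thesis using one_side_bound that by metis
qed

lemma smooth_xi_comps:
  assumes fin: "finite I"
  shows "smooth_on {y::real^4. 0 < y $ 2} (\<lambda>y. xiH I c a \<nu> (base y) $ j)"
    and "smooth_on {y::real^4. 0 < y $ 2} (\<lambda>y. xiR I c a N (base y) $ j)"
proof -
  have o: "open {y::real^4. 0 < y $ 2}" by (intro open_positive continuous_intros)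
  have h: "smooth_on {y::real^4. 0 < y $ 2} (\<lambda>y. hrad (base y) a)" for a
    unfolding hrad_def base_nth by (intro smooth_intros o) (auto simp: add_pos_nonneg)
  have p: "hrad (base y) a \<noteq> 0" "hrad (base y) a * (y $ 1 + a + hrad (base y) a) \<noteq> 0" if "y \<in> {y. 0 < y $ 2}" for y a
    using hrad_pos[of "base y" a] hrad_add_pos[of "base y" a] that by auto
  show "smooth_on {y::real^4. 0 < y $ 2} (\<lambda>y. xiH I c a \<nu> (base y) $ j)"
    unfolding xiH_def by (simp, intro smooth_intros o h fin p) auto
  show "smooth_on {y::real^4. 0 < y $ 2} (\<lambda>y. xiR I c a N (base y) $ j)"
    unfolding xiR_def by (simp, intro smooth_intros o h fin p) auto
qed

lemma smooth_toric_metric: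
  assumes XH: "\<And>j. smooth_on U (\<lambda>y. XH (base y) $ j)" and XR: "\<And>j. smooth_on U (\<lambda>y. XR (base y) $ j)"
    and d: "\<And>y. y \<in> U \<Longrightarrow> det2 (XH (base y)) (XR (base y)) \<noteq> 0"
  shows "smooth_on U (toric_metric XH XR)"
proof -
  have o: "open U" using XH smooth_on_open by blast
  have dt: "smooth_on U (\<lambda>y. det2 (XH (base y)) (XR (base y)))"
    unfolding det2_def by (intro smooth_intros XH XR)
  show ?thesis
  proof (rule smooth_on_matrix[OF o])
    fix i j :: 4
    consider "i = 1" | "i = 2" | "i = 3" | "i = 4" using exhaust_4[of i] by auto
    then show "smooth_on U (\<lambda>y. toric_metric XH XR y $ i $ j)"
      unfolding toric_metric_def Let_def base_nth
      using exhaust_4[of j]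
      by cases (elim disjE; simp only: vector_4; intro smooth_intros XH XR o d dt; assumption?)+
  qed
qed

text \<open>The angular block has determinant \<open>r^2\<close> by Lagrange's identity, so the
  volume density is \<open>|r V|\<close>.\<close>

lemma det_toric_metric:
  assumes "y $ 2 \<noteq> 0" "det2 (XH (base y)) (XR (base y)) \<noteq> 0"
  shows "det (toric_metric XH XR y) = (y $ 2 * (y $ 2 * det2 (XH (base y)) (XR (base y))))\<^sup>2"
proof -
  define r where "r = y $ 2"
  define A where "A = XH (base y)"
  define B where "B = XR (base y)"
  define t where "t = det2 A B"
  define f where "f = r / t"
  have t: "t \<noteq> 0" using assms by (simp add: t_def A_def B_def)
  have "det (toric_metric XH XR y) = (r * t)\<^sup>2 * (f\<^sup>2 * (((A $ 2)\<^sup>2 + (B $ 2)\<^sup>2) * ((A $ 1)\<^sup>2 + (B $ 1)\<^sup>2) - (A $ 1 * A $ 2 + B $ 1 * B $ 2)\<^sup>2))"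
    unfolding det_4 toric_metric_def Let_def base_nth r_def[symmetric] A_def[symmetric] B_def[symmetric]
      t_def[symmetric] f_def[symmetric]
    by (simp add: power2_eq_square algebra_simps)
  also have "((A $ 2)\<^sup>2 + (B $ 2)\<^sup>2) * ((A $ 1)\<^sup>2 + (B $ 1)\<^sup>2) - (A $ 1 * A $ 2 + B $ 1 * B $ 2)\<^sup>2 = t\<^sup>2"
    unfolding t_def det2_def by algebra
  also have "(r * t)\<^sup>2 * (f\<^sup>2 * t\<^sup>2) = (r * (r * t))\<^sup>2"
    using t by (simp add: f_def power2_eq_square)
  finally show ?thesis by (simp add: r_def t_def A_def B_def)
qed

text \<open>The reflection exchanges the two ends of the boundary \<open>r = 0\<close>, so that only \<open>H > - R/2\<close> has to be treated.\<close>

definition flip :: "real^4 \<Rightarrow> real^4" where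
  "flip y = vector [- (y $ 1), y $ 2, y $ 3, y $ 4]"

lemma flip_nth [simp]: "flip y $ 1 = - (y $ 1)" "flip y $ 2 = y $ 2" "flip y $ 3 = y $ 3" "flip y $ 4 = y $ 4"
  by (simp_all add: flip_def)

lemma jacobian_flip:
  "jacobian flip (at y) = vector [vector [- 1, 0, 0, 0], vector [0, 1, 0, 0], vector [0, 0, 1, 0], vector [0, 0, 0, 1]]"
    (is "_ = ?M")
proof (rule jacobian_eqI)
  have "flip = (\<lambda>v. ?M *v v)"
    by (simp add: fun_eq_iff vec_eq_iff forall_4 matrix_vector_mult_def sum_4)
  moreover have "((\<lambda>v. ?M *v v) has_derivative (\<lambda>v. ?M *v v)) (at y)"
    by (intro bounded_linear_imp_has_derivative matrix_vector_mul_bounded_linear)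
  ultimately show "(flip has_derivative (\<lambda>v. ?M *v v)) (at y)" by simp
qed

lemma smooth_flip: "smooth_on UNIV flip"
  unfolding flip_def by (intro smooth_on_vector4 smooth_intros open_UNIV)

text \<open>On the level of \<open>\<xi>\<close> this is
  \<open>log (H + \<rho>) = 2 log r - log (- H + \<rho>)\<close>: the increments change sign, and
  the terms in \<open>log r\<close> add up to the normal \<open>N + sum c I\<close> of the other
  end.\<close>

lemma xi_flip:
  assumes fin: "finite I" and y: "y $ 2 > 0"
  shows "xiH I c a \<nu> (base y) = - xiH I (\<lambda>i. - c i) (\<lambda>i. - a i) (- \<nu>) (base (flip y))"
    and "xiR I c a N (base y) = xiR I (\<lambda>i. - c i) (\<lambda>i. - a i) (N + sum c I) (base (flip y))"
proof -
  have h: "hrad (base (flip y)) (- b) = hrad (base y) b" for b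
    by (simp add: hrad_def power2_eq_square algebra_simps)
  show "xiH I c a \<nu> (base y) = - xiH I (\<lambda>i. - c i) (\<lambda>i. - a i) (- \<nu>) (base (flip y))"
    by (simp add: xiH_def h sum_negf)
  have rb: "base y $ 2 > 0" using y by simp
  \<comment> \<open>The \<open>r\<close> derivative of that relation, a consequence of
    \<open>r^2 = (\<rho> - H) (\<rho> + H)\<close>.\<close>
  have e: "(1 / y $ 2) - (1/2) * (y $ 2 / (\<rho> * (- H + \<rho>))) = (1/2) * (y $ 2 / (\<rho> * (H + \<rho>)))"
    if "\<rho> > 0" "\<bar>H\<bar> < \<rho>" "(y $ 2)\<^sup>2 = \<rho>\<^sup>2 - H\<^sup>2" for \<rho> H
  proof -
    have nz: "\<rho> \<noteq> 0" "\<rho> - H \<noteq> 0" "\<rho> + H \<noteq> 0" "y $ 2 \<noteq> 0" using that y by auto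
    have "y $ 2 / (\<rho> * (- H + \<rho>)) = (\<rho> + H) / (\<rho> * y $ 2)" "y $ 2 / (\<rho> * (H + \<rho>)) = (\<rho> - H) / (\<rho> * y $ 2)"
    proof -
      have d: "\<rho> * (- H + \<rho>) \<noteq> 0" "\<rho> * (H + \<rho>) \<noteq> 0" "\<rho> * y $ 2 \<noteq> 0" using nz by auto
      have "y $ 2 * (\<rho> * y $ 2) = (\<rho> + H) * (\<rho> * (- H + \<rho>))" "y $ 2 * (\<rho> * y $ 2) = (\<rho> - H) * (\<rho> * (H + \<rho>))"
        using that(3) by algebra+
      then show "y $ 2 / (\<rho> * (- H + \<rho>)) = (\<rho> + H) / (\<rho> * y $ 2)" "y $ 2 / (\<rho> * (H + \<rho>)) = (\<rho> - H) / (\<rho> * y $ 2)"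
        unfolding frac_eq_eq[OF d(1,3)] frac_eq_eq[OF d(2,3)] .
    qed
    moreover have "(1 / y $ 2) - (1/2) * ((\<rho> + H) / (\<rho> * y $ 2)) = (1/2) * ((\<rho> - H) / (\<rho> * y $ 2))"
      using nz by (simp add: field_simps)
    ultimately show ?thesis by simp
  qed
  have "(1 / y $ 2) *\<^sub>R (N + sum c I) + (1/2) *\<^sub>R (\<Sum>i\<in>I. (y $ 2 / (hrad (base y) (a i) * (- (y $ 1) - a i + hrad (base y) (a i)))) *\<^sub>R - c i) =
    (1 / y $ 2) *\<^sub>R N + (\<Sum>i\<in>I. (1 / y $ 2 - (1/2) * (y $ 2 / (hrad (base y) (a i) * (- (y $ 1 + a i) + hrad (base y) (a i))))) *\<^sub>R c i)"
    by (simp add: scaleR_right_distrib scaleR_sum_right sum.distrib[symmetric] algebra_simps)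
  also have "(\<Sum>i\<in>I. (1 / y $ 2 - (1/2) * (y $ 2 / (hrad (base y) (a i) * (- (y $ 1 + a i) + hrad (base y) (a i))))) *\<^sub>R c i) =
     (\<Sum>i\<in>I. ((1/2) * (y $ 2 / (hrad (base y) (a i) * ((y $ 1 + a i) + hrad (base y) (a i))))) *\<^sub>R c i)"
  proof (rule sum.cong[OF refl])
    fix i
    have "(1 / y $ 2 - (1/2) * (y $ 2 / (hrad (base y) (a i) * (- (y $ 1 + a i) + hrad (base y) (a i))))) =
      ((1/2) * (y $ 2 / (hrad (base y) (a i) * ((y $ 1 + a i) + hrad (base y) (a i)))))"
      using hrad_pos[OF rb, of "a i"] hrad_gt[OF rb, of "a i"] by (intro e) (auto simp: hrad_def)
    then show "(1 / y $ 2 - (1/2) * (y $ 2 / (hrad (base y) (a i) * (- (y $ 1 + a i) + hrad (base y) (a i))))) *\<^sub>R c i =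
      ((1/2) * (y $ 2 / (hrad (base y) (a i) * ((y $ 1 + a i) + hrad (base y) (a i))))) *\<^sub>R c i" by simp
  qed
  finally show "xiR I c a N (base y) = xiR I (\<lambda>i. - c i) (\<lambda>i. - a i) (N + sum c I) (base (flip y))"
    unfolding xiR_def h by (simp add: scaleR_sum_right algebra_simps)
qed

text \<open>\<open>far_right\<close> for the data and for the reflected data covers
  \<open>H \<ge> - R/2\<close> and \<open>H \<le> R/2\<close>, hence everything far out.\<close>

lemma far_bound:
  fixes I :: "'i set" and c :: "'i \<Rightarrow> real^2"
  assumes fin: "finite I"
    and cond: "\<nu> = 0 \<and> det2 N (N + sum c I) \<noteq> 0 \<or> \<nu> \<noteq> 0 \<and> det2 \<nu> N * det2 \<nu> (N + sum c I) > 0"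
    and nz: "\<And>y. y $ 2 > 0 \<Longrightarrow> det2 (xiH I c a \<nu> (base y)) (xiR I c a N (base y)) \<noteq> 0"
  defines "k \<equiv> if \<nu> = 0 then 0 else (1::nat)"
  obtains C R0 where "R0 \<ge> 1" "\<And>y. y $ 2 > 0 \<Longrightarrow> R0 \<le> norm (base y) \<Longrightarrow>
    \<bar>riemann_norm_sq (toric_metric (xiH I c a \<nu>) (xiR I c a N)) y\<bar> \<le> C / norm (base y) ^ (3 + k) \<and>
    \<bar>y $ 2 * (y $ 2 * det2 (xiH I c a \<nu> (base y)) (xiR I c a N (base y)))\<bar> \<le> C * norm (base y) ^ k"
proof -
  let ?c = "\<lambda>i. - c i" and ?a = "\<lambda>i. - a i" and ?N = "N + sum c I"
  let ?XH = "xiH I c a \<nu>" and ?XR = "xiR I c a N"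
  let ?YH = "xiH I ?c ?a (- \<nu>)" and ?YR = "xiR I ?c ?a ?N"
  obtain C1 R1 where 1: "R1 \<ge> 1" "\<And>y. y $ 2 > 0 \<Longrightarrow> R1 \<le> norm (base y) \<Longrightarrow> - (norm (base y) / 2) \<le> y $ 1 \<Longrightarrow>
    \<bar>riemann_norm_sq (toric_metric ?XH ?XR) y\<bar> \<le> C1 / norm (base y) ^ (3 + k) \<and>
    \<bar>y $ 2 * (y $ 2 * det2 (?XH (base y)) (?XR (base y)))\<bar> \<le> C1 * norm (base y) ^ k"
    using far_right[OF fin cond, where a=a] unfolding k_def by metis
  have "sum ?c I = - sum c I" by (simp add: sum_negf)
  then have "?N + sum ?c I = N" by simp
  then have cond': "- \<nu> = 0 \<and> det2 ?N (?N + sum ?c I) \<noteq> 0 \<or> - \<nu> \<noteq> 0 \<and> det2 (- \<nu>) ?N * det2 (- \<nu>) (?N + sum ?c I) > 0"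
    using cond by (auto simp: det2_def algebra_simps)
  have k': "k = (if - \<nu> = 0 then 0 else 1)" by (simp add: k_def)
  obtain C2 R2 where 2: "R2 \<ge> 1" "\<And>y. y $ 2 > 0 \<Longrightarrow> R2 \<le> norm (base y) \<Longrightarrow> - (norm (base y) / 2) \<le> y $ 1 \<Longrightarrow>
    \<bar>riemann_norm_sq (toric_metric ?YH ?YR) y\<bar> \<le> C2 / norm (base y) ^ (3 + k) \<and>
    \<bar>y $ 2 * (y $ 2 * det2 (?YH (base y)) (?YR (base y)))\<bar> \<le> C2 * norm (base y) ^ k"
    using far_right[OF fin cond', where a="?a"] unfolding k' by metis
  have flip2: "flip (flip y) = y" for y by (simp add: vec_eq_iff forall_4)
  have dY: "det2 (?XH (base y)) (?XR (base y)) = - det2 (?YH (base (flip y))) (?YR (base (flip y)))" if "y $ 2 > 0" for y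
    unfolding xi_flip[OF fin that] by (simp add: det2_def)
  define U where "U = {y::real^4. 0 < y $ 2}"
  have oU: "open U" unfolding U_def by (intro open_positive continuous_intros)
  have nzY: "det2 (?YH (base y)) (?YR (base y)) \<noteq> 0" if "y \<in> U" for y
    using dY[of "flip y"] nz[of "flip y"] that by (simp add: flip2 U_def)
  have sY: "smooth_on U (toric_metric ?YH ?YR)"
    using smooth_xi_comps[OF fin] nzY unfolding U_def by (intro smooth_toric_metric) auto
  have detY: "det (toric_metric ?YH ?YR y) \<noteq> 0" if "y \<in> U" for y
    using det_toric_metric[of y ?YH ?YR] nzY[OF that] that by (simp add: U_def)
  \<comment> \<open>The reflection reverses \<open>\<xi>_H\<close> but not \<open>\<xi>_r\<close>,
    so the determinant and with it the metric formula change sign; the factor \<open>- 1\<close>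
    compensates and disappears in the norm.\<close>
  interpret metric_pullback "\<lambda>y. (- 1) *\<^sub>R toric_metric ?YH ?YR y" "toric_metric ?XH ?XR" flip U U
  proof
    show "smooth_on U (\<lambda>y. (- 1) *\<^sub>R toric_metric ?YH ?YR y)" by (intro smooth_intros sY oU)
    show "transpose ((- 1) *\<^sub>R toric_metric ?YH ?YR u) = (- 1) *\<^sub>R toric_metric ?YH ?YR u" for u
      unfolding toric_metric_def Let_def vec_eq_iff transpose_def by (simp add: forall_4)
    show "det ((- 1) *\<^sub>R toric_metric ?YH ?YR u) \<noteq> 0" if "u \<in> U" for u
    proof -
      have "(- 1) *\<^sub>R toric_metric ?YH ?YR u = matrix ((*\<^sub>R) (- 1)) ** toric_metric ?YH ?YR u"
        by (simp add: matrix_scaleR mat_def matrix_matrix_mult_def vec_eq_iff if_distrib if_distribR cong: if_cong)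
      then have "det ((- 1) *\<^sub>R toric_metric ?YH ?YR u) = det (matrix ((*\<^sub>R) (- 1)) ** toric_metric ?YH ?YR u)"
        by (rule arg_cong)
      then show ?thesis using detY[OF that] by (simp add: det_mul)
    qed
    show "smooth_on U flip" by (rule smooth_on_subset[OF smooth_flip oU]) auto
    show "flip ` U \<subseteq> U" by (auto simp: U_def)
    show "det (jacobian flip (at w)) \<noteq> 0" for w unfolding jacobian_flip det_4 by simp
    show "transpose (jacobian flip (at w)) ** ((- 1) *\<^sub>R toric_metric ?YH ?YR (flip w)) ** jacobian flip (at w) = toric_metric ?XH ?XR w"
      if w: "w \<in> U" for w
    proof -
      have w2: "w $ 2 > 0" using w by (simp add: U_def)
      show ?thesis
        unfolding vec_eq_iff forall_4 jacobian_flip matrix_matrix_mult_def transpose_def sum_4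
        unfolding toric_metric_def Let_def dY[OF w2] unfolding xi_flip[OF fin w2]
        by (simp add: sum_4)
    qed
  qed
  have 3: "riemann_norm_sq (toric_metric ?XH ?XR) y = riemann_norm_sq (toric_metric ?YH ?YR) (flip y)" if "y \<in> U" for y
  proof -
    have "riemann_norm_sq (toric_metric ?XH ?XR) y = riemann_norm_sq (\<lambda>y. (- 1) *\<^sub>R toric_metric ?YH ?YR y) (flip y)"
      by (rule riemann_norm_sq_pullback[OF that])
    also have "\<dots> = riemann_norm_sq (toric_metric ?YH ?YR) (flip y) / (- 1)\<^sup>2"
      using that by (intro riemann_norm_sq_scale[OF sY detY]) (auto simp: U_def)
    finally show ?thesis by simp
  qed
  show ?thesis
  proof (rule that[of "max R1 R2" "max C1 C2"])
    show "max R1 R2 \<ge> 1" using 1 by simp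
    fix y :: "real^4" assume y: "y $ 2 > 0" and R: "max R1 R2 \<le> norm (base y)"
    have n0: "norm (base y) > 0" using R 1 by linarith
    have nf: "norm (base (flip y)) = norm (base y)" by (simp add: norm_base)
    have mx: "C1 / norm (base y) ^ (3 + k) \<le> max C1 C2 / norm (base y) ^ (3 + k)"
      "C2 / norm (base y) ^ (3 + k) \<le> max C1 C2 / norm (base y) ^ (3 + k)"
      "C1 * norm (base y) ^ k \<le> max C1 C2 * norm (base y) ^ k"
      "C2 * norm (base y) ^ k \<le> max C1 C2 * norm (base y) ^ k"
      using n0 by (auto intro!: divide_right_mono mult_right_mono)
    show "\<bar>riemann_norm_sq (toric_metric ?XH ?XR) y\<bar> \<le> max C1 C2 / norm (base y) ^ (3 + k) \<and>
      \<bar>y $ 2 * (y $ 2 * det2 (?XH (base y)) (?XR (base y)))\<bar> \<le> max C1 C2 * norm (base y) ^ k"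
    proof (cases "- (norm (base y) / 2) \<le> y $ 1")
      case True
      then show ?thesis using 1(2)[OF y] R mx by fastforce
    next
      case False
      then have "- (norm (base (flip y)) / 2) \<le> flip y $ 1" unfolding nf flip_nth using n0 by linarith
      then have "\<bar>riemann_norm_sq (toric_metric ?YH ?YR) (flip y)\<bar> \<le> C2 / norm (base y) ^ (3 + k) \<and>
         \<bar>y $ 2 * (y $ 2 * det2 (?YH (base (flip y))) (?YR (base (flip y))))\<bar> \<le> C2 * norm (base y) ^ k"
        using 2(2)[of "flip y"] y R by (simp add: nf)
      then show ?thesis using 3[of y] dY[OF y] y mx by (simp add: U_def)
    qed
  qed
qed

subsection \<open>The metrics of the theorem\<close>

lemma xi_has_derivative:
  assumes h: "h \<in> half_plane"
  shows "(xi d n a \<nu> has_derivative (\<lambda>v. v $ 1 *\<^sub>R xiH {1..d-1} (\<lambda>i. n (i+1) - n i) a \<nu> h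
     + v $ 2 *\<^sub>R xiR {1..d-1} (\<lambda>i. n (i+1) - n i) a (n 1) h)) (at h)"
proof -
  have h2: "h $ 2 > 0" using h by (simp add: half_plane_def)
  have n: "((\<lambda>y::real^2. y $ i) has_derivative (\<lambda>v. v $ i)) (at h)" for i
    by (rule bounded_linear_imp_has_derivative[OF bounded_linear_vec_nth])
  have r: "((\<lambda>y::real^2. sqrt ((y $ 2)\<^sup>2 + (y $ 1 + b)\<^sup>2)) has_derivative
      (\<lambda>v. (h $ 2 * v $ 2 + (h $ 1 + b) * v $ 1) / hrad h b)) (at h)" for b
  proof -
    have "((\<lambda>y::real^2. y $ 2 * y $ 2 + (y $ 1 + b) * (y $ 1 + b)) has_derivative
       (\<lambda>v. (h $ 2 * v $ 2 + v $ 2 * h $ 2) + ((h $ 1 + b) * (v $ 1 + 0) + (v $ 1 + 0) * (h $ 1 + b)))) (at h)"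
      by (intro has_derivative_add has_derivative_mult has_derivative_const n)
    from has_derivative_real_sqrt[OF _ this]
    have *: "((\<lambda>y::real^2. sqrt (y $ 2 * y $ 2 + (y $ 1 + b) * (y $ 1 + b))) has_derivative
       (\<lambda>v. ((h $ 2 * v $ 2 + v $ 2 * h $ 2) + ((h $ 1 + b) * (v $ 1 + 0) + (v $ 1 + 0) * (h $ 1 + b))) *
          (inverse (sqrt (h $ 2 * h $ 2 + (h $ 1 + b) * (h $ 1 + b))) / 2))) (at h)"
      using h2 by (simp add: add_pos_nonneg)
    have e: "sqrt (h $ 2 * h $ 2 + (h $ 1 + b) * (h $ 1 + b)) = hrad h b"
      by (simp add: hrad_def power2_eq_square)
    show ?thesis
    proof (rule has_derivative_eq_rhs[OF *[folded power2_eq_square]], rule ext)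
      fix v :: "real^2"
      have "h $ 2 * v $ 2 + v $ 2 * h $ 2 + ((h $ 1 + b) * (v $ 1 + 0) + (v $ 1 + 0) * (h $ 1 + b)) =
        2 * (h $ 2 * v $ 2 + (h $ 1 + b) * v $ 1)" by (simp add: algebra_simps)
      moreover have "2 * S * (inverse \<rho> / 2) = S / \<rho>" for S \<rho> :: real by (simp add: field_simps)
      ultimately show "(h $ 2 * v $ 2 + v $ 2 * h $ 2 + ((h $ 1 + b) * (v $ 1 + 0) + (v $ 1 + 0) * (h $ 1 + b))) *
         (inverse (sqrt ((h $ 2)\<^sup>2 + (h $ 1 + b)\<^sup>2)) / 2) = (h $ 2 * v $ 2 + (h $ 1 + b) * v $ 1) / hrad h b"
        unfolding hrad_def by (simp only:)
    qed
  qed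
  have l: "((\<lambda>y::real^2. ln (y $ 1 + b + sqrt ((y $ 2)\<^sup>2 + (y $ 1 + b)\<^sup>2))) has_derivative
      (\<lambda>v. v $ 1 * (1 / hrad h b) + v $ 2 * (h $ 2 / (hrad h b * (h $ 1 + b + hrad h b))))) (at h)" for b
  proof -
    have p: "hrad h b > 0" "h $ 1 + b + hrad h b > 0" using hrad_pos[OF h2] hrad_add_pos[OF h2, of b] by auto
    have "((\<lambda>y::real^2. ln (y $ 1 + b + sqrt ((y $ 2)\<^sup>2 + (y $ 1 + b)\<^sup>2))) has_derivative
      (\<lambda>v. (v $ 1 + 0 + (h $ 2 * v $ 2 + (h $ 1 + b) * v $ 1) / hrad h b) * inverse (h $ 1 + b + sqrt ((h $ 2)\<^sup>2 + (h $ 1 + b)\<^sup>2)))) (at h)"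
      using p by (intro has_derivative_ln has_derivative_add has_derivative_const n r) (simp add: hrad_def)
    then show ?thesis
    proof (rule has_derivative_eq_rhs, intro ext)
      fix v :: "real^2"
      have "(v $ 1 + 0 + (h $ 2 * v $ 2 + (h $ 1 + b) * v $ 1) / hrad h b) * inverse (h $ 1 + b + hrad h b) =
        v $ 1 * (1 / hrad h b) + v $ 2 * (h $ 2 / (hrad h b * (h $ 1 + b + hrad h b)))"
        using p by (simp add: divide_simps) (simp add: algebra_simps)
      then show "(v $ 1 + 0 + (h $ 2 * v $ 2 + (h $ 1 + b) * v $ 1) / hrad h b) * inverse (h $ 1 + b + sqrt ((h $ 2)\<^sup>2 + (h $ 1 + b)\<^sup>2)) =
        v $ 1 * (1 / hrad h b) + v $ 2 * (h $ 2 / (hrad h b * (h $ 1 + b + hrad h b)))"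
        by (simp add: hrad_def)
    qed
  qed
  have l2: "((\<lambda>y::real^2. ln (y $ 2)) has_derivative (\<lambda>v. v $ 2 * (1 / h $ 2))) (at h)"
    using has_derivative_ln[OF h2 n] by (simp add: divide_inverse)
  have "(xi d n a \<nu> has_derivative (\<lambda>v. (v $ 2 * (1 / h $ 2)) *\<^sub>R n 1 + (1/2) *\<^sub>R (\<Sum>i=1..d-1.
     (v $ 1 * (1 / hrad h (a i)) + v $ 2 * (h $ 2 / (hrad h (a i) * (h $ 1 + a i + hrad h (a i))))) *\<^sub>R (n (i+1) - n i)) + v $ 1 *\<^sub>R \<nu>)) (at h)"
    unfolding xi_def
    by (intro has_derivative_add has_derivative_scaleR_left has_derivative_scaleR_right has_derivative_sum l l2 n)
  then show ?thesis
    by (rule has_derivative_eq_rhs)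
       (simp add: xiH_def xiR_def fun_eq_iff scaleR_right_distrib scaleR_left_distrib sum.distrib
         scaleR_sum_right algebra_simps del: scaleR_right_diff_distrib)
qed

lemma Dxi_nth:
  assumes h: "h \<in> half_plane"
  shows "Dxi d n a \<nu> h $ i $ 1 = xiH {1..d-1} (\<lambda>i. n (i+1) - n i) a \<nu> h $ i"
    "Dxi d n a \<nu> h $ i $ 2 = xiR {1..d-1} (\<lambda>i. n (i+1) - n i) a (n 1) h $ i"
  using dird_eqI[OF xi_has_derivative[OF h]]
  by (simp_all add: Dxi_def jacobian_nth dird_def[symmetric] axis_def)

text \<open>The inverse of \<open>D\<xi> D\<xi>^t\<close> is written by cofactors; its denominator
  \<open>det (D\<xi>)^2\<close> turns the factor \<open>V\<close> into
  \<open>r / det D\<xi>\<close>.\<close>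

lemma gnu_toric_metric:
  assumes y: "base y \<in> half_plane" and d: "det (Dxi d n a \<nu> (base y)) \<noteq> 0"
  shows "gnu d n a \<nu> y = toric_metric (xiH {1..d-1} (\<lambda>i. n (i+1) - n i) a \<nu>) (xiR {1..d-1} (\<lambda>i. n (i+1) - n i) a (n 1)) y"
    and "Vfun d n a \<nu> (base y) = y $ 2 * det2 (xiH {1..d-1} (\<lambda>i. n (i+1) - n i) a \<nu> (base y)) (xiR {1..d-1} (\<lambda>i. n (i+1) - n i) a (n 1) (base y))"
proof -
  define A where "A = xiH {1..d-1} (\<lambda>i. n (i+1) - n i) a \<nu> (base y)"
  define B where "B = xiR {1..d-1} (\<lambda>i. n (i+1) - n i) a (n 1) (base y)"
  define M where "M = Dxi d n a \<nu> (base y)"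
  have M: "M $ i $ 1 = A $ i" "M $ i $ 2 = B $ i" for i
    using Dxi_nth[OF y] by (simp_all add: M_def A_def B_def)
  have dM: "det M = det2 A B" by (simp add: det_2 M det2_def)
  then have nz: "det2 A B \<noteq> 0" using d by (simp add: M_def)
  have MM: "(M ** transpose M) $ i $ j = A $ i * A $ j + B $ i * B $ j" for i j
    by (simp add: matrix_matrix_mult_def transpose_def sum_2 M)
  define W :: "real^2^2" where "W = (1 / (det2 A B)\<^sup>2) *\<^sub>R
    vector [vector [(A $ 2)\<^sup>2 + (B $ 2)\<^sup>2, - (A $ 1 * A $ 2 + B $ 1 * B $ 2)],
            vector [- (A $ 1 * A $ 2 + B $ 1 * B $ 2), (A $ 1)\<^sup>2 + (B $ 1)\<^sup>2]]"
  have "(M ** transpose M) ** W = mat 1"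
  proof -
    have e: "((A $ 2)\<^sup>2 + (B $ 2)\<^sup>2) * ((A $ 1)\<^sup>2 + (B $ 1)\<^sup>2) - (A $ 1 * A $ 2 + B $ 1 * B $ 2)\<^sup>2 = (det2 A B)\<^sup>2"
      unfolding det2_def by algebra
    define x y m where "x = (A $ 1)\<^sup>2 + (B $ 1)\<^sup>2" and "y = (A $ 2)\<^sup>2 + (B $ 2)\<^sup>2" and "m = A $ 1 * A $ 2 + B $ 1 * B $ 2"
    have MM': "(M ** transpose M) $ 1 $ 1 = x" "(M ** transpose M) $ 1 $ 2 = m" "(M ** transpose M) $ 2 $ 1 = m"
      "(M ** transpose M) $ 2 $ 2 = y"
      unfolding MM x_def y_def m_def by (simp_all add: power2_eq_square)
    have e': "y * x - m\<^sup>2 = (det2 A B)\<^sup>2" using e by (simp add: x_def y_def m_def)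
    have W': "W $ 1 $ 1 = y / (det2 A B)\<^sup>2" "W $ 1 $ 2 = - m / (det2 A B)\<^sup>2" "W $ 2 $ 1 = - m / (det2 A B)\<^sup>2"
      "W $ 2 $ 2 = x / (det2 A B)\<^sup>2"
      by (simp_all add: W_def x_def y_def m_def)
    have d1: "x * (y / (det2 A B)\<^sup>2) + m * (- m / (det2 A B)\<^sup>2) = 1"
    proof -
      have "x * (y / (det2 A B)\<^sup>2) + m * (- m / (det2 A B)\<^sup>2) = (y * x - m\<^sup>2) / (det2 A B)\<^sup>2"
        by (simp add: diff_divide_distrib power2_eq_square mult.commute)
      then show ?thesis unfolding e' using nz by simp
    qed
    have "((M ** transpose M) ** W) $ i $ j = (mat 1 :: real^2^2) $ i $ j" for i j
    proof -
      have "((M ** transpose M) ** W) $ i $ j = (M ** transpose M) $ i $ 1 * W $ 1 $ j + (M ** transpose M) $ i $ 2 * W $ 2 $ j"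
        by (simp only: matrix_matrix_mult_def[of "M ** transpose M" W] sum_2 vec_lambda_beta)
      then show ?thesis using exhaust_2[of i] exhaust_2[of j] d1
        by (elim disjE; simp only: MM' W'; simp add: mat_def mult.commute add.commute)
    qed
    then show ?thesis by (simp add: vec_eq_iff)
  qed
  then have inv: "matrix_inv (M ** transpose M) = W" by (rule matrix_inv_eqI)
  show V: "Vfun d n a \<nu> (base y) = y $ 2 * det2 A B"
    by (simp add: Vfun_def M_def[symmetric] dM)
  have f: "y $ 2 * det2 A B * (1 / (det2 A B)\<^sup>2 * x) = y $ 2 / det2 A B * x"
    "y $ 2 * det2 A B * (1 / (det2 A B)\<^sup>2 * - x) = - (y $ 2 / det2 A B) * x" for x
    using nz by (simp_all add: power2_eq_square)
  show "gnu d n a \<nu> y = toric_metric (xiH {1..d-1} (\<lambda>i. n (i+1) - n i) a \<nu>) (xiR {1..d-1} (\<lambda>i. n (i+1) - n i) a (n 1)) y"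
    unfolding gnu_def Let_def V M_def[symmetric] inv toric_metric_def A_def[symmetric] B_def[symmetric] base_nth
    unfolding W_def vector_scaleR_component real_scaleR_def vector_2 f by (simp only: mult_minus_right mult_minus_left)
qed

text \<open>The increments telescope, so \<open>n 1 + sum c = n d\<close>: the condition of
  \<open>far_bound\<close> is that the unbounded edges are not parallel if \<open>\<nu> = 0\<close>,
  and admissibility otherwise.\<close>

lemma gnu_far_bound:
  assumes d: "2 \<le> d" and par: "det2 (n 1) (n d) \<noteq> 0" and adm: "admissible d n \<nu>"
    and nz: "\<And>h. h \<in> half_plane \<Longrightarrow> det (Dxi d n a \<nu> h) \<noteq> 0"
  obtains k C R0 where "R0 \<ge> 1" "\<And>y. base y \<in> half_plane \<Longrightarrow> R0 \<le> norm (base y) \<Longrightarrow>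
    \<bar>riemann_norm_sq (gnu d n a \<nu>) y\<bar> \<le> C / norm (base y) ^ (3 + k)"
    "\<And>y. base y \<in> half_plane \<Longrightarrow> R0 \<le> norm (base y) \<Longrightarrow>
      sqrt (det (gnu d n a \<nu> y)) \<le> C * norm (base y) ^ k"
proof -
  let ?I = "{1..d-1}" and ?c = "\<lambda>i. n (i+1) - n i"
  let ?XH = "xiH ?I ?c a \<nu>" and ?XR = "xiR ?I ?c a (n 1)"
  have "(\<Sum>i=1..d-1. n (Suc i) - n i) = n (Suc (d - 1)) - n 1"
    using d by (intro sum_Suc_diff) auto
  then have sc: "n 1 + sum ?c ?I = n d" using d by simp
  have cond: "\<nu> = 0 \<and> det2 (n 1) (n 1 + sum ?c ?I) \<noteq> 0 \<or> \<nu> \<noteq> 0 \<and> det2 \<nu> (n 1) * det2 \<nu> (n 1 + sum ?c ?I) > 0"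
    unfolding sc using par adm by (auto simp: admissible_def)
  have hp: "base y \<in> half_plane \<longleftrightarrow> y $ 2 > 0" for y by (simp add: half_plane_def)
  have nz': "det2 (?XH (base y)) (?XR (base y)) \<noteq> 0" if "y $ 2 > 0" for y
  proof -
    have y: "base y \<in> half_plane" using that hp by simp
    have "det (Dxi d n a \<nu> (base y)) = det2 (?XH (base y)) (?XR (base y))"
      by (simp add: det_2 Dxi_nth[OF y] det2_def)
    then show ?thesis using nz[OF y] by simp
  qed
  define k where "k = (if \<nu> = 0 then 0 else (1::nat))"
  have "\<exists>C R0. R0 \<ge> 1 \<and> (\<forall>y. y $ 2 > 0 \<longrightarrow> R0 \<le> norm (base y) \<longrightarrow>
    \<bar>riemann_norm_sq (toric_metric ?XH ?XR) y\<bar> \<le> C / norm (base y) ^ (3 + k) \<and>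
    \<bar>y $ 2 * (y $ 2 * det2 (?XH (base y)) (?XR (base y)))\<bar> \<le> C * norm (base y) ^ k)"
    (is "\<exists>C R0. ?P C R0")
  proof (rule far_bound[OF finite_atLeastAtMost cond nz', folded k_def])
    fix C R0 assume "1 \<le> R0" "\<And>y. 0 < y $ 2 \<Longrightarrow> R0 \<le> norm (base y) \<Longrightarrow>
    \<bar>riemann_norm_sq (toric_metric ?XH ?XR) y\<bar> \<le> C / norm (base y) ^ (3 + k) \<and>
    \<bar>y $ 2 * (y $ 2 * det2 (?XH (base y)) (?XR (base y)))\<bar> \<le> C * norm (base y) ^ k"
    then have "?P C R0" by simp
    then show "\<exists>C R0. ?P C R0" by (intro exI)
  qed
  then obtain C R0 where P: "?P C R0" by blast
  then have *: "R0 \<ge> 1" "\<And>y. y $ 2 > 0 \<Longrightarrow> R0 \<le> norm (base y) \<Longrightarrow>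
    \<bar>riemann_norm_sq (toric_metric ?XH ?XR) y\<bar> \<le> C / norm (base y) ^ (3 + k) \<and>
    \<bar>y $ 2 * (y $ 2 * det2 (?XH (base y)) (?XR (base y)))\<bar> \<le> C * norm (base y) ^ k"
    by auto
  have g: "gnu d n a \<nu> y = toric_metric ?XH ?XR y" if "y $ 2 > 0" for y
    using gnu_toric_metric(1) that hp nz by blast
  have o: "open {y::real^4. 0 < y $ 2}" by (intro open_positive continuous_intros)
  have "riemann_norm_sq (gnu d n a \<nu>) y = riemann_norm_sq (toric_metric ?XH ?XR) y" if "y $ 2 > 0" for y
    by (rule riemann_norm_sq_cong[OF o]) (use g that in auto)
  moreover have "sqrt (det (gnu d n a \<nu> y)) = \<bar>y $ 2 * (y $ 2 * det2 (?XH (base y)) (?XR (base y)))\<bar>" if "y $ 2 > 0" for y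
    using det_toric_metric[of y ?XH ?XR] nz'[OF that] that g by simp
  ultimately show ?thesis using that[of R0 C k] * hp by simp
qed

section \<open>Killing fields\<close>

text \<open>\<open>exp (- C t) E t\<close> starts at zero and does not increase.\<close>

lemma gronwall_zero:
  fixes E E' :: "real \<Rightarrow> real"
  assumes d: "\<And>t. 0 \<le> t \<Longrightarrow> t \<le> 1 \<Longrightarrow> (E has_real_derivative E' t) (at t)"
    and le: "\<And>t. 0 \<le> t \<Longrightarrow> t \<le> 1 \<Longrightarrow> E' t \<le> C * E t" and 0: "E 0 = 0" and pos: "E 1 \<ge> 0"
  shows "E 1 = 0"
proof -
  let ?h = "\<lambda>t. exp (- C * t) * E t"
  have "\<exists>y. (?h has_real_derivative y) (at t) \<and> y \<le> 0" if "0 \<le> t" "t \<le> 1" for t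
  proof (intro exI conjI)
    show "(?h has_real_derivative (exp (- C * t) * (- C)) * E t + E' t * exp (- C * t)) (at t)"
      by (auto intro!: derivative_eq_intros d that)
    have "exp (- C * t) * (E' t - C * E t) \<le> 0" using le[OF that] by (intro mult_nonneg_nonpos) auto
    then show "(exp (- C * t) * (- C)) * E t + E' t * exp (- C * t) \<le> 0" by (simp add: algebra_simps)
  qed
  then have "?h 1 \<le> ?h 0" by (intro DERIV_nonpos_imp_nonincreasing[of 0 1 ?h]) auto
  then have "exp (- C) * E 1 \<le> 0" using 0 by simp
  then have "E 1 \<le> 0" by (simp add: mult_le_0_iff)
  then show ?thesis using pos by simp
qed

text \<open>Along the segment from \<open>u\<close> to \<open>x\<close> the energy, the sum of the
  squares of the \<open>Y a\<close>, satisfies \<open>E' \<le> const E\<close> by the derivative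
  bound and the Cauchy-Schwarz inequality, and it starts at zero.\<close>

lemma linear_system_unique:
  fixes Y :: "'i::finite \<Rightarrow> real^'n \<Rightarrow> real"
  assumes sm: "\<And>a. smooth_on U (Y a)" and B: "ball u r \<subseteq> U" and Y0: "\<And>a. Y a u = 0"
    and le: "\<And>i a x. x \<in> ball u r \<Longrightarrow> \<bar>pd i (Y a) x\<bar> \<le> C * (\<Sum>b\<in>UNIV. \<bar>Y b x\<bar>)" and x: "x \<in> ball u r"
  shows "Y a x = 0"
proof -
  define v where "v = x - u"
  have p: "u + t *\<^sub>R v \<in> ball u r" if "0 \<le> t" "t \<le> 1" for t
  proof -
    have "norm (t *\<^sub>R v) \<le> norm v" using that by (simp add: mult_left_le_one_le)
    then show ?thesis using x by (simp add: v_def dist_norm norm_minus_commute)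
  qed
  define E where "E t = (\<Sum>a\<in>UNIV. (Y a (u + t *\<^sub>R v))\<^sup>2)" for t
  define E' where "E' t = (\<Sum>a\<in>UNIV. 2 * Y a (u + t *\<^sub>R v) * dird v (Y a) (u + t *\<^sub>R v))" for t
  define n where "n = real CARD('i)"
  define V where "V = (\<Sum>i\<in>UNIV. \<bar>v $ i\<bar>)"
  have V0: "V \<ge> 0" by (simp add: V_def sum_nonneg)
  have C': "\<bar>dird v (Y a) y\<bar> \<le> V * \<bar>C\<bar> * (\<Sum>b\<in>UNIV. \<bar>Y b y\<bar>)" if y: "y \<in> ball u r" for a y
  proof -
    have "dird v (Y a) y = (\<Sum>i\<in>UNIV. v $ i * pd i (Y a) y)"
      using smooth_on_diff[OF sm] B y by (intro dird_eqI has_derivative_pd) auto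
    also have "\<bar>\<dots>\<bar> \<le> (\<Sum>i\<in>UNIV. \<bar>v $ i\<bar> * (\<bar>C\<bar> * (\<Sum>b\<in>UNIV. \<bar>Y b y\<bar>)))"
    proof (rule order.trans[OF sum_abs], rule sum_mono)
      fix i
      have "\<bar>pd i (Y a) y\<bar> \<le> C * (\<Sum>b\<in>UNIV. \<bar>Y b y\<bar>)" by (rule le[OF y])
      also have "\<dots> \<le> \<bar>C\<bar> * (\<Sum>b\<in>UNIV. \<bar>Y b y\<bar>)" by (intro mult_right_mono sum_nonneg) auto
      finally show "\<bar>v $ i * pd i (Y a) y\<bar> \<le> \<bar>v $ i\<bar> * (\<bar>C\<bar> * (\<Sum>b\<in>UNIV. \<bar>Y b y\<bar>))"
        unfolding abs_mult by (rule mult_left_mono) auto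
    qed
    finally show ?thesis by (simp add: V_def sum_distrib_right[symmetric] mult.assoc)
  qed
  have "E 1 = 0"
  proof (rule gronwall_zero[of E E' "2 * V * \<bar>C\<bar> * n"])
    fix t :: real assume t: "0 \<le> t" "t \<le> 1"
    have "((\<lambda>t. Y a (u + t *\<^sub>R v)) has_real_derivative dird v (Y a) (u + t *\<^sub>R v)) (at t)" for a
      using p[OF t] B by (intro has_real_derivative_line smooth_on_diff[OF sm]) auto
    then show "(E has_real_derivative E' t) (at t)"
      unfolding E_def[abs_def] E'_def by (auto intro!: derivative_eq_intros simp: algebra_simps)
    let ?S = "\<Sum>b\<in>UNIV. \<bar>Y b (u + t *\<^sub>R v)\<bar>"
    have "E' t \<le> (\<Sum>a\<in>UNIV. 2 * \<bar>Y a (u + t *\<^sub>R v)\<bar> * (V * \<bar>C\<bar> * ?S))"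
      unfolding E'_def
    proof (rule sum_mono)
      fix a
      have "2 * Y a (u + t *\<^sub>R v) * dird v (Y a) (u + t *\<^sub>R v) \<le> 2 * \<bar>Y a (u + t *\<^sub>R v)\<bar> * \<bar>dird v (Y a) (u + t *\<^sub>R v)\<bar>"
        by (metis abs_ge_self abs_mult abs_numeral)
      also have "\<dots> \<le> 2 * \<bar>Y a (u + t *\<^sub>R v)\<bar> * (V * \<bar>C\<bar> * ?S)"
        using C'[OF p[OF t]] by (intro mult_left_mono) auto
      finally show "2 * Y a (u + t *\<^sub>R v) * dird v (Y a) (u + t *\<^sub>R v) \<le> 2 * \<bar>Y a (u + t *\<^sub>R v)\<bar> * (V * \<bar>C\<bar> * ?S)" .
    qed
    also have "\<dots> = 2 * V * \<bar>C\<bar> * ?S\<^sup>2"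
      by (simp add: sum_distrib_left[symmetric] sum_distrib_right[symmetric] power2_eq_square mult_ac)
    also have "?S\<^sup>2 \<le> n * E t"
    proof -
      have "?S\<^sup>2 \<le> (\<Sum>b\<in>UNIV. \<bar>Y b (u + t *\<^sub>R v)\<bar>\<^sup>2) * (\<Sum>b\<in>(UNIV::'i set). 1\<^sup>2)"
        using Cauchy_Schwarz_ineq_sum[of "\<lambda>b. \<bar>Y b (u + t *\<^sub>R v)\<bar>" "\<lambda>b. 1" UNIV] by simp
      then show ?thesis by (simp add: E_def n_def mult.commute)
    qed
    finally show "E' t \<le> 2 * V * \<bar>C\<bar> * n * E t" using V0 by (simp add: mult_left_mono mult.assoc)
  next
    show "E 0 = 0" by (simp add: E_def Y0)
    show "E 1 \<ge> 0" by (simp add: E_def sum_nonneg)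
  qed
  then have "(Y a x)\<^sup>2 = 0"
    unfolding E_def v_def by (simp add: sum_nonneg_eq_0_iff)
  then show ?thesis by simp
qed

text \<open>The Lie derivative of \<open>g\<close> along \<open>K\<close> vanishes, in
  coordinates.\<close>

definition killing :: "(real^'n) set \<Rightarrow> (real^'n \<Rightarrow> real^'n^'n) \<Rightarrow> (real^'n \<Rightarrow> real^'n) \<Rightarrow> bool" where
  "killing W g K \<longleftrightarrow> (\<forall>w\<in>W. \<forall>i j. (\<Sum>l\<in>UNIV. K w $ l * pd l (\<lambda>y. g y $ i $ j) w
     + g w $ l $ j * pd i (\<lambda>y. K y $ l) w + g w $ i $ l * pd j (\<lambda>y. K y $ l) w) = 0)"

text \<open>Prolongation: the lowered field \<open>\<kappa>\<close> satisfies \<open>\<partial>\<^sub>i \<kappa>\<^sub>j + \<partial>\<^sub>j \<kappa>\<^sub>i = S\<^sub>i\<^sub>j\<close> with \<open>S\<close> linear in \<open>\<kappa>\<close>,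
  so all second derivatives of \<open>\<kappa>\<close> are linear in \<open>\<kappa>\<close> and \<open>\<partial>\<kappa>\<close>.\<close>

lemma killing_unique:
  fixes g :: "real^'n \<Rightarrow> real^'n^'n" and K :: "real^'n \<Rightarrow> real^'n"
  assumes g: "smooth_on W g" and sym: "\<And>w. w \<in> W \<Longrightarrow> transpose (g w) = g w"
    and det: "\<And>w. w \<in> W \<Longrightarrow> det (g w) \<noteq> 0" and K: "smooth_on W K" and kil: "killing W g K"
    and u: "u \<in> W" and K0: "K u = 0" and DK0: "\<And>i l. pd i (\<lambda>y. K y $ l) u = 0"
  obtains r where "r > 0" "ball u r \<subseteq> W" "\<And>x. x \<in> ball u r \<Longrightarrow> K x = 0"
proof -
  have o: "open W" using g smooth_on_open by blast
  define \<kappa> where "\<kappa> m w = (\<Sum>l\<in>UNIV. g w $ m $ l * K w $ l)" for m w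
  define gi where "gi w = matrix_inv (g w)" for w
  have s\<kappa>: "smooth_on W (\<kappa> m)" for m unfolding \<kappa>_def by (intro smooth_intros g K o finite)
  have sgi: "smooth_on W gi" unfolding gi_def by (rule smooth_on_matrix_inv[OF g det])
  have sg: "g w $ i $ j = g w $ j $ i" if "w \<in> W" for w i j
    using sym[OF that] by (simp add: vec_eq_iff transpose_def)
  have K\<kappa>: "K w $ l = (\<Sum>m\<in>UNIV. gi w $ l $ m * \<kappa> m w)" if w: "w \<in> W" for w l
  proof -
    have "gi w *v (g w *v K w) = K w"
      by (simp add: gi_def matrix_vector_mul_assoc matrix_inv_mult[OF det[OF w]])
    then have "K w $ l = (gi w *v (g w *v K w)) $ l" by simp
    then show ?thesis by (simp add: matrix_vector_mult_def \<kappa>_def)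
  qed
  \<comment> \<open>\<open>A i j l\<close> is twice a Christoffel symbol of the first kind;
    Killing's equation for the lowered field says that \<open>S i j\<close> is the sum of
    \<open>A i j l\<close> times \<open>K^l\<close>.\<close>
  define A where "A i j l w = pd i (\<lambda>y. g y $ j $ l) w + pd j (\<lambda>y. g y $ i $ l) w - pd l (\<lambda>y. g y $ i $ j) w" for i j l w
  define A' where "A' i j m w = (\<Sum>l\<in>UNIV. A i j l w * gi w $ l $ m)" for i j m w
  have sA': "smooth_on W (A' i j m)" for i j m
    unfolding A'_def A_def by (intro smooth_intros smooth_on_pd g sgi o finite)
  define S where "S i j w = pd i (\<kappa> j) w + pd j (\<kappa> i) w" for i j w
  have S: "S i j w = (\<Sum>m\<in>UNIV. A' i j m w * \<kappa> m w)" if w: "w \<in> W" for i j w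
  proof -
    have d: "(\<lambda>y. g y $ i $ j) differentiable (at w)" "(\<lambda>y. K y $ i) differentiable (at w)" for i j
      by (intro smooth_on_diff[OF _ w] smooth_intros g K)+
    have pk: "pd i (\<kappa> j) w = (\<Sum>l\<in>UNIV. g w $ j $ l * pd i (\<lambda>y. K y $ l) w + pd i (\<lambda>y. g y $ j $ l) w * K w $ l)" for i j
      unfolding \<kappa>_def[abs_def] using d by (simp add: pd_sum pd_mult)
    have "S i j w - (\<Sum>l\<in>UNIV. A i j l w * K w $ l) = (\<Sum>l\<in>UNIV. K w $ l * pd l (\<lambda>y. g y $ i $ j) w
     + g w $ l $ j * pd i (\<lambda>y. K y $ l) w + g w $ i $ l * pd j (\<lambda>y. K y $ l) w)"
      unfolding S_def pk sum.distrib[symmetric] sum_subtractf[symmetric]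
    proof (rule sum.cong[OF refl])
      fix l
      show "g w $ j $ l * pd i (\<lambda>y. K y $ l) w + pd i (\<lambda>y. g y $ j $ l) w * K w $ l
          + (g w $ i $ l * pd j (\<lambda>y. K y $ l) w + pd j (\<lambda>y. g y $ i $ l) w * K w $ l) - A i j l w * K w $ l =
        K w $ l * pd l (\<lambda>y. g y $ i $ j) w + g w $ l $ j * pd i (\<lambda>y. K y $ l) w + g w $ i $ l * pd j (\<lambda>y. K y $ l) w"
        using sg[OF w, of j l] by (simp add: A_def algebra_simps)
    qed
    also have "\<dots> = 0" using kil w by (simp add: killing_def)
    finally have "S i j w = (\<Sum>l\<in>UNIV. A i j l w * K w $ l)" by simp
    also have "\<dots> = (\<Sum>l\<in>UNIV. \<Sum>m\<in>UNIV. A i j l w * gi w $ l $ m * \<kappa> m w)"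
      unfolding K\<kappa>[OF w] by (simp add: sum_distrib_left mult.assoc)
    also have "\<dots> = (\<Sum>m\<in>UNIV. \<Sum>l\<in>UNIV. A i j l w * gi w $ l $ m * \<kappa> m w)" by (rule sum.swap)
    finally show ?thesis by (simp add: A'_def sum_distrib_right)
  qed
  have dS: "pd k (S i j) w = (\<Sum>m\<in>UNIV. A' i j m w * pd k (\<kappa> m) w + pd k (A' i j m) w * \<kappa> m w)" if w: "w \<in> W" for i j k w
  proof -
    have d: "A' i j m differentiable (at w)" "\<kappa> m differentiable (at w)" for m
      using smooth_on_diff[OF sA' w] smooth_on_diff[OF s\<kappa> w] by auto
    have "pd k (S i j) w = pd k (\<lambda>w. \<Sum>m\<in>UNIV. A' i j m w * \<kappa> m w) w"
      by (rule pd_cong_open[OF o S w])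
    also have "\<dots> = (\<Sum>m\<in>UNIV. A' i j m w * pd k (\<kappa> m) w + pd k (A' i j m) w * \<kappa> m w)"
      using d by (simp add: pd_sum pd_mult)
    finally show ?thesis .
  qed
  \<comment> \<open>The alternating sum that isolates the Christoffel symbols from the derivatives
    of a metric also isolates \<open>\<partial>_i \<partial>_j \<kappa>_k\<close> from those of
    \<open>S\<close>.\<close>
  have dd: "pd i (pd j (\<kappa> k)) w = (1/2) * (pd i (S j k) w + pd j (S i k) w - pd k (S i j) w)" if w: "w \<in> W" for i j k w
  proof -
    have d: "pd j (\<kappa> k) differentiable (at w)" for j k by (intro smooth_on_diff[OF smooth_on_pd[OF s\<kappa>] w])
    have e: "pd i (S j k) w = pd i (pd j (\<kappa> k)) w + pd i (pd k (\<kappa> j)) w" for i j k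
      unfolding S_def[abs_def] using d by (simp add: pd_add)
    have c: "pd j (pd i (\<kappa> k)) w = pd i (pd j (\<kappa> k)) w" "pd k (pd i (\<kappa> j)) w = pd i (pd k (\<kappa> j)) w"
      "pd k (pd j (\<kappa> i)) w = pd j (pd k (\<kappa> i)) w"
      by (rule pd_commute[OF s\<kappa> w])+
    show ?thesis unfolding e c by simp
  qed
  obtain r where r: "r > 0" "cball u r \<subseteq> W" using o u open_contains_cball by blast
  have bd: "\<exists>C. \<forall>x\<in>cball u r. \<bar>f x\<bar> \<le> C" if "smooth_on W f" for f :: "real^'n \<Rightarrow> real"
  proof -
    have "continuous_on (cball u r) f" using smooth_on_continuous[OF that] r continuous_on_subset by blast
    then have "bounded (f ` cball u r)" using compact_cball compact_continuous_image compact_imp_bounded by blast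
    then show ?thesis unfolding bounded_iff by (metis image_eqI real_norm_def)
  qed
  \<comment> \<open>One constant for the finitely many coefficients and their first derivatives on
    the compact ball.\<close>
  have "\<exists>C. \<forall>i j k m. \<forall>x\<in>cball u r. \<bar>A' i j m x\<bar> \<le> C \<and> \<bar>pd k (A' i j m) x\<bar> \<le> C"
  proof -
    have "\<forall>t. \<exists>C. \<forall>x\<in>cball u r. (case t of (i, j, k, m) \<Rightarrow> \<bar>A' i j m x\<bar> \<le> C \<and> \<bar>pd k (A' i j m) x\<bar> \<le> C)"
    proof
      fix t :: "'n \<times> 'n \<times> 'n \<times> 'n"
      obtain i j k m where t: "t = (i, j, k, m)" by (cases t) auto
      obtain C1 C2 where "\<forall>x\<in>cball u r. \<bar>A' i j m x\<bar> \<le> C1" "\<forall>x\<in>cball u r. \<bar>pd k (A' i j m) x\<bar> \<le> C2"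
        using bd[OF sA'] bd[OF smooth_on_pd[OF sA']] by metis
      then have "\<forall>x\<in>cball u r. \<bar>A' i j m x\<bar> \<le> max C1 C2 \<and> \<bar>pd k (A' i j m) x\<bar> \<le> max C1 C2"
        by (auto simp: le_max_iff_disj)
      then show "\<exists>C. \<forall>x\<in>cball u r. (case t of (i, j, k, m) \<Rightarrow> \<bar>A' i j m x\<bar> \<le> C \<and> \<bar>pd k (A' i j m) x\<bar> \<le> C)"
        unfolding t by auto
    qed
    then have "\<exists>Cf. \<forall>t. \<forall>x\<in>cball u r. (case t of (i, j, k, m) \<Rightarrow> \<bar>A' i j m x\<bar> \<le> Cf t \<and> \<bar>pd k (A' i j m) x\<bar> \<le> Cf t)"
      by (rule choice)
    then obtain Cf where Cf: "\<And>t x. x \<in> cball u r \<Longrightarrow> (case t of (i, j, k, m) \<Rightarrow> \<bar>A' i j m x\<bar> \<le> Cf t \<and> \<bar>pd k (A' i j m) x\<bar> \<le> Cf t)"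
      by blast
    have m: "Cf t \<le> (\<Sum>t\<in>UNIV. \<bar>Cf t\<bar>)" for t
      using member_le_sum[of t UNIV "\<lambda>t. \<bar>Cf t\<bar>"] by simp
    show ?thesis
    proof (rule exI[of _ "\<Sum>t\<in>UNIV. \<bar>Cf t\<bar>"], intro allI ballI)
      fix i j k m x assume x: "x \<in> cball u r"
      have "\<bar>A' i j m x\<bar> \<le> Cf (i, j, k, m) \<and> \<bar>pd k (A' i j m) x\<bar> \<le> Cf (i, j, k, m)"
        using Cf[OF x, of "(i, j, k, m)"] by simp
      then show "\<bar>A' i j m x\<bar> \<le> (\<Sum>t\<in>UNIV. \<bar>Cf t\<bar>) \<and> \<bar>pd k (A' i j m) x\<bar> \<le> (\<Sum>t\<in>UNIV. \<bar>Cf t\<bar>)"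
        using m[of "(i, j, k, m)"] by linarith
    qed
  qed
  then obtain C0 where C0: "\<And>i j k m x. x \<in> cball u r \<Longrightarrow> \<bar>A' i j m x\<bar> \<le> C0 \<and> \<bar>pd k (A' i j m) x\<bar> \<le> C0" by blast
  define C where "C = max 1 C0"
  have C: "C \<ge> 1" and CA: "x \<in> cball u r \<Longrightarrow> \<bar>A' i j m x\<bar> \<le> C" "x \<in> cball u r \<Longrightarrow> \<bar>pd k (A' i j m) x\<bar> \<le> C" for i j k m x
    using C0[of x i j m k] by (auto simp: C_def)
  \<comment> \<open>The unknowns of the prolonged system: \<open>None\<close> labels the field,
    \<open>Some n\<close> its derivative in direction \<open>n\<close>.\<close>
  define Y where "Y = (\<lambda>(a :: 'n option, m). case a of None \<Rightarrow> \<kappa> m | Some n \<Rightarrow> pd n (\<kappa> m))"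
  have Y: "Y (None, m) = \<kappa> m" "Y (Some n, m) = pd n (\<kappa> m)" for n m by (simp_all add: Y_def)
  define N where "N x = (\<Sum>b\<in>UNIV. \<bar>Y b x\<bar>)" for x
  have YN: "\<bar>Y b x\<bar> \<le> N x" for b x
    unfolding N_def by (rule member_le_sum) auto
  have N2: "(\<Sum>m\<in>UNIV. \<bar>pd k (\<kappa> m) x\<bar> + \<bar>\<kappa> m x\<bar>) \<le> N x" for k x
  proof -
    have "(\<Sum>m\<in>UNIV. \<bar>pd k (\<kappa> m) x\<bar> + \<bar>\<kappa> m x\<bar>) = (\<Sum>m\<in>UNIV. \<Sum>a\<in>{None, Some k}. \<bar>Y (a, m) x\<bar>)"
      by (simp add: Y add.commute)
    also have "\<dots> \<le> (\<Sum>m\<in>UNIV. \<Sum>a\<in>UNIV. \<bar>Y (a, m) x\<bar>)" by (intro sum_mono sum_mono2) auto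
    also have "\<dots> = (\<Sum>a\<in>UNIV. \<Sum>m\<in>UNIV. \<bar>Y (a, m) x\<bar>)" by (rule sum.swap)
    also have "\<dots> = N x" unfolding N_def by (simp add: sum.cartesian_product UNIV_Times_UNIV[symmetric] del: UNIV_Times_UNIV)
    finally show ?thesis .
  qed
  have bS: "\<bar>pd k (S i j) x\<bar> \<le> C * N x" if x: "x \<in> cball u r" for i j k x
  proof -
    have "\<bar>pd k (S i j) x\<bar> \<le> (\<Sum>m\<in>UNIV. C * (\<bar>pd k (\<kappa> m) x\<bar> + \<bar>\<kappa> m x\<bar>))"
      unfolding dS[OF subsetD[OF r(2) x]]
    proof (rule order.trans[OF sum_abs], rule sum_mono)
      fix m
      have "\<bar>A' i j m x * pd k (\<kappa> m) x + pd k (A' i j m) x * \<kappa> m x\<bar> \<le> \<bar>A' i j m x\<bar> * \<bar>pd k (\<kappa> m) x\<bar> + \<bar>pd k (A' i j m) x\<bar> * \<bar>\<kappa> m x\<bar>"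
        by (metis abs_mult abs_triangle_ineq)
      also have "\<dots> \<le> C * \<bar>pd k (\<kappa> m) x\<bar> + C * \<bar>\<kappa> m x\<bar>"
        using CA[OF x] by (intro add_mono mult_right_mono) auto
      finally show "\<bar>A' i j m x * pd k (\<kappa> m) x + pd k (A' i j m) x * \<kappa> m x\<bar> \<le> C * (\<bar>pd k (\<kappa> m) x\<bar> + \<bar>\<kappa> m x\<bar>)"
        by (simp add: distrib_left)
    qed
    also have "\<dots> \<le> C * N x" unfolding sum_distrib_left[symmetric] using N2 C by (intro mult_left_mono) auto
    finally show ?thesis .
  qed
  have le: "\<bar>pd i (Y a) x\<bar> \<le> (2 * C) * N x" if x: "x \<in> ball u r" for i a x
  proof -
    have xc: "x \<in> cball u r" using x by auto
    have N0: "N x \<ge> 0" unfolding N_def by (intro sum_nonneg) auto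
    obtain b m where a: "a = (b, m)" by (cases a)
    show ?thesis
    proof (cases b)
      case None
      have "\<bar>pd i (\<kappa> m) x\<bar> \<le> N x" using YN[of "(Some i, m)" x] by (simp add: Y)
      also have "\<dots> \<le> (2 * C) * N x" using mult_right_mono[of 1 "2 * C" "N x"] C N0 by simp
      finally show ?thesis by (simp add: a None Y)
    next
      case (Some j)
      have "\<bar>pd i (pd j (\<kappa> m)) x\<bar> \<le> (1/2) * (C * N x + C * N x + C * N x)"
        unfolding dd[OF subsetD[OF r(2) xc]]
        using bS[OF xc, of i j m] bS[OF xc, of j i m] bS[OF xc, of m i j] by (simp add: abs_le_iff)
      also have "\<dots> \<le> (2 * C) * N x" using C N0 by simp
      finally show ?thesis by (simp add: a Some Y)
    qed
  qed
  have Y0: "Y a u = 0" for a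
  proof -
    obtain b m where a: "a = (b, m)" by (cases a)
    have d: "(\<lambda>y. g y $ i $ j) differentiable (at u)" "(\<lambda>y. K y $ i) differentiable (at u)" for i j
      by (intro smooth_on_diff[OF _ u] smooth_intros g K)+
    have "pd i (\<kappa> j) u = 0" for i j
      unfolding \<kappa>_def[abs_def] using d by (simp add: pd_sum pd_mult K0 DK0)
    then show ?thesis by (cases b) (simp_all add: a Y \<kappa>_def K0)
  qed
  have sY: "smooth_on W (Y a)" for a
    using s\<kappa> smooth_on_pd[OF s\<kappa>] by (cases a; cases "fst a") (auto simp: Y)
  have "K x = 0" if x: "x \<in> ball u r" for x
  proof -
    have "ball u r \<subseteq> W" using r(2) by (meson ball_subset_cball order.trans)
    then have "Y (None, m) x = 0" for m
      using linear_system_unique[OF sY _ Y0 le[unfolded N_def] x] by blast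
    then have "\<kappa> m x = 0" for m by (simp add: Y)
    moreover have "x \<in> W" using x r(2) by auto
    ultimately show ?thesis using K\<kappa> by (simp add: vec_eq_iff)
  qed
  then show ?thesis using that[of r] r by (meson ball_subset_cball order.trans)
qed

section \<open>The toric action\<close>

lemma dird_slice:
  fixes f :: "'p::euclidean_space \<times> (real^'n) \<Rightarrow> real"
  assumes "smooth_on U f" "(s, y) \<in> U"
  shows "pd i (\<lambda>y. f (s, y)) y = dird (0, axis i 1) f (s, y)"
proof -
  have "((\<lambda>y. (s, y)) has_derivative (\<lambda>v. (0, v))) (at y)"
    by (intro derivative_eq_intros) auto
  from has_derivative_compose[of _ _ y UNIV f, simplified, OF this smooth_on_has_derivative[OF assms]]
  show ?thesis unfolding pd_eq_dird by (rule dird_eqI)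
qed

lemma dird_nth: "f differentiable (at x) \<Longrightarrow> dird v (\<lambda>y. f y $ i) x = dird v f x $ i"
  by (rule dird_eqI) (rule bounded_linear.has_derivative[OF bounded_linear_vec_nth has_derivative_dird])

lemma dird_mult:
  fixes f g :: "'a::euclidean_space \<Rightarrow> real"
  shows "f differentiable (at x) \<Longrightarrow> g differentiable (at x) \<Longrightarrow>
   dird v (\<lambda>y. f y * g y) x = f x * dird v g x + dird v f x * g x"
  by (intro dird_eqI has_derivative_mult has_derivative_dird)

lemma dird_sum:
  "(\<And>k. k \<in> I \<Longrightarrow> f k differentiable (at x)) \<Longrightarrow> dird v (\<lambda>y. \<Sum>k\<in>I. f k y) x = (\<Sum>k\<in>I. dird v (f k) x)"
  by (intro dird_eqI has_derivative_sum has_derivative_dird)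

lemma posdef_det:
  fixes M :: "real^'n^'n"
  assumes "\<And>v. v \<noteq> 0 \<Longrightarrow> v \<bullet> (M *v v) > 0" shows "det M \<noteq> 0"
proof -
  have "M *v v = 0 \<Longrightarrow> v = 0" for v using assms[of v] by force
  then have "\<exists>B. B ** M = mat 1" using matrix_left_invertible_ker by blast
  then show ?thesis by (metis invertible_det_nz invertible_left_inverse)
qed

locale toric_orbifold =
  fixes X :: "'x topology" and A :: "'x chart set" and \<omega> Jc :: "'x field2"
    and act :: "real^2 \<Rightarrow> 'x \<Rightarrow> 'x" and \<phi> :: "'x \<Rightarrow> real^2"
  assumes kaehler_toric: "kaehler_toric_orbifold X A \<omega> Jc act \<phi>"
begin

lemma orb: "orbifold X A" and conn: "connected_space X" and kael: "kaehler_structure A \<omega> Jc"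
  and tor: "torus_action X A act" and mom: "moment_map X A \<omega> act \<phi>"
  and inv_\<omega>: "form_invariant A (act t) \<omega>" and inv_J: "endo_invariant A (act t) Jc"
  using kaehler_toric by (auto simp: kaehler_toric_orbifold_def)

lemma chart: "c \<in> A \<Longrightarrow> orbifold_chart X c"
  using orb by (auto simp: orbifold_def)

lemma open_cdom: "c \<in> A \<Longrightarrow> open (cdom c)"
  using chart by (auto simp: orbifold_chart_def)

lemma cproj_in: "c \<in> A \<Longrightarrow> u \<in> cdom c \<Longrightarrow> cproj c u \<in> topspace X"
  using chart[of c] by (auto simp: orbifold_chart_def continuous_map_def)

lemma cproj_open: "c \<in> A \<Longrightarrow> open U \<Longrightarrow> U \<subseteq> cdom c \<Longrightarrow> openin X (cproj c ` U)"
  using chart[of c] by (auto simp: orbifold_chart_def open_map_def openin_open_eq)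

lemma cproj_vimage_open:
  assumes "c \<in> A" "openin X U" shows "open {u \<in> cdom c. cproj c u \<in> U}"
proof -
  have "openin (top_of_set (cdom c)) {u \<in> topspace (top_of_set (cdom c)). cproj c u \<in> U}"
    using chart[OF assms(1)] assms(2) by (intro openin_continuous_map_preimage) (auto simp: orbifold_chart_def)
  then show ?thesis using open_cdom[OF assms(1)] by (simp add: openin_open_eq)
qed

lemma charts_cover: "p \<in> topspace X \<Longrightarrow> \<exists>c\<in>A. \<exists>u\<in>cdom c. cproj c u = p"
proof -
  assume "p \<in> topspace X"
  then have "p \<in> (\<Union>c\<in>A. cproj c ` cdom c)" using orb by (simp add: orbifold_def)
  then show ?thesis by auto
qed

lemma smooth_\<phi>: "c \<in> A \<Longrightarrow> smooth_on (cdom c) (\<lambda>u. \<phi> (cproj c u))"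
  using mom by (auto simp: moment_map_def o_def)

text \<open>The metric of the given Kaehler structure, to be distinguished from the metric
  \<open>g\<close> of the theorem. Its invariance under the action is inherited from
  \<open>\<omega>\<close> and \<open>Jc\<close>.\<close>

definition gk where "gk c u = \<omega> c u ** Jc c u"

lemma gk: "c \<in> A \<Longrightarrow> smooth_on (cdom c) (gk c)"
  "c \<in> A \<Longrightarrow> u \<in> cdom c \<Longrightarrow> transpose (gk c u) = gk c u"
  "c \<in> A \<Longrightarrow> u \<in> cdom c \<Longrightarrow> det (gk c u) \<noteq> 0"
proof -
  assume c: "c \<in> A"
  have r: "riemannian_metric A (\<lambda>c u. \<omega> c u ** Jc c u)" using kael by (simp add: kaehler_structure_def)
  have e: "gk c = (\<lambda>u. \<omega> c u ** Jc c u)" by (simp add: gk_def fun_eq_iff)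
  show "smooth_on (cdom c) (gk c)" unfolding e using r c by (simp add: riemannian_metric_def)
  show "u \<in> cdom c \<Longrightarrow> transpose (gk c u) = gk c u" using r c by (simp add: riemannian_metric_def gk_def)
  show "u \<in> cdom c \<Longrightarrow> det (gk c u) \<noteq> 0" using r c by (intro posdef_det) (simp add: riemannian_metric_def gk_def)
qed

lemma gk_invariant:
  assumes "c \<in> A" "W \<subseteq> cdom c" "is_lift (act s \<circ> cproj c) c W h" "w \<in> W"
  shows "transpose (jacobian h (at w)) ** gk c (h w) ** jacobian h (at w) = gk c w"
proof -
  have 1: "transpose (jacobian h (at w)) ** \<omega> c (h w) ** jacobian h (at w) = \<omega> c w"
    using inv_\<omega>[of s] assms by (auto simp: form_invariant_def)
  have 2: "jacobian h (at w) ** Jc c w = Jc c (h w) ** jacobian h (at w)"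
    using inv_J[of s] assms by (auto simp: endo_invariant_def)
  have "transpose (jacobian h (at w)) ** gk c (h w) ** jacobian h (at w) =
    transpose (jacobian h (at w)) ** \<omega> c (h w) ** (Jc c (h w) ** jacobian h (at w))"
    by (simp add: gk_def matrix_mul_assoc)
  also have "\<dots> = gk c w" unfolding 2[symmetric] by (simp add: matrix_mul_assoc 1 gk_def)
  finally show ?thesis .
qed

text \<open>The lift provided by the definition of a torus action is the identity at time zero only up to a
  local group element; composing with its inverse normalizes it.\<close>

lemma local_flow:
  assumes c: "c \<in> A" and u: "u \<in> cdom c"
  obtains N V F where "open N" "(0::real^2) \<in> N" "open V" "u \<in> V" "V \<subseteq> cdom c"
    "smooth_on (N \<times> V) (\<lambda>(s, w). F s w)" "\<And>s. s \<in> N \<Longrightarrow> is_lift (act s \<circ> cproj c) c V (F s)"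
    "\<And>w. w \<in> V \<Longrightarrow> F 0 w = w"
proof -
  have z: "0 \<in> period_lattice" by (auto simp: period_lattice_def intro: exI[of _ 0])
  have act0: "act 0 (cproj c w) = cproj c w" if "w \<in> cdom c" for w
    using tor z cproj_in[OF c that] by (auto simp: torus_action_def)
  obtain N W F where N: "open N" "0 \<in> N" and W: "u \<in> W" "W \<subseteq> cdom c"
    and F: "smooth_on (N \<times> W) (\<lambda>(s, w). F s w)" "F 0 u = u" "\<And>s. s \<in> N \<Longrightarrow> is_lift (act s \<circ> cproj c) c W (F s)"
    using tor[unfolded torus_action_def, THEN conjunct2, THEN conjunct2, THEN conjunct2, rule_format, OF c c u u act0[OF u]]
    by blast
  have oW: "open W" using F(3)[OF N(2)] by (simp add: is_lift_def)
  have l0: "smooth_on W (F 0)" "det (jacobian (F 0) (at u)) \<noteq> 0" "F 0 ` W \<subseteq> cdom c"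
    "\<And>w. w \<in> W \<Longrightarrow> cproj c (F 0 w) = cproj c w"
    using F(3)[OF N(2)] W act0 by (auto simp: is_lift_def)
  obtain U' V k where k: "open U'" "U' \<subseteq> W" "u \<in> U'" "open V" "homeomorphism U' V (F 0) k" "smooth_on V k"
    "\<And>y. y \<in> V \<Longrightarrow> det (jacobian k (at y)) \<noteq> 0"
    using smooth_local_inverse[OF l0(1) W(1) l0(2)] by metis
  have kV: "k w \<in> U'" "F 0 (k w) = w" if "w \<in> V" for w
    using k(5) that by (auto simp: homeomorphism_def)
  have uV: "u \<in> V" using k(5) k(3) F(2) by (metis homeomorphism_image1 imageI)
  have Vc: "V \<subseteq> cdom c"
  proof
    fix w assume w: "w \<in> V"
    then have "F 0 (k w) \<in> cdom c" using l0(3) kV(1) k(2) by blast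
    then show "w \<in> cdom c" using kV(2)[OF w] by simp
  qed
  have kc: "cproj c (k w) = cproj c w" if "w \<in> V" for w
    using l0(4)[of "k w"] kV[OF that] k(2) by auto
  show ?thesis
  proof (rule that[of N V "\<lambda>s w. F s (k w)"])
    show "open N" "0 \<in> N" "open V" "u \<in> V" "V \<subseteq> cdom c" by (fact N k(4) uV Vc)+
    have oNV: "open (N \<times> V)" by (rule open_Times[OF N(1) k(4)])
    have "smooth_on (N \<times> V) (\<lambda>p. (\<lambda>(s, w). F s w) (fst p, k (snd p)))"
    proof (rule smooth_on_compose[OF F(1)])
      have "smooth_on (N \<times> V) (\<lambda>p. k (snd p))"
        by (rule smooth_on_compose[OF k(6)]) (auto intro!: smooth_intros oNV)
      then show "smooth_on (N \<times> V) (\<lambda>p. (fst p, k (snd p)))"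
        by (intro smooth_intros oNV)
      show "(\<lambda>p. (fst p, k (snd p))) ` (N \<times> V) \<subseteq> N \<times> W" using kV k(2) by auto
    qed
    then show "smooth_on (N \<times> V) (\<lambda>(s, w). F s (k w))" by (simp add: case_prod_beta')
    show "F 0 (k w) = w" if "w \<in> V" for w using kV[OF that] by simp
    show "is_lift (act s \<circ> cproj c) c V (\<lambda>w. F s (k w))" if s: "s \<in> N" for s
    proof -
      have L: "smooth_on W (F s)" "inj_on (F s) W" "\<And>w. w \<in> W \<Longrightarrow> det (jacobian (F s) (at w)) \<noteq> 0"
        "F s ` W \<subseteq> cdom c" "\<And>w. w \<in> W \<Longrightarrow> cproj c (F s w) = act s (cproj c w)"
        using F(3)[OF s] by (auto simp: is_lift_def)
      have kW: "k w \<in> W" if "w \<in> V" for w using kV[OF that] k(2) by auto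
      have "smooth_on V (\<lambda>w. F s (k w))" by (rule smooth_on_compose[OF L(1) k(6)]) (use kW in auto)
      moreover have "inj_on (\<lambda>w. F s (k w)) V"
      proof (rule inj_onI)
        fix w w' assume w: "w \<in> V" "w' \<in> V" "F s (k w) = F s (k w')"
        have "k w = k w'" by (rule inj_onD[OF L(2) w(3) kW[OF w(1)] kW[OF w(2)]])
        then have "F 0 (k w) = F 0 (k w')" by (rule arg_cong)
        then show "w = w'" unfolding kV(2)[OF w(1)] kV(2)[OF w(2)] .
      qed
      moreover have "det (jacobian (\<lambda>w. F s (k w)) (at w)) \<noteq> 0" if w: "w \<in> V" for w
        unfolding jacobian_compose[OF smooth_on_diff[OF k(6) w] smooth_on_diff[OF L(1) kW[OF w]]]
        using L(3)[OF kW[OF w]] k(7)[OF w] by (simp add: det_mul)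
      ultimately show ?thesis using k(4) L(4,5) kW kc by (auto simp: is_lift_def)
    qed
  qed
qed

text \<open>\<open>K\<close> is the velocity at time zero of the local flow in direction
  \<open>\<nu>\<close>. The gradient formula extends the moment map condition linearly from the axes
  to \<open>\<nu>\<close>; Killing's equation is the derivative at time zero of the invariance of
  \<open>gk\<close>.\<close>

lemma killing_field:
  assumes c: "c \<in> A" and u: "u \<in> cdom c"
  obtains V K where "open V" "u \<in> V" "V \<subseteq> cdom c" "smooth_on V K" "killing V (gk c) K"
    "\<And>w v. w \<in> V \<Longrightarrow> dird v (\<lambda>y. \<phi> (cproj c y) \<bullet> \<nu>) w = v \<bullet> (\<omega> c w *v K w)"
proof -
  obtain N V F where N: "open N" "(0::real^2) \<in> N" and V: "open V" "u \<in> V" "V \<subseteq> cdom c"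
    and F: "smooth_on (N \<times> V) (\<lambda>(s, w). F s w)" and L: "\<And>s. s \<in> N \<Longrightarrow> is_lift (act s \<circ> cproj c) c V (F s)"
    and F0: "\<And>w. w \<in> V \<Longrightarrow> F 0 w = w"
    using local_flow[OF c u] by metis
  define FF where "FF = (\<lambda>(s, w). F s w)"
  have FF: "FF (s, w) = F s w" for s w by (simp add: FF_def)
  have sF: "smooth_on (N \<times> V) FF" using F by (simp add: FF_def)
  have o: "open (N \<times> V)" using N V by (intro open_Times)
  have sFi: "smooth_on (N \<times> V) (\<lambda>p. FF p $ i)" for i by (intro smooth_intros sF)
  have mem: "(0, w) \<in> N \<times> V" if "w \<in> V" for w using N that by simp
  define K where "K w = dird (\<nu>, 0) FF (0, w)" for w
  have sK: "smooth_on V K" unfolding K_def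
    by (rule smooth_on_compose[OF smooth_on_dird[OF sF]]) (use N V in \<open>auto intro!: smooth_intros\<close>)
  have grad: "dird v (\<lambda>y. \<phi> (cproj c y) \<bullet> \<nu>) w = v \<bullet> (\<omega> c w *v K w)" if w: "w \<in> V" for w v
  proof -
    have wc: "w \<in> cdom c" using w V by auto
    have d: "(\<lambda>y. \<phi> (cproj c y) $ a) differentiable (at w)" for a
      by (intro smooth_on_diff[OF _ wc] smooth_intros smooth_\<phi>[OF c])
    have vd: "vector_derivative (\<lambda>s. F (s *\<^sub>R e) w) (at 0) = dird (e, 0) FF (0, w)" for e
    proof (rule vector_derivative_at)
      have "((\<lambda>s. (s *\<^sub>R e, w)) has_derivative (\<lambda>h. (h *\<^sub>R e, 0))) (at 0)"
        by (intro derivative_eq_intros) auto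
      moreover have "(FF has_derivative (\<lambda>v. dird v FF (0, w))) (at ((0::real) *\<^sub>R e, w))"
        using smooth_on_has_derivative[OF sF mem[OF w]] by simp
      ultimately have "((\<lambda>s. FF (s *\<^sub>R e, w)) has_derivative (\<lambda>h. dird (h *\<^sub>R e, 0) FF (0, w))) (at 0)"
        by (rule has_derivative_compose)
      moreover have "dird (h *\<^sub>R e, 0) FF (0, w) = h *\<^sub>R dird (e, 0) FF (0, w)" for h
        using linear_cmul[OF dird_linear[OF smooth_on_diff[OF sF mem[OF w]]], of h "(e, 0)"] by simp
      ultimately show "((\<lambda>s. F (s *\<^sub>R e) w) has_vector_derivative dird (e, 0) FF (0, w)) (at 0)"
        by (simp add: has_vector_derivative_def FF)
    qed
    have m: "frechet_derivative (\<lambda>y. \<phi> (cproj c y) $ a) (at w) v = v \<bullet> (\<omega> c w *v dird (axis a 1, 0) FF (0, w))" for a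
    proof -
      have "open N \<and> 0 \<in> N \<and> V \<subseteq> cdom c \<and> smooth_on (N \<times> V) (\<lambda>(s, w). F s w) \<and>
        (\<forall>s\<in>N. is_lift (act s \<circ> cproj c) c V (F s)) \<and> (\<forall>w\<in>V. F 0 w = w)"
        using N V F L F0 by blast
      from mom[unfolded moment_map_def, THEN conjunct2, THEN conjunct2, rule_format, OF c this w]
      show ?thesis unfolding vd .
    qed
    have "((\<lambda>y. \<Sum>a\<in>UNIV. \<phi> (cproj c y) $ a * \<nu> $ a) has_derivative
       (\<lambda>v. \<Sum>a\<in>UNIV. dird v (\<lambda>y. \<phi> (cproj c y) $ a) w * \<nu> $ a)) (at w)"
      by (intro has_derivative_sum has_derivative_mult_left has_derivative_dird d)
    from dird_eqI[OF this] have "dird v (\<lambda>y. \<phi> (cproj c y) \<bullet> \<nu>) w =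
       (\<Sum>a\<in>UNIV. v \<bullet> (\<omega> c w *v dird (axis a 1, 0) FF (0, w)) * \<nu> $ a)"
      by (simp add: inner_vec_def[of "\<phi> _"] dird_def[of v "\<lambda>y. \<phi> (cproj c y) $ _"] m)
    also have "\<dots> = v \<bullet> (\<omega> c w *v (\<Sum>a\<in>UNIV. \<nu> $ a *\<^sub>R dird (axis a 1, 0) FF (0, w)))"
      by (simp add: linear_sum[OF matrix_vector_mul_linear] inner_sum_right matrix_vector_mult_scaleR mult.commute)
    also have "(\<Sum>a\<in>UNIV. \<nu> $ a *\<^sub>R dird (axis a 1, 0) FF (0, w)) = K w"
    proof -
      have "(\<Sum>a\<in>UNIV. \<nu> $ a *\<^sub>R (axis a 1 :: real^2, 0 :: real^4)) = (\<nu>, 0)"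
        by (simp add: sum_2 vec_eq_iff forall_2 axis_def)
      then show ?thesis unfolding K_def
        using dird_lincomb[OF smooth_on_diff[OF sF mem[OF w]], of "\<lambda>a. \<nu> $ a" "\<lambda>a. (axis a 1, 0)" UNIV] by simp
    qed
    finally show ?thesis .
  qed
  have "killing V (gk c) K"
    unfolding killing_def
  proof (intro ballI allI)
    fix w i j assume w: "w \<in> V"
    define b where "b a i P = dird (0, axis i 1) (\<lambda>p. FF p $ a) P" for a i P
    have sb: "smooth_on (N \<times> V) (b a i)" for a i
      unfolding b_def by (rule smooth_on_dird[OF sFi])
    have jb: "jacobian (F s) (at w) $ a $ i = b a i (s, w)" if s: "s \<in> N" "w \<in> V" for s w a i
    proof -
      have "F s differentiable (at w)" using L[OF s(1)] smooth_on_diff s(2) by (auto simp: is_lift_def)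
      from pd_component[OF this] have "jacobian (F s) (at w) $ a $ i = pd i (\<lambda>y. F s y $ a) w" by simp
      also have "\<dots> = b a i (s, w)"
        using dird_slice[OF sFi, of s w i a] s by (simp add: b_def FF)
      finally show ?thesis .
    qed
    have FFc: "FF P \<in> cdom c" if "P \<in> N \<times> V" for P
    proof -
      obtain s w where P: "P = (s, w)" by (cases P)
      then have "is_lift (act s \<circ> cproj c) c V (F s)" "w \<in> V" using L that by auto
      then show ?thesis unfolding P FF by (auto simp: is_lift_def)
    qed
    have sg: "smooth_on (N \<times> V) (\<lambda>P. gk c (FF P) $ a $ b)" for a b
      by (intro smooth_intros smooth_on_compose[OF gk(1)[OF c] sF]) (use FFc in auto)
    have id: "(\<Sum>a\<in>UNIV. \<Sum>a'\<in>UNIV. b a i P * gk c (FF P) $ a $ a' * b a' j P) = gk c (snd P) $ i $ j"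
      if P: "P \<in> N \<times> V" for P
    proof -
      obtain s w where Pe: "P = (s, w)" and s: "s \<in> N" "w \<in> V" using P by auto
      have "transpose (jacobian (F s) (at w)) ** gk c (F s w) ** jacobian (F s) (at w) = gk c w"
        by (rule gk_invariant[OF c V(3) L[OF s(1)] s(2)])
      then have "(transpose (jacobian (F s) (at w)) ** gk c (F s w) ** jacobian (F s) (at w)) $ i $ j = gk c w $ i $ j"
        by simp
      then show ?thesis
        unfolding Pe snd_conv FF
        by (simp add: matrix_matrix_mult_def transpose_def sum_distrib_right jb[OF s]) (subst sum.swap, simp)
    qed
    have P0: "(0, w) \<in> N \<times> V" by (rule mem[OF w])
    have dif: "b a i differentiable (at (0, w))" "(\<lambda>P. gk c (FF P) $ a $ a') differentiable (at (0, w))" for a a' i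
      using smooth_on_diff[OF sb P0] smooth_on_diff[OF sg P0] by auto
    have b0: "b a i (0, w) = (if a = i then 1 else 0)" for a i
    proof -
      have "b a i (0, w) = pd i (\<lambda>y. F 0 y $ a) w"
        using dird_slice[OF sFi P0] by (simp add: b_def FF)
      also have "\<dots> = pd i (\<lambda>y. y $ a) w"
        by (rule pd_cong_open[OF V(1) _ w]) (simp add: F0)
      also have "\<dots> = axis i 1 $ a"
        unfolding pd_eq_dird by (rule dird_eqI[OF bounded_linear_imp_has_derivative[OF bounded_linear_vec_nth]])
      finally show ?thesis by (simp add: axis_def)
    qed
    \<comment> \<open>Time and space derivatives of the flow commute.\<close>
    have db: "dird (\<nu>, 0) (b a i) (0, w) = pd i (\<lambda>y. K y $ a) w" for a i
    proof -
      have "dird (\<nu>, 0) (b a i) (0, w) = dird (0, axis i 1) (dird (\<nu>, 0) (\<lambda>p. FF p $ a)) (0, w)"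
        unfolding b_def[abs_def] by (rule dird_commute[OF sFi P0])
      also have "\<dots> = pd i (\<lambda>y. dird (\<nu>, 0) (\<lambda>p. FF p $ a) (0, y)) w"
        by (rule dird_slice[OF smooth_on_dird[OF sFi] P0, symmetric])
      also have "\<dots> = pd i (\<lambda>y. K y $ a) w"
        by (rule pd_cong_open[OF V(1) _ w]) (simp add: K_def dird_nth smooth_on_diff[OF sF mem])
      finally show ?thesis .
    qed
    have dg: "dird (\<nu>, 0) (\<lambda>P. gk c (FF P) $ a $ a') (0, w) = (\<Sum>l\<in>UNIV. K w $ l * pd l (\<lambda>y. gk c y $ a $ a') w)" for a a'
    proof -
      have wc: "w \<in> cdom c" using w V by auto
      have "((\<lambda>y. gk c y $ a $ a') has_derivative (\<lambda>v. \<Sum>l\<in>UNIV. v $ l * pd l (\<lambda>y. gk c y $ a $ a') w)) (at (FF (0, w)))"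
        unfolding FF F0[OF w] by (intro has_derivative_pd smooth_on_diff[OF _ wc] smooth_intros gk(1)[OF c])
      from has_derivative_compose[OF smooth_on_has_derivative[OF sF P0] this]
      have "((\<lambda>P. gk c (FF P) $ a $ a') has_derivative
        (\<lambda>v. \<Sum>l\<in>UNIV. dird v FF (0, w) $ l * pd l (\<lambda>y. gk c y $ a $ a') w)) (at (0, w))" .
      from dird_eqI[OF this] show ?thesis by (simp add: K_def)
    qed
    \<comment> \<open>By invariance the pulled back metric does not depend on time, so its time
      derivative vanishes; the product rule then produces the terms of Killing's equation.\<close>
    have "0 = dird (\<nu>, 0) (\<lambda>P. gk c (snd P) $ i $ j) (0, w)"
    proof -
      have wc: "w \<in> cdom c" using w V by auto
      have "((\<lambda>y. gk c y $ i $ j) has_derivative (\<lambda>v. dird v (\<lambda>y. gk c y $ i $ j) w)) (at (snd (0::real^2, w)))"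
        unfolding snd_conv by (intro has_derivative_dird smooth_on_diff[OF _ wc] smooth_intros gk(1)[OF c])
      from has_derivative_compose[OF bounded_linear_imp_has_derivative[OF bounded_linear_snd] this]
      have h: "((\<lambda>P::(real^2) \<times> (real^4). gk c (snd P) $ i $ j) has_derivative (\<lambda>v. dird (snd v) (\<lambda>y. gk c y $ i $ j) w)) (at (0, w))" .
      have "dird 0 (\<lambda>y. gk c y $ i $ j) w = 0"
        using linear_0[OF dird_linear[OF smooth_on_diff[OF _ wc]]] smooth_on_nth[OF smooth_on_nth[OF gk(1)[OF c]]] by blast
      then show ?thesis using dird_eqI[OF h] by simp
    qed
    also have "\<dots> = dird (\<nu>, 0) (\<lambda>P. \<Sum>a\<in>UNIV. \<Sum>a'\<in>UNIV. b a i P * gk c (FF P) $ a $ a' * b a' j P) (0, w)"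
      by (rule dird_cong_open[OF o _ P0]) (simp add: id)
    also have "\<dots> = (\<Sum>a\<in>UNIV. \<Sum>a'\<in>UNIV. b a i (0, w) * gk c w $ a $ a' * pd j (\<lambda>y. K y $ a') w +
       (b a i (0, w) * (\<Sum>l\<in>UNIV. K w $ l * pd l (\<lambda>y. gk c y $ a $ a') w) + pd i (\<lambda>y. K y $ a) w * gk c w $ a $ a') * b a' j (0, w))"
      using dif by (simp add: dird_sum dird_mult differentiable_sum db dg FF F0[OF w])
    also have "\<dots> = (\<Sum>a\<in>UNIV. \<Sum>a'\<in>UNIV. (if a = i then gk c w $ i $ a' * pd j (\<lambda>y. K y $ a') w else 0))
       + (\<Sum>a\<in>UNIV. \<Sum>a'\<in>UNIV. if a = i then (if a' = j then (\<Sum>l\<in>UNIV. K w $ l * pd l (\<lambda>y. gk c y $ i $ j) w) else 0) else 0)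
       + (\<Sum>a\<in>UNIV. \<Sum>a'\<in>UNIV. if a' = j then pd i (\<lambda>y. K y $ a) w * gk c w $ a $ j else 0)"
      unfolding sum.distrib[symmetric] by (intro sum.cong refl) (simp add: b0)
    also have "(\<Sum>a\<in>UNIV. \<Sum>a'\<in>UNIV. (if a = i then gk c w $ i $ a' * pd j (\<lambda>y. K y $ a') w else 0)) =
       (\<Sum>l\<in>UNIV. gk c w $ i $ l * pd j (\<lambda>y. K y $ l) w)"
      by (subst sum.swap) simp
    also have "(\<Sum>a\<in>UNIV. \<Sum>a'\<in>UNIV. if a = i then (if a' = j then (\<Sum>l\<in>UNIV. K w $ l * pd l (\<lambda>y. gk c y $ i $ j) w) else 0) else 0) =
       (\<Sum>l\<in>UNIV. K w $ l * pd l (\<lambda>y. gk c y $ i $ j) w)"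
      by (subst sum.swap) simp
    finally show "(\<Sum>l\<in>UNIV. K w $ l * pd l (\<lambda>y. gk c y $ i $ j) w
     + gk c w $ l $ j * pd i (\<lambda>y. K y $ l) w + gk c w $ i $ l * pd j (\<lambda>y. K y $ l) w) = 0"
      by (simp add: sum.distrib algebra_simps)
  qed
  then show ?thesis using that[of V K] V sK grad by blast
qed

section \<open>Critical points of the moment map\<close>

lemma smooth_\<phi>\<nu>: "c \<in> A \<Longrightarrow> smooth_on (cdom c) (\<lambda>y. \<phi> (cproj c y) \<bullet> \<nu>)"
  by (intro smooth_intros smooth_\<phi> open_cdom)

text \<open>The differential of the component is \<open>\<omega>\<close> applied to
  \<open>K\<close>. As \<open>\<omega>\<close> is nondegenerate, vanishing first and second
  derivatives of the component mean that \<open>K\<close> and its first derivatives vanish at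
  \<open>u\<close>; then \<open>K\<close> vanishes nearby and the component is constant
  there.\<close>

lemma moment_constant_near:
  assumes c: "c \<in> A" and u: "u \<in> cdom c"
    and g: "\<And>j. pd j (\<lambda>y. \<phi> (cproj c y) \<bullet> \<nu>) u = 0"
    and h: "\<And>i j. pd i (pd j (\<lambda>y. \<phi> (cproj c y) \<bullet> \<nu>)) u = 0"
  obtains r where "r > 0" "ball u r \<subseteq> cdom c" "\<And>x. x \<in> ball u r \<Longrightarrow> \<phi> (cproj c x) \<bullet> \<nu> = \<phi> (cproj c u) \<bullet> \<nu>"
proof -
  let ?f = "\<lambda>y. \<phi> (cproj c y) \<bullet> \<nu>"
  obtain V K where V: "open V" "u \<in> V" "V \<subseteq> cdom c" and K: "smooth_on V K" "killing V (gk c) K"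
    and d: "\<And>w v. w \<in> V \<Longrightarrow> dird v ?f w = v \<bullet> (\<omega> c w *v K w)"
    using killing_field[OF c u] by metis
  have s\<omega>: "smooth_on (cdom c) (\<omega> c)" and d\<omega>: "det (\<omega> c u) \<noteq> 0"
    using kael c u by (auto simp: kaehler_structure_def symplectic_form_def)
  have s\<omega>V: "smooth_on V (\<omega> c)" by (rule smooth_on_subset[OF s\<omega> V(1,3)])
  have pdf: "pd j ?f w = (\<Sum>l\<in>UNIV. \<omega> c w $ j $ l * K w $ l)" if "w \<in> V" for j w
    using d[OF that, of "axis j 1"] by (simp add: pd_eq_dird inner_axis' matrix_vector_mult_def)
  have inj: "x = 0" if "\<omega> c u *v x = 0" for x
  proof -
    have "x = matrix_inv (\<omega> c u) *v (\<omega> c u *v x)"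
      by (simp add: matrix_vector_mul_assoc matrix_inv_mult[OF d\<omega>])
    then show ?thesis using that by simp
  qed
  have K0: "K u = 0"
    by (rule inj) (use g pdf[OF V(2)] in \<open>simp add: vec_eq_iff matrix_vector_mult_def\<close>)
  have DK0: "pd i (\<lambda>y. K y $ l) u = 0" for i l
  proof -
    have dif: "(\<lambda>y. \<omega> c y $ a $ b) differentiable (at u)" "(\<lambda>y. K y $ a) differentiable (at u)" for a b
      by (intro smooth_on_diff[OF _ V(2)] smooth_intros s\<omega>V K)+
    have "pd i (pd j ?f) u = (\<Sum>l\<in>UNIV. \<omega> c u $ j $ l * pd i (\<lambda>y. K y $ l) u)" for j
    proof -
      have "pd i (pd j ?f) u = pd i (\<lambda>w. \<Sum>l\<in>UNIV. \<omega> c w $ j $ l * K w $ l) u"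
        by (rule pd_cong_open[OF V(1) pdf V(2)])
      then show ?thesis using dif by (simp add: pd_sum pd_mult K0)
    qed
    then have "\<omega> c u *v (\<chi> l. pd i (\<lambda>y. K y $ l) u) = 0"
      using h by (simp add: vec_eq_iff matrix_vector_mult_def)
    from inj[OF this] show ?thesis by (simp add: vec_eq_iff)
  qed
  have gV: "smooth_on V (gk c)" by (rule smooth_on_subset[OF gk(1)[OF c] V(1,3)])
  obtain r where r: "r > 0" "ball u r \<subseteq> V" "\<And>x. x \<in> ball u r \<Longrightarrow> K x = 0"
    using killing_unique[OF gV gk(2)[OF c] gk(3)[OF c] K V(2) K0 DK0] V(3) by blast
  have "\<exists>b. \<forall>x\<in>ball u r. ?f x = b"
  proof (rule has_derivative_zero_constant[OF convex_ball])
    fix x assume x: "x \<in> ball u r"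
    then have xV: "x \<in> V" using r by blast
    have "(?f has_derivative (\<lambda>v. dird v ?f x)) (at x)"
      using smooth_on_has_derivative[OF smooth_\<phi>\<nu>[OF c]] xV V(3) by blast
    then have "(?f has_derivative (\<lambda>v. 0)) (at x)" unfolding d[OF xV] r(3)[OF x] by simp
    then show "(?f has_derivative (\<lambda>v. 0)) (at x within ball u r)" by (rule has_derivative_at_withinI)
  qed
  then obtain b where "\<forall>x\<in>ball u r. ?f x = b" ..
  then have "?f x = ?f u" if "x \<in> ball u r" for x using that r(1) centre_in_ball by metis
  then show ?thesis using that[of r] r V(3) by blast
qed

text \<open>Otherwise the set \<open>B\<close> of points where the component is locally constant is
  nonempty. It is open and closed, hence all of \<open>X\<close>; then the level sets are open and
  closed too, and the component is constant, contrary to \<open>nc\<close>.\<close>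

lemma hessian_nonzero:
  assumes nc: "\<exists>p\<in>topspace X. \<exists>q\<in>topspace X. \<phi> p \<bullet> \<nu> \<noteq> \<phi> q \<bullet> \<nu>"
    and c: "c \<in> A" and u: "u \<in> cdom c" and g: "\<And>j. pd j (\<lambda>y. \<phi> (cproj c y) \<bullet> \<nu>) u = 0"
  shows "\<exists>i j. pd i (pd j (\<lambda>y. \<phi> (cproj c y) \<bullet> \<nu>)) u \<noteq> 0"
proof (rule ccontr)
  assume neg: "\<not> ?thesis"
  define B where "B = {p \<in> topspace X. \<exists>U. openin X U \<and> p \<in> U \<and> (\<forall>q\<in>U. \<phi> q \<bullet> \<nu> = \<phi> p \<bullet> \<nu>)}"
  have inB: "cproj c u \<in> B"
    if c: "c \<in> A" and u: "u \<in> cdom c" and g: "\<And>j. pd j (\<lambda>y. \<phi> (cproj c y) \<bullet> \<nu>) u = 0"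
     and h: "\<And>i j. pd i (pd j (\<lambda>y. \<phi> (cproj c y) \<bullet> \<nu>)) u = 0" for c u
  proof -
    obtain r where r: "r > 0" "ball u r \<subseteq> cdom c" "\<And>x. x \<in> ball u r \<Longrightarrow> \<phi> (cproj c x) \<bullet> \<nu> = \<phi> (cproj c u) \<bullet> \<nu>"
      using moment_constant_near[OF c u g h] by metis
    have "openin X (cproj c ` ball u r)" by (rule cproj_open[OF c open_ball r(2)])
    moreover have "cproj c u \<in> cproj c ` ball u r" using r(1) by simp
    moreover have "\<forall>q\<in>cproj c ` ball u r. \<phi> q \<bullet> \<nu> = \<phi> (cproj c u) \<bullet> \<nu>" using r(3) by blast
    ultimately show ?thesis unfolding B_def using cproj_in[OF c u] by blast
  qed
  have oB: "openin X B"
  proof (subst openin_subopen, intro ballI)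
    fix p assume "p \<in> B"
    then obtain U where U: "openin X U" "p \<in> U" "\<forall>q\<in>U. \<phi> q \<bullet> \<nu> = \<phi> p \<bullet> \<nu>" by (auto simp: B_def)
    have "U \<subseteq> B"
    proof
      fix q assume q: "q \<in> U"
      then have "\<phi> q \<bullet> \<nu> = \<phi> p \<bullet> \<nu>" using U(3) by blast
      then have "\<forall>x\<in>U. \<phi> x \<bullet> \<nu> = \<phi> q \<bullet> \<nu>" using U(3) by simp
      then show "q \<in> B" unfolding B_def using U(1) q openin_subset[OF U(1)] by blast
    qed
    then show "\<exists>T. openin X T \<and> p \<in> T \<and> T \<subseteq> B" using U by blast
  qed
  have vanish: "pd j (\<lambda>y. \<phi> (cproj c y) \<bullet> \<nu>) w = 0 \<and> pd i (pd j (\<lambda>y. \<phi> (cproj c y) \<bullet> \<nu>)) w = 0"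
    if c: "c \<in> A" and w: "w \<in> cdom c" "cproj c w \<in> B" for c w i j
  proof -
    obtain U where U: "openin X U" "cproj c w \<in> U" "\<forall>q\<in>U. \<phi> q \<bullet> \<nu> = \<phi> (cproj c w) \<bullet> \<nu>"
      using w by (auto simp: B_def)
    let ?V = "{u \<in> cdom c. cproj c u \<in> U}"
    have oV: "open ?V" by (rule cproj_vimage_open[OF c U(1)])
    have 1: "pd j (\<lambda>y. \<phi> (cproj c y) \<bullet> \<nu>) x = 0" if "x \<in> ?V" for x j
    proof -
      have "pd j (\<lambda>y. \<phi> (cproj c y) \<bullet> \<nu>) x = pd j (\<lambda>y. \<phi> (cproj c w) \<bullet> \<nu>) x"
        by (rule pd_cong_open[OF oV _ that]) (use U(3) in blast)
      then show ?thesis by simp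
    qed
    have wV: "w \<in> ?V" using w(1) U(2) by blast
    have "pd i (pd j (\<lambda>y. \<phi> (cproj c y) \<bullet> \<nu>)) w = pd i (\<lambda>y. 0) w"
      by (rule pd_cong_open[OF oV 1 wV])
    then show ?thesis using 1[OF wV, of j] by simp
  qed
  have cB: "openin X (topspace X - B)"
  proof (subst openin_subopen, intro ballI)
    fix p assume p: "p \<in> topspace X - B"
    then obtain c u where c: "c \<in> A" and u: "u \<in> cdom c" "cproj c u = p" using charts_cover by blast
    let ?f = "\<lambda>y. \<phi> (cproj c y) \<bullet> \<nu>"
    \<comment> \<open>Outside \<open>B\<close> some first or second derivative is nonzero at
      \<open>u\<close>, while all of them vanish over \<open>B\<close>; so the set where
      \<open>G\<close> is nonzero projects to a neighbourhood that misses \<open>B\<close>.\<close>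
    have "\<exists>G. smooth_on (cdom c) G \<and> G u \<noteq> 0 \<and> (\<forall>w\<in>cdom c. cproj c w \<in> B \<longrightarrow> G w = (0::real))"
    proof (cases "\<forall>j. pd j ?f u = 0")
      case False
      then obtain j where "pd j ?f u \<noteq> 0" by blast
      then show ?thesis using smooth_on_pd[OF smooth_\<phi>\<nu>[OF c]] vanish[OF c] by blast
    next
      case True
      then obtain i j where "pd i (pd j ?f) u \<noteq> 0" using inB[OF c u(1)] p u by blast
      then show ?thesis using smooth_on_pd[OF smooth_on_pd[OF smooth_\<phi>\<nu>[OF c]]] vanish[OF c] by blast
    qed
    then obtain G where G: "smooth_on (cdom c) G" "G u \<noteq> 0" "\<And>w. w \<in> cdom c \<Longrightarrow> cproj c w \<in> B \<Longrightarrow> G w = (0::real)"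
      by blast
    let ?O = "G -` (- {0}) \<inter> cdom c"
    have "open ?O"
      using smooth_on_continuous[OF G(1)] continuous_on_open_vimage[OF open_cdom[OF c]] by blast
    then have "openin X (cproj c ` ?O)" by (intro cproj_open[OF c]) auto
    moreover have "p \<in> cproj c ` ?O" using G(2) u by auto
    moreover have "cproj c ` ?O \<subseteq> topspace X - B" using G(3) cproj_in[OF c] by auto
    ultimately show "\<exists>T. openin X T \<and> p \<in> T \<and> T \<subseteq> topspace X - B" by blast
  qed
  have BX: "B \<subseteq> topspace X" by (auto simp: B_def)
  have "closedin X B" unfolding closedin_def using BX cB by blast
  then have "B = {} \<or> B = topspace X" using conn oB unfolding connected_space_clopen_in by blast
  moreover have "cproj c u \<in> B" using inB[OF c u g] neg by blast
  ultimately have B: "B = topspace X" by blast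
  obtain p q where pq: "p \<in> topspace X" "q \<in> topspace X" "\<phi> p \<bullet> \<nu> \<noteq> \<phi> q \<bullet> \<nu>" using nc by blast
  have lev: "openin X {x \<in> topspace X. P (\<phi> x \<bullet> \<nu>)}" for P
  proof (subst openin_subopen, intro ballI)
    fix x assume x: "x \<in> {x \<in> topspace X. P (\<phi> x \<bullet> \<nu>)}"
    then have "x \<in> B" using B by simp
    then obtain U where U: "openin X U" "x \<in> U" "\<forall>q\<in>U. \<phi> q \<bullet> \<nu> = \<phi> x \<bullet> \<nu>" by (auto simp: B_def)
    have "U \<subseteq> {x \<in> topspace X. P (\<phi> x \<bullet> \<nu>)}"
    proof
      fix q assume q: "q \<in> U"
      then have "\<phi> q \<bullet> \<nu> = \<phi> x \<bullet> \<nu>" using U(3) by blast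
      then show "q \<in> {x \<in> topspace X. P (\<phi> x \<bullet> \<nu>)}" using x q openin_subset[OF U(1)] by auto
    qed
    then show "\<exists>T. openin X T \<and> x \<in> T \<and> T \<subseteq> {x \<in> topspace X. P (\<phi> x \<bullet> \<nu>)}" using U by blast
  qed
  let ?L = "{x \<in> topspace X. \<phi> x \<bullet> \<nu> = \<phi> p \<bullet> \<nu>}"
  have "topspace X - ?L = {x \<in> topspace X. \<phi> x \<bullet> \<nu> \<noteq> \<phi> p \<bullet> \<nu>}" by auto
  then have "openin X (topspace X - ?L)" using lev[of "\<lambda>t. t \<noteq> \<phi> p \<bullet> \<nu>"] by simp
  then have "closedin X ?L" unfolding closedin_def by auto
  then have "?L = {} \<or> ?L = topspace X"
    using conn lev[of "\<lambda>t. t = \<phi> p \<bullet> \<nu>"] unfolding connected_space_clopen_in by blast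
  moreover have "p \<in> ?L" using pq by simp
  ultimately have "q \<in> ?L" using pq(2) by blast
  then show False using pq(3) by simp
qed

text \<open>Points of the level set are minima, hence critical. Some second derivative is nonzero
  there, so each lies on the regular zero set of some first derivative.\<close>

lemma boundary_negligible:
  assumes nc: "\<exists>p\<in>topspace X. \<exists>q\<in>topspace X. \<phi> p \<bullet> \<nu> \<noteq> \<phi> q \<bullet> \<nu>"
    and ge: "\<And>p. p \<in> topspace X \<Longrightarrow> l \<le> \<phi> p \<bullet> \<nu>" and c: "c \<in> A"
  shows "negligible {u \<in> cdom c. \<phi> (cproj c u) \<bullet> \<nu> = l}"
proof -
  let ?f = "\<lambda>y. \<phi> (cproj c y) \<bullet> \<nu>"
  have "{u \<in> cdom c. ?f u = l} \<subseteq> (\<Union>(j, i)\<in>UNIV. {u \<in> cdom c. pd j ?f u = 0 \<and> pd i (pd j ?f) u \<noteq> 0})"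
  proof
    fix u assume u: "u \<in> {u \<in> cdom c. ?f u = l}"
    have "(\<lambda>v. dird v ?f u) = (\<lambda>v. 0)"
    proof (rule differential_zero_maxmin[of u "cdom c" ?f])
      show "u \<in> cdom c" "open (cdom c)" using u open_cdom[OF c] by auto
      show "(?f has_derivative (\<lambda>v. dird v ?f u)) (at u)"
        using smooth_on_has_derivative[OF smooth_\<phi>\<nu>[OF c]] u by blast
      show "(\<forall>y\<in>cdom c. ?f y \<le> ?f u) \<or> (\<forall>y\<in>cdom c. ?f u \<le> ?f y)"
        using ge cproj_in[OF c] u by auto
    qed
    then have g: "pd j ?f u = 0" for j unfolding pd_eq_dird by (rule fun_cong)
    have uc: "u \<in> cdom c" using u by simp
    obtain i j where "pd i (pd j ?f) u \<noteq> 0"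
      using hessian_nonzero[OF nc c uc g] by blast
    then show "u \<in> (\<Union>(j, i)\<in>UNIV. {u \<in> cdom c. pd j ?f u = 0 \<and> pd i (pd j ?f) u \<noteq> 0})"
      using g u by auto
  qed
  moreover have "negligible (\<Union>(j, i)\<in>UNIV. {u \<in> cdom c. pd j ?f u = 0 \<and> pd i (pd j ?f) u \<noteq> 0})"
  proof (rule negligible_Union, simp)
    fix T assume "T \<in> (\<lambda>(j, i). {u \<in> cdom c. pd j ?f u = 0 \<and> pd i (pd j ?f) u \<noteq> 0}) ` UNIV"
    then show "negligible T"
      by (auto intro!: negligible_regular_zeros smooth_on_pd[OF smooth_\<phi>\<nu>[OF c]])
  qed
  ultimately show ?thesis using negligible_subset by blast
qed

lemma openin_moment_vimage:
  assumes S: "open S" shows "openin X {p \<in> topspace X. \<phi> p \<in> S}"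
proof -
  let ?V = "\<lambda>c. (\<lambda>u. \<phi> (cproj c u)) -` S \<inter> cdom c"
  have "{p \<in> topspace X. \<phi> p \<in> S} = (\<Union>c\<in>A. cproj c ` ?V c)"
    using charts_cover cproj_in by fastforce
  moreover have "openin X (cproj c ` ?V c)" if "c \<in> A" for c
    using smooth_on_continuous[OF smooth_\<phi>[OF that]] S continuous_on_open_vimage[OF open_cdom[OF that]]
    by (intro cproj_open that) auto
  ultimately show ?thesis by auto
qed

end

section \<open>Volume and curvature on the orbifold\<close>

text \<open>Area inequality. If the right side is infinite there is nothing to prove; otherwise both
  integrals are finite and equal to gauge integrals, for which the inequality for smooth images is
  available.\<close>

lemma nn_integral_image_le:
  fixes k :: "real^'n::{finite,wellorder} \<Rightarrow> real^'n::_" and F :: "real^'n::_ \<Rightarrow> real"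
  assumes k: "smooth_on W k" and S: "S \<in> sets borel" "S \<subseteq> W"
    and F: "continuous_on W (\<lambda>w. F (k w))" and F0: "\<And>w. w \<in> W \<Longrightarrow> F (k w) \<ge> 0"
  shows "(\<integral>\<^sup>+u. ennreal (F u) * indicator (k ` S) u \<partial>lborel) \<le>
    (\<integral>\<^sup>+w. ennreal (\<bar>det (jacobian k (at w))\<bar> * F (k w)) * indicator S w \<partial>lborel)"
proof (cases "(\<integral>\<^sup>+w. ennreal (\<bar>det (jacobian k (at w))\<bar> * F (k w)) * indicator S w \<partial>lborel) < \<infinity>")
  case False
  then show ?thesis by (simp add: not_less top_unique)
next
  case True
  let ?G = "\<lambda>w. \<bar>det (jacobian k (at w))\<bar> * F (k w)"
  let ?G' = "\<lambda>w. if w \<in> S then ?G w else 0"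
  have cG: "continuous_on S ?G"
    using continuous_on_subset[OF F S(2)]
      continuous_on_subset[OF smooth_on_continuous[OF smooth_on_det[OF smooth_on_jacobian[OF k]]] S(2)]
    by (intro continuous_intros)
  have mG: "?G' \<in> borel_measurable borel"
    using S(1) cG by (intro borel_measurable_continuous_on_if continuous_on_const)
  have e: "ennreal (?G w) * indicator S w = ennreal (?G' w)" for w by (simp add: indicator_def)
  have "?G' integrable_on UNIV"
    using True F0 S(2) unfolding e by (intro nn_integral_integrable_on mG) auto
  then have iG: "?G integrable_on S" by (simp add: integrable_restrict_UNIV)
  have aG: "?G absolutely_integrable_on S"
    using iG F0 S(2) by (subst absolutely_integrable_on_iff_nonneg) auto
  have der: "(k has_derivative (\<lambda>v. jacobian k (at w) *v v)) (at w within S)" if "w \<in> S" for w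
    by (rule has_derivative_at_withinI[OF jacobian_works[THEN iffD1, OF smooth_on_diff[OF k subsetD[OF S(2) that]]]])
  have m: "matrix (\<lambda>v. jacobian k (at w) *v v) = jacobian k (at w)" for w by simp
  have aF: "F absolutely_integrable_on (k ` S)"
    by (rule absolutely_integrable_on_image_real[OF der]) (use aG in simp_all)
  have le: "integral (k ` S) F \<le> integral S ?G"
    using integral_on_image_ubound[OF _ der, of F] F0 S(2) iG by (auto simp: m)
  have iF: "F integrable_on (k ` S)" using aF set_lebesgue_integral_eq_integral(1) by blast
  have "(\<integral>\<^sup>+u. ennreal (F u) * indicator (k ` S) u \<partial>lborel) = ennreal (integral (k ` S) F)"
    using F0 S(2) iF by (intro nn_integral_has_integral_lebesgue') auto
  moreover have "(\<integral>\<^sup>+w. ennreal (?G w) * indicator S w \<partial>lborel) = ennreal (integral S ?G)"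
    using F0 S(2) iG by (intro nn_integral_has_integral_lebesgue') auto
  ultimately show ?thesis using le by (simp add: ennreal_leI)
qed

locale toric_volume = toric_orbifold +
  fixes g :: "'a field2" and vol :: "'a measure"
  assumes g_metric: "riemannian_metric A g" and vol: "riemannian_volume X A g vol"
begin

lemma g: "c \<in> A \<Longrightarrow> smooth_on (cdom c) (g c)"
  "c \<in> A \<Longrightarrow> u \<in> cdom c \<Longrightarrow> transpose (g c u) = g c u"
  "c \<in> A \<Longrightarrow> u \<in> cdom c \<Longrightarrow> det (g c u) \<noteq> 0"
  "c \<in> A \<Longrightarrow> u \<in> cdom c \<Longrightarrow> v \<noteq> 0 \<Longrightarrow> v \<bullet> (g c u *v v) > 0"
  using g_metric by (auto simp: riemannian_metric_def intro!: posdef_det)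

lemma space_vol: "space vol = topspace X" and sets_vol: "sets vol = sigma_sets (topspace X) {S. openin X S}"
  using vol by (auto simp: riemannian_volume_def)

lemma sets_vol_open: "openin X U \<Longrightarrow> U \<in> sets vol"
  unfolding sets_vol by (rule sigma_sets.Basic) simp

lemma vol_eq:
  "c \<in> A \<Longrightarrow> B \<in> sets vol \<Longrightarrow> B \<subseteq> cproj c ` cdom c \<Longrightarrow>
    emeasure vol B = (\<integral>\<^sup>+u. ennreal (sqrt (det (g c u))) * indicator {u \<in> cdom c. cproj c u \<in> B} u \<partial>lborel)
      / of_nat (card (cgrp c))"
  using vol by (simp add: riemannian_volume_def)

text \<open>The \<open>SOME\<close> in the definition picks one chart and preimage. Any other choice
  is related to it by a lift of the identity, under which \<open>g\<close> is a pull-back.\<close>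

lemma curvature_norm_sq_cproj:
  assumes c: "c \<in> A" and u: "u \<in> cdom c"
  shows "curvature_norm_sq A g (cproj c u) = riemann_norm_sq (g c) u"
proof -
  have eq: "riemann_norm_sq (g d) v = riemann_norm_sq (g c) u"
    if d: "d \<in> A" and v: "v \<in> cdom d" and p: "cproj d v = cproj c u" for d v
  proof -
    obtain W h where W: "u \<in> W" "W \<subseteq> cdom c" and hl: "is_lift (cproj c) d W h" "h u = v"
      using orb[unfolded orbifold_def, THEN conjunct2, THEN conjunct2, THEN conjunct2, THEN conjunct2,
          rule_format, OF c d u v p[symmetric]] by blast
    have inv: "transpose (jacobian h (at w)) ** g d (h w) ** jacobian h (at w) = g c w" if "w \<in> W" for w
      using g_metric c d W hl that unfolding riemannian_metric_def form_invariant_def by auto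
    interpret metric_pullback "g d" "g c" h "cdom d" W
      using hl(1) g[OF d] inv by unfold_locales (auto simp: is_lift_def)
    show ?thesis using riemann_norm_sq_pullback[OF W(1)] hl(2) by simp
  qed
  have "\<exists>y. \<exists>d\<in>A. \<exists>v\<in>cdom d. cproj d v = cproj c u \<and> y = riemann_norm_sq (g d) v"
    using c u by blast
  then have "\<exists>d\<in>A. \<exists>v\<in>cdom d. cproj d v = cproj c u \<and> curvature_norm_sq A g (cproj c u) = riemann_norm_sq (g d) v"
    unfolding curvature_norm_sq_def by (rule someI_ex)
  then show ?thesis using eq by metis
qed

lemma smooth_curvature: "c \<in> A \<Longrightarrow> smooth_on (cdom c) (riemann_norm_sq (g c))"
  using g smooth_on_riemann_norm_sq by blast

text \<open>Preimages of open sets are open, being unions of projected open sets; the atlas may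
  therefore be uncountable.\<close>

lemma curvature_measurable: "curvature_norm_sq A g \<in> borel_measurable vol"
proof (rule borel_measurableI)
  fix S :: "real set" assume S: "open S"
  let ?V = "\<lambda>c. riemann_norm_sq (g c) -` S \<inter> cdom c"
  have "curvature_norm_sq A g -` S \<inter> space vol = (\<Union>c\<in>A. cproj c ` ?V c)"
  proof (intro equalityI subsetI)
    fix p assume p: "p \<in> curvature_norm_sq A g -` S \<inter> space vol"
    then obtain c u where c: "c \<in> A" "u \<in> cdom c" "cproj c u = p" using charts_cover space_vol by blast
    then have "u \<in> ?V c" using p curvature_norm_sq_cproj[OF c(1,2)] by simp
    then show "p \<in> (\<Union>c\<in>A. cproj c ` ?V c)" using c by blast
  next
    fix p assume "p \<in> (\<Union>c\<in>A. cproj c ` ?V c)"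
    then obtain c u where c: "c \<in> A" "u \<in> cdom c" "p = cproj c u" "riemann_norm_sq (g c) u \<in> S" by blast
    then show "p \<in> curvature_norm_sq A g -` S \<inter> space vol"
      using curvature_norm_sq_cproj[OF c(1,2)] cproj_in[OF c(1,2)] space_vol by simp
  qed
  moreover have "openin X (cproj c ` ?V c)" if "c \<in> A" for c
    using smooth_on_continuous[OF smooth_curvature[OF that]] S continuous_on_open_vimage[OF open_cdom[OF that]]
    by (intro cproj_open that) auto
  ultimately show "curvature_norm_sq A g -` S \<inter> space vol \<in> sets vol"
    by (auto intro!: sets_vol_open)
qed

section \<open>Volume in charts\<close>

lemma vimage_borel:
  assumes p: "\<And>U. openin X U \<Longrightarrow> open {w \<in> W. p w \<in> U}" and W: "open W" and pW: "p ` W \<subseteq> topspace X"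
    and B: "B \<in> sets vol"
  shows "{w \<in> W. p w \<in> B} \<in> sets borel"
  using B unfolding sets_vol
proof (induction rule: sigma_sets.induct)
  case (Basic U)
  then show ?case using p by auto
next
  case Empty
  show ?case by simp
next
  case (Compl B)
  have "{w \<in> W. p w \<in> topspace X - B} = W - {w \<in> W. p w \<in> B}" using pW by auto
  then show ?case using Compl W by auto
next
  case (Union B)
  have "{w \<in> W. p w \<in> (\<Union>i. B i)} = (\<Union>i. {w \<in> W. p w \<in> B i})" by auto
  then show ?case using Union by auto
qed

text \<open>The inverse group element is smooth as well, which makes each element a diffeomorphism
  of the chart domain with nonzero Jacobian determinant.\<close>

lemma group_element:
  assumes c: "c \<in> A" and \<gamma>: "\<gamma> \<in> cgrp c"
  shows "smooth_on (cdom c) \<gamma>" "bij_betw \<gamma> (cdom c) (cdom c)"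
    "\<And>u. u \<in> cdom c \<Longrightarrow> det (jacobian \<gamma> (at u)) \<noteq> 0"
    "\<And>u. u \<in> cdom c \<Longrightarrow> cproj c (\<gamma> u) = cproj c u"
proof -
  have sub: "subgroup (cgrp c) (BijGroup (cdom c))" and sm: "\<And>\<gamma>. \<gamma> \<in> cgrp c \<Longrightarrow> smooth_on (cdom c) \<gamma>"
    and pr: "\<And>u v. u \<in> cdom c \<Longrightarrow> v \<in> cdom c \<Longrightarrow> cproj c u = cproj c v \<longleftrightarrow> (\<exists>\<gamma>\<in>cgrp c. \<gamma> u = v)"
    using chart[OF c] by (auto simp: orbifold_chart_def)
  interpret G: group "BijGroup (cdom c)" by (rule group_BijGroup)
  interpret H: subgroup "cgrp c" "BijGroup (cdom c)" by (rule sub)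
  have B: "\<gamma> \<in> Bij (cdom c)" if "\<gamma> \<in> cgrp c" for \<gamma> using H.subset that by (auto simp: BijGroup_def)
  show "smooth_on (cdom c) \<gamma>" by (rule sm[OF \<gamma>])
  show b: "bij_betw \<gamma> (cdom c) (cdom c)" using B[OF \<gamma>] by (simp add: Bij_def)
  then have im: "\<gamma> u \<in> cdom c" if "u \<in> cdom c" for u using that by (auto simp: bij_betw_def)
  show "cproj c (\<gamma> u) = cproj c u" if u: "u \<in> cdom c" for u
    using pr[OF u im[OF u]] \<gamma> by auto
  define \<gamma>' where "\<gamma>' = inv\<^bsub>BijGroup (cdom c)\<^esub> \<gamma>"
  have \<gamma>': "\<gamma>' \<in> cgrp c" unfolding \<gamma>'_def by (rule H.m_inv_closed[OF \<gamma>])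
  have "\<gamma>' \<otimes>\<^bsub>BijGroup (cdom c)\<^esub> \<gamma> = \<one>\<^bsub>BijGroup (cdom c)\<^esub>"
    unfolding \<gamma>'_def using \<gamma> H.subset by (intro G.l_inv) auto
  then have "compose (cdom c) \<gamma>' \<gamma> = (\<lambda>x\<in>cdom c. x)"
    using B[OF \<gamma>] B[OF \<gamma>'] by (simp add: BijGroup_def)
  then have id: "\<gamma>' (\<gamma> x) = x" if "x \<in> cdom c" for x
    using that by (metis compose_eq restrict_apply)
  show "det (jacobian \<gamma> (at u)) \<noteq> 0" if u: "u \<in> cdom c" for u
    by (rule det_jacobian_left_inverse[OF smooth_on_diff[OF sm[OF \<gamma>] u] smooth_on_diff[OF sm[OF \<gamma>'] im[OF u]]
          open_cdom[OF c] u id])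
qed

lemma cgrp_props:
  assumes c: "c \<in> A"
  shows "finite (cgrp c)" "card (cgrp c) > 0"
    "\<And>u v. u \<in> cdom c \<Longrightarrow> v \<in> cdom c \<Longrightarrow> cproj c u = cproj c v \<Longrightarrow> \<exists>\<gamma>\<in>cgrp c. \<gamma> u = v"
proof -
  show fin: "finite (cgrp c)" using chart[OF c] by (auto simp: orbifold_chart_def)
  have "subgroup (cgrp c) (BijGroup (cdom c))" using chart[OF c] by (auto simp: orbifold_chart_def)
  then have "cgrp c \<noteq> {}" using subgroup.one_closed by blast
  then show "card (cgrp c) > 0" using fin by (simp add: card_gt_0_iff)
  show "\<And>u v. u \<in> cdom c \<Longrightarrow> v \<in> cdom c \<Longrightarrow> cproj c u = cproj c v \<Longrightarrow> \<exists>\<gamma>\<in>cgrp c. \<gamma> u = v"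
    using chart[OF c] by (auto simp: orbifold_chart_def)
qed

lemma is_lift_group:
  assumes c: "c \<in> A" and h: "is_lift p c W h" and \<gamma>: "\<gamma> \<in> cgrp c"
  shows "is_lift p c W (\<lambda>w. \<gamma> (h w))"
proof -
  note G = group_element[OF c \<gamma>]
  have hW: "h w \<in> cdom c" if "w \<in> W" for w using h that by (auto simp: is_lift_def)
  have "inj_on (\<lambda>w. \<gamma> (h w)) W"
  proof (rule inj_onI)
    fix x y assume xy: "x \<in> W" "y \<in> W" "\<gamma> (h x) = \<gamma> (h y)"
    then have "h x = h y" using G(2) hW by (metis bij_betw_def inj_onD)
    then show "x = y" using h xy by (auto simp: is_lift_def inj_on_def)
  qed
  moreover have "smooth_on W (\<lambda>w. \<gamma> (h w))"
    using h by (intro smooth_on_compose[OF G(1)]) (auto simp: is_lift_def)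
  moreover have "det (jacobian (\<lambda>w. \<gamma> (h w)) (at w)) \<noteq> 0" if w: "w \<in> W" for w
  proof -
    have "h differentiable (at w)" using h w smooth_on_diff by (auto simp: is_lift_def)
    from jacobian_compose[OF this smooth_on_diff[OF G(1) hW[OF w]]]
    show ?thesis using G(3)[OF hW[OF w]] h w by (simp add: det_mul is_lift_def)
  qed
  moreover have "\<gamma> (h w) \<in> cdom c" if "w \<in> W" for w
    using G(2) hW[OF that] by (auto simp: bij_betw_def)
  moreover have "cproj c (\<gamma> (h w)) = p w" if "w \<in> W" for w
    using G(4)[OF hW[OF that]] h that by (auto simp: is_lift_def)
  ultimately show ?thesis using h by (auto simp: is_lift_def)
qed

text \<open>\<open>p\<close> factors through the lift. A lift has open image by invariance of
  domain, and chart projections are open and continuous.\<close>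

lemma lift_props:
  assumes c: "c \<in> A" and h: "is_lift p c W h"
  shows "open W" "p ` W \<subseteq> topspace X" "p ` W \<subseteq> cproj c ` cdom c"
    "\<And>U. openin X U \<Longrightarrow> open {w \<in> W. p w \<in> U}"
    "\<And>U. open U \<Longrightarrow> U \<subseteq> W \<Longrightarrow> openin X (p ` U)"
proof -
  have W: "open W" and hc: "h ` W \<subseteq> cdom c" and ph: "\<And>w. w \<in> W \<Longrightarrow> cproj c (h w) = p w"
    and sh: "smooth_on W h" and inj: "inj_on h W"
    using h by (auto simp: is_lift_def)
  show "open W" by (rule W)
  show "p ` W \<subseteq> topspace X" "p ` W \<subseteq> cproj c ` cdom c"
    using ph hc cproj_in[OF c] by (auto simp: image_iff) (metis image_subset_iff)+
  show "open {w \<in> W. p w \<in> U}" if U: "openin X U" for U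
  proof -
    have "open (h -` {u \<in> cdom c. cproj c u \<in> U} \<inter> W)"
      using cproj_vimage_open[OF c U] smooth_on_continuous[OF sh] continuous_on_open_vimage[OF W] by blast
    moreover have "h -` {u \<in> cdom c. cproj c u \<in> U} \<inter> W = {w \<in> W. p w \<in> U}" using hc ph by auto
    ultimately show ?thesis by simp
  qed
  show "openin X (p ` U)" if U: "open U" "U \<subseteq> W" for U
  proof -
    have "open (h ` U)"
      by (rule invariance_of_domain[OF continuous_on_subset[OF smooth_on_continuous[OF sh] U(2)] U(1) inj_on_subset[OF inj U(2)]])
    then have "openin X (cproj c ` (h ` U))" using U(2) hc by (intro cproj_open[OF c]) auto
    moreover have "cproj c ` (h ` U) = p ` U" using ph U(2) by (auto simp: image_image intro!: image_cong)
    ultimately show ?thesis by simp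
  qed
qed

text \<open>Only an upper bound is needed, so the group elements need not act freely.\<close>

lemma volume_le:
  fixes Gp :: "real^4 \<Rightarrow> real^4^4"
  assumes c: "c \<in> A" and h: "is_lift p c W h"
    and Gp: "\<And>k w. is_lift p c W k \<Longrightarrow> w \<in> W \<Longrightarrow> transpose (jacobian k (at w)) ** g c (k w) ** jacobian k (at w) = Gp w"
    and B: "B \<in> sets vol" "B \<subseteq> p ` W"
  shows "emeasure vol B \<le> (\<integral>\<^sup>+w. ennreal (sqrt (det (Gp w))) * indicator {w \<in> W. p w \<in> B} w \<partial>lborel)"
proof -
  let ?S = "{w \<in> W. p w \<in> B}"
  let ?I = "\<integral>\<^sup>+w. ennreal (sqrt (det (Gp w))) * indicator ?S w \<partial>lborel"
  let ?F = "\<lambda>u. max 0 (sqrt (det (g c u)))"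
  note L = lift_props[OF c h]
  have S: "?S \<in> sets borel" by (rule vimage_borel[OF L(4) L(1) L(2) B(1)])
  \<comment> \<open>\<open>ennreal\<close> sends negative numbers to zero; \<open>max 0\<close>
    makes this explicit, so that the area inequality receives a nonnegative density.\<close>
  have enF: "ennreal (sqrt x) = ennreal (max 0 (sqrt x))" for x
    by (cases "sqrt x \<ge> 0") (auto simp: ennreal_neg)
  have one: "(\<integral>\<^sup>+u. ennreal (sqrt (det (g c u))) * indicator ((\<lambda>w. \<gamma> (h w)) ` ?S) u \<partial>lborel) \<le> ?I"
    if \<gamma>: "\<gamma> \<in> cgrp c" for \<gamma>
  proof -
    let ?k = "\<lambda>w. \<gamma> (h w)"
    have k: "is_lift p c W ?k" by (rule is_lift_group[OF c h \<gamma>])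
    have sk: "smooth_on W ?k" and kc: "?k ` W \<subseteq> cdom c" using k by (auto simp: is_lift_def)
    have "continuous_on W (\<lambda>w. det (g c (?k w)))"
      by (intro smooth_on_continuous smooth_on_det smooth_on_compose[OF g(1)[OF c] sk kc])
    then have cF: "continuous_on W (\<lambda>w. ?F (?k w))" by (intro continuous_intros)
    have "(\<integral>\<^sup>+u. ennreal (?F u) * indicator (?k ` ?S) u \<partial>lborel) \<le>
      (\<integral>\<^sup>+w. ennreal (\<bar>det (jacobian ?k (at w))\<bar> * ?F (?k w)) * indicator ?S w \<partial>lborel)"
      by (rule nn_integral_image_le[OF sk S _ cF]) auto
    also have "\<dots> = ?I"
    proof (rule nn_integral_cong)
      fix w
      show "ennreal (\<bar>det (jacobian ?k (at w))\<bar> * ?F (?k w)) * indicator ?S w = ennreal (sqrt (det (Gp w))) * indicator ?S w"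
      proof (cases "w \<in> ?S")
        case True
        then have "det (Gp w) = (det (jacobian ?k (at w)))\<^sup>2 * det (g c (?k w))"
          using Gp[OF k, of w] by (auto simp: det_mul det_transpose power2_eq_square simp flip: Gp[OF k])
        then have "sqrt (det (Gp w)) = \<bar>det (jacobian ?k (at w))\<bar> * sqrt (det (g c (?k w)))"
          by (simp add: real_sqrt_mult)
        then have "max 0 (sqrt (det (Gp w))) = \<bar>det (jacobian ?k (at w))\<bar> * ?F (?k w)"
          by (simp add: max_mult_distrib_left)
        then show ?thesis unfolding enF[of "det (Gp w)"] by simp
      qed simp
    qed
    finally show ?thesis unfolding enF .
  qed
  have hc: "h ` W \<subseteq> cdom c" and ph: "\<And>w. w \<in> W \<Longrightarrow> cproj c (h w) = p w" using h by (auto simp: is_lift_def)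
  \<comment> \<open>Points over \<open>B\<close> differ from those in the image of \<open>h\<close>
    by group elements. Each of the \<open>card (cgrp c)\<close> translates contributes at most the
    same integral, and the factor \<open>1 / card (cgrp c)\<close> in the volume cancels their
    number.\<close>
  have cov: "{u \<in> cdom c. cproj c u \<in> B} \<subseteq> (\<Union>\<gamma>\<in>cgrp c. (\<lambda>w. \<gamma> (h w)) ` ?S)"
  proof
    fix u assume u: "u \<in> {u \<in> cdom c. cproj c u \<in> B}"
    then obtain w where w: "w \<in> W" "cproj c u = p w" using B(2) by auto
    then obtain \<gamma> where "\<gamma> \<in> cgrp c" "\<gamma> (h w) = u"
      using cgrp_props(3)[OF c, of "h w" u] ph[OF w(1)] hc u by auto
    moreover have "w \<in> ?S" using u w by auto
    ultimately show "u \<in> (\<Union>\<gamma>\<in>cgrp c. (\<lambda>w. \<gamma> (h w)) ` ?S)" by blast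
  qed
  have idc: "{u \<in> cdom c. cproj c u \<in> B} \<in> sets borel"
    by (rule vimage_borel[OF cproj_vimage_open[OF c] open_cdom[OF c] _ B(1)]) (use cproj_in[OF c] in auto)
  have meas: "(\<lambda>w. \<gamma> (h w)) ` ?S \<in> sets borel" if \<gamma>: "\<gamma> \<in> cgrp c" for \<gamma>
  proof -
    let ?k = "\<lambda>w. \<gamma> (h w)"
    have k: "is_lift p c W ?k" by (rule is_lift_group[OF c h \<gamma>])
    then have "open (?k ` W)"
      by (intro invariance_of_domain smooth_on_continuous) (auto simp: is_lift_def)
    moreover have "?k ` ?S = ?k ` W \<inter> {u \<in> cdom c. cproj c u \<in> B}"
      using k by (auto simp: is_lift_def)
    ultimately show ?thesis using idc by auto
  qed
  \<comment> \<open>Outside \<open>cdom c\<close> nothing is known about \<open>g c\<close>; the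
    cut-off gives a Borel function on the whole space.\<close>
  define F' where "F' = (\<lambda>u. if u \<in> cdom c then sqrt (det (g c u)) else 0)"
  have F'[measurable]: "F' \<in> borel_measurable borel"
    unfolding F'_def using open_cdom[OF c] smooth_on_continuous[OF smooth_on_det[OF g(1)[OF c]]]
    by (intro borel_measurable_continuous_on_if continuous_on_const continuous_on_real_sqrt) auto
  have sub: "(\<lambda>w. \<gamma> (h w)) ` ?S \<subseteq> cdom c" if "\<gamma> \<in> cgrp c" for \<gamma>
    using is_lift_group[OF c h that] by (auto simp: is_lift_def)
  have F'eq: "ennreal (F' u) * indicator ((\<lambda>w. \<gamma> (h w)) ` ?S) u =
     ennreal (sqrt (det (g c u))) * indicator ((\<lambda>w. \<gamma> (h w)) ` ?S) u" if "\<gamma> \<in> cgrp c" for \<gamma> u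
    using sub[OF that] by (auto simp: F'_def indicator_def)
  have "(\<integral>\<^sup>+u. ennreal (sqrt (det (g c u))) * indicator {u \<in> cdom c. cproj c u \<in> B} u \<partial>lborel) \<le>
    (\<integral>\<^sup>+u. (\<Sum>\<gamma>\<in>cgrp c. ennreal (F' u) * indicator ((\<lambda>w. \<gamma> (h w)) ` ?S) u) \<partial>lborel)"
  proof (rule nn_integral_mono)
    fix u
    show "ennreal (sqrt (det (g c u))) * indicator {u \<in> cdom c. cproj c u \<in> B} u \<le>
      (\<Sum>\<gamma>\<in>cgrp c. ennreal (F' u) * indicator ((\<lambda>w. \<gamma> (h w)) ` ?S) u)"
    proof (cases "u \<in> {u \<in> cdom c. cproj c u \<in> B}")
      case True
      then obtain \<gamma> where \<gamma>: "\<gamma> \<in> cgrp c" "u \<in> (\<lambda>w. \<gamma> (h w)) ` ?S" using cov by blast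
      have "ennreal (sqrt (det (g c u))) * indicator {u \<in> cdom c. cproj c u \<in> B} u =
        ennreal (F' u) * indicator ((\<lambda>w. \<gamma> (h w)) ` ?S) u"
        using True \<gamma>(2) unfolding F'eq[OF \<gamma>(1)] by simp
      also have "\<dots> \<le> (\<Sum>\<gamma>\<in>cgrp c. ennreal (F' u) * indicator ((\<lambda>w. \<gamma> (h w)) ` ?S) u)"
        using \<gamma>(1) cgrp_props(1)[OF c] by (intro member_le_sum) auto
      finally show ?thesis .
    qed simp
  qed
  also have "\<dots> = (\<Sum>\<gamma>\<in>cgrp c. \<integral>\<^sup>+u. ennreal (F' u) * indicator ((\<lambda>w. \<gamma> (h w)) ` ?S) u \<partial>lborel)"
    using meas by (intro nn_integral_sum) auto
  also have "\<dots> \<le> (\<Sum>\<gamma>\<in>cgrp c. ?I)"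
    by (rule sum_mono) (simp only: F'eq one)
  also have "\<dots> = of_nat (card (cgrp c)) * ?I" by simp
  finally have "(\<integral>\<^sup>+u. ennreal (sqrt (det (g c u))) * indicator {u \<in> cdom c. cproj c u \<in> B} u \<partial>lborel) \<le> of_nat (card (cgrp c)) * ?I" .
  then have "emeasure vol B \<le> of_nat (card (cgrp c)) * ?I / of_nat (card (cgrp c))"
    unfolding vol_eq[OF c B(1) order.trans[OF B(2) L(3)]] by (rule divide_right_mono_ennreal)
  also have "\<dots> = ?I"
    using cgrp_props(2)[OF c] by (subst mult.commute) (simp add: ennreal_mult_divide_eq)
  finally show ?thesis .
qed

lemma local_bound:
  assumes p: "p \<in> topspace X"
  shows "\<exists>U M. openin X U \<and> p \<in> U \<and> emeasure vol U < \<infinity> \<and> 0 \<le> M \<and> (\<forall>q\<in>U. \<bar>curvature_norm_sq A g q\<bar> \<le> M)"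
proof -
  obtain c u where c: "c \<in> A" "u \<in> cdom c" "cproj c u = p" using charts_cover[OF p] by blast
  obtain r where r: "r > 0" "cball u r \<subseteq> cdom c"
    using open_cdom[OF c(1)] c(2) open_contains_cball by blast
  then have bc: "ball u r \<subseteq> cdom c" by auto
  have bounded: "\<exists>M\<ge>0. \<forall>w\<in>cball u r. \<bar>f w\<bar> \<le> M" if "smooth_on (cdom c) f" for f :: "real^4 \<Rightarrow> real"
  proof -
    have "bounded (f ` cball u r)"
      using continuous_on_subset[OF smooth_on_continuous[OF that] r(2)]
      by (intro compact_imp_bounded compact_continuous_image compact_cball)
    then show ?thesis unfolding bounded_pos by (auto intro: less_imp_le)
  qed
  obtain M where M: "M \<ge> 0" "\<And>w. w \<in> cball u r \<Longrightarrow> \<bar>riemann_norm_sq (g c) w\<bar> \<le> M"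
    using bounded[OF smooth_curvature[OF c(1)]] by blast
  obtain D where D: "D \<ge> 0" "\<And>w. w \<in> cball u r \<Longrightarrow> \<bar>det (g c w)\<bar> \<le> D"
    using bounded[OF smooth_on_det[OF g(1)[OF c(1)]]] by blast
  let ?U = "cproj c ` ball u r"
  have U: "openin X ?U" by (rule cproj_open[OF c(1) open_ball bc])
  have jid: "jacobian (\<lambda>w. w) (at w) = mat 1" for w :: "real^4" by (rule jacobian_eqI) simp
  have lift: "is_lift (cproj c) c (ball u r) (\<lambda>w. w)"
    unfolding is_lift_def jid using bc by (auto intro!: smooth_intros)
  have "emeasure vol ?U \<le> (\<integral>\<^sup>+w. ennreal (sqrt (det (g c w))) * indicator {w \<in> ball u r. cproj c w \<in> ?U} w \<partial>lborel)"
  proof (rule volume_le[OF c(1) lift _ sets_vol_open[OF U]])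
    show "transpose (jacobian k (at w)) ** g c (k w) ** jacobian k (at w) = g c w"
      if "is_lift (cproj c) c (ball u r) k" "w \<in> ball u r" for k w
      using g_metric c bc that unfolding riemannian_metric_def form_invariant_def by auto
  qed auto
  also have "\<dots> \<le> (\<integral>\<^sup>+w. ennreal (sqrt D) * indicator (cball u r) w \<partial>lborel)"
  proof (rule nn_integral_mono)
    fix w
    show "ennreal (sqrt (det (g c w))) * indicator {w \<in> ball u r. cproj c w \<in> ?U} w \<le> ennreal (sqrt D) * indicator (cball u r) w"
      using D(2)[of w] by (auto simp: indicator_def intro!: ennreal_leI)
  qed
  also have "\<dots> < \<infinity>"
    using emeasure_lborel_cball_finite[of u r] by (simp add: nn_integral_cmult_indicator ennreal_mult_less_top)
  finally have fin: "emeasure vol ?U < \<infinity>" .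
  have "\<bar>curvature_norm_sq A g q\<bar> \<le> M" if "q \<in> ?U" for q
    using that M(2) bc curvature_norm_sq_cproj[OF c(1)] by auto
  then show ?thesis using U fin M(1) c(3) r(1) by (intro exI[of _ ?U] exI[of _ M]) auto
qed

text \<open>Finitely many neighbourhoods from \<open>local_bound\<close> cover \<open>K\<close>;
  their union serves as \<open>U\<close>, which is open and so measurable.\<close>

lemma curvature_on_compact:
  assumes K: "compactin X K"
  obtains U where "openin X U" "K \<subseteq> U"
    "(\<integral>\<^sup>+p. ennreal \<bar>curvature_norm_sq A g p\<bar> * indicator U p \<partial>vol) < \<infinity>"
proof -
  let ?f = "\<lambda>p. ennreal \<bar>curvature_norm_sq A g p\<bar>"
  have KX: "K \<subseteq> topspace X" using K by (simp add: compactin_def)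
  obtain U M where U: "\<And>p. p \<in> topspace X \<Longrightarrow> openin X (U p) \<and> p \<in> U p \<and> emeasure vol (U p) < \<infinity> \<and>
      0 \<le> M p \<and> (\<forall>q\<in>U p. \<bar>curvature_norm_sq A g q\<bar> \<le> M p)"
    using local_bound by metis
  have "\<forall>V\<in>U ` K. openin X V" "K \<subseteq> \<Union> (U ` K)" using U KX by blast+
  then obtain F where F: "finite F" "F \<subseteq> U ` K" "K \<subseteq> \<Union> F"
    using K unfolding compactin_def by meson
  obtain S where S: "S \<subseteq> K" "finite S" "F = U ` S" using finite_subset_image[OF F(1,2)] by blast
  have US: "openin X (U p)" "emeasure vol (U p) < \<infinity>" "\<And>q. q \<in> U p \<Longrightarrow> \<bar>curvature_norm_sq A g q\<bar> \<le> M p" if "p \<in> S" for p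
    using U[of p] S(1) KX that by auto
  let ?W = "\<Union> (U ` S)"
  have cm[measurable]: "curvature_norm_sq A g \<in> borel_measurable vol" by (rule curvature_measurable)
  have sm[measurable]: "p \<in> S \<Longrightarrow> U p \<in> sets vol" for p using US(1) sets_vol_open by blast
  have W: "openin X ?W" using US(1) by auto
  have "(\<integral>\<^sup>+q. ?f q * indicator ?W q \<partial>vol) \<le> (\<integral>\<^sup>+q. (\<Sum>p\<in>S. ?f q * indicator (U p) q) \<partial>vol)"
  proof (rule nn_integral_mono)
    fix q
    show "?f q * indicator ?W q \<le> (\<Sum>p\<in>S. ?f q * indicator (U p) q)"
    proof (cases "q \<in> ?W")
      case True
      then obtain p where p: "p \<in> S" "q \<in> U p" by blast
      then have "?f q * indicator ?W q = ?f q * indicator (U p) q" using True by simp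
      also have "\<dots> \<le> (\<Sum>p\<in>S. ?f q * indicator (U p) q)" using p(1) S(2) by (intro member_le_sum) auto
      finally show ?thesis .
    qed simp
  qed
  also have "\<dots> = (\<Sum>p\<in>S. \<integral>\<^sup>+q. ?f q * indicator (U p) q \<partial>vol)"
    by (rule nn_integral_sum) simp
  also have "\<dots> \<le> (\<Sum>p\<in>S. \<integral>\<^sup>+q. ennreal (M p) * indicator (U p) q \<partial>vol)"
    using US(3) by (intro sum_mono nn_integral_mono) (auto simp: indicator_def intro!: ennreal_leI)
  also have "\<dots> = (\<Sum>p\<in>S. ennreal (M p) * emeasure vol (U p))"
    by (intro sum.cong refl nn_integral_cmult_indicator) simp
  also have "\<dots> < \<infinity>" using US(2) S(2) by (auto simp: ennreal_mult_less_top)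
  finally show ?thesis using that[OF W] F(3) S(3) by simp
qed

lemma boundary_null:
  assumes nc: "\<exists>p\<in>topspace X. \<exists>q\<in>topspace X. \<phi> p \<bullet> \<nu> \<noteq> \<phi> q \<bullet> \<nu>"
    and ge: "\<And>p. p \<in> topspace X \<Longrightarrow> l \<le> \<phi> p \<bullet> \<nu>"
  shows "{p \<in> topspace X. \<phi> p \<bullet> \<nu> = l} \<in> null_sets vol"
proof -
  let ?Z = "{p \<in> topspace X. \<phi> p \<bullet> \<nu> = l}"
  have "openin X {p \<in> topspace X. \<phi> p \<in> {x. x \<bullet> \<nu> \<noteq> l}}" (is "openin X ?O")
    by (intro openin_moment_vimage open_Collect_neq continuous_intros)
  then have "space vol - ?O \<in> sets vol" by (intro sets.compl_sets sets_vol_open)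
  moreover have "space vol - ?O = ?Z" unfolding space_vol by auto
  ultimately have Z: "?Z \<in> sets vol" by simp
  from orb[unfolded orbifold_def, THEN conjunct2, THEN conjunct1]
  obtain \<B> where B0: "countable \<B> \<and> (\<forall>B\<in>\<B>. openin X B) \<and>
      (\<forall>U x. openin X U \<and> x \<in> U \<longrightarrow> (\<exists>B\<in>\<B>. x \<in> B \<and> B \<subseteq> U))" ..
  have B: "countable \<B>" "B \<in> \<B> \<Longrightarrow> openin X B"
    "openin X U \<Longrightarrow> x \<in> U \<Longrightarrow> \<exists>B\<in>\<B>. x \<in> B \<and> B \<subseteq> U" for U x B
    using B0 by simp_all
  \<comment> \<open>The volume is prescribed only for sets inside one chart image. The base sets of
    this kind are countably many and cover \<open>X\<close>, so null pieces add up to a null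
    set.\<close>
  define \<B>' where "\<B>' = {B \<in> \<B>. \<exists>c\<in>A. B \<subseteq> cproj c ` cdom c}"
  have "countable \<B>'" unfolding \<B>'_def by (rule countable_subset[OF _ B(1)]) auto
  moreover have "?Z \<inter> B \<in> null_sets vol" if BB: "B \<in> \<B>'" for B
  proof -
    obtain c where c: "c \<in> A" "B \<subseteq> cproj c ` cdom c" and oB: "openin X B"
      using BB B(2) unfolding \<B>'_def by blast
    have m: "?Z \<inter> B \<in> sets vol" using Z sets_vol_open[OF oB] by blast
    have "{u \<in> cdom c. cproj c u \<in> ?Z \<inter> B} \<in> sets borel"
      by (rule vimage_borel[OF cproj_vimage_open[OF c(1)] open_cdom[OF c(1)] _ m]) (use cproj_in[OF c(1)] in auto)
    moreover have "negligible {u \<in> cdom c. cproj c u \<in> ?Z \<inter> B}"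
      by (rule negligible_subset[OF boundary_negligible[OF nc ge c(1)]]) auto
    ultimately have "{u \<in> cdom c. cproj c u \<in> ?Z \<inter> B} \<in> null_sets lborel"
      unfolding negligible_iff_null_sets null_sets_def by (simp add: emeasure_completion)
    then have "AE u in lborel. ennreal (sqrt (det (g c u))) * indicator {u \<in> cdom c. cproj c u \<in> ?Z \<inter> B} u = 0"
      by (rule AE_I') (auto simp: indicator_def split: if_splits)
    then have "(\<integral>\<^sup>+u. ennreal (sqrt (det (g c u))) * indicator {u \<in> cdom c. cproj c u \<in> ?Z \<inter> B} u \<partial>lborel) = (\<integral>\<^sup>+u. 0 \<partial>(lborel::(real^4) measure))"
      by (rule nn_integral_cong_AE)
    then have "emeasure vol (?Z \<inter> B) = 0" using vol_eq[OF c(1) m] c(2) by auto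
    then show ?thesis using m by auto
  qed
  ultimately have "(\<Union>B\<in>\<B>'. ?Z \<inter> B) \<in> null_sets vol" by (intro null_sets_UN') auto
  moreover have "?Z \<subseteq> (\<Union>B\<in>\<B>'. ?Z \<inter> B)"
  proof
    fix p assume p: "p \<in> ?Z"
    then obtain c u where c: "c \<in> A" "u \<in> cdom c" "cproj c u = p" using charts_cover by blast
    then have "p \<in> cproj c ` cdom c" by blast
    from B(3)[OF cproj_open[OF c(1) open_cdom[OF c(1)] order_refl] this]
    obtain B where "B \<in> \<B>" "p \<in> B" "B \<subseteq> cproj c ` cdom c" by blast
    then show "p \<in> (\<Union>B\<in>\<B>'. ?Z \<inter> B)" using p c(1) by (auto simp: \<B>'_def)
  qed
  ultimately show ?thesis by (rule null_sets_subset[OF _ Z])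
qed

end

section \<open>The metric on the dense torus orbits\<close>

lemma base_join4 [simp]: "base (join4 x t) = x"
  by (simp add: base_def join4_def vec_eq_iff forall_2)

lemma angle_join4 [simp]: "angle (join4 x t) = t"
  by (simp add: angle_def join4_def vec_eq_iff forall_2)

lemma angle_nth [simp]: "angle y $ 1 = y $ 3" "angle y $ 2 = y $ 4"
  by (simp_all add: angle_def)

lemma join4_base_angle [simp]: "join4 (base y) (angle y) = y"
  by (simp add: join4_def vec_eq_iff forall_4)

lemma smooth_on_base: "open U \<Longrightarrow> smooth_on U base"
proof (rule smooth_on_vec)
  fix i :: 2 assume "open U"
  then show "smooth_on U (\<lambda>y. base y $ i)"
    using exhaust_2[of i] by (elim disjE) (simp_all add: smooth_on_nth smooth_on_id)
qed

lemma continuous_on_base: "continuous_on U base"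
  using continuous_on_subset[OF smooth_on_continuous[OF smooth_on_base[OF open_UNIV]]] by blast

lemma open_half_plane: "open half_plane"
  unfolding half_plane_def by (intro open_Collect_less continuous_intros)

lemma open_base_vimage: "open Q \<Longrightarrow> open {y. base y \<in> Q}"
  using open_vimage[OF _ continuous_on_base, of Q] by (simp add: vimage_def)

lemma smooth_on_join4_base:
  assumes "smooth_on Q f" shows "smooth_on {y. base y \<in> Q} (\<lambda>y. join4 (f (base y)) (angle y))"
proof -
  have o: "open {y. base y \<in> Q}" by (rule open_base_vimage[OF smooth_on_open[OF assms]])
  have "smooth_on {y. base y \<in> Q} (\<lambda>y. f (base y))"
    by (rule smooth_on_compose[OF assms smooth_on_base[OF o]]) auto
  then show ?thesis unfolding join4_def angle_nth
    by (intro smooth_on_vector4 smooth_intros o)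
qed

lemma angle_reduce:
  obtains t' where "t - t' \<in> period_lattice" "\<And>i. 0 \<le> t' $ i" "\<And>i. t' $ i \<le> 2 * pi"
proof -
  let ?t' = "\<chi> i. 2 * pi * frac (t $ i / (2 * pi))"
  have "t $ i - ?t' $ i = 2 * pi * of_int \<lfloor>t $ i / (2 * pi)\<rfloor>" for i
    by (simp add: frac_def right_diff_distrib)
  then have "t - ?t' \<in> period_lattice" unfolding period_lattice_def by auto
  moreover have "0 \<le> ?t' $ i" "?t' $ i \<le> 2 * pi" for i
    using frac_ge_0[of "t $ i / (2 * pi)"] frac_lt_1[of "t $ i / (2 * pi)"] by (auto simp: mult_le_cancel_left1)
  ultimately show ?thesis by (rule that)
qed

lemma prod_4: "prod f (UNIV :: 4 set) = f 1 * f 2 * f 3 * f 4"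
  unfolding UNIV_4 by (simp add: ac_simps)

text \<open>The open interval from \<open>- 1\<close> to \<open>8\<close> contains
  \<open>[0, 2 pi]\<close>, hence a representative of every angle modulo periods.\<close>

lemma open_base_angle:
  assumes "open Q" shows "open {y. base y \<in> Q \<and> (\<forall>i. angle y $ i \<in> {-1<..<8})}"
proof -
  have "open {y. angle y $ i \<in> {-1<..<8}}" for i
    unfolding angle_def using exhaust_2[of i]
    by (elim disjE) (auto intro!: open_Collect_conj open_Collect_less continuous_intros)
  then have "open (\<Inter>i. {y. angle y $ i \<in> {-1<..<8}})" by (intro open_INT ballI) auto
  then have "open ({y. base y \<in> Q} \<inter> (\<Inter>i. {y. angle y $ i \<in> {-1<..<8}}))"
    using open_base_vimage[OF assms] by (rule open_Int[rotated])
  moreover have "{y. base y \<in> Q} \<inter> (\<Inter>i. {y. angle y $ i \<in> {-1<..<8}}) =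
    {y. base y \<in> Q \<and> (\<forall>i. angle y $ i \<in> {-1<..<8})}" by auto
  ultimately show ?thesis by simp
qed

locale toric_gnu = toric_volume +
  fixes P :: "(real^2) set" and d :: nat and n :: "nat \<Rightarrow> real^2" and lam a :: "nat \<Rightarrow> real"
    and \<nu> :: "real^2" and \<mu> :: "real^2 \<Rightarrow> real^2" and \<Psi> :: "real^4 \<Rightarrow> 'a"
  assumes P: "P = \<phi> ` topspace X" and poly: "strictly_unbounded_polygon P d n lam"
    and adm: "admissible d n \<nu>" and mu: "moment_coordinates P d n a \<nu> \<mu>"
    and aa: "action_angle X A \<omega> act \<phi> \<Psi>" and ext: "extends_gnu A d n a \<nu> \<mu> \<Psi> g"
begin

section \<open>The coordinates \<open>(H, r, \<theta>)\<close> on the dense orbits\<close>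

definition \<Phi> where "\<Phi> y = \<Psi> (join4 (\<mu> (base y)) (angle y))"

definition E where "E = {y. base y \<in> half_plane}"

lemma open_E: "open E" unfolding E_def by (rule open_base_vimage[OF open_half_plane])

lemma mu_bij: "bij_betw \<mu> half_plane (interior P)" and mu_smooth: "smooth_on half_plane \<mu>"
  and mu_inv_smooth: "smooth_on (interior P) (inv_into half_plane \<mu>)"
  using mu by (auto simp: moment_coordinates_def)

lemma mu_in: "h \<in> half_plane \<Longrightarrow> \<mu> h \<in> interior P"
  using mu_bij by (auto simp: bij_betw_def)

lemma mu_inv: "h \<in> half_plane \<Longrightarrow> inv_into half_plane \<mu> (\<mu> h) = h"
  using mu_bij by (simp add: bij_betw_def)

lemma action_angle':
  "\<Psi> ` {y. base y \<in> interior P} = {p \<in> topspace X. \<phi> p \<in> interior P}"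
  "base y \<in> interior P \<Longrightarrow> \<phi> (\<Psi> y) = base y"
  "base y \<in> interior P \<Longrightarrow> base z \<in> interior P \<Longrightarrow> \<Psi> y = \<Psi> z \<longleftrightarrow> base y = base z \<and> angle y - angle z \<in> period_lattice"
  "c \<in> A \<Longrightarrow> u \<in> cdom c \<Longrightarrow> base y \<in> interior P \<Longrightarrow> cproj c u = \<Psi> y \<Longrightarrow>
     \<exists>W h. y \<in> W \<and> W \<subseteq> {y. base y \<in> interior P} \<and> is_lift \<Psi> c W h \<and> h y = u"
proof -
  note H = aa[unfolded action_angle_def Let_def P[symmetric]]
  show "\<Psi> ` {y. base y \<in> interior P} = {p \<in> topspace X. \<phi> p \<in> interior P}" by (rule H[THEN conjunct1])
  show "base y \<in> interior P \<Longrightarrow> \<phi> (\<Psi> y) = base y"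
    using H[THEN conjunct2, THEN conjunct1] by simp
  show "base y \<in> interior P \<Longrightarrow> base z \<in> interior P \<Longrightarrow> \<Psi> y = \<Psi> z \<longleftrightarrow> base y = base z \<and> angle y - angle z \<in> period_lattice"
    using H[THEN conjunct2, THEN conjunct2, THEN conjunct2, THEN conjunct1] by simp
  show "c \<in> A \<Longrightarrow> u \<in> cdom c \<Longrightarrow> base y \<in> interior P \<Longrightarrow> cproj c u = \<Psi> y \<Longrightarrow>
     \<exists>W h. y \<in> W \<and> W \<subseteq> {y. base y \<in> interior P} \<and> is_lift \<Psi> c W h \<and> h y = u"
    using H[THEN conjunct2, THEN conjunct2, THEN conjunct2, THEN conjunct2, THEN conjunct1, rule_format, of c u y] by simp
qed

lemma \<Phi>_in: "y \<in> E \<Longrightarrow> \<Phi> y \<in> topspace X" and moment_\<Phi>: "y \<in> E \<Longrightarrow> \<phi> (\<Phi> y) = \<mu> (base y)"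
proof -
  assume y: "y \<in> E"
  then have i: "base (join4 (\<mu> (base y)) (angle y)) \<in> interior P" using mu_in by (simp add: E_def)
  then have "\<Psi> (join4 (\<mu> (base y)) (angle y)) \<in> \<Psi> ` {y. base y \<in> interior P}" by blast
  then show "\<Phi> y \<in> topspace X" unfolding action_angle'(1) \<Phi>_def by simp
  show "\<phi> (\<Phi> y) = \<mu> (base y)" unfolding \<Phi>_def action_angle'(2)[OF i] by simp
qed

lemma \<Phi>_surj:
  assumes p: "p \<in> topspace X" and h: "h \<in> half_plane" "\<phi> p = \<mu> h"
  obtains t where "p = \<Phi> (join4 h t)" "\<And>i. 0 \<le> t $ i" "\<And>i. t $ i \<le> 2 * pi"
proof -
  have "p \<in> \<Psi> ` {y. base y \<in> interior P}" unfolding action_angle'(1) using p h mu_in by simp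
  then obtain y where y: "p = \<Psi> y" "base y \<in> interior P" by blast
  obtain t where t: "angle y - t \<in> period_lattice" "\<And>i. 0 \<le> t $ i" "\<And>i. t $ i \<le> 2 * pi"
    using angle_reduce by metis
  have "base y = \<mu> h" using action_angle'(2)[OF y(2)] y(1) h(2) by simp
  then have "\<Psi> y = \<Psi> (join4 (\<mu> h) t)" using action_angle'(3)[OF y(2), of "join4 (\<mu> h) t"] y(2) t(1) by simp
  then show ?thesis using that[of t] y(1) t by (simp add: \<Phi>_def)
qed

text \<open>\<open>\<Phi>\<close> is \<open>\<Psi>\<close> after \<open>m\<close>, which acts by
  \<open>\<mu>\<close> on the base and trivially on the angles. As \<open>\<mu>\<close> has a smooth
  inverse, composing a lift of \<open>\<Psi>\<close> with \<open>m\<close> gives a lift of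
  \<open>\<Phi>\<close>.\<close>

lemma lift_at:
  assumes y: "y \<in> E" and U: "open U" "y \<in> U"
  shows "\<exists>c W h. c \<in> A \<and> y \<in> W \<and> W \<subseteq> E \<inter> U \<and> is_lift \<Phi> c W h"
proof -
  define m where "m = (\<lambda>y. join4 (\<mu> (base y)) (angle y))"
  define m' where "m' = (\<lambda>y. join4 (inv_into half_plane \<mu> (base y)) (angle y))"
  have sm: "smooth_on E m" unfolding m_def E_def by (rule smooth_on_join4_base[OF mu_smooth])
  have sm': "smooth_on {y. base y \<in> interior P} m'" unfolding m'_def by (rule smooth_on_join4_base[OF mu_inv_smooth])
  have mi: "base (m z) \<in> interior P" if "z \<in> E" for z using that mu_in by (simp add: m_def E_def)
  have m'm: "m' (m z) = z" if "z \<in> E" for z using that mu_inv by (simp add: m_def m'_def E_def)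
  have dm: "det (jacobian m (at z)) \<noteq> 0" if z: "z \<in> E" for z
    by (rule det_jacobian_left_inverse[OF smooth_on_diff[OF sm z] smooth_on_diff[OF sm'] open_E z m'm])
      (use mi[OF z] in auto)
  have \<Phi>m: "\<Phi> z = \<Psi> (m z)" for z by (simp add: \<Phi>_def m_def)
  obtain c u where c: "c \<in> A" "u \<in> cdom c" "cproj c u = \<Psi> (m y)"
    using charts_cover[OF \<Phi>_in[OF y]] unfolding \<Phi>m by blast
  obtain W h where W: "m y \<in> W" "W \<subseteq> {y. base y \<in> interior P}" "is_lift \<Psi> c W h"
    using action_angle'(4)[OF c(1,2) mi[OF y] c(3)] by blast
  define V where "V = m -` W \<inter> E \<inter> U"
  have oV: "open V" unfolding V_def
    using continuous_on_open_vimage[OF open_E, of m] smooth_on_continuous[OF sm] W(3) U(1) by (auto simp: is_lift_def)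
  have VE: "V \<subseteq> E \<inter> U" "m ` V \<subseteq> W" by (auto simp: V_def)
  have smV: "smooth_on V m" using smooth_on_subset[OF sm oV] VE by blast
  have L: "smooth_on W h" "inj_on h W" "\<And>w. w \<in> W \<Longrightarrow> det (jacobian h (at w)) \<noteq> 0" "h ` W \<subseteq> cdom c"
    "\<And>w. w \<in> W \<Longrightarrow> cproj c (h w) = \<Psi> w"
    using W(3) by (auto simp: is_lift_def)
  have "is_lift \<Phi> c V (\<lambda>z. h (m z))"
    unfolding is_lift_def
  proof (intro conjI ballI)
    show "smooth_on V (\<lambda>z. h (m z))" by (rule smooth_on_compose[OF L(1) smV VE(2)])
    have "inj_on m V" by (rule inj_on_inverseI[of _ m']) (use m'm VE in auto)
    then show "inj_on (\<lambda>z. h (m z)) V"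
      using comp_inj_on[of m V h] inj_on_subset[OF L(2) VE(2)] by (simp add: o_def)
    fix z assume z: "z \<in> V"
    then have zE: "z \<in> E" "m z \<in> W" using VE by auto
    show "det (jacobian (\<lambda>z. h (m z)) (at z)) \<noteq> 0"
      unfolding jacobian_compose[OF smooth_on_diff[OF sm zE(1)] smooth_on_diff[OF L(1) zE(2)]]
      using dm[OF zE(1)] L(3)[OF zE(2)] by (simp add: det_mul)
    show "cproj c (h (m z)) = \<Phi> z" unfolding L(5)[OF zE(2)] \<Phi>m ..
  qed (use oV L(4) VE in auto)
  moreover have "y \<in> V" using y U W(1) by (simp add: V_def)
  ultimately show ?thesis using c(1) VE(1) by (intro exI[of _ c] exI[of _ V] exI[of _ "\<lambda>z. h (m z)"]) simp
qed

lemma lift_metric: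
  assumes "c \<in> A" "W \<subseteq> E" "is_lift \<Phi> c W h" "w \<in> W"
  shows "transpose (jacobian h (at w)) ** g c (h w) ** jacobian h (at w) = gnu d n a \<nu> w"
  using ext assms unfolding extends_gnu_def E_def \<Phi>_def by blast

text \<open>Positive definiteness of \<open>g\<close> forces this: the squared length of the
  coordinate field of \<open>H\<close> is \<open>V = r det D\<xi>\<close>, so
  \<open>V > 0\<close>.\<close>

lemma det_Dxi:
  assumes h: "h \<in> half_plane" shows "det (Dxi d n a \<nu> h) \<noteq> 0"
proof -
  let ?y = "join4 h 0" and ?e = "axis 1 1 :: real^4"
  have y: "?y \<in> E" using h by (simp add: E_def)
  obtain c W k where c: "c \<in> A" "?y \<in> W" "W \<subseteq> E" and k: "is_lift \<Phi> c W k"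
    using lift_at[OF y open_UNIV] by auto
  let ?J = "jacobian k (at ?y)"
  have J: "det ?J \<noteq> 0" and kc: "k ?y \<in> cdom c" using k c(2) by (auto simp: is_lift_def)
  have "?J *v ?e \<noteq> 0"
  proof
    assume "?J *v ?e = 0"
    then have "matrix_inv ?J *v (?J *v ?e) = 0" by simp
    then have "?e = 0" unfolding matrix_vector_mul_assoc matrix_inv_mult[OF J] by simp
    then show False by (simp add: axis_eq_0_iff)
  qed
  from g(4)[OF c(1) kc this] have "0 < ?e \<bullet> (gnu d n a \<nu> ?y *v ?e)"
    unfolding lift_metric[OF c(1,3) k c(2), symmetric]
    by (simp add: matrix_vector_mul_assoc[symmetric] transpose_matrix_vector inner_commute[of ?e] dot_lmul_matrix)
      (simp add: inner_commute)
  also have "?e \<bullet> (gnu d n a \<nu> ?y *v ?e) = Vfun d n a \<nu> h"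
    by (simp add: inner_axis' matrix_vector_mult_basis column_def gnu_def Let_def)
  finally show ?thesis by (auto simp: Vfun_def)
qed

lemma curvature_\<Phi>:
  assumes y: "y \<in> E"
  shows "curvature_norm_sq A g (\<Phi> y) = riemann_norm_sq (gnu d n a \<nu>) y"
proof -
  obtain c W k where c: "c \<in> A" "y \<in> W" "W \<subseteq> E" and k: "is_lift \<Phi> c W k"
    using lift_at[OF y open_UNIV] by auto
  interpret metric_pullback "g c" "gnu d n a \<nu>" k "cdom c" W
    using k g[OF c(1)] lift_metric[OF c(1,3) k] by unfold_locales (auto simp: is_lift_def)
  have "cproj c (k y) = \<Phi> y" "k y \<in> cdom c" using k c(2) by (auto simp: is_lift_def)
  then show ?thesis using curvature_norm_sq_cproj[OF c(1), of "k y"] riemann_norm_sq_pullback[OF c(2)] by simp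
qed

subsection \<open>Volume of the shells\<close>

text \<open>\<open>\<Phi>\<close> is periodic in the angles and lifts to charts only locally. By the
  Lindelof property countably many lift domains in the box suffice. Making their images disjoint in
  \<open>X\<close> makes the pieces \<open>T k\<close> disjoint in the box, so
  \<open>volume_le\<close> on each piece sums to at most \<open>C\<close> times the volume of the
  box.\<close>

lemma shell_volume:
  assumes Q: "open Q" "Q \<subseteq> half_plane"
    and C: "\<And>y. base y \<in> Q \<Longrightarrow> sqrt (det (gnu d n a \<nu> y)) \<le> C"
  shows "openin X {p \<in> topspace X. \<phi> p \<in> \<mu> ` Q}" (is "openin X ?S")
    and "emeasure vol {p \<in> topspace X. \<phi> p \<in> \<mu> ` Q} \<le>
      ennreal C * emeasure lborel {y. base y \<in> Q \<and> (\<forall>i. angle y $ i \<in> {-1<..<8})}" (is "_ \<le> _ * emeasure _ ?O")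
proof -
  have "\<mu> ` Q = inv_into half_plane \<mu> -` Q \<inter> interior P"
  proof (intro equalityI subsetI)
    fix x assume "x \<in> \<mu> ` Q"
    then show "x \<in> inv_into half_plane \<mu> -` Q \<inter> interior P" using Q(2) mu_in mu_inv by auto
  next
    fix x assume x: "x \<in> inv_into half_plane \<mu> -` Q \<inter> interior P"
    then have "x \<in> \<mu> ` half_plane" using mu_bij by (simp add: bij_betw_def)
    then have "\<mu> (inv_into half_plane \<mu> x) = x" by (rule f_inv_into_f)
    then show "x \<in> \<mu> ` Q" using x by force
  qed
  moreover have "open (inv_into half_plane \<mu> -` Q \<inter> interior P)"
    by (rule continuous_on_open_vimage[THEN iffD1, rule_format, OF open_interior smooth_on_continuous[OF mu_inv_smooth] Q(1)])
  ultimately have "open (\<mu> ` Q)" by simp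
  then show S: "openin X ?S" by (rule openin_moment_vimage)
  have O: "open ?O" by (rule open_base_angle[OF Q(1)])
  have OE: "?O \<subseteq> E" using Q(2) by (auto simp: E_def)
  define \<F> where "\<F> = {W. W = {} \<or> (W \<subseteq> ?O \<and> (\<exists>c h. c \<in> A \<and> is_lift \<Phi> c W h))}"
  have "open W" if "W \<in> \<F>" for W using that by (auto simp: \<F>_def is_lift_def)
  then obtain \<F>' where F': "\<F>' \<subseteq> \<F>" "countable \<F>'" "\<Union> \<F>' = \<Union> \<F>" by (rule Lindelof)
  define W where "W = from_nat_into (insert {} \<F>')"
  have rW: "range W = insert {} \<F>'" unfolding W_def using F'(2) by (intro range_from_nat_into) auto
  have WF: "W k \<in> \<F>" for k
  proof -
    have "W k \<in> insert {} \<F>'" using rW by blast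
    then show ?thesis using F'(1) by (auto simp: \<F>_def)
  qed
  have WO: "W k \<subseteq> ?O" for k using WF[of k] by (auto simp: \<F>_def)
  have UW: "(\<Union>k. W k) = \<Union> \<F>" using rW F'(3) by simp
  have oU: "openin X (\<Phi> ` W k)" for k
    using WF[of k] lift_props(5)[OF _ _ lift_props(1)] by (auto simp: \<F>_def)
  have US: "\<Phi> ` W k \<subseteq> ?S" for k
  proof
    fix p assume "p \<in> \<Phi> ` W k"
    then obtain y where y: "p = \<Phi> y" "y \<in> ?O" using WO by blast
    then have "y \<in> E" using OE by blast
    then show "p \<in> ?S" using y \<Phi>_in moment_\<Phi> by auto
  qed
  have "?S \<subseteq> (\<Union>k. \<Phi> ` W k)"
  proof
    fix p assume "p \<in> ?S"
    then obtain h where p: "p \<in> topspace X" and h: "h \<in> Q" "\<phi> p = \<mu> h" by blast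
    obtain t where t: "p = \<Phi> (join4 h t)" "\<And>i. 0 \<le> t $ i" "\<And>i. t $ i \<le> 2 * pi"
      using \<Phi>_surj[OF p _ h(2)] h(1) Q(2) by blast
    have "t $ i \<in> {-1<..<8}" for i using t(2,3)[of i] pi_less_4 by auto
    then have yO: "join4 h t \<in> ?O" using h(1) by simp
    then obtain c V k where "c \<in> A" "join4 h t \<in> V" "V \<subseteq> E \<inter> ?O" "is_lift \<Phi> c V k"
      using lift_at[OF _ O yO] OE by blast
    then have "join4 h t \<in> \<Union> \<F>" by (auto simp: \<F>_def)
    then show "p \<in> (\<Union>k. \<Phi> ` W k)" unfolding UW[symmetric] t(1) by blast
  qed
  then have SU: "?S = (\<Union>k. \<Phi> ` W k)" using US by blast
  define B where "B = disjointed (\<lambda>k. \<Phi> ` W k)"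
  have Bsub: "B k \<subseteq> \<Phi> ` W k" for k unfolding B_def by (rule disjointed_subset)
  have mB: "B k \<in> sets vol" for k
    unfolding B_def disjointed_def using sets_vol_open[OF oU] by auto
  have SB: "?S = (\<Union>k. B k)" unfolding SU B_def by (rule UN_disjointed_eq[symmetric])
  have disB: "disjoint_family B" unfolding B_def by (rule disjoint_family_disjointed)
  define T where "T k = {w \<in> W k. \<Phi> w \<in> B k}" for k
  have TW: "T k = {} \<or> (\<exists>c h. c \<in> A \<and> is_lift \<Phi> c (W k) h)" for k using WF[of k] by (auto simp: \<F>_def T_def)
  have mT: "T k \<in> sets borel" for k
    using TW[of k]
  proof
    assume "\<exists>c h. c \<in> A \<and> is_lift \<Phi> c (W k) h"
    then obtain c h where "c \<in> A" "is_lift \<Phi> c (W k) h" by blast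
    note L = lift_props[OF this]
    show ?thesis unfolding T_def by (rule vimage_borel[OF L(4) L(1) L(2) mB])
  qed simp
  have BT: "emeasure vol (B k) \<le> ennreal C * emeasure lborel (T k)" for k
    using TW[of k]
  proof
    assume "T k = {}"
    then have "B k = {}" using Bsub by (auto simp: T_def)
    then show ?thesis by simp
  next
    assume "\<exists>c h. c \<in> A \<and> is_lift \<Phi> c (W k) h"
    then obtain c h where c: "c \<in> A" "is_lift \<Phi> c (W k) h" by blast
    have WE: "W k \<subseteq> E" using WO OE by blast
    have "emeasure vol (B k) \<le> (\<integral>\<^sup>+w. ennreal (sqrt (det (gnu d n a \<nu> w))) * indicator {w \<in> W k. \<Phi> w \<in> B k} w \<partial>lborel)"
      by (rule volume_le[OF c lift_metric[OF c(1) WE] mB Bsub])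
    also have "\<dots> \<le> (\<integral>\<^sup>+w. ennreal C * indicator (T k) w \<partial>lborel)"
      unfolding T_def[symmetric]
    proof (rule nn_integral_mono)
      fix w
      show "ennreal (sqrt (det (gnu d n a \<nu> w))) * indicator (T k) w \<le> ennreal C * indicator (T k) w"
        using C[of w] WO[of k] by (auto simp: indicator_def T_def intro!: ennreal_leI)
    qed
    also have "\<dots> = ennreal C * emeasure lborel (T k)" using mT[of k] by (intro nn_integral_cmult_indicator) simp
    finally show ?thesis .
  qed
  have "emeasure vol ?S = (\<Sum>k. emeasure vol (B k))"
    unfolding SB using mB disB by (intro suminf_emeasure[symmetric]) auto
  also have "\<dots> \<le> (\<Sum>k. ennreal C * emeasure lborel (T k))" by (intro suminf_le BT) auto
  also have "\<dots> = ennreal C * (\<Sum>k. emeasure lborel (T k))" by simp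
  also have "(\<Sum>k. emeasure lborel (T k)) = emeasure lborel (\<Union>k. T k)"
  proof (rule suminf_emeasure)
    show "disjoint_family T" using disB by (fastforce simp: disjoint_family_on_def T_def)
  qed (use mT in auto)
  also have "ennreal C * \<dots> \<le> ennreal C * emeasure lborel ?O"
    using WO O by (intro mult_left_mono emeasure_mono) (auto simp: T_def)
  finally show "emeasure vol ?S \<le> ennreal C * emeasure lborel ?O" .
qed

text \<open>The enclosing box has sides \<open>2 s\<close>, \<open>2 s\<close>, \<open>9\<close>,
  \<open>9\<close>, and \<open>4 * 81 = 324\<close>.\<close>

lemma shell_box:
  assumes "s > 0"
  shows "emeasure lborel {y. base y \<in> half_plane \<inter> ball 0 s \<and> (\<forall>i. angle y $ i \<in> {-1<..<8})} \<le> ennreal (324 * s\<^sup>2)"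
proof -
  let ?a = "vector [-s, -s, -1, -1] :: real^4" and ?b = "vector [s, s, 8, 8] :: real^4"
  have "{y. base y \<in> half_plane \<inter> ball 0 s \<and> (\<forall>i. angle y $ i \<in> {-1<..<8})} \<subseteq> cbox ?a ?b"
  proof
    fix y assume "y \<in> {y. base y \<in> half_plane \<inter> ball 0 s \<and> (\<forall>i. angle y $ i \<in> {-1<..<8})}"
    then have y: "norm (base y) < s" "\<And>i. angle y $ i \<in> {-1<..<8}" by auto
    have "\<bar>base y $ i\<bar> < s" for i using component_le_norm_cart[of "base y" i] y(1) by linarith
    from this[of 1] this[of 2] y(2)[of 1] y(2)[of 2] show "y \<in> cbox ?a ?b"
      by (auto simp: mem_box_cart forall_4 vector_4)
  qed
  then have "emeasure lborel {y. base y \<in> half_plane \<inter> ball 0 s \<and> (\<forall>i. angle y $ i \<in> {-1<..<8})}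
    \<le> emeasure lborel (cbox ?a ?b)" by (intro emeasure_mono) auto
  also have "\<dots> = ennreal (measure lborel (cbox ?a ?b))" 
    using emeasure_lborel_cbox_finite[of ?a ?b] by (intro emeasure_eq_ennreal_measure) simp
  also have "measure lborel (cbox ?a ?b) = (\<Prod>i\<in>UNIV. ?b $ i - ?a $ i)"
    using assms by (intro content_cbox_cart) (auto simp: interval_ne_empty_cart forall_4 vector_4)
  also have "\<dots> = 324 * s\<^sup>2"
    by (simp only: prod_4 vector_4) (simp add: power2_eq_square)
  finally show ?thesis .
qed

lemma interior_P_nonempty: "interior P \<noteq> {}"
proof -
  have "vector [0, 1] \<in> half_plane" by (simp add: half_plane_def)
  then show ?thesis using mu_in by blast
qed

text \<open>Off the interior of \<open>P\<close> one of the defining inequalities is an equality. No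
  component along \<open>n i\<close> is constant, since \<open>P\<close> would then lie in a line,
  while its interior contains the image of \<open>\<mu>\<close>.\<close>

lemma boundary_null_P: "AE p in vol. \<phi> p \<in> interior P"
proof -
  have P': "P = {x. \<forall>i\<in>{1..d}. x \<bullet> n i \<ge> lam i}" and prim: "\<And>i. i \<in> {1..d} \<Longrightarrow> primitive_vector (n i)"
    using poly by (auto simp: strictly_unbounded_polygon_def)
  let ?Z = "\<lambda>i. {p \<in> topspace X. \<phi> p \<bullet> n i = lam i}"
  have "?Z i \<in> null_sets vol" if i: "i \<in> {1..d}" for i
  proof (rule boundary_null)
    have \<phi>P: "\<phi> p \<in> P" if "p \<in> topspace X" for p using that P by blast
    show "lam i \<le> \<phi> p \<bullet> n i" if "p \<in> topspace X" for p using \<phi>P[OF that] i unfolding P' by blast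
    have n0: "n i \<noteq> 0"
    proof
      assume z: "n i = 0"
      obtain u v :: int where uv: "coprime u v" "n i = vector [of_int u, of_int v]"
        using prim[OF i] unfolding primitive_vector_def by blast
      have "n i $ 1 = of_int u" "n i $ 2 = of_int v" using uv(2) by simp_all
      then show False using z uv(1) by simp
    qed
    show "\<exists>p\<in>topspace X. \<exists>q\<in>topspace X. \<phi> p \<bullet> n i \<noteq> \<phi> q \<bullet> n i"
    proof (rule ccontr)
      assume "\<not> ?thesis"
      then have const: "\<phi> p \<bullet> n i = \<phi> q \<bullet> n i" if "p \<in> topspace X" "q \<in> topspace X" for p q using that by blast
      obtain q where q: "q \<in> topspace X" using interior_P_nonempty interior_subset P by blast
      have "P \<subseteq> {x. n i \<bullet> x = \<phi> q \<bullet> n i}"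
        using const[OF _ q] unfolding P by (auto simp: inner_commute)
      then have "interior P \<subseteq> interior {x. n i \<bullet> x = \<phi> q \<bullet> n i}" by (rule interior_mono)
      then show False using interior_hyperplane[OF n0] interior_P_nonempty by simp
    qed
  qed
  then have "(\<Union>i\<in>{1..d}. ?Z i) \<in> null_sets vol" by (intro null_sets_UN') auto
  then show ?thesis
  proof (rule AE_I')
    have "interior P \<supseteq> {x. \<forall>i\<in>{1..d}. lam i < x \<bullet> n i}"
    proof (rule interior_maximal)
      have "{x. \<forall>i\<in>{1..d}. lam i < x \<bullet> n i} = (\<Inter>i\<in>{1..d}. {x. lam i < x \<bullet> n i})" by auto
      then show "open {x. \<forall>i\<in>{1..d}. lam i < x \<bullet> n i}"
        by (auto intro!: open_INT open_Collect_less continuous_intros)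
    qed (auto simp: P' intro: less_imp_le)
    then have strict: "\<exists>i\<in>{1..d}. \<not> lam i < \<phi> p \<bullet> n i" if "\<phi> p \<notin> interior P" for p using that by blast
    have ge: "lam i \<le> \<phi> p \<bullet> n i" if "p \<in> topspace X" "i \<in> {1..d}" for p i
    proof -
      have "\<phi> p \<in> P" using that(1) P by blast
      then show ?thesis using that(2) unfolding P' by blast
    qed
    show "{p \<in> space vol. \<phi> p \<notin> interior P} \<subseteq> (\<Union>i\<in>{1..d}. ?Z i)"
    proof
      fix p assume "p \<in> {p \<in> space vol. \<phi> p \<notin> interior P}"
      then have p: "p \<in> topspace X" "\<phi> p \<notin> interior P" by (auto simp: space_vol)
      obtain i where i: "i \<in> {1..d}" "\<not> lam i < \<phi> p \<bullet> n i" using strict[OF p(2)] by blast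
      then have "\<phi> p \<bullet> n i = lam i" using ge[OF p(1) i(1)] by simp
      then show "p \<in> (\<Union>i\<in>{1..d}. ?Z i)" using p(1) i(1) by blast
    qed
  qed
qed

text \<open>The partial derivatives of \<open>\<mu>\<close> are, up to sign, components of
  \<open>r \<xi>_H\<close> and \<open>r \<xi>_r\<close>. These stay bounded as \<open>r\<close>
  tends to \<open>0\<close>, so \<open>\<mu>\<close> is Lipschitz on the convex half disc. Together
  with properness this puts the part of \<open>X\<close> over small \<open>(H, r)\<close> into a
  compact set.\<close>

lemma mu_bounded: "bounded (\<mu> ` (half_plane \<inter> cball 0 R))"
proof -
  let ?I = "{1..d-1}" and ?c = "\<lambda>i. n (i+1) - n i"
  let ?T = "half_plane \<inter> cball 0 R"
  define S where "S = (\<Sum>i\<in>?I. norm (?c i))"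
  define M where "M = norm (n 1) + S + \<bar>R\<bar> * norm \<nu>"
  have bound: "norm (h $ 2 *\<^sub>R xiH ?I ?c a \<nu> h) \<le> M" "norm (h $ 2 *\<^sub>R xiR ?I ?c a (n 1) h) \<le> M" if h: "h \<in> ?T" for h
  proof -
    have h2: "h $ 2 > 0" and hR: "h $ 2 \<le> \<bar>R\<bar>"
      using h component_le_norm_cart[of h 2] by (auto simp: half_plane_def)
    have le: "h $ 2 \<le> hrad h b" for b
      unfolding hrad_def using h2 by (intro real_le_rsqrt) simp
    have c1: "\<bar>h $ 2 * (1 / hrad h b)\<bar> \<le> 1" for b using le[of b] hrad_pos[OF h2, of b] h2 by (simp add: field_simps)
    \<comment> \<open>\<open>r^2 / (\<rho> (H + \<rho>)) = (\<rho> - H) / \<rho>\<close>, with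
      \<open>H\<close> shifted by \<open>b\<close>, and \<open>|H| < \<rho>\<close>.\<close>
    have c2: "\<bar>h $ 2 * (h $ 2 / (hrad h b * (h $ 1 + b + hrad h b)))\<bar> \<le> 2" for b
    proof -
      let ?\<rho> = "hrad h b"
      note p = hrad_pos[OF h2, of b] hrad_add_pos[OF h2, of b] hrad_gt[OF h2, of b]
      have "?\<rho>\<^sup>2 = (h $ 2)\<^sup>2 + (h $ 1 + b)\<^sup>2" unfolding hrad_def by simp
      then have "h $ 2 * h $ 2 = (?\<rho> - (h $ 1 + b)) * (h $ 1 + b + ?\<rho>)" by (simp add: power2_eq_square algebra_simps)
      also have "\<dots> \<le> (2 * ?\<rho>) * (h $ 1 + b + ?\<rho>)" using p by (intro mult_right_mono) auto
      finally show ?thesis using p h2 by (simp add: divide_le_eq mult.assoc abs_mult)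
    qed
    have S: "norm (\<Sum>i\<in>?I. w i *\<^sub>R ?c i) \<le> b * S" if "\<And>i. \<bar>w i\<bar> \<le> b" for w b
      unfolding S_def sum_distrib_left by (intro sum_norm_le) (auto simp: that mult_right_mono)
    have "norm (h $ 2 *\<^sub>R xiH ?I ?c a \<nu> h) =
      norm ((1/2) *\<^sub>R (\<Sum>i\<in>?I. (h $ 2 * (1 / hrad h (a i))) *\<^sub>R ?c i) + h $ 2 *\<^sub>R \<nu>)"
      by (simp add: xiH_def scaleR_add_right scaleR_sum_right mult_ac)
    also have "\<dots> \<le> (1/2) * norm (\<Sum>i\<in>?I. (h $ 2 * (1 / hrad h (a i))) *\<^sub>R ?c i) + h $ 2 * norm \<nu>"
      by (rule order.trans[OF norm_triangle_ineq]) (use h2 in simp)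
    also have "\<dots> \<le> (1/2) * (1 * S) + \<bar>R\<bar> * norm \<nu>"
      using c1 hR by (intro add_mono mult_left_mono mult_right_mono S) auto
    also have "\<dots> \<le> M" unfolding M_def S_def by (simp add: sum_nonneg add_increasing)
    finally show "norm (h $ 2 *\<^sub>R xiH ?I ?c a \<nu> h) \<le> M" .
    have "norm (h $ 2 *\<^sub>R xiR ?I ?c a (n 1) h) =
      norm (n 1 + (1/2) *\<^sub>R (\<Sum>i\<in>?I. (h $ 2 * (h $ 2 / (hrad h (a i) * (h $ 1 + a i + hrad h (a i))))) *\<^sub>R ?c i))"
      using h2 by (simp add: xiR_def scaleR_add_right scaleR_sum_right mult_ac)
    also have "\<dots> \<le> norm (n 1) + (1/2) * norm (\<Sum>i\<in>?I. (h $ 2 * (h $ 2 / (hrad h (a i) * (h $ 1 + a i + hrad h (a i))))) *\<^sub>R ?c i)"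
      by (rule order.trans[OF norm_triangle_ineq]) simp
    also have "\<dots> \<le> norm (n 1) + (1/2) * (2 * S)"
      using c2 by (intro add_mono mult_left_mono S) auto
    also have "\<dots> \<le> M" unfolding M_def by simp
    finally show "norm (h $ 2 *\<^sub>R xiR ?I ?c a (n 1) h) \<le> M" .
  qed
  have "\<exists>B. \<forall>x\<in>?T. \<forall>y\<in>?T. norm (\<mu> x - \<mu> y) \<le> B * norm (x - y)"
  proof (intro exI ballI)
    fix x y assume xy: "x \<in> ?T" "y \<in> ?T"
    have conv: "convex ?T"
      using convex_halfspace_gt[of 0 "axis 2 1 :: real^2"] by (intro convex_Int convex_cball) (simp add: half_plane_def inner_axis')
    show "norm (\<mu> x - \<mu> y) \<le> (4 * M) * norm (x - y)"
    proof (rule differentiable_bound[OF conv _ _ xy])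
      fix h assume h: "h \<in> ?T"
      then have hh: "h \<in> half_plane" by blast
      have dm: "\<mu> differentiable (at h)" by (rule smooth_on_diff[OF mu_smooth hh])
      then show "(\<mu> has_derivative (\<lambda>v. jacobian \<mu> (at h) *v v)) (at h within ?T)"
        by (rule has_derivative_at_withinI[OF jacobian_works[THEN iffD1]])
      note D = xi_has_derivative[OF hh, of d n a \<nu>]
      have pxi: "pd 1 (\<lambda>y. xi d n a \<nu> y $ i) h = xiH ?I ?c a \<nu> h $ i" "pd 2 (\<lambda>y. xi d n a \<nu> y $ i) h = xiR ?I ?c a (n 1) h $ i" for i
        unfolding pd_eq_dird
        by (subst dird_eqI[OF bounded_linear.has_derivative[OF bounded_linear_vec_nth D]], simp add: axis_def)+
      have mc: "pd 1 (\<lambda>y. \<mu> y $ 1) h = h $ 2 * xiR ?I ?c a (n 1) h $ 2"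
        "pd 2 (\<lambda>y. \<mu> y $ 1) h = - h $ 2 * xiH ?I ?c a \<nu> h $ 2"
        "pd 1 (\<lambda>y. \<mu> y $ 2) h = - h $ 2 * xiR ?I ?c a (n 1) h $ 1"
        "pd 2 (\<lambda>y. \<mu> y $ 2) h = h $ 2 * xiH ?I ?c a \<nu> h $ 1"
        using mu[unfolded moment_coordinates_def, THEN conjunct2, THEN conjunct2, THEN conjunct2, rule_format, OF hh]
        unfolding pxi by blast+
      have comp: "\<bar>h $ 2 * xiH ?I ?c a \<nu> h $ i\<bar> \<le> M" "\<bar>h $ 2 * xiR ?I ?c a (n 1) h $ i\<bar> \<le> M" for i
        using component_le_norm_cart[of "h $ 2 *\<^sub>R xiH ?I ?c a \<nu> h" i] bound(1)[OF h]
          component_le_norm_cart[of "h $ 2 *\<^sub>R xiR ?I ?c a (n 1) h" i] bound(2)[OF h] by auto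
      have ent: "\<bar>jacobian \<mu> (at h) $ i $ j\<bar> \<le> M" for i j
        unfolding pd_component[OF dm, symmetric] using exhaust_2[of i] exhaust_2[of j] comp
        by (elim disjE) (simp_all add: mc)
      show "onorm (\<lambda>v. jacobian \<mu> (at h) *v v) \<le> 4 * M"
      proof (rule onorm_le)
        fix v :: "real^2"
        have "norm (jacobian \<mu> (at h) *v v) \<le> (\<Sum>i\<in>UNIV. \<bar>(jacobian \<mu> (at h) *v v) $ i\<bar>)" by (rule norm_le_l1_cart)
        also have "\<dots> \<le> (\<Sum>i\<in>(UNIV::2 set). \<Sum>j\<in>(UNIV::2 set). M * norm v)"
        proof (rule sum_mono)
          fix i :: 2
          have "\<bar>(jacobian \<mu> (at h) *v v) $ i\<bar> \<le> (\<Sum>j\<in>UNIV. \<bar>jacobian \<mu> (at h) $ i $ j * v $ j\<bar>)"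
            unfolding matrix_vector_mult_def by simp
          also have "\<dots> \<le> (\<Sum>j\<in>(UNIV::2 set). M * norm v)"
            unfolding abs_mult using ent component_le_norm_cart[of v] order.trans[OF abs_ge_zero ent]
            by (intro sum_mono mult_mono) auto
          finally show "\<bar>(jacobian \<mu> (at h) *v v) $ i\<bar> \<le> (\<Sum>j\<in>(UNIV::2 set). M * norm v)" .
        qed
        also have "\<dots> = 4 * M * norm v" by simp
        finally show "norm (jacobian \<mu> (at h) *v v) \<le> 4 * M * norm v" .
      qed
    qed
  qed
  then obtain B where B: "\<And>x y. x \<in> ?T \<Longrightarrow> y \<in> ?T \<Longrightarrow> norm (\<mu> x - \<mu> y) \<le> B * norm (x - y)" by blast
  show ?thesis
  proof (cases "?T = {}")
    case False
    then obtain x0 where x0: "x0 \<in> ?T" by blast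
    show ?thesis unfolding bounded_iff
    proof (intro exI ballI)
      fix z assume "z \<in> \<mu> ` ?T"
      then obtain x where x: "x \<in> ?T" "z = \<mu> x" by blast
      have "norm (x - x0) \<le> 2 * \<bar>R\<bar>" using norm_triangle_ineq4[of x x0] x x0 by auto
      then have "norm (\<mu> x - \<mu> x0) \<le> \<bar>B\<bar> * (2 * \<bar>R\<bar>)"
        using B[OF x(1) x0] by (meson abs_ge_self abs_ge_zero mult_mono norm_ge_zero order.trans)
      then show "norm z \<le> norm (\<mu> x0) + \<bar>B\<bar> * (2 * \<bar>R\<bar>)"
        unfolding x(2) using norm_triangle_sub[of "\<mu> x" "\<mu> x0"] by linarith
    qed
  qed (simp only: image_empty bounded_empty)
qed

lemma moment_compact: "compactin X {p \<in> topspace X. \<phi> p \<in> cball 0 M}"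
proof -
  have pm: "proper_map X (top_of_set P) \<phi>" using kaehler_toric unfolding kaehler_toric_orbifold_def P by simp
  have P': "P = (\<Inter>i\<in>{1..d}. {x. lam i \<le> x \<bullet> n i})"
    using poly by (auto simp: strictly_unbounded_polygon_def)
  have "closed P" unfolding P' by (intro closed_INT ballI closed_Collect_le continuous_intros)
  then have "compact (P \<inter> cball 0 M)" by (intro closed_Int_compact compact_cball)
  then have "compactin (top_of_set P) (P \<inter> cball 0 M)" by (simp add: compactin_subtopology)
  from compactin_proper_map_preimage[OF pm this]
  have "compactin X {p \<in> topspace X. \<phi> p \<in> P \<inter> cball 0 M}" .
  moreover have "{p \<in> topspace X. \<phi> p \<in> P \<inter> cball 0 M} = {p \<in> topspace X. \<phi> p \<in> cball 0 M}" using P by auto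
  ultimately show ?thesis by simp
qed

subsection \<open>Integrability\<close>

lemma curvature_integrable: "integrable vol (curvature_norm_sq A g)"
proof -
  let ?f = "\<lambda>p. ennreal \<bar>curvature_norm_sq A g p\<bar>"
  have dim: "2 \<le> d" and par: "det2 (n 1) (n d) \<noteq> 0"
    using poly by (auto simp: strictly_unbounded_polygon_def)
  have "\<exists>k C0 R. R \<ge> 1 \<and> (\<forall>y. base y \<in> half_plane \<longrightarrow> R \<le> norm (base y) \<longrightarrow>
      \<bar>riemann_norm_sq (gnu d n a \<nu>) y\<bar> \<le> C0 / norm (base y) ^ (3 + k) \<and>
      sqrt (det (gnu d n a \<nu> y)) \<le> C0 * norm (base y) ^ k)"
  proof (rule gnu_far_bound[OF dim par adm det_Dxi])
    fix k C0 R
    assume "R \<ge> 1"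
      "\<And>y. base y \<in> half_plane \<Longrightarrow> R \<le> norm (base y) \<Longrightarrow> \<bar>riemann_norm_sq (gnu d n a \<nu>) y\<bar> \<le> C0 / norm (base y) ^ (3 + k)"
      "\<And>y. base y \<in> half_plane \<Longrightarrow> R \<le> norm (base y) \<Longrightarrow> sqrt (det (gnu d n a \<nu> y)) \<le> C0 * norm (base y) ^ k"
    then show ?thesis by (intro exI[of _ k] exI[of _ C0] exI[of _ R]) simp
  qed
  then obtain k C0 R where RC: "R \<ge> 1 \<and> (\<forall>y. base y \<in> half_plane \<longrightarrow> R \<le> norm (base y) \<longrightarrow>
      \<bar>riemann_norm_sq (gnu d n a \<nu>) y\<bar> \<le> C0 / norm (base y) ^ (3 + k) \<and>
      sqrt (det (gnu d n a \<nu> y)) \<le> C0 * norm (base y) ^ k)"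
    by (elim exE)
  then have R: "R \<ge> 1" and C0: "base y \<in> half_plane \<Longrightarrow> R \<le> norm (base y) \<Longrightarrow> \<bar>riemann_norm_sq (gnu d n a \<nu>) y\<bar> \<le> C0 / norm (base y) ^ (3 + k)"
    "base y \<in> half_plane \<Longrightarrow> R \<le> norm (base y) \<Longrightarrow> sqrt (det (gnu d n a \<nu> y)) \<le> C0 * norm (base y) ^ k" for y
    by simp_all
  define C where "C = max C0 0"
  have C: "C \<ge> 0" "C0 \<le> C" by (auto simp: C_def)
  \<comment> \<open>The shells \<open>s j < norm h < 4 s j\<close> are open and overlap, since
    \<open>s (j+1) = 2 s j\<close>. The first starts at \<open>s 0 = R/2\<close>, so that no radius
    above \<open>R\<close> is missed.\<close>
  define s where "s j = R * 2 ^ j / 2" for j :: nat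
  have s0: "s j > 0" and s1: "2 ^ j / 2 \<le> s j" for j using R by (auto simp: s_def)
  define Q where "Q j = half_plane \<inter> {h. R < norm h \<and> s j < norm h} \<inter> ball 0 (4 * s j)" for j
  have Q: "open (Q j)" "Q j \<subseteq> half_plane" for j
    unfolding Q_def by (auto intro!: open_Int open_half_plane open_Collect_conj open_Collect_less continuous_intros)
  define S where "S j = {p \<in> topspace X. \<phi> p \<in> \<mu> ` Q j}" for j
  have sq: "sqrt (det (gnu d n a \<nu> y)) \<le> C * (4 * s j) ^ k" if y: "base y \<in> Q j" for y j
  proof -
    have "sqrt (det (gnu d n a \<nu> y)) \<le> C0 * norm (base y) ^ k" using y by (intro C0) (auto simp: Q_def)
    also have "\<dots> \<le> C * (4 * s j) ^ k"
      using y C by (intro mult_mono power_mono) (auto simp: Q_def)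
    finally show ?thesis .
  qed
  have oS: "openin X (S j)" for j unfolding S_def by (rule shell_volume(1)[OF Q sq])
  have vS: "emeasure vol (S j) \<le> ennreal (C * (4 * s j) ^ k * (324 * (4 * s j)\<^sup>2))" for j
  proof -
    let ?D = "C * (4 * s j) ^ k"
    have "emeasure vol (S j) \<le> ennreal ?D * emeasure lborel {y. base y \<in> Q j \<and> (\<forall>i. angle y $ i \<in> {-1<..<8})}"
      unfolding S_def by (rule shell_volume(2)[OF Q sq])
    also have "\<dots> \<le> ennreal ?D * emeasure lborel {y. base y \<in> half_plane \<inter> ball 0 (4 * s j) \<and> (\<forall>i. angle y $ i \<in> {-1<..<8})}"
    proof (intro mult_left_mono emeasure_mono)
      show "{y. base y \<in> half_plane \<inter> ball 0 (4 * s j) \<and> (\<forall>i. angle y $ i \<in> {-1<..<8})} \<in> sets lborel"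
        unfolding sets_lborel by (rule borel_open[OF open_base_angle[OF open_Int[OF open_half_plane open_ball]]])
    qed (auto simp: Q_def)
    also have "\<dots> \<le> ennreal ?D * ennreal (324 * (4 * s j)\<^sup>2)"
      using s0[of j] by (intro mult_left_mono shell_box) auto
    also have "\<dots> = ennreal (?D * (324 * (4 * s j)\<^sup>2))" using C s0[of j] by (intro ennreal_mult[symmetric]) auto
    finally show ?thesis .
  qed
  have fS: "\<bar>curvature_norm_sq A g p\<bar> \<le> C / s j ^ (3 + k)" if p: "p \<in> S j" for p j
  proof -
    obtain h where h: "h \<in> Q j" "\<phi> p = \<mu> h" using p by (auto simp: S_def)
    have hp: "h \<in> half_plane" "p \<in> topspace X" using h(1) Q(2) p by (auto simp: S_def)
    have hn: "R \<le> norm h" "s j \<le> norm h" using h(1) by (simp_all add: Q_def)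
    obtain t where t: "p = \<Phi> (join4 h t)" by (rule \<Phi>_surj[OF hp(2,1) h(2)])
    have "join4 h t \<in> E" using hp(1) by (simp add: E_def)
    then have "\<bar>curvature_norm_sq A g p\<bar> = \<bar>riemann_norm_sq (gnu d n a \<nu>) (join4 h t)\<bar>"
      unfolding t by (simp add: curvature_\<Phi>)
    also have "\<dots> \<le> C0 / norm h ^ (3 + k)"
      using C0(1)[of "join4 h t"] hp(1) hn by simp
    also have "\<dots> \<le> C / s j ^ (3 + k)"
      using C hn s0[of j] by (intro frac_le power_mono zero_less_power) simp_all
    finally show ?thesis .
  qed
  obtain M where M: "\<And>x. x \<in> \<mu> ` (half_plane \<inter> cball 0 R) \<Longrightarrow> norm x \<le> M"
    using mu_bounded[of R] unfolding bounded_iff by blast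
  obtain U where U: "openin X U" "{p \<in> topspace X. \<phi> p \<in> cball 0 M} \<subseteq> U" "(\<integral>\<^sup>+p. ?f p * indicator U p \<partial>vol) < \<infinity>"
    by (rule curvature_on_compact[OF moment_compact])
  have cover: "p \<in> U \<or> (\<exists>j. p \<in> S j)" if p: "p \<in> topspace X" "\<phi> p \<in> interior P" for p
  proof -
    obtain h where h: "h \<in> half_plane" "\<phi> p = \<mu> h" using p(2) mu_bij unfolding bij_betw_def by blast
    \<comment> \<open>Induction finds \<open>N\<close> with
      \<open>R 2^N \<le> norm h < R 2^(N+1)\<close>, that is
      \<open>2 s N \<le> norm h < 4 s N\<close>.\<close>
    have exj: "\<exists>j. s j < norm h \<and> norm h < 4 * s j" if "R < norm h" "norm h < R * 2 ^ N" for N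
      using that
    proof (induction N)
      case (Suc N)
      show ?case
      proof (cases "norm h < R * 2 ^ N")
        case False
        then show ?thesis using Suc.prems R s0[of N] by (intro exI[of _ N]) (auto simp: s_def)
      qed (use Suc in blast)
    qed simp
    show ?thesis
    proof (cases "R < norm h")
      case True
      obtain N where "norm h < 2 ^ N" using real_arch_pow[of 2 "norm h"] by auto
      also have "\<dots> \<le> R * 2 ^ N" using R by simp
      finally obtain j where "s j < norm h" "norm h < 4 * s j" using exj True by blast
      then have "h \<in> Q j" using True h(1) by (simp add: Q_def)
      then show ?thesis using p(1) h(2) by (auto simp: S_def)
    next
      case False
      then have "\<phi> p \<in> cball 0 M" using M[of "\<mu> h"] h by auto
      then show ?thesis using U(2) p(1) by auto
    qed
  qed
  have fm[measurable]: "curvature_norm_sq A g \<in> borel_measurable vol" by (rule curvature_measurable)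
  have Sm[measurable]: "S j \<in> sets vol" "U \<in> sets vol" for j using oS U(1) sets_vol_open by auto
  have "AE p in vol. ?f p \<le> ?f p * indicator U p + (\<Sum>j. ?f p * indicator (S j) p)"
    using boundary_null_P AE_space
  proof eventually_elim
    case (elim p)
    then consider "p \<in> U" | j where "p \<in> S j" using cover space_vol by auto
    then show ?case
    proof cases
      case 2
      have "?f p = (\<Sum>i\<in>{j}. ?f p * indicator (S i) p)" using 2 by simp
      also have "\<dots> \<le> (\<Sum>j. ?f p * indicator (S j) p)" by (rule sum_le_suminf) auto
      finally show ?thesis by (rule order.trans) simp
    qed simp
  qed
  then have "(\<integral>\<^sup>+p. ?f p \<partial>vol) \<le> (\<integral>\<^sup>+p. ?f p * indicator U p + (\<Sum>j. ?f p * indicator (S j) p) \<partial>vol)"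
    by (rule nn_integral_mono_AE)
  also have "\<dots> = (\<integral>\<^sup>+p. ?f p * indicator U p \<partial>vol) + (\<Sum>j. \<integral>\<^sup>+p. ?f p * indicator (S j) p \<partial>vol)"
    by (subst nn_integral_suminf[symmetric], measurable, intro nn_integral_add borel_measurable_suminf) measurable
  also have "\<dots> < \<infinity>"
  proof -
    \<comment> \<open>\<open>324 * 4^2 = 5184\<close> from the box of radius \<open>4 s j\<close>,
      doubled because \<open>s j \<ge> 2^j / 2\<close>.\<close>
    let ?c = "C\<^sup>2 * 4 ^ k * 10368"
    have "(\<integral>\<^sup>+p. ?f p * indicator (S j) p \<partial>vol) \<le> ennreal (?c * (1/2) ^ j)" for j
    proof -
      have "(\<integral>\<^sup>+p. ?f p * indicator (S j) p \<partial>vol) \<le> (\<integral>\<^sup>+p. ennreal (C / s j ^ (3 + k)) * indicator (S j) p \<partial>vol)"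
        by (rule nn_integral_mono) (auto simp: indicator_def intro!: ennreal_leI fS)
      also have "\<dots> = ennreal (C / s j ^ (3 + k)) * emeasure vol (S j)"
        by (intro nn_integral_cmult_indicator) simp
      also have "\<dots> \<le> ennreal (C / s j ^ (3 + k)) * ennreal (C * (4 * s j) ^ k * (324 * (4 * s j)\<^sup>2))"
        by (intro mult_left_mono vS) simp
      also have "\<dots> = ennreal (C / s j ^ (3 + k) * (C * (4 * s j) ^ k * (324 * (4 * s j)\<^sup>2)))"
        using C s0[of j] by (intro ennreal_mult[symmetric]) auto
      \<comment> \<open>Curvature \<open>s^-(3+k)\<close>, density \<open>s^k\<close> and coordinate
        area \<open>s^2\<close> leave \<open>1 / s j\<close> in both regimes.\<close>
      also have "C / s j ^ (3 + k) * (C * (4 * s j) ^ k * (324 * (4 * s j)\<^sup>2)) = C\<^sup>2 * 4 ^ k * 5184 / s j"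
        using s0[of j] by (simp add: power_add power_mult_distrib power2_eq_square power3_eq_cube)
      also have "\<dots> \<le> C\<^sup>2 * 4 ^ k * 5184 / (2 ^ j / 2)"
        using s0[of j] s1[of j] by (intro divide_left_mono) auto
      also have "\<dots> = ?c * (1/2) ^ j" by (simp add: power_divide)
      finally show ?thesis by (simp add: ennreal_leI)
    qed
    then have "(\<Sum>j. \<integral>\<^sup>+p. ?f p * indicator (S j) p \<partial>vol) \<le> (\<Sum>j. ennreal (?c * (1/2) ^ j))"
      by (intro suminf_le) auto
    also have "\<dots> < \<infinity>"
      unfolding infinity_ennreal_def less_top[symmetric] by (intro ennreal_suminf_neq_top summable_mult summable_geometric) auto
    finally show ?thesis using U(3) by simp
  qed
  finally show ?thesis by (intro integrableI_bounded) auto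
qed

end

theorem theorem1p1:
  fixes X :: "'x topology" and A :: "'x chart set"
    and \<omega> J g :: "'x field2"
    and act :: "real^2 \<Rightarrow> 'x \<Rightarrow> 'x" and \<phi> :: "'x \<Rightarrow> real^2"
    and P :: "(real^2) set" and d :: nat and n :: "nat \<Rightarrow> real^2" and lam a :: "nat \<Rightarrow> real"
    and \<nu> :: "real^2" and \<mu> :: "real^2 \<Rightarrow> real^2" and \<Psi> :: "real^4 \<Rightarrow> 'x"
    and vol :: "'x measure"
  assumes "kaehler_toric_orbifold X A \<omega> J act \<phi>"
    and "P = \<phi> ` topspace X"
    and "strictly_unbounded_polygon P d n lam"
    and "admissible d n \<nu>"
    and "edge_parameters P d n lam a"
    and "moment_coordinates P d n a \<nu> \<mu>"
    and "action_angle X A \<omega> act \<phi> \<Psi>"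
    and "extends_gnu A d n a \<nu> \<mu> \<Psi> g"
    and "riemannian_volume X A g vol"
  shows "integrable vol (curvature_norm_sq A g)"
proof -
  interpret toric_gnu X A \<omega> J act \<phi> g vol P d n lam a \<nu> \<mu> \<Psi>
    using assms by unfold_locales (auto simp: extends_gnu_def)
  show ?thesis by (rule curvature_integrable)
qed

end
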